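(* Assume that $K(t,s)=\overline{K}(t-s) 1_{s\leq t}$, $s,t \in [0,T]$, for some $\overline{K}\colon[0,T]\to\mathbb{R}^{d\times d}$ with components $\overline{K}_{ij}$. Suppose that $K$ is measurable with $\sup_{t \in [0,T]} \int_0^t \|K(t,s)\|^2 ds < \infty$, and that there exist $\gamma \in (0,2]$ and $c \in (0,\infty)$ such that for all $i,j \in \{1,\ldots,d\}$ and all $0\leq s< t\leq T$, $$\int_s^t \left(\overline{K}_{ij}(t-u)\right)^2 du \leq c (t-s)^{\gamma}\quad\text{and}\quad \int_0^s \left( \overline{K}_{ij}(t-u) - \overline{K}_{ij}(s-u) \right)^2 du \leq c (t-s)^{\gamma}.$$ Let the coefficients $b\colon[0,T]\times\mathbb{R}^d\to\mathbb{R}^d$ and $\sigma\colon[0,T]\times\mathbb{R}^d\to\mathbb{R}^{d\times m}$ be Lipschitz continuous. Then the equation $$X_t=X_0+\int_0^t \overline{K}(t-s)b(s,X_s)ds+\int_0^t \overline{K}(t-s)\sigma(s,X_s)dW_s, \quad t\in [0,T],$$ admits a unique continuous strong solution.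
   Context: $T \in (0,\infty)$, $m,d\in\mathbb{N}$, $X_0\in\mathbb{R}^d$ is deterministic, and $\|\cdot\|$ is the Frobenius norm. The equation has a strong solution if for any $m$-dimensional Brownian motion $W$ on a filtered probability space $(\Omega,\mathcal{F},(\mathcal{F}_t)_{t\in[0,T]},P)$, where $(\mathcal{F}_t)_{t\in[0,T]}$ is the completed right-continuous filtration generated by $W$, there exists an adapted continuous $d$-dimensional process $X=(X_t)_{t\in[0,T]}$ such that the equation holds $P$-a.s. *)

theory Defs
  imports "HOL-Probability.Probability"
begin

text \<open>
  Vectors are elements of \<open>real ^ 'd\<close>, and matrices with d rows and m columns are elements of
  \<open>real ^ 'm ^ 'd\<close>, on which \<^const>\<open>norm\<close> is the Frobenius norm.
  Processes on the time interval [0,T] are functions on all of \<^typ>\<open>real\<close> whose values outside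
  [0,T] are never used.
\<close>

definition generated_sigma ::
  "'a measure \<Rightarrow> real set \<Rightarrow> (real \<Rightarrow> 'a \<Rightarrow> 'b::topological_space) \<Rightarrow> 'a measure" where
  "generated_sigma M I W =
     sigma (space M) {W u -` A \<inter> space M |u A. u \<in> I \<and> A \<in> sets borel}"

text \<open>
  Standard m-dimensional Brownian motion: the law of an increment is given by the density of the
  centred normal distribution with covariance matrix (t - s) times the identity.
\<close>

definition brownian_motion :: "'a measure \<Rightarrow> real \<Rightarrow> (real \<Rightarrow> 'a \<Rightarrow> real ^ 'm::finite) \<Rightarrow> bool" where
  "brownian_motion M T W \<longleftrightarrow>
     prob_space M \<and>
     (\<forall>t\<in>{0..T}. W t \<in> borel_measurable M) \<and>
     (AE \<omega> in M. W 0 \<omega> = 0) \<and>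
     (\<forall>s t. 0 \<le> s \<and> s < t \<and> t \<le> T \<longrightarrow>
        prob_space.indep_set M (sets (generated_sigma M {0..s} W))
          (sets (vimage_algebra (space M) (\<lambda>\<omega>. W t \<omega> - W s \<omega>) borel)) \<and>
        distributed M lborel (\<lambda>\<omega>. W t \<omega> - W s \<omega>)
          (\<lambda>x. ennreal (\<Prod>i\<in>UNIV. normal_density 0 (sqrt (t - s)) (x $ i)))) \<and>
     (AE \<omega> in M. continuous_on {0..T} (\<lambda>t. W t \<omega>))"

text \<open>
  The filtration generated by W, completed by all subsets of null sets and made right-continuous.
  It consists of sub-sigma-algebras of \<^term>\<open>completion M\<close>, which is M itself if M is complete.
  Because of the minimum with T, the intersection at time T is the completed sigma-algebra
  generated by W on [0,T].
\<close>

definition completed_sigma ::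
  "'a measure \<Rightarrow> real set \<Rightarrow> (real \<Rightarrow> 'a \<Rightarrow> 'b::topological_space) \<Rightarrow> 'a measure" where
  "completed_sigma M I W =
     sigma (space M) (sets (generated_sigma M I W) \<union> null_sets (completion M))"

definition completed_filtration ::
  "'a measure \<Rightarrow> real \<Rightarrow> (real \<Rightarrow> 'a \<Rightarrow> 'b::topological_space) \<Rightarrow> real \<Rightarrow> 'a measure" where
  "completed_filtration M T W t =
     sigma (space M) (\<Inter>s\<in>{t<..}. sets (completed_sigma M {0..min s T} W))"

definition progressively_measurable ::
  "(real \<Rightarrow> 'a measure) \<Rightarrow> real \<Rightarrow> (real \<Rightarrow> 'a \<Rightarrow> 'b::topological_space) \<Rightarrow> bool" where
  "progressively_measurable F t H \<longleftrightarrow>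
     (\<forall>s\<in>{0..t}. (\<lambda>(u, \<omega>). H u \<omega>) \<in> borel_measurable (restrict_space borel {0..s} \<Otimes>\<^sub>M F s))"

text \<open>
  The integrands of the Ito integral over [0,t] are the progressively measurable processes with
  almost surely square integrable paths.  The integral of a simple integrand
  \<open>\<Sum>k<n. \<xi> k * indicator of (\<tau> k, \<tau> (k+1)]\<close> is defined directly, and the general one as
  limit in probability along simple integrands converging in probability with respect to the
  L2 distance of paths.  The integral is only determined up to almost sure equality, hence
  it is rendered as a relation.
\<close>

definition ito_integrand ::
  "'a measure \<Rightarrow> (real \<Rightarrow> 'a measure) \<Rightarrow> real \<Rightarrow> (real \<Rightarrow> 'a \<Rightarrow> real ^ 'm::finite ^ 'd::finite) \<Rightarrow> bool"
where
  "ito_integrand P F t H \<longleftrightarrow>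
     progressively_measurable F t H \<and>
     (AE \<omega> in P. (\<integral>\<^sup>+ s\<in>{0..t}. ennreal ((norm (H s \<omega>))\<^sup>2) \<partial>lborel) < \<infinity>)"

definition simple_integrand ::
  "'a measure \<Rightarrow> (real \<Rightarrow> 'a measure) \<Rightarrow> real \<Rightarrow> nat \<Rightarrow> (nat \<Rightarrow> real) \<Rightarrow>
     (nat \<Rightarrow> 'a \<Rightarrow> real ^ 'm::finite ^ 'd::finite) \<Rightarrow> bool" where
  "simple_integrand P F t n \<tau> \<xi> \<longleftrightarrow>
     \<tau> 0 = 0 \<and> \<tau> n = t \<and> (\<forall>k<n. \<tau> k \<le> \<tau> (Suc k)) \<and>
     (\<forall>k<n. \<xi> k \<in> borel_measurable (F (\<tau> k)) \<and> (\<exists>B. \<forall>\<omega>\<in>space P. norm (\<xi> k \<omega>) \<le> B))"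

definition simple_process ::
  "nat \<Rightarrow> (nat \<Rightarrow> real) \<Rightarrow> (nat \<Rightarrow> 'a \<Rightarrow> real ^ 'm::finite ^ 'd::finite) \<Rightarrow>
     real \<Rightarrow> 'a \<Rightarrow> real ^ 'm ^ 'd" where
  "simple_process n \<tau> \<xi> s \<omega> = (\<Sum>k<n. indicator {\<tau> k<..\<tau> (Suc k)} s *\<^sub>R \<xi> k \<omega>)"

definition simple_ito_integral ::
  "(real \<Rightarrow> 'a \<Rightarrow> real ^ 'm::finite) \<Rightarrow> nat \<Rightarrow> (nat \<Rightarrow> real) \<Rightarrow>
     (nat \<Rightarrow> 'a \<Rightarrow> real ^ 'm ^ 'd::finite) \<Rightarrow> 'a \<Rightarrow> real ^ 'd" where
  "simple_ito_integral W n \<tau> \<xi> \<omega> = (\<Sum>k<n. \<xi> k \<omega> *v (W (\<tau> (Suc k)) \<omega> - W (\<tau> k) \<omega>))"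

definition has_ito_integral ::
  "'a measure \<Rightarrow> (real \<Rightarrow> 'a measure) \<Rightarrow> (real \<Rightarrow> 'a \<Rightarrow> real ^ 'm::finite) \<Rightarrow> real \<Rightarrow>
     (real \<Rightarrow> 'a \<Rightarrow> real ^ 'm ^ 'd::finite) \<Rightarrow> ('a \<Rightarrow> real ^ 'd) \<Rightarrow> bool" where
  "has_ito_integral P F W t H Z \<longleftrightarrow>
     ito_integrand P F t H \<and> Z \<in> borel_measurable P \<and>
     (\<exists>n \<tau> \<xi>.
        (\<forall>k. simple_integrand P F t (n k) (\<tau> k) (\<xi> k)) \<and>
        (\<forall>\<epsilon>>0. (\<lambda>k. measure P {\<omega> \<in> space P. ennreal \<epsilon> <
             (\<integral>\<^sup>+ s\<in>{0..t}. ennreal ((norm (simple_process (n k) (\<tau> k) (\<xi> k) s \<omega> - H s \<omega>))\<^sup>2)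
                \<partial>lborel)}) \<longlonglongrightarrow> 0) \<and>
        (\<forall>\<epsilon>>0. (\<lambda>k. measure P {\<omega> \<in> space P. \<epsilon> <
             norm (simple_ito_integral W (n k) (\<tau> k) (\<xi> k) \<omega> - Z \<omega>)}) \<longlonglongrightarrow> 0))"

text \<open>
  Since the stochastic integral at each t is only determined almost surely, the equation is
  required to hold almost surely for every t; by choice of the version Z for each t
  this is the same as requiring it almost surely simultaneously for all t, for some versions.
\<close>

definition volterra_strong_solution ::
  "'a measure \<Rightarrow> (real \<Rightarrow> 'a \<Rightarrow> real ^ 'm::finite) \<Rightarrow> real \<Rightarrow> real ^ 'd::finite \<Rightarrow>
     (real \<Rightarrow> real ^ 'd ^ 'd) \<Rightarrow> (real \<times> (real ^ 'd) \<Rightarrow> real ^ 'd) \<Rightarrow>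
     (real \<times> (real ^ 'd) \<Rightarrow> real ^ 'm ^ 'd) \<Rightarrow> (real \<Rightarrow> 'a \<Rightarrow> real ^ 'd) \<Rightarrow> bool" where
  "volterra_strong_solution M W T X\<^sub>0 k b \<sigma> X \<longleftrightarrow>
     (\<forall>t\<in>{0..T}. X t \<in> borel_measurable (completed_filtration M T W t)) \<and>
     (\<forall>\<omega>\<in>space M. continuous_on {0..T} (\<lambda>t. X t \<omega>)) \<and>
     (\<forall>t\<in>{0..T}. \<exists>Z.
        has_ito_integral (completion M) (completed_filtration M T W) W t
          (\<lambda>s \<omega>. k (t - s) ** \<sigma> (s, X s \<omega>)) Z \<and>
        (AE \<omega> in M. set_integrable lborel {0..t} (\<lambda>s. k (t - s) *v b (s, X s \<omega>)) \<and>
           X t \<omega> = X\<^sub>0 + (LINT s:{0..t}|lborel. k (t - s) *v b (s, X s \<omega>)) + Z \<omega>))"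

end

theory Submission
  imports Defs
begin

text \<open>
  The solution is the fixed point of the map that sends a process to the right-hand side of the
  equation.  Everything rests on one bound for even moments of stochastic integrals.  For a simple
  integrand \<open>\<xi>\<close> whose value \<open>\<xi> k\<close> has \<open>2n\<close>-th moment at most \<open>v k ^ n\<close>, the \<open>2n\<close>-th moment of the integral
  is at most \<open>(C * (\<Sum>k. (\<tau> (Suc k) - \<tau> k) * v k)) ^ n\<close>, with \<open>C\<close> depending only on \<open>n\<close> and the
  dimensions.  This follows by adding the summands one at a time: in the binomial expansion of the new
  \<open>2n\<close>-th power the Gaussian increment is independent of the past, its odd moments vanish, and
  Young's inequality reassembles the remaining terms into an \<open>n\<close>-th power
  (\<open>discrete_moment_bound\<close>, \<open>simple_integral_moment\<close>).

  With \<open>n = 1\<close>, stopping a simple integrand when its path energy exceeds a level gives the tail bound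
  \<open>simple_integral_prob_bound\<close>, which controls the integral by the energy in probability.
  It makes the Ito integral unique and local (\<open>has_ito_integral_diff_on\<close>), and it makes the
  integrals of approximating simple integrands Cauchy in probability, so that the integral of a square
  integrable kernel times a left-continuous adapted process exists and inherits the moment bound
  (\<open>kernel_ito_integral_exists\<close>).  Together with the Cauchy-Schwarz inequality for the drift this
  yields \<open>volterra_estimate\<close>: if \<open>g u\<close> bounds the squared \<open>2n\<close>-th moment norm of both integrands at
  time \<open>u\<close>, and \<open>g\<close> increases, then that of the convolution is at most a constant times
  \<open>\<integral>(norm (\<kappa> u))\<^sup>2 * g u\<close>.

  This estimate enters in three ways.  Applied to the difference of the kernels at two times, it
  bounds the \<open>2n\<close>-th moments of increments of the right-hand side by a multiple of \<open>(t - s) powr (n * \<gamma>)\<close>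
  (\<open>increment_moment\<close>); choosing \<open>n\<close> with \<open>n * \<gamma> > 1\<close>, Kolmogorov's criterion provides a continuous
  version (\<open>continuous_modification\<close>).  Applied to the difference of two processes with
  \<open>g u\<close> proportional to \<open>exp (\<theta> * u)\<close>, it shows that the map contracts, since
  \<open>\<integral>(norm (k v))\<^sup>2 * exp (- \<theta> * v)\<close> tends to zero as \<open>\<theta>\<close> grows (\<open>picard_difference\<close>); hence the Picard
  iterates converge.  Finally, an arbitrary solution is only known to be continuous, so for uniqueness
  the difference of two solutions is switched off once one of them has left a ball; the switched
  difference is bounded, and by locality of the integral the contraction applies to it.
\<close>

section \<open>Even moments of sums with Gaussian increments\<close>

definition gauss_moment :: "nat \<Rightarrow> real \<Rightarrow> real" where
  "gauss_moment i \<delta> =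
     (if even i then fact i / (2 ^ (i div 2) * fact (i div 2)) * \<delta> ^ (i div 2) else 0)"

text \<open>
  A constant that dominates every coefficient \<open>2 * ((2n) choose (2l)) * gauss_moment (2l) 1\<close> and is at
  least 1, so that the coefficients with \<open>l \<ge> 1\<close> are also at most \<open>moment_const n ^ l\<close>.
\<close>

definition moment_const :: "nat \<Rightarrow> real" where
  "moment_const n = 1 + (\<Sum>l\<le>n. 2 * real ((2 * n) choose (2 * l)) * gauss_moment (2 * l) 1)"

lemma gauss_moment_nonneg: "0 \<le> \<delta> \<Longrightarrow> 0 \<le> gauss_moment i \<delta>"
  by (simp add: gauss_moment_def)

lemma gauss_moment_even: "gauss_moment (2 * l) \<delta> = gauss_moment (2 * l) 1 * \<delta> ^ l"
  by (simp add: gauss_moment_def)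

lemma moment_const_ge_1: "1 \<le> moment_const n"
  unfolding moment_const_def by (auto intro!: sum_nonneg mult_nonneg_nonneg gauss_moment_nonneg)

lemma moment_const_ge:
  assumes "l \<le> n"
  shows "2 * real ((2 * n) choose (2 * l)) * gauss_moment (2 * l) 1 \<le> moment_const n"
proof -
  have "2 * real ((2 * n) choose (2 * l)) * gauss_moment (2 * l) 1
      \<le> (\<Sum>l\<le>n. 2 * real ((2 * n) choose (2 * l)) * gauss_moment (2 * l) 1)"
    using assms by (intro member_le_sum) (auto intro!: mult_nonneg_nonneg gauss_moment_nonneg)
  then show ?thesis by (simp add: moment_const_def)
qed

lemma sum_even_indices:
  fixes f :: "nat \<Rightarrow> real"
  assumes "\<And>i. odd i \<Longrightarrow> f i = 0"
  shows "(\<Sum>i\<le>2 * n. f i) = (\<Sum>l\<le>n. f (2 * l))"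
  by (induction n) (auto simp: assms)

lemma power_mult_le_add_power:
  fixes x y :: real
  assumes "0 \<le> x" "0 \<le> y" "l \<le> n"
  shows "x ^ (n - l) * y ^ l \<le> x ^ n + y ^ n"
proof -
  have "x ^ (n - l) * y ^ l \<le> max x y ^ (n - l) * max x y ^ l"
    using assms by (intro mult_mono power_mono) auto
  also have "\<dots> = max x y ^ n"
    using assms by (simp flip: power_add)
  also have "\<dots> \<le> x ^ n + y ^ n"
    using assms by (auto simp: max_def)
  finally show ?thesis .
qed

lemma power_sum_le_card:
  fixes x :: "'b \<Rightarrow> real"
  assumes "finite A" "A \<noteq> {}" "\<And>a. a \<in> A \<Longrightarrow> 0 \<le> x a"
  shows "(\<Sum>a\<in>A. x a) ^ p \<le> real (card A) ^ p * (\<Sum>a\<in>A. x a ^ p)"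
proof -
  have "Max (x ` A) \<in> x ` A" using assms by (intro Max_in) auto
  then obtain a where "a \<in> A" "x a = Max (x ` A)" by auto
  then have a: "a \<in> A" "\<And>b. b \<in> A \<Longrightarrow> x b \<le> x a" using assms by auto
  have "(\<Sum>a\<in>A. x a) \<le> real (card A) * x a"
    using a by (intro sum_bounded_above) auto
  then have "(\<Sum>a\<in>A. x a) ^ p \<le> (real (card A) * x a) ^ p"
    using assms by (intro power_mono sum_nonneg) auto
  also have "\<dots> = real (card A) ^ p * x a ^ p" by (simp add: power_mult_distrib)
  also have "\<dots> \<le> real (card A) ^ p * (\<Sum>a\<in>A. x a ^ p)"
    using assms a by (intro mult_left_mono member_le_sum) auto
  finally show ?thesis .
qed

text \<open>
  Induction on the number of summands.  The positive \<open>\<epsilon>\<close> keeps the bounds \<open>a\<close> and \<open>u\<close> for the two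
  factors away from zero, so that both can be normalised before Young's inequality is applied.
  The assumption \<open>gauss\<close> expresses, without conditional expectations, that given the past \<open>G k\<close> the
  increment \<open>D k\<close> has the moments of a centred Gaussian variable with variance \<open>\<delta> k\<close>.
\<close>

lemma (in prob_space) discrete_moment_bound_eps:
  fixes \<xi> D :: "nat \<Rightarrow> 'a \<Rightarrow> real" and G :: "nat \<Rightarrow> 'a measure"
  assumes sub: "\<And>k. k < N \<Longrightarrow> subalgebra M (G k)"
    and adapted: "\<And>j k. j \<le> k \<Longrightarrow> k < N \<Longrightarrow> \<xi> j \<in> borel_measurable (G k)"
    and past: "\<And>j k. j < k \<Longrightarrow> k < N \<Longrightarrow> D j \<in> borel_measurable (G k)"
    and bdd: "\<And>k. k < N \<Longrightarrow> \<exists>B. \<forall>\<omega>\<in>space M. \<bar>\<xi> k \<omega>\<bar> \<le> B"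
    and gauss: "\<And>k i Y. k < N \<Longrightarrow> Y \<in> borel_measurable (G k) \<Longrightarrow> integrable M Y \<Longrightarrow>
       integrable M (\<lambda>\<omega>. Y \<omega> * D k \<omega> ^ i) \<and>
       (\<integral>\<omega>. Y \<omega> * D k \<omega> ^ i \<partial>M) = (\<integral>\<omega>. Y \<omega> \<partial>M) * gauss_moment i (\<delta> k)"
    and \<delta>: "\<And>k. k < N \<Longrightarrow> 0 \<le> \<delta> k" and v: "\<And>k. k < N \<Longrightarrow> 0 \<le> v k"
    and \<xi>v: "\<And>k. k < N \<Longrightarrow> (\<integral>\<omega>. \<xi> k \<omega> ^ (2 * n) \<partial>M) \<le> v k ^ n"
    and "0 < \<epsilon>" "k \<le> N"
  shows "(\<forall>p. integrable M (\<lambda>\<omega>. (\<Sum>j<k. \<xi> j \<omega> * D j \<omega>) ^ p)) \<and>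
    (\<integral>\<omega>. (\<Sum>j<k. \<xi> j \<omega> * D j \<omega>) ^ (2 * n) \<partial>M)
      \<le> (\<epsilon> + moment_const n * (\<Sum>j<k. \<delta> j * (v j + \<epsilon>))) ^ n"
  using \<open>k \<le> N\<close>
proof (induction k)
  case 0
  have "(0::real) ^ (2 * n) \<le> \<epsilon> ^ n"
    using \<open>0 < \<epsilon>\<close> by (cases "n = 0") (auto simp: power_0_left)
  then show ?case by (simp add: prob_space power_mult)
next
  case (Suc k)
  define S where "S = (\<lambda>\<omega>. \<Sum>j<k. \<xi> j \<omega> * D j \<omega>)"
  define C where "C = moment_const n"
  define a where "a = \<epsilon> + C * (\<Sum>j<k. \<delta> j * (v j + \<epsilon>))"
  define u where "u = v k + \<epsilon>"
  have kN: "k < N" using Suc by simp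
  have Sp: "integrable M (\<lambda>\<omega>. S \<omega> ^ p)" for p
    using Suc kN by (simp add: S_def)
  have Sb: "(\<integral>\<omega>. S \<omega> ^ (2 * n) \<partial>M) \<le> a ^ n"
    using Suc kN by (simp add: S_def a_def C_def)
  have C1: "1 \<le> C" unfolding C_def by (rule moment_const_ge_1)
  have a0: "0 < a"
    using C1 \<open>0 < \<epsilon>\<close> \<delta> v kN unfolding a_def
    by (intro add_pos_nonneg mult_nonneg_nonneg sum_nonneg) (auto intro!: add_nonneg_nonneg)
  have u0: "0 < u" using v[OF kN] \<open>0 < \<epsilon>\<close> by (simp add: u_def)
  have mG: "S \<in> borel_measurable (G k)"
    unfolding S_def using adapted past kN by (intro borel_measurable_sum borel_measurable_times) auto
  have xiG: "\<xi> k \<in> borel_measurable (G k)" using adapted kN by auto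
  have xiM[measurable]: "\<xi> k \<in> borel_measurable M"
    using xiG sub[OF kN] measurable_from_subalg by blast
  obtain B where B: "\<And>\<omega>. \<omega> \<in> space M \<Longrightarrow> \<bar>\<xi> k \<omega>\<bar> \<le> B" using bdd kN by blast
  have Yint: "integrable M (\<lambda>\<omega>. S \<omega> ^ p * \<xi> k \<omega> ^ i)" for p i
  proof (rule Bochner_Integration.integrable_bound[OF integrable_mult_right[OF integrable_abs[OF Sp[of p]], of "B ^ i"]])
    show "(\<lambda>\<omega>. S \<omega> ^ p * \<xi> k \<omega> ^ i) \<in> borel_measurable M"
      using borel_measurable_integrable[OF Sp[of p]] by measurable
    show "AE \<omega> in M. norm (S \<omega> ^ p * \<xi> k \<omega> ^ i) \<le> norm (B ^ i * \<bar>S \<omega> ^ p\<bar>)"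
    proof (rule AE_I2)
      fix \<omega> assume "\<omega> \<in> space M"
      then have "\<bar>\<xi> k \<omega> ^ i\<bar> \<le> B ^ i" using B by (simp add: power_abs power_mono)
      then show "norm (S \<omega> ^ p * \<xi> k \<omega> ^ i) \<le> norm (B ^ i * \<bar>S \<omega> ^ p\<bar>)"
        using mult_left_mono[of "\<bar>\<xi> k \<omega> ^ i\<bar>" "B ^ i" "\<bar>S \<omega> ^ p\<bar>"]
        by (simp add: abs_mult mult.commute)
    qed
  qed
  have Ymeas: "(\<lambda>\<omega>. S \<omega> ^ p * \<xi> k \<omega> ^ i) \<in> borel_measurable (G k)" for p i
    using mG xiG by measurable
  have expand: "(\<Sum>j<Suc k. \<xi> j \<omega> * D j \<omega>) ^ p =
      (\<Sum>i\<le>p. real (p choose i) * ((S \<omega> ^ (p - i) * \<xi> k \<omega> ^ i) * D k \<omega> ^ i))" for p \<omega>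
    using binomial_ring[of "\<xi> k \<omega> * D k \<omega>" "S \<omega>" p]
    by (simp add: S_def[symmetric] add.commute power_mult_distrib mult_ac S_def)
  have gi: "integrable M (\<lambda>\<omega>. (S \<omega> ^ p * \<xi> k \<omega> ^ i) * D k \<omega> ^ i)"
    and ge: "(\<integral>\<omega>. (S \<omega> ^ p * \<xi> k \<omega> ^ i) * D k \<omega> ^ i \<partial>M) =
      (\<integral>\<omega>. S \<omega> ^ p * \<xi> k \<omega> ^ i \<partial>M) * gauss_moment i (\<delta> k)" for p i
    using gauss[OF kN Ymeas[of p i] Yint[of p i], of i] by auto
  have int: "integrable M (\<lambda>\<omega>. (\<Sum>j<Suc k. \<xi> j \<omega> * D j \<omega>) ^ p)" for p
    unfolding expand using gi by (intro Bochner_Integration.integrable_sum integrable_mult_right) auto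
  \<comment> \<open>Young's inequality for the normalised variables plays the role of Hoelder's inequality.\<close>
  have young: "(\<integral>\<omega>. S \<omega> ^ (2 * n - 2 * l) * \<xi> k \<omega> ^ (2 * l) \<partial>M) \<le> 2 * (a ^ (n - l) * u ^ l)"
    if "l \<le> n" for l
  proof -
    have pw: "S \<omega> ^ (2 * n - 2 * l) * \<xi> k \<omega> ^ (2 * l) \<le>
        (a ^ (n - l) * u ^ l) * (S \<omega> ^ (2 * n) / a ^ n + \<xi> k \<omega> ^ (2 * n) / u ^ n)" for \<omega>
    proof -
      have "((S \<omega>)\<^sup>2 / a) ^ (n - l) * ((\<xi> k \<omega>)\<^sup>2 / u) ^ l
        \<le> ((S \<omega>)\<^sup>2 / a) ^ n + ((\<xi> k \<omega>)\<^sup>2 / u) ^ n"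
        using a0 u0 that by (intro power_mult_le_add_power) auto
      then have "(a ^ (n - l) * u ^ l) * (((S \<omega>)\<^sup>2 / a) ^ (n - l) * ((\<xi> k \<omega>)\<^sup>2 / u) ^ l)
        \<le> (a ^ (n - l) * u ^ l) * (((S \<omega>)\<^sup>2 / a) ^ n + ((\<xi> k \<omega>)\<^sup>2 / u) ^ n)"
        using a0 u0 by (intro mult_left_mono) auto
      moreover have "(a ^ (n - l) * u ^ l) * (((S \<omega>)\<^sup>2 / a) ^ (n - l) * ((\<xi> k \<omega>)\<^sup>2 / u) ^ l)
        = S \<omega> ^ (2 * n - 2 * l) * \<xi> k \<omega> ^ (2 * l)"
        using a0 u0 by (simp add: power_divide flip: power_mult right_diff_distrib')
      ultimately show ?thesis by (simp add: power_divide flip: power_mult)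
    qed
    have i2: "integrable M (\<lambda>\<omega>. \<xi> k \<omega> ^ (2 * n))" using Yint[of 0 "2 * n"] by simp
    have "(\<integral>\<omega>. S \<omega> ^ (2 * n - 2 * l) * \<xi> k \<omega> ^ (2 * l) \<partial>M) \<le>
      (\<integral>\<omega>. (a ^ (n - l) * u ^ l) * (S \<omega> ^ (2 * n) / a ^ n + \<xi> k \<omega> ^ (2 * n) / u ^ n) \<partial>M)"
      by (intro integral_mono Yint pw integrable_mult_right Bochner_Integration.integrable_add integrable_divide Sp i2)
    also have "\<dots> = (a ^ (n - l) * u ^ l) *
        ((\<integral>\<omega>. S \<omega> ^ (2 * n) \<partial>M) / a ^ n + (\<integral>\<omega>. \<xi> k \<omega> ^ (2 * n) \<partial>M) / u ^ n)"
      using Sp[of "2 * n"] i2 by (simp add: Bochner_Integration.integral_add integrable_divide)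
    also have "\<dots> \<le> (a ^ (n - l) * u ^ l) * (1 + 1)"
    proof (intro mult_left_mono add_mono)
      have "(\<integral>\<omega>. \<xi> k \<omega> ^ (2 * n) \<partial>M) \<le> u ^ n"
        using \<xi>v[OF kN] v[OF kN] \<open>0 < \<epsilon>\<close> power_mono[of "v k" u n] by (simp add: u_def)
      then show "(\<integral>\<omega>. \<xi> k \<omega> ^ (2 * n) \<partial>M) / u ^ n \<le> 1" using u0 by simp
    qed (use Sb a0 u0 in auto)
    finally show ?thesis by simp
  qed
  have "(\<integral>\<omega>. (\<Sum>j<Suc k. \<xi> j \<omega> * D j \<omega>) ^ (2 * n) \<partial>M) =
    (\<Sum>i\<le>2 * n. real ((2 * n) choose i) *
      ((\<integral>\<omega>. S \<omega> ^ (2 * n - i) * \<xi> k \<omega> ^ i \<partial>M) * gauss_moment i (\<delta> k)))"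
    unfolding expand by (subst Bochner_Integration.integral_sum) (auto simp: gi ge)
  also have "\<dots> = (\<Sum>l\<le>n. real ((2 * n) choose (2 * l)) *
      ((\<integral>\<omega>. S \<omega> ^ (2 * n - 2 * l) * \<xi> k \<omega> ^ (2 * l) \<partial>M) * gauss_moment (2 * l) (\<delta> k)))"
    by (rule sum_even_indices) (simp add: gauss_moment_def)
  also have "\<dots> \<le> (\<Sum>l\<le>n. real (n choose l) * (C * (\<delta> k * u)) ^ l * a ^ (n - l))"
  proof (rule sum_mono)
    fix l assume "l \<in> {..n}"
    then have l: "l \<le> n" by simp
    show "real ((2 * n) choose (2 * l)) *
      ((\<integral>\<omega>. S \<omega> ^ (2 * n - 2 * l) * \<xi> k \<omega> ^ (2 * l) \<partial>M) * gauss_moment (2 * l) (\<delta> k))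
      \<le> real (n choose l) * (C * (\<delta> k * u)) ^ l * a ^ (n - l)"
    \<comment> \<open>The term \<open>l = 0\<close> must keep the coefficient 1, so it uses the induction hypothesis itself.\<close>
    proof (cases "l = 0")
      case True
      then show ?thesis using Sb by (simp add: gauss_moment_def)
    next
      case False
      have "real ((2 * n) choose (2 * l)) *
      ((\<integral>\<omega>. S \<omega> ^ (2 * n - 2 * l) * \<xi> k \<omega> ^ (2 * l) \<partial>M) * gauss_moment (2 * l) (\<delta> k))
       \<le> real ((2 * n) choose (2 * l)) * ((2 * (a ^ (n - l) * u ^ l)) * gauss_moment (2 * l) (\<delta> k))"
        using young[OF l] \<delta>[OF kN] by (intro mult_left_mono mult_right_mono gauss_moment_nonneg) auto
      also have "\<dots> = (2 * real ((2 * n) choose (2 * l)) * gauss_moment (2 * l) 1) *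
          ((\<delta> k * u) ^ l * a ^ (n - l))"
        by (subst gauss_moment_even) (simp add: power_mult_distrib)
      also have "\<dots> \<le> C ^ l * ((\<delta> k * u) ^ l * a ^ (n - l))"
      proof (rule mult_right_mono)
        have "2 * real ((2 * n) choose (2 * l)) * gauss_moment (2 * l) 1 \<le> C"
          unfolding C_def by (rule moment_const_ge[OF l])
        also have "C \<le> C ^ l" using C1 False by (simp add: self_le_power)
        finally show "2 * real ((2 * n) choose (2 * l)) * gauss_moment (2 * l) 1 \<le> C ^ l" .
      qed (use \<delta>[OF kN] u0 a0 in auto)
      also have "\<dots> = 1 * ((C * (\<delta> k * u)) ^ l * a ^ (n - l))" by (simp add: power_mult_distrib)
      also have "\<dots> \<le> real (n choose l) * ((C * (\<delta> k * u)) ^ l * a ^ (n - l))"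
        using \<delta>[OF kN] u0 a0 C1 l zero_less_binomial[OF l]
        by (intro mult_right_mono) (auto simp: Suc_le_eq simp del: zero_less_binomial_iff)
      finally show ?thesis by simp
    qed
  qed
  also have "\<dots> = (C * (\<delta> k * u) + a) ^ n"
    by (subst binomial_ring) simp
  also have "C * (\<delta> k * u) + a = \<epsilon> + C * (\<Sum>j<Suc k. \<delta> j * (v j + \<epsilon>))"
    by (simp add: a_def u_def algebra_simps)
  finally show ?case using int by (simp add: C_def)
qed

lemma (in prob_space) discrete_moment_bound:
  fixes \<xi> D :: "nat \<Rightarrow> 'a \<Rightarrow> real" and G :: "nat \<Rightarrow> 'a measure"
  assumes sub: "\<And>k. k < N \<Longrightarrow> subalgebra M (G k)"
    and adapted: "\<And>j k. j \<le> k \<Longrightarrow> k < N \<Longrightarrow> \<xi> j \<in> borel_measurable (G k)"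
    and past: "\<And>j k. j < k \<Longrightarrow> k < N \<Longrightarrow> D j \<in> borel_measurable (G k)"
    and bdd: "\<And>k. k < N \<Longrightarrow> \<exists>B. \<forall>\<omega>\<in>space M. \<bar>\<xi> k \<omega>\<bar> \<le> B"
    and gauss: "\<And>k i Y. k < N \<Longrightarrow> Y \<in> borel_measurable (G k) \<Longrightarrow> integrable M Y \<Longrightarrow>
       integrable M (\<lambda>\<omega>. Y \<omega> * D k \<omega> ^ i) \<and>
       (\<integral>\<omega>. Y \<omega> * D k \<omega> ^ i \<partial>M) = (\<integral>\<omega>. Y \<omega> \<partial>M) * gauss_moment i (\<delta> k)"
    and \<delta>: "\<And>k. k < N \<Longrightarrow> 0 \<le> \<delta> k" and v: "\<And>k. k < N \<Longrightarrow> 0 \<le> v k"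
    and \<xi>v: "\<And>k. k < N \<Longrightarrow> (\<integral>\<omega>. \<xi> k \<omega> ^ (2 * n) \<partial>M) \<le> v k ^ n"
  shows "(\<integral>\<^sup>+\<omega>. ennreal ((\<Sum>j<N. \<xi> j \<omega> * D j \<omega>) ^ (2 * n)) \<partial>M)
      \<le> ennreal ((moment_const n * (\<Sum>j<N. \<delta> j * v j)) ^ n)"
proof -
  let ?S = "\<lambda>\<omega>. \<Sum>j<N. \<xi> j \<omega> * D j \<omega>"
  have *: "(\<forall>p. integrable M (\<lambda>\<omega>. ?S \<omega> ^ p)) \<and> (\<integral>\<omega>. ?S \<omega> ^ (2 * n) \<partial>M)
      \<le> (\<epsilon> + moment_const n * (\<Sum>j<N. \<delta> j * (v j + \<epsilon>))) ^ n" if "0 < \<epsilon>" for \<epsilon>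
    by (rule discrete_moment_bound_eps[of N G \<xi> D \<delta> v n \<epsilon> N];
        (fact sub adapted past bdd gauss \<delta> v \<xi>v that | simp))
  have lim: "((\<lambda>\<epsilon>. (\<epsilon> + moment_const n * (\<Sum>j<N. \<delta> j * (v j + \<epsilon>))) ^ n)
      \<longlongrightarrow> (0 + moment_const n * (\<Sum>j<N. \<delta> j * (v j + 0))) ^ n) (at_right 0)"
    by (intro tendsto_intros)
  have ev: "eventually (\<lambda>\<epsilon>. (\<integral>\<omega>. ?S \<omega> ^ (2 * n) \<partial>M)
      \<le> (\<epsilon> + moment_const n * (\<Sum>j<N. \<delta> j * (v j + \<epsilon>))) ^ n) (at_right 0)"
    by (rule eventually_mono[OF eventually_at_right_less]) (rule conjunct2[OF *])
  have "(\<integral>\<omega>. ?S \<omega> ^ (2 * n) \<partial>M) \<le> (moment_const n * (\<Sum>j<N. \<delta> j * v j)) ^ n"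
    using tendsto_lowerbound[OF lim ev] by simp
  moreover have "(\<integral>\<^sup>+\<omega>. ennreal (?S \<omega> ^ (2 * n)) \<partial>M) = ennreal (\<integral>\<omega>. ?S \<omega> ^ (2 * n) \<partial>M)"
    using conjunct1[OF *[OF zero_less_one]]
    by (intro nn_integral_eq_integral) (auto simp: zero_le_even_power)
  ultimately show ?thesis by (simp add: ennreal_leI)
qed

section \<open>Brownian motion and its completed filtration\<close>

lemma space_generated_sigma [simp]: "space (generated_sigma M I W) = space M"
  by (simp add: generated_sigma_def space_measure_of_conv)

lemma space_completed_sigma [simp]: "space (completed_sigma M I W) = space M"
  by (simp add: completed_sigma_def space_measure_of_conv)

lemma space_completed_filtration [simp]: "space (completed_filtration M T W t) = space M"
  by (simp add: completed_filtration_def space_measure_of_conv)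

lemma sets_generated_sigma:
  "sets (generated_sigma M I W) =
     sigma_sets (space M) {W u -` A \<inter> space M |u A. u \<in> I \<and> A \<in> sets borel}"
  unfolding generated_sigma_def by (rule sets_measure_of) auto

lemma sets_completed_sigma:
  "sets (completed_sigma M I W) =
     sigma_sets (space M) (sets (generated_sigma M I W) \<union> null_sets (completion M))"
  unfolding completed_sigma_def
  by (rule sets_measure_of) (use sets.space_closed[of "generated_sigma M I W"] sets.space_closed[of "completion M"] in \<open>auto simp: null_sets_def\<close>)

lemma sets_completed_filtration:
  "sets (completed_filtration M T W t) = (\<Inter>s\<in>{t<..}. sets (completed_sigma M {0..min s T} W))"
  (is "_ = ?R")
proof -
  have "?R \<subseteq> Pow (space M)"
    using sets.space_closed[of "completed_sigma M {0..min (t + 1) T} W"] by (auto dest!: INT_D[of _ _ _ "t + 1"])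
  then have "sets (completed_filtration M T W t) = sigma_sets (space M) ?R"
    unfolding completed_filtration_def by (rule sets_measure_of)
  moreover have "sigma_sets (space M) ?R \<subseteq> sets (completed_sigma M {0..min s T} W)" if "t < s" for s
    using sets.sigma_sets_subset[of ?R "completed_sigma M {0..min s T} W"] that by auto
  ultimately show ?thesis by auto
qed

text \<open>
  The sets that differ from a set of the generated sigma-algebra by a null set form a sigma-algebra
  that contains both generators.
\<close>

lemma sym_diff_null_generated_sigma:
  assumes "A \<in> sets (completed_sigma M I W)"
  shows "\<exists>B\<in>sets (generated_sigma M I W). sym_diff A B \<in> null_sets (completion M)"
  using assms unfolding sets_completed_sigma
proof (induction rule: sigma_sets.induct)
  case (Basic a)
  then show ?case
    by (auto intro: bexI[of _ a] bexI[of _ "{}"])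
next
  case Empty
  then show ?case by (auto intro: bexI[of _ "{}"])
next
  case (Compl a)
  then obtain B where B: "B \<in> sets (generated_sigma M I W)" "sym_diff a B \<in> null_sets (completion M)"
    by auto
  then have "space M - B \<in> sets (generated_sigma M I W)"
    using sets.compl_sets[OF B(1)] by simp
  moreover have "sym_diff (space M - a) (space M - B) \<in> null_sets (completion M)"
    by (rule null_sets_completion_subset[OF _ B(2)]) auto
  ultimately show ?case by blast
next
  case (Union a)
  then obtain B where B: "\<And>i. B i \<in> sets (generated_sigma M I W)"
      "\<And>i::nat. sym_diff (a i) (B i) \<in> null_sets (completion M)"
    by metis
  have "(\<Union>i. sym_diff (a i) (B i)) \<in> null_sets (completion M)"
    using B(2) by (rule null_sets_UN)
  then have "sym_diff (\<Union>(range a)) (\<Union>(range B)) \<in> null_sets (completion M)"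
    by (rule null_sets_completion_subset[rotated]) auto
  then show ?case using B(1) by (intro bexI[of _ "\<Union>(range B)"]) auto
qed

lemma borel_measurable_vec_nth [measurable (raw)]:
  fixes f :: "'a \<Rightarrow> ('b::{topological_space}) ^ 'n::finite"
  assumes "f \<in> borel_measurable N"
  shows "(\<lambda>x. f x $ i) \<in> borel_measurable N"
proof -
  have "(\<lambda>v::'b^'n. v $ i) \<in> borel_measurable borel"
    by (intro borel_measurable_continuous_onI continuous_intros)
  then show ?thesis by (rule measurable_compose[OF assms])
qed

locale brownian =
  fixes M :: "'a measure" and T :: real and W :: "real \<Rightarrow> 'a \<Rightarrow> real ^ 'm::finite"
  assumes brownian: "brownian_motion M T W" and T_pos: "0 < T"
begin

abbreviation "P \<equiv> completion M"

abbreviation "F \<equiv> completed_filtration M T W"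

sublocale M: prob_space M
  using brownian by (simp add: brownian_motion_def)

sublocale P: prob_space P
  by (rule M.prob_space_completion)

lemma W_measurable_M: "t \<in> {0..T} \<Longrightarrow> W t \<in> borel_measurable M"
  using brownian by (auto simp: brownian_motion_def)

lemma sets_generated_sigma_le: "I \<subseteq> {0..T} \<Longrightarrow> sets (generated_sigma M I W) \<subseteq> sets M"
  unfolding sets_generated_sigma
  by (intro sets.sigma_sets_subset) (auto intro: measurable_sets[OF W_measurable_M])

lemma sets_completed_sigma_le:
  assumes "I \<subseteq> {0..T}"
  shows "sets (completed_sigma M I W) \<subseteq> sets P"
proof -
  have "sets (completed_sigma M I W) \<subseteq> sigma_sets (space P) (sets P)"
    unfolding sets_completed_sigma space_completion using sets_generated_sigma_le[OF assms]
    by (intro sigma_sets_mono') auto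
  then show ?thesis by (simp add: sets.sigma_sets_eq del: space_completion)
qed

lemma null_sets_in_F: "N \<in> null_sets P \<Longrightarrow> N \<in> sets (F t)"
  by (auto simp: sets_completed_filtration sets_completed_sigma)

lemma sets_F_le: "sets (F t) \<subseteq> sets P"
  using sets_completed_sigma_le[of "{0..min (t + 1) T}"]
  by (auto simp: sets_completed_filtration)

lemma sets_F_mono: "s \<le> t \<Longrightarrow> sets (F s) \<subseteq> sets (F t)"
  by (auto simp: sets_completed_filtration)

lemma sets_F_le_completed: "s < t \<Longrightarrow> sets (F s) \<subseteq> sets (completed_sigma M {0..min t T} W)"
  by (auto simp: sets_completed_filtration)

lemma subalgebra_F: "subalgebra P (F t)"
  using sets_F_le by (simp add: subalgebra_def)

lemma measurable_F_P: "f \<in> measurable (F t) N \<Longrightarrow> f \<in> measurable P N"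
  using measurable_from_subalg[OF subalgebra_F] by blast

lemma measurable_F_mono: "s \<le> t \<Longrightarrow> f \<in> measurable (F s) N \<Longrightarrow> f \<in> measurable (F t) N"
  using measurable_from_subalg[of "F t" "F s"] sets_F_mono by (auto simp: subalgebra_def)

lemma W_measurable_generated:
  "u \<in> I \<Longrightarrow> W u \<in> borel_measurable (generated_sigma M I W)"
  by (rule measurableI) (auto simp: sets_generated_sigma intro!: sigma_sets.Basic)

lemma W_measurable_completed:
  assumes "u \<in> I"
  shows "W u \<in> borel_measurable (completed_sigma M I W)"
proof (rule measurable_from_subalg[OF _ W_measurable_generated[OF assms]])
  show "subalgebra (completed_sigma M I W) (generated_sigma M I W)"
    by (auto simp: subalgebra_def sets_completed_sigma)
qed

lemma W_measurable_F:
  assumes "0 \<le> u" "u \<le> t" "u \<le> T"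
  shows "W u \<in> borel_measurable (F t)"
proof (rule measurableI)
  fix A :: "(real ^ 'm) set" assume A: "A \<in> sets borel"
  have "W u -` A \<inter> space M \<in> sets (completed_sigma M {0..min s T} W)" if "t < s" for s
    using measurable_sets[OF W_measurable_completed[of u "{0..min s T}"] A] assms that by auto
  then show "W u -` A \<inter> space (F t) \<in> sets (F t)"
    by (auto simp: sets_completed_filtration)
qed auto

lemma W_measurable_P: "u \<in> {0..T} \<Longrightarrow> W u \<in> borel_measurable P"
  by (rule measurable_completion[OF W_measurable_M])

text \<open>Every \<open>F t\<close> contains the null sets, so it does not distinguish versions.\<close>

lemma measurable_F_cong_AE:
  fixes f g :: "'a \<Rightarrow> 'c::topological_space"
  assumes f: "f \<in> borel_measurable (F t)" and eq: "AE \<omega> in M. f \<omega> = g \<omega>"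
  shows "g \<in> borel_measurable (F t)"
proof (rule measurableI)
  fix A :: "'c set" assume A: "A \<in> sets borel"
  obtain N where N: "N \<in> null_sets M" "{\<omega>\<in>space M. f \<omega> \<noteq> g \<omega>} \<subseteq> N"
    using AE_E[OF eq] by (auto simp: null_sets_def)
  have NP: "N \<in> null_sets P" using N by (auto intro: null_sets_completionI)
  have "f -` A \<inter> space M \<in> sets (F t)" using measurable_sets[OF f A] by simp
  moreover have "N \<in> sets (F t)" using NP by (rule null_sets_in_F)
  moreover have "g -` A \<inter> N \<inter> space M \<in> sets (F t)"
    by (rule null_sets_in_F[OF null_sets_completion_subset[OF _ NP]]) auto
  moreover have "g -` A \<inter> space (F t) = ((f -` A \<inter> space M) - N) \<union> (g -` A \<inter> N \<inter> space M)"
    using N(2) by auto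
  ultimately show "g -` A \<inter> space (F t) \<in> sets (F t)" by auto
qed auto

text \<open>
  Both probabilities are unchanged when \<open>A\<close> is replaced by an equivalent event that is generated
  by the Brownian motion itself.
\<close>

lemma indep_increment_completed:
  assumes st: "0 \<le> s" "s < t" "t \<le> T"
    and A: "A \<in> sets (completed_sigma M {0..s} W)"
    and E: "E \<in> sets (vimage_algebra (space M) (\<lambda>\<omega>. W t \<omega> - W s \<omega>) borel)"
  shows "measure P (A \<inter> E) = measure P A * measure P E"
proof -
  have ind: "M.indep_set (sets (generated_sigma M {0..s} W))
          (sets (vimage_algebra (space M) (\<lambda>\<omega>. W t \<omega> - W s \<omega>) borel))"
    using brownian st by (auto simp: brownian_motion_def)
  obtain B where B: "B \<in> sets (generated_sigma M {0..s} W)" "sym_diff A B \<in> null_sets P"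
    using sym_diff_null_generated_sigma[OF A] by auto
  have BM: "B \<in> sets M" and EM: "E \<in> sets M"
    using B(1) E ind by (auto simp: M.indep_sets2_eq)
  have AP: "A \<in> sets P" using A sets_completed_sigma_le[of "{0..s}"] st by auto
  have ae: "AE \<omega> in P. \<omega> \<in> A \<longleftrightarrow> \<omega> \<in> B"
    by (rule AE_I'[OF B(2)]) auto
  have "measure P A = measure P B"
    using ae AP BM by (intro P.finite_measure_eq_AE) auto
  moreover have "measure P (A \<inter> E) = measure P (B \<inter> E)"
    using ae AP BM EM by (intro P.finite_measure_eq_AE) (auto elim!: eventually_mono)
  moreover have "measure M (B \<inter> E) = measure M B * measure M E"
    using M.indep_setD[OF ind B(1) E] .
  ultimately show ?thesis using BM EM by simp
qed

text \<open>Integrating out the other coordinates of the product density leaves a one-dimensional normal law.\<close>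

lemma distributed_increment:
  assumes st: "0 \<le> s" "s < t" "t \<le> T"
  shows "distributed M lborel (\<lambda>\<omega>. (W t \<omega> - W s \<omega>) $ j) (\<lambda>x. ennreal (normal_density 0 (sqrt (t - s)) x))"
proof -
  define \<phi> where "\<phi> = (\<lambda>x. normal_density 0 (sqrt (t - s)) x)"
  have \<phi>m[measurable]: "\<phi> \<in> borel_measurable borel" by (simp add: \<phi>_def)
  have \<phi>0: "0 \<le> \<phi> x" for x by (simp add: \<phi>_def)
  have \<phi>1: "(\<integral>\<^sup>+x. ennreal (\<phi> x) \<partial>lborel) = 1"
    using st unfolding \<phi>_def by (subst nn_integral_eq_integral) (auto simp: integrable_normal_density integral_normal_density)
  have d: "distributed M lborel (\<lambda>\<omega>. W t \<omega> - W s \<omega>)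
          (\<lambda>x. ennreal (\<Prod>i\<in>UNIV. \<phi> (x $ i)))"
    using brownian st by (auto simp: brownian_motion_def \<phi>_def)
  have Wm[measurable]: "W t \<in> borel_measurable M" "W s \<in> borel_measurable M"
    using st by (auto intro: W_measurable_M)
  have "distr M lborel (\<lambda>\<omega>. (W t \<omega> - W s \<omega>) $ j) = density lborel (\<lambda>x. ennreal (\<phi> x))"
  proof (rule measure_eqI)
    fix A :: "real set" assume "A \<in> sets (distr M lborel (\<lambda>\<omega>. (W t \<omega> - W s \<omega>) $ j))"
    then have A[measurable]: "A \<in> sets borel" by simp
    have jm: "(\<lambda>x::real^'m. x $ j) \<in> borel_measurable borel" by measurable
    have Bj[measurable]: "(\<lambda>x::real^'m. x $ j) -` A \<in> sets borel"
      using measurable_sets[OF jm A] by simp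
    define f where "f = (\<lambda>(b::real^'m) y. ennreal (\<phi> y) * (if b = axis j 1 then indicator A y else 1))"
    have bij: "bij_betw (\<lambda>i. axis i (1::real)) UNIV (Basis :: (real^'m) set)"
      by (auto simp: bij_betw_def inj_on_def axis_eq_axis Basis_vec_def)
    have fprod: "(\<Prod>b\<in>Basis. f b (x \<bullet> b)) = ennreal (\<Prod>i\<in>UNIV. \<phi> (x $ i)) * indicator ((\<lambda>x. x $ j) -` A) x" for x
    proof -
      have "(\<Prod>b\<in>Basis. f b (x \<bullet> b)) = (\<Prod>i\<in>UNIV. f (axis i 1) (x \<bullet> axis i 1))"
        by (rule prod.reindex_bij_betw[OF bij, symmetric])
      also have "\<dots> = (\<Prod>i\<in>UNIV. ennreal (\<phi> (x $ i))) * (\<Prod>i\<in>UNIV. if i = j then indicator A (x $ i) else 1)"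
        by (simp add: f_def prod.distrib inner_axis axis_eq_axis)
      also have "(\<Prod>i\<in>UNIV. if i = j then indicator A (x $ i) else (1::ennreal)) = indicator A (x $ j)"
        by (simp add: prod.delta)
      finally show ?thesis using \<phi>0 by (simp add: prod_ennreal indicator_def)
    qed
    have "emeasure (distr M lborel (\<lambda>\<omega>. (W t \<omega> - W s \<omega>) $ j)) A =
        emeasure (distr M lborel (\<lambda>\<omega>. W t \<omega> - W s \<omega>)) ((\<lambda>x. x $ j) -` A)"
      by (subst (1 2) emeasure_distr) (auto intro!: arg_cong2[where f = emeasure])
    also have "\<dots> = (\<integral>\<^sup>+x. ennreal (\<Prod>i\<in>UNIV. \<phi> (x $ i)) * indicator ((\<lambda>x. x $ j) -` A) x \<partial>lborel)"
      by (subst distributed_distr_eq_density[OF d], subst emeasure_density)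
         (use distributed_borel_measurable[OF d] in auto)
    also have "\<dots> = (\<integral>\<^sup>+x. (\<Prod>b\<in>Basis. f b (x \<bullet> b)) \<partial>lborel)"
      by (simp add: fprod)
    also have "\<dots> = (\<Prod>b\<in>Basis. (\<integral>\<^sup>+y. f b y \<partial>lborel))"
      by (rule nn_integral_lborel_prod) (auto simp: f_def)
    also have "\<dots> = (\<Prod>i\<in>UNIV. (\<integral>\<^sup>+y. f (axis i 1) y \<partial>lborel))"
      by (rule prod.reindex_bij_betw[OF bij, symmetric])
    also have "\<dots> = (\<Prod>i\<in>UNIV. if i = j then (\<integral>\<^sup>+y. ennreal (\<phi> y) * indicator A y \<partial>lborel) else 1)"
      by (intro prod.cong) (auto simp: f_def axis_eq_axis \<phi>1)
    also have "\<dots> = (\<integral>\<^sup>+y. ennreal (\<phi> y) * indicator A y \<partial>lborel)"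
      by (simp add: prod.delta)
    also have "\<dots> = emeasure (density lborel (\<lambda>x. ennreal (\<phi> x))) A"
      by (simp add: emeasure_density)
    finally show "emeasure (distr M lborel (\<lambda>\<omega>. (W t \<omega> - W s \<omega>) $ j)) A
      = emeasure (density lborel (\<lambda>x. ennreal (\<phi> x))) A" .
  qed auto
  then show ?thesis by (simp add: distributed_def \<phi>_def)
qed

lemma increment_moments:
  assumes st: "0 \<le> s" "s < t" "t \<le> T"
  shows "integrable M (\<lambda>\<omega>. ((W t \<omega> - W s \<omega>) $ j) ^ i)"
    and "(\<integral>\<omega>. ((W t \<omega> - W s \<omega>) $ j) ^ i \<partial>M) = gauss_moment i (t - s)"
proof -
  note d = distributed_increment[OF st, of j]
  have pos: "0 < sqrt (t - s)" using st by simp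
  have hb: "has_bochner_integral lborel (\<lambda>x. normal_density 0 (sqrt (t - s)) x * x ^ i) (gauss_moment i (t - s))"
  proof (cases "even i")
    case True
    then obtain k where "i = 2 * k" by (auto elim: evenE)
    then show ?thesis using normal_moment_even[OF pos, of 0 k] st
      by (simp add: gauss_moment_def power_divide field_simps)
  next
    case False
    then obtain k where "i = 2 * k + 1" by (auto elim: oddE)
    then show ?thesis using normal_moment_odd[OF pos, of 0 k]
      by (simp add: gauss_moment_def)
  qed
  show "integrable M (\<lambda>\<omega>. ((W t \<omega> - W s \<omega>) $ j) ^ i)"
    by (subst distributed_integrable[OF d, symmetric]) (use hb in \<open>auto intro: integrable.intros\<close>)
  show "(\<integral>\<omega>. ((W t \<omega> - W s \<omega>) $ j) ^ i \<partial>M) = gauss_moment i (t - s)"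
    by (subst distributed_integral[OF d, symmetric]) (use hb in \<open>auto intro: has_bochner_integral_integral_eq\<close>)
qed

lemma gauss_increment:
  assumes st: "0 \<le> s" "s \<le> t" "t \<le> T"
    and Y: "Y \<in> borel_measurable (completed_sigma M {0..s} W)" "integrable P Y"
  shows "integrable P (\<lambda>\<omega>. Y \<omega> * ((W t \<omega> - W s \<omega>) $ j) ^ i) \<and>
    (\<integral>\<omega>. Y \<omega> * ((W t \<omega> - W s \<omega>) $ j) ^ i \<partial>P) = (\<integral>\<omega>. Y \<omega> \<partial>P) * gauss_moment i (t - s)"
proof (cases "s = t")
  case True
  then show ?thesis using Y(2) by (cases i) (auto simp: gauss_moment_def)
next
  case False
  then have lt: "s < t" using st by simp
  define D where "D = (\<lambda>\<omega>. W t \<omega> - W s \<omega>)"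
  have [measurable]: "W t \<in> borel_measurable M" "W s \<in> borel_measurable M"
    using st by (auto intro: W_measurable_M)
  have Dm[measurable]: "D \<in> borel_measurable M" by (simp add: D_def)
  have DPm: "(\<lambda>\<omega>. (D \<omega> $ j) ^ i) \<in> borel_measurable M" by measurable
  have YP: "Y \<in> borel_measurable P" using Y(2) by auto
  have "P.indep_set (sigma_sets (space P) {Y -` A \<inter> space P |A. A \<in> sets borel})
      (sigma_sets (space P) {(\<lambda>\<omega>. (D \<omega> $ j) ^ i) -` A \<inter> space P |A. A \<in> sets borel})"
  proof (rule P.indep_setI)
    show "sigma_sets (space P) {Y -` A \<inter> space P |A. A \<in> sets borel} \<subseteq> P.events"
      by (rule sets.sigma_sets_subset) (use measurable_sets[OF YP] in auto)
    show "sigma_sets (space P) {(\<lambda>\<omega>. (D \<omega> $ j) ^ i) -` A \<inter> space P |A. A \<in> sets borel} \<subseteq> P.events"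
      by (rule sets.sigma_sets_subset) (use measurable_sets[OF measurable_completion[OF DPm]] in auto)
    fix a b assume a: "a \<in> sigma_sets (space P) {Y -` A \<inter> space P |A. A \<in> sets borel}"
      and b: "b \<in> sigma_sets (space P) {(\<lambda>\<omega>. (D \<omega> $ j) ^ i) -` A \<inter> space P |A. A \<in> sets borel}"
    have "sigma_sets (space (completed_sigma M {0..s} W)) {Y -` A \<inter> space P |A. A \<in> sets borel}
        \<subseteq> sets (completed_sigma M {0..s} W)"
      by (rule sets.sigma_sets_subset) (use measurable_sets[OF Y(1)] in auto)
    then have a': "a \<in> sets (completed_sigma M {0..s} W)" using a by auto
    let ?V = "vimage_algebra (space M) D borel"
    have mV: "(\<lambda>\<omega>. (D \<omega> $ j) ^ i) \<in> borel_measurable ?V"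
      by (rule measurable_compose[OF measurable_vimage_algebra1]) auto
    have "sigma_sets (space ?V) {(\<lambda>\<omega>. (D \<omega> $ j) ^ i) -` A \<inter> space P |A. A \<in> sets borel} \<subseteq> sets ?V"
      by (intro sets.sigma_sets_subset) (use measurable_sets[OF mV] in auto)
    then have b': "b \<in> sets ?V" using b by auto
    show "P.prob (a \<inter> b) = P.prob a * P.prob b"
      by (rule indep_increment_completed[OF st(1) lt st(3) a']) (use b' in \<open>simp add: D_def\<close>)
  qed
  then have ind: "P.indep_var borel Y borel (\<lambda>\<omega>. (D \<omega> $ j) ^ i)"
    unfolding P.indep_var_eq using YP measurable_completion[OF DPm] by blast
  have i1: "integrable P (\<lambda>\<omega>. (D \<omega> $ j) ^ i)"
    using increment_moments(1)[OF st(1) lt st(3), of j i] DPm by (simp add: integrable_completion D_def)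
  have "(\<integral>\<omega>. (D \<omega> $ j) ^ i \<partial>P) = gauss_moment i (t - s)"
    using increment_moments(2)[OF st(1) lt st(3), of j i] DPm by (simp add: integral_completion D_def)
  then show ?thesis
    using P.indep_var_integrable[OF ind Y(2) i1] P.indep_var_lebesgue_integral[OF ind Y(2) i1]
    by (simp add: D_def)
qed

end

section \<open>Matrix products and the Frobenius norm\<close>

lemma norm_matrix_vector_mult_le:
  fixes A :: "real ^ 'n::finite ^ 'm::finite"
  shows "norm (A *v x) \<le> norm A * norm x"
proof -
  have "norm ((A *v x) $ i) \<le> norm (A $ i) * norm x" for i
    using Cauchy_Schwarz_ineq2[of "A $ i" x] by (simp add: matrix_vector_mult_def inner_vec_def)
  then have "L2_set (\<lambda>i. norm ((A *v x) $ i)) UNIV \<le> L2_set (\<lambda>i. norm (A $ i) * norm x) UNIV"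
    by (intro L2_set_mono) auto
  also have "\<dots> = L2_set (\<lambda>i. norm (A $ i)) UNIV * norm x"
    by (rule L2_set_left_distrib[symmetric]) simp
  finally show ?thesis by (simp add: norm_vec_def)
qed

lemma bounded_bilinear_matrix_vector_mult:
  "bounded_bilinear ((*v) :: real ^ 'n::finite ^ 'm::finite \<Rightarrow> real ^ 'n \<Rightarrow> real ^ 'm)"
proof (rule bounded_bilinear.intro)
  fix A :: "real ^ 'n ^ 'm" and r :: real and x :: "real ^ 'n"
  show "(r *\<^sub>R A) *v x = r *\<^sub>R (A *v x)"
    by (simp add: vec_eq_iff matrix_vector_mult_def sum_distrib_left mult_ac)
next
  show "\<exists>K. \<forall>(A :: real ^ 'n ^ 'm) x. norm (A *v x) \<le> norm A * norm x * K"
    using norm_matrix_vector_mult_le by (intro exI[of _ 1]) auto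
qed (auto simp: algebra_simps vec_eq_iff matrix_vector_mult_def sum.distrib sum_distrib_left)

lemma norm_matrix_matrix_mult_le:
  fixes A :: "real ^ 'n::finite ^ 'm::finite" and B :: "real ^ 'k::finite ^ 'n"
  shows "norm (A ** B) \<le> norm A * norm B"
proof -
  have "norm ((A ** B) $ i) \<le> norm (A $ i) * norm B" for i
  proof -
    have "(A ** B) $ i = (\<Sum>k\<in>UNIV. (A $ i $ k) *\<^sub>R (B $ k))"
      by (simp add: vec_eq_iff matrix_matrix_mult_def)
    then have "norm ((A ** B) $ i) \<le> (\<Sum>k\<in>UNIV. \<bar>A $ i $ k\<bar> * \<bar>norm (B $ k)\<bar>)"
      by (simp add: sum_norm_le)
    also have "\<dots> \<le> L2_set (\<lambda>k. A $ i $ k) UNIV * L2_set (\<lambda>k. norm (B $ k)) UNIV"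
      by (rule L2_set_mult_ineq)
    finally show ?thesis by (simp add: norm_vec_def L2_set_def)
  qed
  then have "L2_set (\<lambda>i. norm ((A ** B) $ i)) UNIV \<le> L2_set (\<lambda>i. norm (A $ i) * norm B) UNIV"
    by (intro L2_set_mono) auto
  also have "\<dots> = L2_set (\<lambda>i. norm (A $ i)) UNIV * norm B"
    by (rule L2_set_left_distrib[symmetric]) simp
  finally show ?thesis by (simp add: norm_vec_def)
qed

lemma abs_entry_le_norm:
  fixes A :: "real ^ 'n::finite ^ 'm::finite"
  shows "\<bar>A $ i $ j\<bar> \<le> norm A"
  by (rule order_trans[OF component_le_norm_cart Finite_Cartesian_Product.norm_nth_le])

lemma bounded_bilinear_matrix_matrix_mult:
  "bounded_bilinear ((**) :: real ^ 'n::finite ^ 'm::finite \<Rightarrow> real ^ 'k::finite ^ 'n \<Rightarrow> real ^ 'k ^ 'm)"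
proof (rule bounded_bilinear.intro)
  show "\<exists>K. \<forall>(A::real ^ 'n ^ 'm) (B::real ^ 'k ^ 'n). norm (A ** B) \<le> norm A * norm B * K"
    using norm_matrix_matrix_mult_le by (intro exI[of _ 1]) auto
qed (auto simp: algebra_simps vec_eq_iff matrix_matrix_mult_def sum.distrib sum_distrib_left)

interpretation mv: bounded_bilinear "(*v) :: real ^ 'n::finite ^ 'm::finite \<Rightarrow> real ^ 'n \<Rightarrow> real ^ 'm"
  by (rule bounded_bilinear_matrix_vector_mult)

interpretation mm: bounded_bilinear "(**) :: real ^ 'n::finite ^ 'm::finite \<Rightarrow> real ^ 'k::finite ^ 'n \<Rightarrow> real ^ 'k ^ 'm"
  by (rule bounded_bilinear_matrix_matrix_mult)

lemma borel_measurable_matrix_vector_mult [measurable (raw)]: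
  fixes f :: "'a \<Rightarrow> real ^ 'n::finite ^ 'm::finite"
  assumes "f \<in> borel_measurable N" "g \<in> borel_measurable N"
  shows "(\<lambda>x. f x *v g x) \<in> borel_measurable N"
  by (rule borel_measurable_continuous_Pair[OF assms]) (intro mv.continuous_on continuous_intros)

lemma borel_measurable_matrix_matrix_mult [measurable (raw)]:
  fixes f :: "'a \<Rightarrow> real ^ 'n::finite ^ 'm::finite" and g :: "'a \<Rightarrow> real ^ 'k::finite ^ 'n"
  assumes "f \<in> borel_measurable N" "g \<in> borel_measurable N"
  shows "(\<lambda>x. f x ** g x) \<in> borel_measurable N"
  by (rule borel_measurable_continuous_Pair[OF assms]) (intro mm.continuous_on continuous_intros)

text \<open>Fatou's lemma in the form in which moment bounds pass to limits of random variables.\<close>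

lemma nn_integral_le_of_tendsto:
  fixes f :: "'a \<Rightarrow> ennreal"
  assumes u: "\<And>q::nat. u q \<in> borel_measurable N" and lim: "AE x in N. (\<lambda>q. u q x) \<longlonglongrightarrow> f x"
    and bd: "\<And>q. (\<integral>\<^sup>+x. u q x \<partial>N) \<le> c q" and c: "c \<longlonglongrightarrow> C"
  shows "(\<integral>\<^sup>+x. f x \<partial>N) \<le> C"
proof -
  have "(\<integral>\<^sup>+x. f x \<partial>N) = (\<integral>\<^sup>+x. liminf (\<lambda>q. u q x) \<partial>N)"
    using lim by (intro nn_integral_cong_AE) (auto elim!: eventually_mono dest: lim_imp_Liminf[OF trivial_limit_sequentially])
  also have "\<dots> \<le> liminf (\<lambda>q. \<integral>\<^sup>+x. u q x \<partial>N)"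
    using u by (rule nn_integral_liminf)
  also have "\<dots> \<le> liminf c"
    using bd by (intro Liminf_mono) auto
  also have "\<dots> = C"
    using c by (rule lim_imp_Liminf[OF trivial_limit_sequentially])
  finally show ?thesis .
qed

section \<open>Partitions and simple integrands\<close>

lemma partition_mono:
  fixes \<tau> :: "nat \<Rightarrow> real"
  assumes "\<And>k. k < N \<Longrightarrow> \<tau> k \<le> \<tau> (Suc k)" "i \<le> j" "j \<le> N"
  shows "\<tau> i \<le> \<tau> j"
  using \<open>i \<le> j\<close> \<open>j \<le> N\<close> by (induction rule: dec_induct) (auto intro: order_trans[OF _ assms(1)])

lemma partition_cell_exists:
  fixes \<tau> :: "nat \<Rightarrow> real"
  assumes "\<tau> 0 < s" "s \<le> \<tau> N"
  shows "\<exists>k<N. \<tau> k < s \<and> s \<le> \<tau> (Suc k)"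
  using assms
proof (induction N)
  case (Suc N)
  show ?case
  proof (cases "s \<le> \<tau> N")
    case True
    then obtain k where "k < N" "\<tau> k < s" "s \<le> \<tau> (Suc k)" using Suc by blast
    then show ?thesis by (intro exI[of _ k]) simp
  next
    case False
    then show ?thesis using Suc.prems by (intro exI[of _ N]) simp
  qed
qed simp

lemma sum_partition_cell:
  fixes \<tau> :: "nat \<Rightarrow> real" and f :: "nat \<Rightarrow> 'b::real_vector"
  assumes mono: "\<And>k. k < N \<Longrightarrow> \<tau> k \<le> \<tau> (Suc k)" and k: "k < N" "\<tau> k < s" "s \<le> \<tau> (Suc k)"
  shows "(\<Sum>i<N. indicator {\<tau> i<..\<tau> (Suc i)} s *\<^sub>R f i) = f k"
proof -
  have "indicator {\<tau> i<..\<tau> (Suc i)} s *\<^sub>R f i = (if i = k then f i else 0)" if "i < N" for i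
  proof (cases i k rule: linorder_cases)
    case less
    then have "\<tau> (Suc i) \<le> \<tau> k" using k by (intro partition_mono[where \<tau> = \<tau> and N = N, OF mono]) auto
    then show ?thesis using less k by (auto simp: indicator_def)
  next
    case greater
    then have "\<tau> (Suc k) \<le> \<tau> i" using that by (intro partition_mono[where \<tau> = \<tau> and N = N, OF mono]) auto
    then show ?thesis using greater k by (auto simp: indicator_def)
  qed (use k in auto)
  then have "(\<Sum>i<N. indicator {\<tau> i<..\<tau> (Suc i)} s *\<^sub>R f i) = (\<Sum>i<N. if i = k then f i else 0)"
    by (intro sum.cong) auto
  then show ?thesis using k by (simp add: sum.delta)
qed

lemma sum_partition_outside:
  fixes \<tau> :: "nat \<Rightarrow> real" and f :: "nat \<Rightarrow> 'b::real_vector"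
  assumes mono: "\<And>k. k < N \<Longrightarrow> \<tau> k \<le> \<tau> (Suc k)" and "s \<le> \<tau> 0 \<or> \<tau> N < s"
  shows "(\<Sum>i<N. indicator {\<tau> i<..\<tau> (Suc i)} s *\<^sub>R f i) = 0"
proof (intro sum.neutral ballI)
  fix i assume "i \<in> {..<N}"
  then have "\<tau> 0 \<le> \<tau> i" "\<tau> (Suc i) \<le> \<tau> N"
    by (auto intro!: partition_mono[where \<tau> = \<tau> and N = N, OF mono])
  then show "indicator {\<tau> i<..\<tau> (Suc i)} s *\<^sub>R f i = 0"
    using assms(2) by (auto simp: indicator_def)
qed

lemma simple_process_cell:
  assumes "\<And>k. k < N \<Longrightarrow> \<tau> k \<le> \<tau> (Suc k)" "k < N" "\<tau> k < s" "s \<le> \<tau> (Suc k)"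
  shows "simple_process N \<tau> \<xi> s \<omega> = \<xi> k \<omega>"
  unfolding simple_process_def using assms by (rule sum_partition_cell)

lemma simple_process_outside:
  assumes "\<And>k. k < N \<Longrightarrow> \<tau> k \<le> \<tau> (Suc k)" "s \<le> \<tau> 0 \<or> \<tau> N < s"
  shows "simple_process N \<tau> \<xi> s \<omega> = 0"
  unfolding simple_process_def using assms by (rule sum_partition_outside)

lemma simple_process_energy:
  fixes \<xi> :: "nat \<Rightarrow> 'a \<Rightarrow> real ^ 'm::finite ^ 'd::finite"
  assumes mono: "\<And>k. k < N \<Longrightarrow> \<tau> k \<le> \<tau> (Suc k)" and "\<tau> 0 = 0" "\<tau> N = t"
  shows "(\<integral>\<^sup>+s\<in>{0..t}. ennreal ((norm (simple_process N \<tau> \<xi> s \<omega>))\<^sup>2) \<partial>lborel)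
    = ennreal (\<Sum>k<N. (\<tau> (Suc k) - \<tau> k) * (norm (\<xi> k \<omega>))\<^sup>2)"
proof -
  have pt: "ennreal ((norm (simple_process N \<tau> \<xi> s \<omega>))\<^sup>2) * indicator {0..t} s =
      (\<Sum>k<N. ennreal ((norm (\<xi> k \<omega>))\<^sup>2) * indicator {\<tau> k<..\<tau> (Suc k)} s)" (is "?L = ?R") for s
  proof -
    have R: "?R = ennreal (\<Sum>k<N. indicator {\<tau> k<..\<tau> (Suc k)} s *\<^sub>R (norm (\<xi> k \<omega>))\<^sup>2)"
      by (subst sum_ennreal[symmetric]) (auto intro!: sum.cong simp: indicator_def)
    show ?thesis
    proof (cases "\<tau> 0 < s \<and> s \<le> \<tau> N")
      case True
      then obtain k where k: "k < N" "\<tau> k < s" "s \<le> \<tau> (Suc k)"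
        using partition_cell_exists by blast
      have e1: "simple_process N \<tau> \<xi> s \<omega> = \<xi> k \<omega>"
        using mono k by (rule simple_process_cell)
      have e2: "(\<Sum>i<N. indicator {\<tau> i<..\<tau> (Suc i)} s *\<^sub>R (norm (\<xi> i \<omega>))\<^sup>2) = (norm (\<xi> k \<omega>))\<^sup>2"
        using mono k by (rule sum_partition_cell)
      show ?thesis
        unfolding R e1 e2 using True assms(2,3) by (simp add: indicator_def)
    next
      case False
      then have o: "s \<le> \<tau> 0 \<or> \<tau> N < s" by auto
      have e1: "simple_process N \<tau> \<xi> s \<omega> = 0"
        using mono o by (rule simple_process_outside)
      have e2: "(\<Sum>i<N. indicator {\<tau> i<..\<tau> (Suc i)} s *\<^sub>R (norm (\<xi> i \<omega>))\<^sup>2) = 0"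
        using mono o by (rule sum_partition_outside)
      show ?thesis unfolding R e1 e2 by simp
    qed
  qed
  have "(\<integral>\<^sup>+s\<in>{0..t}. ennreal ((norm (simple_process N \<tau> \<xi> s \<omega>))\<^sup>2) \<partial>lborel)
    = (\<Sum>k<N. \<integral>\<^sup>+s. ennreal ((norm (\<xi> k \<omega>))\<^sup>2) * indicator {\<tau> k<..\<tau> (Suc k)} s \<partial>lborel)"
    unfolding pt by (rule nn_integral_sum) auto
  also have "\<dots> = (\<Sum>k<N. ennreal ((\<tau> (Suc k) - \<tau> k) * (norm (\<xi> k \<omega>))\<^sup>2))"
    using mono by (intro sum.cong) (auto simp: nn_integral_multc nn_integral_cmult ennreal_mult mult.commute)
  also have "\<dots> = ennreal (\<Sum>k<N. (\<tau> (Suc k) - \<tau> k) * (norm (\<xi> k \<omega>))\<^sup>2)"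
    using mono by (intro sum_ennreal) auto
  finally show ?thesis .
qed

section \<open>Moments and tails of simple Ito integrals\<close>

definition ito_const :: "nat \<Rightarrow> nat \<Rightarrow> real" where
  "ito_const c n = real c ^ 3 * moment_const n"

lemma ito_const_nonneg: "0 \<le> ito_const c n"
  using moment_const_ge_1[of n] by (simp add: ito_const_def)

context brownian
begin

lemma simple_integrandD:
  assumes "simple_integrand P F t N \<tau> \<xi>"
  shows "\<tau> 0 = 0" "\<tau> N = t" "\<And>k. k < N \<Longrightarrow> \<tau> k \<le> \<tau> (Suc k)"
    "\<And>i j. i \<le> j \<Longrightarrow> j \<le> N \<Longrightarrow> \<tau> i \<le> \<tau> j"
    "\<And>k. k \<le> N \<Longrightarrow> 0 \<le> \<tau> k" "\<And>k. k \<le> N \<Longrightarrow> \<tau> k \<le> t"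
    "\<And>k. k < N \<Longrightarrow> \<xi> k \<in> borel_measurable (F (\<tau> k))"
    "\<And>k. k < N \<Longrightarrow> \<exists>B. \<forall>\<omega>\<in>space M. norm (\<xi> k \<omega>) \<le> B"
proof -
  show 1: "\<tau> 0 = 0" "\<tau> N = t" "\<And>k. k < N \<Longrightarrow> \<tau> k \<le> \<tau> (Suc k)"
    "\<And>k. k < N \<Longrightarrow> \<xi> k \<in> borel_measurable (F (\<tau> k))"
    "\<And>k. k < N \<Longrightarrow> \<exists>B. \<forall>\<omega>\<in>space M. norm (\<xi> k \<omega>) \<le> B"
    using assms by (auto simp: simple_integrand_def)
  show mono: "\<And>i j. i \<le> j \<Longrightarrow> j \<le> N \<Longrightarrow> \<tau> i \<le> \<tau> j"
    by (rule partition_mono[where \<tau> = \<tau> and N = N, OF 1(3)]) auto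
  show "\<And>k. k \<le> N \<Longrightarrow> 0 \<le> \<tau> k" "\<And>k. k \<le> N \<Longrightarrow> \<tau> k \<le> t"
    using mono[of 0] mono[of _ N] 1 by auto
qed

lemma simple_integrand_measurable_F:
  assumes "simple_integrand P F t N \<tau> \<xi>" "k < N"
  shows "\<xi> k \<in> borel_measurable (F t)"
  using simple_integrandD(6)[OF assms(1), of k] simple_integrandD(7)[OF assms(1,2)] assms(2)
  by (auto intro: measurable_F_mono)

lemma simple_ito_integral_measurable:
  assumes S: "simple_integrand P F t N \<tau> \<xi>" and "t \<le> T"
  shows "simple_ito_integral W N \<tau> \<xi> \<in> borel_measurable (F t)"
proof -
  note D = simple_integrandD[OF S]
  have [measurable]: "\<xi> k \<in> borel_measurable (F t)" if "k < N" for k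
    using simple_integrand_measurable_F[OF S that] .
  have [measurable]: "W (\<tau> k) \<in> borel_measurable (F t)" if "k \<le> N" for k
    using D(5,6)[OF that] assms(2) by (intro W_measurable_F) auto
  show ?thesis
    unfolding simple_ito_integral_def[abs_def] by (intro borel_measurable_sum) auto
qed

text \<open>
  Because the filtration is made right-continuous, \<open>F (\<tau> k)\<close> contains events just after \<open>\<tau> k\<close>, and the
  independence of the increment over the whole cell is not immediate.  But \<open>F (\<tau> k)\<close> is contained in
  the completed sigma-algebra generated up to \<open>\<tau> k + h\<close>, which is independent of the increment that
  starts at \<open>\<tau> k + h\<close>.
\<close>

lemma shifted_simple_integral_moment:
  fixes \<xi> :: "nat \<Rightarrow> 'a \<Rightarrow> real ^ 'm ^ 'd::finite"
  assumes S: "simple_integrand P F t N \<tau> \<xi>" and t: "t \<le> T"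
    and v: "\<And>k. k < N \<Longrightarrow> 0 \<le> v k"
    and \<xi>v: "\<And>k. k < N \<Longrightarrow> (\<integral>\<^sup>+\<omega>. ennreal (norm (\<xi> k \<omega>) ^ (2 * n)) \<partial>P) \<le> ennreal (v k ^ n)"
    and "0 < h"
  shows "(\<integral>\<^sup>+\<omega>. ennreal ((\<Sum>k<N. \<xi> k \<omega> $ i $ j * (W (\<tau> (Suc k)) \<omega> - W (min (\<tau> k + h) (\<tau> (Suc k))) \<omega>) $ j) ^ (2 * n)) \<partial>P)
    \<le> ennreal ((moment_const n * (\<Sum>k<N. (\<tau> (Suc k) - \<tau> k) * v k)) ^ n)"
proof -
  note D = simple_integrandD[OF S]
  define \<delta> where "\<delta> = (\<lambda>k. \<tau> (Suc k) - min (\<tau> k + h) (\<tau> (Suc k)))"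
  define G where "G = (\<lambda>k. completed_sigma M {0..min (\<tau> k + h) T} W)"
  have \<tau>T: "0 \<le> \<tau> k" "\<tau> k \<le> T" if "k \<le> N" for k using D(5,6)[OF that] t by auto
  have FG: "sets (F (\<tau> k)) \<subseteq> sets (G k)" for k
    unfolding G_def using \<open>0 < h\<close> by (intro sets_F_le_completed) auto
  have \<xi>P: "\<xi> k \<in> borel_measurable P" if "k < N" for k
    using D(7)[OF that] by (rule measurable_F_P)
  have "(\<integral>\<^sup>+\<omega>. ennreal ((\<Sum>k<N. \<xi> k \<omega> $ i $ j * (W (\<tau> (Suc k)) \<omega> - W (min (\<tau> k + h) (\<tau> (Suc k))) \<omega>) $ j) ^ (2 * n)) \<partial>P)
    \<le> ennreal ((moment_const n * (\<Sum>k<N. \<delta> k * v k)) ^ n)"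
  proof (rule P.discrete_moment_bound[where G = G])
    fix k assume k: "k < N"
    show "subalgebra P (G k)"
      unfolding subalgebra_def G_def using sets_completed_sigma_le[of "{0..min (\<tau> k + h) T}"] by auto
    show "\<exists>B. \<forall>\<omega>\<in>space P. \<bar>\<xi> k \<omega> $ i $ j\<bar> \<le> B"
    proof -
      obtain B where B: "\<And>\<omega>. \<omega> \<in> space M \<Longrightarrow> norm (\<xi> k \<omega>) \<le> B" using D(8)[OF k] by blast
      have "\<bar>\<xi> k \<omega> $ i $ j\<bar> \<le> norm (\<xi> k \<omega>)" for \<omega>
        by (rule abs_entry_le_norm)
      then show ?thesis using B by (intro exI[of _ B]) (auto intro: order_trans)
    qed
    show "0 \<le> \<delta> k" by (simp add: \<delta>_def)
    show "0 \<le> v k" using v[OF k] .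
    show "(\<integral>\<omega>. (\<xi> k \<omega> $ i $ j) ^ (2 * n) \<partial>P) \<le> v k ^ n"
    proof -
      obtain B where B: "\<And>\<omega>. \<omega> \<in> space M \<Longrightarrow> norm (\<xi> k \<omega>) \<le> B" using D(8)[OF k] by blast
      have c: "\<bar>\<xi> k \<omega> $ i $ j\<bar> \<le> norm (\<xi> k \<omega>)" for \<omega>
        by (rule abs_entry_le_norm)
      have le: "(\<xi> k \<omega> $ i $ j) ^ (2 * n) \<le> norm (\<xi> k \<omega>) ^ (2 * n)" for \<omega>
        using power_mono[OF c[of \<omega>] abs_ge_zero, of "2 * n"] by (simp add: power_even_abs)
      have i: "integrable P (\<lambda>\<omega>. (\<xi> k \<omega> $ i $ j) ^ (2 * n))"
      proof (rule P.integrable_const_bound[of _ "B ^ (2 * n)"])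
        show "AE \<omega> in P. norm ((\<xi> k \<omega> $ i $ j) ^ (2 * n)) \<le> B ^ (2 * n)"
          using B le by (intro AE_I2) (auto simp: power_even_abs intro!: order_trans[OF le] power_mono)
        show "(\<lambda>\<omega>. (\<xi> k \<omega> $ i $ j) ^ (2 * n)) \<in> borel_measurable P"
          using \<xi>P[OF k] by measurable
      qed
      have "ennreal (\<integral>\<omega>. (\<xi> k \<omega> $ i $ j) ^ (2 * n) \<partial>P) = (\<integral>\<^sup>+\<omega>. ennreal ((\<xi> k \<omega> $ i $ j) ^ (2 * n)) \<partial>P)"
        using i by (intro nn_integral_eq_integral[symmetric]) (auto simp: zero_le_even_power)
      also have "\<dots> \<le> (\<integral>\<^sup>+\<omega>. ennreal (norm (\<xi> k \<omega>) ^ (2 * n)) \<partial>P)"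
        using le by (intro nn_integral_mono ennreal_leI)
      also have "\<dots> \<le> ennreal (v k ^ n)" using \<xi>v[OF k] .
      finally show ?thesis using v[OF k] by (simp add: ennreal_le_iff)
    qed
  next
    fix l k assume lk: "l \<le> k" "k < N"
    then have "\<xi> l \<in> borel_measurable (F (\<tau> k))"
      using D(4)[of l k] D(7)[of l] by (auto intro: measurable_F_mono)
    moreover have "subalgebra (G k) (F (\<tau> k))" using FG by (auto simp: subalgebra_def G_def)
    ultimately have "\<xi> l \<in> borel_measurable (G k)" by (rule measurable_from_subalg[rotated])
    then show "(\<lambda>\<omega>. \<xi> l \<omega> $ i $ j) \<in> borel_measurable (G k)" by measurable
  next
    fix l k assume lk: "l < k" "k < N"
    then have "\<tau> (Suc l) \<le> \<tau> k" "\<tau> l \<le> \<tau> (Suc l)" using D(4)[of "Suc l" k] D(4)[of l "Suc l"] by auto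
    then have "W (\<tau> (Suc l)) \<in> borel_measurable (G k)"
      "W (min (\<tau> l + h) (\<tau> (Suc l))) \<in> borel_measurable (G k)"
      unfolding G_def using lk \<tau>T[of "Suc l"] \<tau>T[of l] \<open>0 < h\<close> by (auto intro!: W_measurable_completed)
    then show "(\<lambda>\<omega>. (W (\<tau> (Suc l)) \<omega> - W (min (\<tau> l + h) (\<tau> (Suc l))) \<omega>) $ j) \<in> borel_measurable (G k)"
      by measurable
  next
    fix k q and Y :: "'a \<Rightarrow> real" assume k: "k < N" and Y: "Y \<in> borel_measurable (G k)" "integrable P Y"
    show "integrable P (\<lambda>\<omega>. Y \<omega> * ((W (\<tau> (Suc k)) \<omega> - W (min (\<tau> k + h) (\<tau> (Suc k))) \<omega>) $ j) ^ q) \<and>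
      (\<integral>\<omega>. Y \<omega> * ((W (\<tau> (Suc k)) \<omega> - W (min (\<tau> k + h) (\<tau> (Suc k))) \<omega>) $ j) ^ q \<partial>P)
        = (\<integral>\<omega>. Y \<omega> \<partial>P) * gauss_moment q (\<delta> k)"
    proof (cases "\<tau> k + h \<le> \<tau> (Suc k)")
      case True
      then have "Y \<in> borel_measurable (completed_sigma M {0..\<tau> k + h} W)"
        using Y(1) \<tau>T[of "Suc k"] k by (simp add: G_def min_def)
      then show ?thesis
        using gauss_increment[of "\<tau> k + h" "\<tau> (Suc k)" Y j q] True Y(2) \<tau>T[of "Suc k"] \<tau>T[of k] k \<open>0 < h\<close>
        by (simp add: \<delta>_def)
    next
      case False
      then show ?thesis using Y(2) by (cases q) (auto simp: gauss_moment_def \<delta>_def)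
    qed
  qed
  also have "\<dots> \<le> ennreal ((moment_const n * (\<Sum>k<N. (\<tau> (Suc k) - \<tau> k) * v k)) ^ n)"
  proof (intro ennreal_leI power_mono mult_left_mono sum_mono mult_right_mono)
    show "0 \<le> moment_const n" using moment_const_ge_1[of n] by simp
    then show "0 \<le> moment_const n * (\<Sum>k<N. \<delta> k * v k)"
      using v by (intro mult_nonneg_nonneg sum_nonneg) (auto simp: \<delta>_def)
  qed (use v D(3) \<open>0 < h\<close> in \<open>auto simp: \<delta>_def\<close>)
  finally show ?thesis .
qed

text \<open>
  The shift \<open>h\<close> tends to zero, by continuity of the Brownian paths and Fatou's lemma.
\<close>

lemma simple_integral_moment_component:
  fixes \<xi> :: "nat \<Rightarrow> 'a \<Rightarrow> real ^ 'm ^ 'd::finite"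
  assumes S: "simple_integrand P F t N \<tau> \<xi>" and t: "t \<le> T"
    and v: "\<And>k. k < N \<Longrightarrow> 0 \<le> v k"
    and \<xi>v: "\<And>k. k < N \<Longrightarrow> (\<integral>\<^sup>+\<omega>. ennreal (norm (\<xi> k \<omega>) ^ (2 * n)) \<partial>P) \<le> ennreal (v k ^ n)"
  shows "(\<integral>\<^sup>+\<omega>. ennreal ((\<Sum>k<N. \<xi> k \<omega> $ i $ j * (W (\<tau> (Suc k)) \<omega> - W (\<tau> k) \<omega>) $ j) ^ (2 * n)) \<partial>P)
    \<le> ennreal ((moment_const n * (\<Sum>k<N. (\<tau> (Suc k) - \<tau> k) * v k)) ^ n)"
proof (rule nn_integral_le_of_tendsto)
  note D = simple_integrandD[OF S]
  define h where "h = (\<lambda>q::nat. inverse (real (Suc q)))"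
  have h0: "0 < h q" for q by (simp add: h_def)
  have h: "h \<longlonglongrightarrow> 0" unfolding h_def by (rule LIMSEQ_inverse_real_of_nat)
  have \<tau>T: "0 \<le> \<tau> k" "\<tau> k \<le> T" if "k \<le> N" for k using D(5,6)[OF that] t by auto
  let ?u = "\<lambda>q \<omega>. ennreal ((\<Sum>k<N. \<xi> k \<omega> $ i $ j * (W (\<tau> (Suc k)) \<omega> - W (min (\<tau> k + h q) (\<tau> (Suc k))) \<omega>) $ j) ^ (2 * n))"
  show "(\<integral>\<^sup>+\<omega>. ?u q \<omega> \<partial>P) \<le> ennreal ((moment_const n * (\<Sum>k<N. (\<tau> (Suc k) - \<tau> k) * v k)) ^ n)" for q
    by (rule shifted_simple_integral_moment[OF S t v \<xi>v h0])
  show "?u q \<in> borel_measurable P" for q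
  proof -
    have [measurable]: "\<xi> k \<in> borel_measurable P" if "k < N" for k
      using D(7)[OF that] by (rule measurable_F_P)
    have [measurable]: "W (\<tau> (Suc k)) \<in> borel_measurable P" "W (min (\<tau> k + h q) (\<tau> (Suc k))) \<in> borel_measurable P" if "k < N" for k
      using \<tau>T[of "Suc k"] \<tau>T[of k] that h0[of q] by (auto intro!: W_measurable_P)
    show ?thesis
      by (intro measurable_compose[OF _ measurable_ennreal] borel_measurable_power borel_measurable_sum) auto
  qed
  have "AE \<omega> in P. continuous_on {0..T} (\<lambda>t. W t \<omega>)"
    by (rule AE_completion) (use brownian in \<open>simp add: brownian_motion_def\<close>)
  then show "AE \<omega> in P. (\<lambda>q. ?u q \<omega>) \<longlonglongrightarrow> ennreal ((\<Sum>k<N. \<xi> k \<omega> $ i $ j * (W (\<tau> (Suc k)) \<omega> - W (\<tau> k) \<omega>) $ j) ^ (2 * n))"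
  proof eventually_elim
    fix \<omega> assume c: "continuous_on {0..T} (\<lambda>t. W t \<omega>)"
    have "(\<lambda>q. W (min (\<tau> k + h q) (\<tau> (Suc k))) \<omega>) \<longlonglongrightarrow> W (\<tau> k) \<omega>" if "k < N" for k
    proof (rule continuous_on_tendsto_compose[OF c])
      have "(\<lambda>q. min (\<tau> k + h q) (\<tau> (Suc k))) \<longlonglongrightarrow> min (\<tau> k + 0) (\<tau> (Suc k))"
        by (intro tendsto_intros h)
      then show "(\<lambda>q. min (\<tau> k + h q) (\<tau> (Suc k))) \<longlonglongrightarrow> \<tau> k" using D(3)[OF that] by (simp add: min_def)
      have "0 \<le> min (\<tau> k + h q) (\<tau> (Suc k)) \<and> min (\<tau> k + h q) (\<tau> (Suc k)) \<le> T" for q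
        using \<tau>T[of k] \<tau>T[of "Suc k"] h0[of q] that by auto
      then show "\<forall>\<^sub>F q in sequentially. min (\<tau> k + h q) (\<tau> (Suc k)) \<in> {0..T}" by auto
    qed (use \<tau>T[of k] that in auto)
    then show "(\<lambda>q. ?u q \<omega>) \<longlonglongrightarrow> ennreal ((\<Sum>k<N. \<xi> k \<omega> $ i $ j * (W (\<tau> (Suc k)) \<omega> - W (\<tau> k) \<omega>) $ j) ^ (2 * n))"
      by (intro tendsto_ennrealI tendsto_intros) auto
  qed
qed auto

text \<open>
  The norm is estimated by the sum of the products of single matrix entries with single coordinates of
  the Brownian motion; the power 3 in \<open>ito_const\<close> absorbs their number, once as such
  and twice from the \<open>2n\<close>-th power of a sum.
\<close>

lemma simple_integral_moment:
  fixes \<xi> :: "nat \<Rightarrow> 'a \<Rightarrow> real ^ 'm ^ 'd::finite"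
  assumes S: "simple_integrand P F t N \<tau> \<xi>" and t: "t \<le> T" and n: "1 \<le> n"
    and v: "\<And>k. k < N \<Longrightarrow> 0 \<le> v k"
    and \<xi>v: "\<And>k. k < N \<Longrightarrow> (\<integral>\<^sup>+\<omega>. ennreal (norm (\<xi> k \<omega>) ^ (2 * n)) \<partial>P) \<le> ennreal (v k ^ n)"
  shows "(\<integral>\<^sup>+\<omega>. ennreal (norm (simple_ito_integral W N \<tau> \<xi> \<omega>) ^ (2 * n)) \<partial>P)
    \<le> ennreal ((ito_const (CARD('d) * CARD('m)) n * (\<Sum>k<N. (\<tau> (Suc k) - \<tau> k) * v k)) ^ n)"
proof -
  note D = simple_integrandD[OF S]
  define c where "c = CARD('d) * CARD('m)"
  have c1: "1 \<le> real c"
    unfolding c_def real_of_nat_ge_one_iff by (simp add: Suc_le_eq)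
  define X where "X = (\<lambda>(i, j) \<omega>. \<Sum>k<N. \<xi> k \<omega> $ i $ j * (W (\<tau> (Suc k)) \<omega> - W (\<tau> k) \<omega>) $ j)"
  define A where "A = moment_const n * (\<Sum>k<N. (\<tau> (Suc k) - \<tau> k) * v k)"
  have A0: "0 \<le> A" unfolding A_def using D(3) v moment_const_ge_1[of n]
    by (intro mult_nonneg_nonneg sum_nonneg) auto
  have [measurable]: "\<xi> k \<in> borel_measurable P" if "k < N" for k
    using D(7)[OF that] by (rule measurable_F_P)
  have [measurable]: "W (\<tau> k) \<in> borel_measurable P" if "k \<le> N" for k
    using D(5,6)[OF that] t by (auto intro!: W_measurable_P)
  have Xm[measurable]: "X p \<in> borel_measurable P" for p
    unfolding X_def by (cases p) (auto intro!: borel_measurable_sum)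
  have comp: "simple_ito_integral W N \<tau> \<xi> \<omega> $ i = (\<Sum>j\<in>UNIV. X (i, j) \<omega>)" for i \<omega>
    unfolding simple_ito_integral_def X_def
    by (simp add: matrix_vector_mult_def) (rule sum.swap)
  have le: "norm (simple_ito_integral W N \<tau> \<xi> \<omega>) ^ (2 * n) \<le> (\<Sum>p\<in>UNIV. real c ^ (2 * n) * X p \<omega> ^ (2 * n))" for \<omega>
  proof -
    have "norm (simple_ito_integral W N \<tau> \<xi> \<omega>) \<le> (\<Sum>i\<in>UNIV. \<bar>\<Sum>j\<in>UNIV. X (i, j) \<omega>\<bar>)"
      using norm_le_l1_cart[of "simple_ito_integral W N \<tau> \<xi> \<omega>"] by (simp add: comp)
    also have "\<dots> \<le> (\<Sum>i\<in>UNIV. \<Sum>j\<in>UNIV. \<bar>X (i, j) \<omega>\<bar>)"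
      by (intro sum_mono sum_abs)
    also have "\<dots> = (\<Sum>p\<in>UNIV. \<bar>X p \<omega>\<bar>)"
      by (simp add: sum.cartesian_product flip: UNIV_Times_UNIV)
    finally have "norm (simple_ito_integral W N \<tau> \<xi> \<omega>) ^ (2 * n) \<le> (\<Sum>p\<in>UNIV. \<bar>X p \<omega>\<bar>) ^ (2 * n)"
      by (intro power_mono) auto
    also have "\<dots> \<le> real (card (UNIV :: ('d \<times> 'm) set)) ^ (2 * n) * (\<Sum>p\<in>UNIV. \<bar>X p \<omega>\<bar> ^ (2 * n))"
      by (intro power_sum_le_card) auto
    finally show ?thesis by (simp add: c_def power_even_abs sum_distrib_left)
  qed
  have "(\<integral>\<^sup>+\<omega>. ennreal (norm (simple_ito_integral W N \<tau> \<xi> \<omega>) ^ (2 * n)) \<partial>P)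
      \<le> (\<integral>\<^sup>+\<omega>. (\<Sum>p\<in>UNIV. ennreal (real c ^ (2 * n)) * ennreal (X p \<omega> ^ (2 * n))) \<partial>P)"
    by (intro nn_integral_mono)
       (use le in \<open>auto simp: ennreal_mult''[symmetric] zero_le_even_power sum_ennreal intro!: ennreal_leI\<close>)
  also have "\<dots> = (\<Sum>p\<in>UNIV. ennreal (real c ^ (2 * n)) * (\<integral>\<^sup>+\<omega>. ennreal (X p \<omega> ^ (2 * n)) \<partial>P))"
    by (subst nn_integral_sum) (auto simp: nn_integral_cmult)
  also have "\<dots> \<le> (\<Sum>p\<in>(UNIV :: ('d \<times> 'm) set). ennreal (real c ^ (2 * n)) * ennreal (A ^ n))"
    using simple_integral_moment_component[OF S t v \<xi>v]
    by (intro sum_mono mult_left_mono) (auto simp: X_def A_def split: prod.split)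
  also have "\<dots> = ennreal (real c * (real c ^ (2 * n) * A ^ n))"
    using A0 by (simp add: c_def ennreal_mult ennreal_of_nat_eq_real_of_nat)
  also have "\<dots> \<le> ennreal ((real c ^ 3 * A) ^ n)"
  proof (rule ennreal_leI)
    have "real c * (real c ^ (2 * n) * A ^ n) = real c ^ (2 * n + 1) * A ^ n" by simp
    also have "\<dots> \<le> real c ^ (3 * n) * A ^ n"
      using c1 n A0 by (intro mult_right_mono power_increasing) auto
    finally show "real c * (real c ^ (2 * n) * A ^ n) \<le> (real c ^ 3 * A) ^ n"
      by (simp add: power_mult_distrib power_mult)
  qed
  finally show ?thesis by (simp add: A_def c_def ito_const_def mult.assoc)
qed

end

lemma (in finite_measure) measure_gt_le_of_nn_integral:
  fixes f :: "'a \<Rightarrow> real"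
  assumes [measurable]: "f \<in> borel_measurable M" and f0: "\<And>\<omega>. 0 \<le> f \<omega>"
    and le: "(\<integral>\<^sup>+\<omega>. ennreal (f \<omega>) \<partial>M) \<le> ennreal B" and "0 < a" "0 \<le> B"
  shows "measure M {\<omega>\<in>space M. a < f \<omega>} \<le> B / a"
proof -
  have "ennreal a * emeasure M {\<omega>\<in>space M. a < f \<omega>} = (\<integral>\<^sup>+\<omega>. ennreal a * indicator {\<omega>\<in>space M. a < f \<omega>} \<omega> \<partial>M)"
    by (simp add: nn_integral_cmult)
  also have "\<dots> \<le> (\<integral>\<^sup>+\<omega>. ennreal (f \<omega>) \<partial>M)"
    using f0 by (intro nn_integral_mono) (auto simp: indicator_def intro!: ennreal_leI)
  also note le
  finally have "ennreal (a * measure M {\<omega>\<in>space M. a < f \<omega>}) \<le> ennreal B"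
    using \<open>0 < a\<close> by (simp add: emeasure_eq_measure ennreal_mult)
  then have "a * measure M {\<omega>\<in>space M. a < f \<omega>} \<le> B"
    using \<open>0 \<le> B\<close> by (simp add: ennreal_le_iff)
  then show ?thesis using \<open>0 < a\<close> by (simp add: field_simps)
qed

context brownian
begin

text \<open>
  Stopping the integrand before its energy exceeds \<open>\<delta>\<close> keeps it simple and adapted, and does not change
  the integral on the event in question; Chebyshev's inequality applies to the stopped integral.
\<close>

lemma simple_integral_prob_bound:
  fixes \<xi> :: "nat \<Rightarrow> 'a \<Rightarrow> real ^ 'm ^ 'd::finite"
  assumes S: "simple_integrand P F t N \<tau> \<xi>" and t: "t \<le> T" and "0 < \<epsilon>" "0 \<le> \<delta>"
  shows "measure P {\<omega> \<in> space P. \<epsilon> < norm (simple_ito_integral W N \<tau> \<xi> \<omega>) \<and>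
      (\<Sum>k<N. (\<tau> (Suc k) - \<tau> k) * (norm (\<xi> k \<omega>))\<^sup>2) \<le> \<delta>}
    \<le> ito_const (CARD('d) * CARD('m)) 1 * \<delta> / \<epsilon>\<^sup>2"
proof -
  note D = simple_integrandD[OF S]
  define e where "e = (\<lambda>k \<omega>. \<Sum>j<k. (\<tau> (Suc j) - \<tau> j) * (norm (\<xi> j \<omega>))\<^sup>2)"
  \<comment> \<open>The energy of the cell \<open>k\<close> is known at its left end point, so it may be included in the test.\<close>
  define \<xi>' where "\<xi>' = (\<lambda>k \<omega>. if e (Suc k) \<omega> \<le> \<delta> then \<xi> k \<omega> else 0)"
  have e_mono: "e i \<omega> \<le> e j \<omega>" if "i \<le> j" "j \<le> N" for i j \<omega>
    unfolding e_def using that D(3) by (intro sum_mono2) auto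
  have \<xi>m: "\<xi> j \<in> borel_measurable (F (\<tau> k))" if "j \<le> k" "k < N" for j k
    using D(7)[of j] D(4)[of j k] that by (auto intro: measurable_F_mono)
  have \<xi>'m: "\<xi>' k \<in> borel_measurable (F (\<tau> k))" if "k < N" for k
  proof -
    have [measurable]: "\<xi> j \<in> borel_measurable (F (\<tau> k))" if "j \<in> {..<Suc k}" for j
      using \<xi>m[of j k] that \<open>k < N\<close> by auto
    have [measurable]: "e (Suc k) \<in> borel_measurable (F (\<tau> k))"
      unfolding e_def[abs_def] by (intro borel_measurable_sum) measurable
    have [measurable]: "\<xi> k \<in> borel_measurable (F (\<tau> k))" using \<xi>m[of k k] that by auto
    show ?thesis unfolding \<xi>'_def[abs_def] by measurable
  qed
  have S': "simple_integrand P F t N \<tau> \<xi>'"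
    unfolding simple_integrand_def
  proof (intro conjI allI impI)
    fix k assume k: "k < N"
    obtain B where B: "\<And>\<omega>. \<omega> \<in> space M \<Longrightarrow> norm (\<xi> k \<omega>) \<le> B" using D(8)[OF k] by blast
    then show "\<exists>B. \<forall>\<omega>\<in>space P. norm (\<xi>' k \<omega>) \<le> B"
      by (intro exI[of _ "max 0 B"]) (auto simp: \<xi>'_def le_max_iff_disj)
  qed (use D \<xi>'m in auto)
  have energy: "(\<Sum>k<i. (\<tau> (Suc k) - \<tau> k) * (norm (\<xi>' k \<omega>))\<^sup>2) \<le> \<delta>" if "i \<le> N" for i \<omega>
    using that
  proof (induction i)
    case (Suc i)
    show ?case
    proof (cases "e (Suc i) \<omega> \<le> \<delta>")
      case True
      have "(\<Sum>k<Suc i. (\<tau> (Suc k) - \<tau> k) * (norm (\<xi>' k \<omega>))\<^sup>2) \<le> e (Suc i) \<omega>"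
        unfolding e_def using D(3) Suc.prems by (intro sum_mono mult_left_mono) (auto simp: \<xi>'_def)
      then show ?thesis using True by simp
    qed (use Suc in \<open>simp add: \<xi>'_def\<close>)
  qed (use \<open>0 \<le> \<delta>\<close> in simp)
  have int: "integrable P (\<lambda>\<omega>. (norm (\<xi>' k \<omega>))\<^sup>2)" if k: "k < N" for k
  proof -
    obtain B where B: "\<forall>\<omega>\<in>space M. norm (\<xi>' k \<omega>) \<le> B" using simple_integrandD(8)[OF S' k] by blast
    show ?thesis
    proof (rule P.integrable_const_bound[of _ "B\<^sup>2"])
      show "AE \<omega> in P. norm ((norm (\<xi>' k \<omega>))\<^sup>2) \<le> B\<^sup>2"
        using B by (intro AE_I2) (auto intro!: power_mono)
      show "(\<lambda>\<omega>. (norm (\<xi>' k \<omega>))\<^sup>2) \<in> borel_measurable P"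
        using measurable_F_P[OF \<xi>'m[OF k]] by measurable
    qed
  qed
  define v where "v = (\<lambda>k. \<integral>\<omega>. (norm (\<xi>' k \<omega>))\<^sup>2 \<partial>P)"
  have "(\<integral>\<^sup>+\<omega>. ennreal (norm (simple_ito_integral W N \<tau> \<xi>' \<omega>) ^ (2 * 1)) \<partial>P)
    \<le> ennreal ((ito_const (CARD('d) * CARD('m)) 1 * (\<Sum>k<N. (\<tau> (Suc k) - \<tau> k) * v k)) ^ 1)"
  proof (rule simple_integral_moment[OF S' t])
    fix k assume k: "k < N"
    show "0 \<le> v k" by (simp add: v_def)
    show "(\<integral>\<^sup>+\<omega>. ennreal (norm (\<xi>' k \<omega>) ^ (2 * 1)) \<partial>P) \<le> ennreal (v k ^ 1)"
      using int[OF k] by (simp add: v_def nn_integral_eq_integral)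
  qed simp
  also have "(\<Sum>k<N. (\<tau> (Suc k) - \<tau> k) * v k) = (\<integral>\<omega>. (\<Sum>k<N. (\<tau> (Suc k) - \<tau> k) * (norm (\<xi>' k \<omega>))\<^sup>2) \<partial>P)"
    unfolding v_def using int by (subst Bochner_Integration.integral_sum) auto
  also have "ennreal ((ito_const (CARD('d) * CARD('m)) 1 * (\<integral>\<omega>. (\<Sum>k<N. (\<tau> (Suc k) - \<tau> k) * (norm (\<xi>' k \<omega>))\<^sup>2) \<partial>P)) ^ 1)
      \<le> ennreal (ito_const (CARD('d) * CARD('m)) 1 * \<delta>)"
  proof -
    have "(\<integral>\<omega>. (\<Sum>k<N. (\<tau> (Suc k) - \<tau> k) * (norm (\<xi>' k \<omega>))\<^sup>2) \<partial>P) \<le> \<delta>"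
      using int energy by (intro P.integral_le_const Bochner_Integration.integrable_sum integrable_mult_right AE_I2) auto
    then show ?thesis by (auto intro!: ennreal_leI mult_left_mono ito_const_nonneg)
  qed
  finally have "(\<integral>\<^sup>+\<omega>. ennreal ((norm (simple_ito_integral W N \<tau> \<xi>' \<omega>))\<^sup>2) \<partial>P) \<le> ennreal (ito_const (CARD('d) * CARD('m)) 1 * \<delta>)"
    by simp
  then have "measure P {\<omega>\<in>space P. \<epsilon>\<^sup>2 < (norm (simple_ito_integral W N \<tau> \<xi>' \<omega>))\<^sup>2} \<le> ito_const (CARD('d) * CARD('m)) 1 * \<delta> / \<epsilon>\<^sup>2"
    using measurable_F_P[OF simple_ito_integral_measurable[OF S' t]] \<open>0 < \<epsilon>\<close> \<open>0 \<le> \<delta>\<close>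
    by (intro P.measure_gt_le_of_nn_integral mult_nonneg_nonneg ito_const_nonneg) auto
  moreover have "measure P {\<omega> \<in> space P. \<epsilon> < norm (simple_ito_integral W N \<tau> \<xi> \<omega>) \<and>
      (\<Sum>k<N. (\<tau> (Suc k) - \<tau> k) * (norm (\<xi> k \<omega>))\<^sup>2) \<le> \<delta>}
    \<le> measure P {\<omega>\<in>space P. \<epsilon>\<^sup>2 < (norm (simple_ito_integral W N \<tau> \<xi>' \<omega>))\<^sup>2}"
  proof (rule P.finite_measure_mono)
    show "{\<omega>\<in>space P. \<epsilon>\<^sup>2 < (norm (simple_ito_integral W N \<tau> \<xi>' \<omega>))\<^sup>2} \<in> sets P"
      using measurable_F_P[OF simple_ito_integral_measurable[OF S' t]] by measurable
    have "simple_ito_integral W N \<tau> \<xi>' \<omega> = simple_ito_integral W N \<tau> \<xi> \<omega>" if "e N \<omega> \<le> \<delta>" for \<omega>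
    proof -
      have "e (Suc k) \<omega> \<le> \<delta>" if "k < N" for k
        using e_mono[of "Suc k" N \<omega>] that \<open>e N \<omega> \<le> \<delta>\<close> by simp
      then show ?thesis
        unfolding simple_ito_integral_def by (intro sum.cong) (auto simp: \<xi>'_def)
    qed
    then show "{\<omega> \<in> space P. \<epsilon> < norm (simple_ito_integral W N \<tau> \<xi> \<omega>) \<and>
      (\<Sum>k<N. (\<tau> (Suc k) - \<tau> k) * (norm (\<xi> k \<omega>))\<^sup>2) \<le> \<delta>}
      \<subseteq> {\<omega>\<in>space P. \<epsilon>\<^sup>2 < (norm (simple_ito_integral W N \<tau> \<xi>' \<omega>))\<^sup>2}"
      using \<open>0 < \<epsilon>\<close> by (auto simp: e_def intro!: power_strict_mono)
  qed
  ultimately show ?thesis by simp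
qed

text \<open>
  The integral over a refined partition telescopes over each old cell.  The value on a new cell is read
  off at its right end point, because cells contain their right but not their left end points.
\<close>

lemma simple_integrand_refine:
  fixes \<xi> :: "nat \<Rightarrow> 'a \<Rightarrow> real ^ 'm ^ 'd::finite"
  assumes S: "simple_integrand P F t N \<tau> \<xi>"
    and C: "finite C" "\<tau> ` {..N} \<subseteq> C" "C \<subseteq> {0..t}"
  defines "c \<equiv> \<lambda>i. sorted_list_of_set C ! i" and "L \<equiv> card C - 1"
  defines "\<xi>' \<equiv> \<lambda>i. simple_process N \<tau> \<xi> (c (Suc i))"
  shows "simple_integrand P F t L c \<xi>'"
    and "simple_process L c \<xi>' s \<omega> = simple_process N \<tau> \<xi> s \<omega>"
    and "simple_ito_integral W L c \<xi>' \<omega> = simple_ito_integral W N \<tau> \<xi> \<omega>"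
proof -
  note D = simple_integrandD[OF S]
  have len: "length (sorted_list_of_set C) = card C" by simp
  have \<tau>C: "\<tau> k \<in> C" if "k \<le> N" for k using C(2) that by auto
  have C0: "C \<noteq> {}" using \<tau>C[of 0] by auto
  then have L: "card C = Suc L" using C(1) by (simp add: L_def card_gt_0_iff)
  have strict: "c i < c j" if "i < j" "j \<le> L" for i j
    unfolding c_def using that L len
    by (intro sorted_wrt_nth_less[OF strict_sorted_list_of_set]) auto
  have le_iff: "c i \<le> c j \<longleftrightarrow> i \<le> j" "c i < c j \<longleftrightarrow> i < j" if "i \<le> L" "j \<le> L" for i j
    using strict[of i j] strict[of j i] that by (cases i j rule: linorder_cases; auto)+
  have cC: "c i \<in> C" if "i \<le> L" for i
    using nth_mem[of i "sorted_list_of_set C"] that L len C(1) by (simp add: c_def)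
  have idx: "\<exists>i\<le>L. x = c i" if "x \<in> C" for x
  proof -
    have "x \<in> set (sorted_list_of_set C)" using that C(1) by simp
    then obtain i where "i < length (sorted_list_of_set C)" "sorted_list_of_set C ! i = x"
      by (auto simp: in_set_conv_nth)
    then show ?thesis using L len by (intro exI[of _ i]) (auto simp: c_def)
  qed
  have c0: "c 0 = 0"
  proof -
    obtain i where "i \<le> L" "0 = c i" using idx[of 0] \<tau>C[of 0] D(1) by auto
    then show ?thesis using le_iff(1)[of 0 i] cC[of 0] C(3) by force
  qed
  have cL: "c L = t"
  proof -
    obtain i where "i \<le> L" "t = c i" using idx[of t] \<tau>C[of N] D(2) by auto
    then show ?thesis using le_iff(1)[of i L] cC[of L] C(3) by force
  qed
  have mono: "c k \<le> c (Suc k)" if "k < L" for k using strict[of k "Suc k"] that by simp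
  have cell: "\<exists>k<N. \<tau> k \<le> c i \<and> c (Suc i) \<le> \<tau> (Suc k) \<and> \<xi>' i = \<xi> k" if i: "i < L" for i
  proof -
    have "\<tau> 0 < c (Suc i)" "c (Suc i) \<le> \<tau> N"
      using le_iff(2)[of 0 "Suc i"] cC[of "Suc i"] C(3) i c0 D(1,2) by auto
    then obtain k where k: "k < N" "\<tau> k < c (Suc i)" "c (Suc i) \<le> \<tau> (Suc k)"
      using partition_cell_exists by blast
    obtain a where "a \<le> L" "\<tau> k = c a" using idx[OF \<tau>C[of k]] k by auto
    then have "\<tau> k \<le> c i" using k(2) le_iff[of a "Suc i"] le_iff[of a i] i by auto
    moreover have "\<xi>' i = \<xi> k"
      unfolding \<xi>'_def using k D(3) by (intro ext simple_process_cell) auto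
    ultimately show ?thesis using k by auto
  qed
  show S': "simple_integrand P F t L c \<xi>'"
    unfolding simple_integrand_def
  proof (intro conjI allI impI c0 cL mono)
    fix i assume i: "i < L"
    then obtain k where k: "k < N" "\<tau> k \<le> c i" "\<xi>' i = \<xi> k" using cell by blast
    show "\<xi>' i \<in> borel_measurable (F (c i))"
      using D(7)[OF k(1)] k measurable_F_mono by auto
    show "\<exists>B. \<forall>\<omega>\<in>space P. norm (\<xi>' i \<omega>) \<le> B"
      using D(8)[OF k(1)] k by auto
  qed
  show "simple_process L c \<xi>' s \<omega> = simple_process N \<tau> \<xi> s \<omega>" for s \<omega>
  proof (cases "0 < s \<and> s \<le> t")
    case True
    then obtain i where i: "i < L" "c i < s" "s \<le> c (Suc i)"
      using partition_cell_exists[of c s L] c0 cL by auto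
    obtain k where k: "k < N" "\<tau> k < s" "s \<le> \<tau> (Suc k)"
      using partition_cell_exists[of \<tau> s N] D(1,2) True by auto
    obtain k' where k': "k' < N" "\<tau> k' \<le> c i" "c (Suc i) \<le> \<tau> (Suc k')" "\<xi>' i = \<xi> k'"
      using cell[OF i(1)] by blast
    have "simple_process L c \<xi>' s \<omega> = \<xi>' i \<omega>"
      using mono i by (rule simple_process_cell)
    also have "\<dots> = simple_process N \<tau> \<xi> s \<omega>"
      using k' i D(3) by (subst simple_process_cell[of N \<tau> k']) auto
    finally show ?thesis .
  next
    case False
    then have "s \<le> c 0 \<or> c L < s" "s \<le> \<tau> 0 \<or> \<tau> N < s" using c0 cL D(1,2) by auto
    then show ?thesis
      using mono D(3) by (simp add: simple_process_outside)
  qed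
  have tele: "(\<Sum>i<L. indicator {\<tau> k<..\<tau> (Suc k)} (c (Suc i)) *\<^sub>R (W (c (Suc i)) \<omega> - W (c i) \<omega>))
      = W (\<tau> (Suc k)) \<omega> - W (\<tau> k) \<omega>" if k: "k < N" for k \<omega>
  proof -
    obtain a where a: "a \<le> L" "\<tau> k = c a" using idx[OF \<tau>C[of k]] k by auto
    obtain b where b: "b \<le> L" "\<tau> (Suc k) = c b" using idx[OF \<tau>C[of "Suc k"]] k by auto
    have ab: "a \<le> b" using D(3)[OF k] a b le_iff(1)[of a b] by simp
    have "indicator {\<tau> k<..\<tau> (Suc k)} (c (Suc i)) = (if i \<in> {a..<b} then 1 else 0 :: real)" if "i < L" for i
      using le_iff[of a "Suc i"] le_iff[of "Suc i" b] that a b by (auto simp: indicator_def)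
    then have "(\<Sum>i<L. indicator {\<tau> k<..\<tau> (Suc k)} (c (Suc i)) *\<^sub>R (W (c (Suc i)) \<omega> - W (c i) \<omega>))
      = (\<Sum>i<L. if i \<in> {a..<b} then W (c (Suc i)) \<omega> - W (c i) \<omega> else 0)"
      by (intro sum.cong) auto
    also have "\<dots> = (\<Sum>i=a..<b. W (c (Suc i)) \<omega> - W (c i) \<omega>)"
      using b by (intro sum.mono_neutral_cong_right) auto
    also have "\<dots> = W (c b) \<omega> - W (c a) \<omega>"
      using sum_Suc_diff'[OF ab, of "\<lambda>i. W (c i) \<omega>"] .
    finally show ?thesis using a b by simp
  qed
  show "simple_ito_integral W L c \<xi>' \<omega> = simple_ito_integral W N \<tau> \<xi> \<omega>" for \<omega>
  proof -
    have "simple_ito_integral W L c \<xi>' \<omega> =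
      (\<Sum>i<L. \<Sum>k<N. \<xi> k \<omega> *v (indicator {\<tau> k<..\<tau> (Suc k)} (c (Suc i)) *\<^sub>R (W (c (Suc i)) \<omega> - W (c i) \<omega>)))"
      by (simp add: simple_ito_integral_def \<xi>'_def simple_process_def mv.sum_left mv.scaleR_left mv.scaleR_right)
    also have "\<dots> = (\<Sum>k<N. \<Sum>i<L. \<xi> k \<omega> *v (indicator {\<tau> k<..\<tau> (Suc k)} (c (Suc i)) *\<^sub>R (W (c (Suc i)) \<omega> - W (c i) \<omega>)))"
      by (rule sum.swap)
    also have "\<dots> = (\<Sum>k<N. \<xi> k \<omega> *v (W (\<tau> (Suc k)) \<omega> - W (\<tau> k) \<omega>))"
      by (intro sum.cong refl) (simp only: mv.sum_right[symmetric] tele lessThan_iff)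
    finally show ?thesis by (simp add: simple_ito_integral_def)
  qed
qed

lemma simple_integrand_diff:
  fixes \<xi>1 \<xi>2 :: "nat \<Rightarrow> 'a \<Rightarrow> real ^ 'm ^ 'd::finite"
  assumes S1: "simple_integrand P F t N1 \<tau>1 \<xi>1" and S2: "simple_integrand P F t N2 \<tau>2 \<xi>2"
  shows "\<exists>N \<tau> \<xi>. simple_integrand P F t N \<tau> (\<xi> :: nat \<Rightarrow> 'a \<Rightarrow> real ^ 'm ^ 'd) \<and>
    (\<forall>s \<omega>. simple_process N \<tau> \<xi> s \<omega> = simple_process N1 \<tau>1 \<xi>1 s \<omega> - simple_process N2 \<tau>2 \<xi>2 s \<omega>) \<and>
    (\<forall>\<omega>. simple_ito_integral W N \<tau> \<xi> \<omega> = simple_ito_integral W N1 \<tau>1 \<xi>1 \<omega> - simple_ito_integral W N2 \<tau>2 \<xi>2 \<omega>)"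
proof -
  note D1 = simple_integrandD[OF S1] and D2 = simple_integrandD[OF S2]
  define C where "C = \<tau>1 ` {..N1} \<union> \<tau>2 ` {..N2}"
  have C: "finite C" "\<tau>1 ` {..N1} \<subseteq> C" "\<tau>2 ` {..N2} \<subseteq> C" "C \<subseteq> {0..t}"
    using D1(5,6) D2(5,6) by (auto simp: C_def)
  define c where "c = (\<lambda>i. sorted_list_of_set C ! i)"
  define L where "L = card C - 1"
  define \<xi> where "\<xi> = (\<lambda>i \<omega>. simple_process N1 \<tau>1 \<xi>1 (c (Suc i)) \<omega> - simple_process N2 \<tau>2 \<xi>2 (c (Suc i)) \<omega>)"
  note R1 = simple_integrand_refine[OF S1 C(1,2,4), folded c_def L_def]
  note R2 = simple_integrand_refine[OF S2 C(1,3,4), folded c_def L_def]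
  have "simple_integrand P F t L c \<xi>"
    unfolding simple_integrand_def
  proof (intro conjI allI impI)
    fix k assume k: "k < L"
    show "\<xi> k \<in> borel_measurable (F (c k))"
      unfolding \<xi>_def using simple_integrandD(7)[OF R1(1) k] simple_integrandD(7)[OF R2(1) k] by measurable
    obtain B1 B2 where "\<forall>\<omega>\<in>space M. norm (simple_process N1 \<tau>1 \<xi>1 (c (Suc k)) \<omega>) \<le> B1"
      "\<forall>\<omega>\<in>space M. norm (simple_process N2 \<tau>2 \<xi>2 (c (Suc k)) \<omega>) \<le> B2"
      using simple_integrandD(8)[OF R1(1) k] simple_integrandD(8)[OF R2(1) k] by blast
    then show "\<exists>B. \<forall>\<omega>\<in>space P. norm (\<xi> k \<omega>) \<le> B"
      unfolding \<xi>_def by (intro exI[of _ "B1 + B2"]) (auto intro!: order_trans[OF norm_triangle_ineq4] add_mono)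
  qed (use simple_integrandD[OF R1(1)] in auto)
  moreover have "simple_process L c \<xi> s \<omega> = simple_process N1 \<tau>1 \<xi>1 s \<omega> - simple_process N2 \<tau>2 \<xi>2 s \<omega>" for s \<omega>
    unfolding R1(2)[symmetric, of s \<omega>] R2(2)[symmetric, of s \<omega>]
    by (subst (1 2 3) simple_process_def) (simp add: \<xi>_def scaleR_diff_right sum_subtractf)
  moreover have "simple_ito_integral W L c \<xi> \<omega> = simple_ito_integral W N1 \<tau>1 \<xi>1 \<omega> - simple_ito_integral W N2 \<tau>2 \<xi>2 \<omega>" for \<omega>
    unfolding R1(3)[symmetric, of \<omega>] R2(3)[symmetric, of \<omega>]
    by (simp add: simple_ito_integral_def \<xi>_def mv.diff_left sum_subtractf)
  ultimately show ?thesis by blast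
qed

end

section \<open>Locality and uniqueness of the Ito integral\<close>

abbreviation lebesgue_upto :: "real \<Rightarrow> real measure" where
  "lebesgue_upto t \<equiv> restrict_space lborel {0..t}"

lemma nn_integral_lebesgue_upto:
  "(\<integral>\<^sup>+s\<in>{0..t}. f s \<partial>lborel) = (\<integral>\<^sup>+s. f s \<partial>lebesgue_upto t)"
  by (simp add: nn_integral_restrict_space)

lemma measurable_lebesgue_upto_pair:
  "measurable (restrict_space borel {0..t} \<Otimes>\<^sub>M N) K = measurable (lebesgue_upto t \<Otimes>\<^sub>M N) K"
  by (intro measurable_cong_sets sets_pair_measure_cong sets_restrict_space_cong) auto

lemma borel_measurable_nn_integral_upto:
  fixes g :: "real \<Rightarrow> 'a \<Rightarrow> ennreal"
  assumes "(\<lambda>(u, \<omega>). g u \<omega>) \<in> borel_measurable (restrict_space borel {0..t} \<Otimes>\<^sub>M N)"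
  shows "(\<lambda>\<omega>. \<integral>\<^sup>+s\<in>{0..t}. g s \<omega> \<partial>lborel) \<in> borel_measurable N"
proof -
  interpret L: sigma_finite_measure "lebesgue_upto t"
    by (rule sigma_finite_measure_restrict_space[OF sigma_finite_lborel]) auto
  have "(\<lambda>(\<omega>, u). g u \<omega>) \<in> borel_measurable (N \<Otimes>\<^sub>M lebesgue_upto t)"
    using assms unfolding measurable_lebesgue_upto_pair
    by (subst measurable_pair_swap_iff) (simp add: case_prod_beta)
  then show ?thesis
    unfolding nn_integral_lebesgue_upto by (rule L.borel_measurable_nn_integral)
qed

lemma measurable_pair_section:
  assumes "(\<lambda>(u, \<omega>). g u \<omega>) \<in> measurable (K \<Otimes>\<^sub>M N) R" "\<omega> \<in> space N"
  shows "(\<lambda>u. g u \<omega>) \<in> measurable K R"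
  using measurable_compose[OF measurable_Pair2'[OF assms(2)] assms(1)] by simp

lemma sum3_power2_le: "(x + y + z)\<^sup>2 \<le> 3 * (x\<^sup>2 + y\<^sup>2 + z\<^sup>2)" for x y z :: real
proof -
  have "0 \<le> (x - y)\<^sup>2 + (y - z)\<^sup>2 + (x - z)\<^sup>2" by simp
  then show ?thesis by (simp add: power2_eq_square algebra_simps)
qed

lemma (in prob_space) AE_eq_0_of_measure:
  fixes Q :: "'a \<Rightarrow> 'b::{real_normed_vector, second_countable_topology}"
  assumes Q[measurable]: "Q \<in> borel_measurable M" and A[measurable]: "A \<in> sets M"
    and "\<And>\<epsilon>. 0 < \<epsilon> \<Longrightarrow> measure M {\<omega> \<in> space M. \<omega> \<in> A \<and> \<epsilon> < norm (Q \<omega>)} = 0"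
  shows "AE \<omega> in M. \<omega> \<in> A \<longrightarrow> Q \<omega> = 0"
proof -
  have "AE \<omega> in M. \<forall>n::nat. \<omega> \<in> A \<longrightarrow> norm (Q \<omega>) \<le> inverse (Suc n)"
    unfolding AE_all_countable
  proof
    fix n
    have "emeasure M {\<omega> \<in> space M. \<omega> \<in> A \<and> inverse (real (Suc n)) < norm (Q \<omega>)} = 0"
      using assms(3)[of "inverse (real (Suc n))"] by (simp add: emeasure_eq_measure)
    then have "{\<omega> \<in> space M. \<omega> \<in> A \<and> inverse (real (Suc n)) < norm (Q \<omega>)} \<in> null_sets M"
      by (intro null_setsI) auto
    then show "AE \<omega> in M. \<omega> \<in> A \<longrightarrow> norm (Q \<omega>) \<le> inverse (Suc n)"
      by (rule AE_I') auto
  qed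
  then show ?thesis
  proof eventually_elim
    fix \<omega> assume *: "\<forall>n::nat. \<omega> \<in> A \<longrightarrow> norm (Q \<omega>) \<le> inverse (Suc n)"
    show "\<omega> \<in> A \<longrightarrow> Q \<omega> = 0"
    proof
      assume "\<omega> \<in> A"
      then have "norm (Q \<omega>) \<le> 0"
        using * by (intro LIMSEQ_le_const[OF LIMSEQ_inverse_real_of_nat]) auto
      then show "Q \<omega> = 0" by simp
    qed
  qed
qed

context brownian
begin

lemma simple_process_measurable:
  assumes S: "simple_integrand P F t N \<tau> \<xi>"
  shows "(\<lambda>(u, \<omega>). simple_process N \<tau> \<xi> u \<omega>) \<in> borel_measurable (restrict_space borel {0..t} \<Otimes>\<^sub>M F t)"
  unfolding simple_process_def case_prod_beta
proof (intro borel_measurable_sum borel_measurable_scaleR)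
  fix k assume "k \<in> {..<N}"
  then have "\<xi> k \<in> borel_measurable (F t)" using simple_integrand_measurable_F[OF S] by auto
  then show "(\<lambda>x. \<xi> k (snd x)) \<in> borel_measurable (restrict_space borel {0..t} \<Otimes>\<^sub>M F t)"
    by (rule measurable_compose[OF measurable_snd])
  have "indicat_real {\<tau> k<..\<tau> (Suc k)} \<in> borel_measurable (restrict_space borel {0..t})"
    by (intro measurable_restrict_space1) auto
  then show "(\<lambda>x. indicat_real {\<tau> k<..\<tau> (Suc k)} (fst x)) \<in> borel_measurable (restrict_space borel {0..t} \<Otimes>\<^sub>M F t)"
    by (rule measurable_compose[OF measurable_fst])
qed

lemma l2_distance_measurable:
  fixes \<xi> :: "nat \<Rightarrow> 'a \<Rightarrow> real ^ 'm ^ 'd::finite"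
  assumes S: "simple_integrand P F t N \<tau> \<xi>"
    and H: "(\<lambda>(u, \<omega>). H u \<omega>) \<in> borel_measurable (restrict_space borel {0..t} \<Otimes>\<^sub>M F t)"
  shows "(\<lambda>\<omega>. \<integral>\<^sup>+s\<in>{0..t}. ennreal ((norm (simple_process N \<tau> \<xi> s \<omega> - H s \<omega>))\<^sup>2) \<partial>lborel) \<in> borel_measurable P"
proof (rule measurable_F_P[OF borel_measurable_nn_integral_upto])
  show "(\<lambda>(u, \<omega>). ennreal ((norm (simple_process N \<tau> \<xi> u \<omega> - H u \<omega>))\<^sup>2)) \<in> borel_measurable (restrict_space borel {0..t} \<Otimes>\<^sub>M F t)"
    using simple_process_measurable[OF S] H unfolding case_prod_beta by measurable
qed

lemma ito_integrand_joint:
  assumes "ito_integrand P F t H" "0 \<le> t"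
  shows "(\<lambda>(u, \<omega>). H u \<omega>) \<in> borel_measurable (restrict_space borel {0..t} \<Otimes>\<^sub>M F t)"
  using assms by (auto simp: ito_integrand_def progressively_measurable_def)

text \<open>
  Locality and uniqueness of the Ito integral at once.  The approximations of the three integrands
  combine to one simple integrand, whose energy on \<open>A\<close> is small with high probability; the tail bound
  shows that its integral is small as well.
\<close>

lemma has_ito_integral_diff_on:
  fixes H1 H2 H3 :: "real \<Rightarrow> 'a \<Rightarrow> real ^ 'm ^ 'd::finite"
  assumes t: "0 \<le> t" "t \<le> T"
    and I1: "has_ito_integral P F W t H1 Z1" and I2: "has_ito_integral P F W t H2 Z2"
    and I3: "has_ito_integral P F W t H3 Z3" and A[measurable]: "A \<in> sets P"
    and eq: "\<And>s \<omega>. s \<in> {0..t} \<Longrightarrow> \<omega> \<in> A \<Longrightarrow> H3 s \<omega> = H1 s \<omega> - H2 s \<omega>"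
  shows "AE \<omega> in P. \<omega> \<in> A \<longrightarrow> Z3 \<omega> = Z1 \<omega> - Z2 \<omega>"
proof -
  define dist where "dist = (\<lambda>n \<tau> \<xi> (H :: real \<Rightarrow> 'a \<Rightarrow> real ^ 'm ^ 'd) \<omega>.
    \<integral>\<^sup>+s\<in>{0..t}. ennreal ((norm (simple_process n \<tau> \<xi> s \<omega> - H s \<omega>))\<^sup>2) \<partial>lborel)"
  define C where "C = ito_const (CARD('d) * CARD('m)) 1"
  have C0: "0 \<le> C" unfolding C_def by (rule ito_const_nonneg)
  obtain n1 \<tau>1 \<xi>1 where S1: "\<And>k::nat. simple_integrand P F t (n1 k) (\<tau>1 k) (\<xi>1 k :: nat \<Rightarrow> 'a \<Rightarrow> real ^ 'm ^ 'd)"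
    and d1: "\<forall>\<epsilon>>0. (\<lambda>k. measure P {\<omega> \<in> space P. ennreal \<epsilon> <
             (\<integral>\<^sup>+ s\<in>{0..t}. ennreal ((norm (simple_process (n1 k) (\<tau>1 k) (\<xi>1 k) s \<omega> - H1 s \<omega>))\<^sup>2)
                \<partial>lborel)}) \<longlonglongrightarrow> 0"
    and z1: "\<forall>\<epsilon>>0. (\<lambda>k. measure P {\<omega> \<in> space P. \<epsilon> <
             norm (simple_ito_integral W (n1 k) (\<tau>1 k) (\<xi>1 k) \<omega> - Z1 \<omega>)}) \<longlonglongrightarrow> 0"
    using I1 unfolding has_ito_integral_def by blast
  obtain n2 \<tau>2 \<xi>2 where S2: "\<And>k::nat. simple_integrand P F t (n2 k) (\<tau>2 k) (\<xi>2 k :: nat \<Rightarrow> 'a \<Rightarrow> real ^ 'm ^ 'd)"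
    and d2: "\<forall>\<epsilon>>0. (\<lambda>k. measure P {\<omega> \<in> space P. ennreal \<epsilon> <
             (\<integral>\<^sup>+ s\<in>{0..t}. ennreal ((norm (simple_process (n2 k) (\<tau>2 k) (\<xi>2 k) s \<omega> - H2 s \<omega>))\<^sup>2)
                \<partial>lborel)}) \<longlonglongrightarrow> 0"
    and z2: "\<forall>\<epsilon>>0. (\<lambda>k. measure P {\<omega> \<in> space P. \<epsilon> <
             norm (simple_ito_integral W (n2 k) (\<tau>2 k) (\<xi>2 k) \<omega> - Z2 \<omega>)}) \<longlonglongrightarrow> 0"
    using I2 unfolding has_ito_integral_def by blast
  obtain n3 \<tau>3 \<xi>3 where S3: "\<And>k::nat. simple_integrand P F t (n3 k) (\<tau>3 k) (\<xi>3 k :: nat \<Rightarrow> 'a \<Rightarrow> real ^ 'm ^ 'd)"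
    and d3: "\<forall>\<epsilon>>0. (\<lambda>k. measure P {\<omega> \<in> space P. ennreal \<epsilon> <
             (\<integral>\<^sup>+ s\<in>{0..t}. ennreal ((norm (simple_process (n3 k) (\<tau>3 k) (\<xi>3 k) s \<omega> - H3 s \<omega>))\<^sup>2)
                \<partial>lborel)}) \<longlonglongrightarrow> 0"
    and z3: "\<forall>\<epsilon>>0. (\<lambda>k. measure P {\<omega> \<in> space P. \<epsilon> <
             norm (simple_ito_integral W (n3 k) (\<tau>3 k) (\<xi>3 k) \<omega> - Z3 \<omega>)}) \<longlonglongrightarrow> 0"
    using I3 unfolding has_ito_integral_def by blast
  have Zm: "Z1 \<in> borel_measurable P" "Z2 \<in> borel_measurable P" "Z3 \<in> borel_measurable P"
    and It: "ito_integrand P F t H1" "ito_integrand P F t H2" "ito_integrand P F t H3"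
    using I1 I2 I3 by (auto simp: has_ito_integral_def)
  note joint = It[THEN ito_integrand_joint, OF t(1)]
  have dm: "dist (n1 k) (\<tau>1 k) (\<xi>1 k) H1 \<in> borel_measurable P"
    "dist (n2 k) (\<tau>2 k) (\<xi>2 k) H2 \<in> borel_measurable P"
    "dist (n3 k) (\<tau>3 k) (\<xi>3 k) H3 \<in> borel_measurable P" for k
    unfolding dist_def by (intro l2_distance_measurable S1 S2 S3 joint)+
  have Jm: "simple_ito_integral W (n1 k) (\<tau>1 k) (\<xi>1 k) \<in> borel_measurable P"
    "simple_ito_integral W (n2 k) (\<tau>2 k) (\<xi>2 k) \<in> borel_measurable P"
    "simple_ito_integral W (n3 k) (\<tau>3 k) (\<xi>3 k) \<in> borel_measurable P" for k
    using simple_ito_integral_measurable[OF S1 t(2)] simple_ito_integral_measurable[OF S2 t(2)]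
      simple_ito_integral_measurable[OF S3 t(2)] measurable_F_P by blast+
  define Q where "Q = (\<lambda>\<omega>. Z1 \<omega> - Z2 \<omega> - Z3 \<omega>)"
  have Qm[measurable]: "Q \<in> borel_measurable P" unfolding Q_def using Zm by measurable
  have bound: "measure P {\<omega> \<in> space P. \<omega> \<in> A \<and> 4 * \<epsilon> < norm (Q \<omega>)} \<le> C * \<delta> / \<epsilon>\<^sup>2"
    if "0 < \<epsilon>" "0 < \<delta>" for \<epsilon> \<delta>
  proof -
    define D1 where "D1 = (\<lambda>k. {\<omega> \<in> space P. ennreal (\<delta> / 9) < dist (n1 k) (\<tau>1 k) (\<xi>1 k) H1 \<omega>})"
    define D2 where "D2 = (\<lambda>k. {\<omega> \<in> space P. ennreal (\<delta> / 9) < dist (n2 k) (\<tau>2 k) (\<xi>2 k) H2 \<omega>})"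
    define D3 where "D3 = (\<lambda>k. {\<omega> \<in> space P. ennreal (\<delta> / 9) < dist (n3 k) (\<tau>3 k) (\<xi>3 k) H3 \<omega>})"
    define B1 where "B1 = (\<lambda>k. {\<omega> \<in> space P. \<epsilon> < norm (simple_ito_integral W (n1 k) (\<tau>1 k) (\<xi>1 k) \<omega> - Z1 \<omega>)})"
    define B2 where "B2 = (\<lambda>k. {\<omega> \<in> space P. \<epsilon> < norm (simple_ito_integral W (n2 k) (\<tau>2 k) (\<xi>2 k) \<omega> - Z2 \<omega>)})"
    define B3 where "B3 = (\<lambda>k. {\<omega> \<in> space P. \<epsilon> < norm (simple_ito_integral W (n3 k) (\<tau>3 k) (\<xi>3 k) \<omega> - Z3 \<omega>)})"
    have sets: "D1 k \<in> sets P" "D2 k \<in> sets P" "D3 k \<in> sets P" "B1 k \<in> sets P" "B2 k \<in> sets P" "B3 k \<in> sets P" for k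
      unfolding D1_def D2_def D3_def B1_def B2_def B3_def using dm[of k] Jm[of k] Zm by measurable
    have le: "measure P {\<omega> \<in> space P. \<omega> \<in> A \<and> 4 * \<epsilon> < norm (Q \<omega>)} \<le>
      C * \<delta> / \<epsilon>\<^sup>2 + (measure P (D1 k) + measure P (D2 k) + measure P (D3 k) + measure P (B1 k) + measure P (B2 k) + measure P (B3 k))" for k
    proof -
      obtain N' \<tau>' \<xi>' where S': "simple_integrand P F t N' \<tau>' (\<xi>' :: nat \<Rightarrow> 'a \<Rightarrow> real ^ 'm ^ 'd)"
        and p': "\<And>s \<omega>. simple_process N' \<tau>' \<xi>' s \<omega> = simple_process (n1 k) (\<tau>1 k) (\<xi>1 k) s \<omega> - simple_process (n2 k) (\<tau>2 k) (\<xi>2 k) s \<omega>"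
        and i': "\<And>\<omega>. simple_ito_integral W N' \<tau>' \<xi>' \<omega> = simple_ito_integral W (n1 k) (\<tau>1 k) (\<xi>1 k) \<omega> - simple_ito_integral W (n2 k) (\<tau>2 k) (\<xi>2 k) \<omega>"
        using simple_integrand_diff[OF S1[of k] S2[of k]] by blast
      obtain N \<tau> \<xi> where S: "simple_integrand P F t N \<tau> (\<xi> :: nat \<Rightarrow> 'a \<Rightarrow> real ^ 'm ^ 'd)"
        and p: "\<And>s \<omega>. simple_process N \<tau> \<xi> s \<omega> = simple_process N' \<tau>' \<xi>' s \<omega> - simple_process (n3 k) (\<tau>3 k) (\<xi>3 k) s \<omega>"
        and i: "\<And>\<omega>. simple_ito_integral W N \<tau> \<xi> \<omega> = simple_ito_integral W N' \<tau>' \<xi>' \<omega> - simple_ito_integral W (n3 k) (\<tau>3 k) (\<xi>3 k) \<omega>"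
        using simple_integrand_diff[OF S' S3[of k]] by blast
      let ?e = "\<lambda>\<omega>. \<Sum>j<N. (\<tau> (Suc j) - \<tau> j) * (norm (\<xi> j \<omega>))\<^sup>2"
      define E where "E = {\<omega> \<in> space P. \<epsilon> < norm (simple_ito_integral W N \<tau> \<xi> \<omega>) \<and> ?e \<omega> \<le> \<delta>}"
      have \<xi>m: "\<xi> j \<in> borel_measurable P" if "j < N" for j
        using measurable_F_P[OF simple_integrand_measurable_F[OF S that]] .
      have em: "?e \<in> borel_measurable P"
        by (intro borel_measurable_sum borel_measurable_times borel_measurable_power borel_measurable_norm)
          (auto intro!: measurable_compose[OF \<xi>m borel_measurable_norm])
      have Em: "E \<in> sets P"
        unfolding E_def using measurable_F_P[OF simple_ito_integral_measurable[OF S t(2)]] em by measurable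
      have Eb: "measure P E \<le> C * \<delta> / \<epsilon>\<^sup>2"
        unfolding E_def C_def using S t(2) that by (intro simple_integral_prob_bound) auto
      have small: "?e \<omega> \<le> \<delta>" if \<omega>: "\<omega> \<in> A" and dd: "dist (n1 k) (\<tau>1 k) (\<xi>1 k) H1 \<omega> \<le> ennreal (\<delta> / 9)"
        "dist (n2 k) (\<tau>2 k) (\<xi>2 k) H2 \<omega> \<le> ennreal (\<delta> / 9)" "dist (n3 k) (\<tau>3 k) (\<xi>3 k) H3 \<omega> \<le> ennreal (\<delta> / 9)" for \<omega>
      proof -
        let ?f1 = "\<lambda>s. simple_process (n1 k) (\<tau>1 k) (\<xi>1 k) s \<omega> - H1 s \<omega>"
        let ?f2 = "\<lambda>s. simple_process (n2 k) (\<tau>2 k) (\<xi>2 k) s \<omega> - H2 s \<omega>"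
        let ?f3 = "\<lambda>s. simple_process (n3 k) (\<tau>3 k) (\<xi>3 k) s \<omega> - H3 s \<omega>"
        have sp: "\<omega> \<in> space (F t)" using \<omega> sets.sets_into_space[OF A] by auto
        have fm: "?f1 \<in> borel_measurable (lebesgue_upto t)" "?f2 \<in> borel_measurable (lebesgue_upto t)"
          "?f3 \<in> borel_measurable (lebesgue_upto t)"
          using measurable_pair_section[OF simple_process_measurable[OF S1[of k], unfolded measurable_lebesgue_upto_pair] sp]
            measurable_pair_section[OF simple_process_measurable[OF S2[of k], unfolded measurable_lebesgue_upto_pair] sp]
            measurable_pair_section[OF simple_process_measurable[OF S3[of k], unfolded measurable_lebesgue_upto_pair] sp]
            joint[unfolded measurable_lebesgue_upto_pair, THEN measurable_pair_section, OF sp]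
          by measurable
        have "ennreal (?e \<omega>) = (\<integral>\<^sup>+s. ennreal ((norm (simple_process N \<tau> \<xi> s \<omega>))\<^sup>2) \<partial>lebesgue_upto t)"
          using simple_process_energy[of N \<tau> t \<xi> \<omega>] simple_integrandD(1-3)[OF S]
          by (simp add: nn_integral_lebesgue_upto)
        also have "\<dots> \<le> (\<integral>\<^sup>+s. 3 * (ennreal ((norm (?f1 s))\<^sup>2) + ennreal ((norm (?f2 s))\<^sup>2) + ennreal ((norm (?f3 s))\<^sup>2)) \<partial>lebesgue_upto t)"
        proof (rule nn_integral_mono)
          fix s assume "s \<in> space (lebesgue_upto t)"
          then have sf: "simple_process N \<tau> \<xi> s \<omega> = ?f1 s - ?f2 s - ?f3 s"
            using eq[of s \<omega>] \<omega> by (simp add: p p' space_restrict_space)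
          have "norm (simple_process N \<tau> \<xi> s \<omega>) \<le> norm (?f1 s) + norm (?f2 s) + norm (?f3 s)"
            unfolding sf by (rule order_trans[OF norm_triangle_ineq4 add_right_mono[OF norm_triangle_ineq4]])
          then have "(norm (simple_process N \<tau> \<xi> s \<omega>))\<^sup>2 \<le> (norm (?f1 s) + norm (?f2 s) + norm (?f3 s))\<^sup>2"
            by (intro power_mono) auto
          also have "\<dots> \<le> 3 * ((norm (?f1 s))\<^sup>2 + (norm (?f2 s))\<^sup>2 + (norm (?f3 s))\<^sup>2)"
            by (rule sum3_power2_le)
          finally have "ennreal ((norm (simple_process N \<tau> \<xi> s \<omega>))\<^sup>2) \<le> ennreal (3 * ((norm (?f1 s))\<^sup>2 + (norm (?f2 s))\<^sup>2 + (norm (?f3 s))\<^sup>2))"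
            by (rule ennreal_leI)
          then show "ennreal ((norm (simple_process N \<tau> \<xi> s \<omega>))\<^sup>2) \<le> 3 * (ennreal ((norm (?f1 s))\<^sup>2) + ennreal ((norm (?f2 s))\<^sup>2) + ennreal ((norm (?f3 s))\<^sup>2))"
            by (simp add: ennreal_mult)
        qed
        also have "\<dots> = 3 * (dist (n1 k) (\<tau>1 k) (\<xi>1 k) H1 \<omega> + dist (n2 k) (\<tau>2 k) (\<xi>2 k) H2 \<omega> + dist (n3 k) (\<tau>3 k) (\<xi>3 k) H3 \<omega>)"
          unfolding dist_def nn_integral_lebesgue_upto using fm by (simp add: nn_integral_cmult nn_integral_add)
        also have "\<dots> \<le> 3 * (ennreal (\<delta> / 9) + ennreal (\<delta> / 9) + ennreal (\<delta> / 9))"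
          using dd by (intro mult_left_mono add_mono) auto
        also have "\<dots> = ennreal \<delta>"
        proof -
          have "3 * (ennreal (\<delta> / 9) + ennreal (\<delta> / 9) + ennreal (\<delta> / 9)) = ennreal 3 * ennreal (\<delta> / 9 + \<delta> / 9 + \<delta> / 9)"
            using \<open>0 < \<delta>\<close> by (simp only: ennreal_plus[symmetric] divide_nonneg_nonneg less_imp_le add_nonneg_nonneg) simp
          also have "\<dots> = ennreal (3 * (\<delta> / 9 + \<delta> / 9 + \<delta> / 9))"
            using \<open>0 < \<delta>\<close> by (intro ennreal_mult[symmetric]) auto
          finally show ?thesis by simp
        qed
        finally show ?thesis using \<open>0 < \<delta>\<close> by (simp add: ennreal_le_iff)
      qed
      have "{\<omega> \<in> space P. \<omega> \<in> A \<and> 4 * \<epsilon> < norm (Q \<omega>)} \<subseteq> E \<union> (D1 k \<union> D2 k \<union> D3 k \<union> B1 k \<union> B2 k \<union> B3 k)"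
      proof (rule subsetI, rule ccontr)
        fix \<omega> assume \<omega>: "\<omega> \<in> {\<omega> \<in> space P. \<omega> \<in> A \<and> 4 * \<epsilon> < norm (Q \<omega>)}"
          and nin: "\<omega> \<notin> E \<union> (D1 k \<union> D2 k \<union> D3 k \<union> B1 k \<union> B2 k \<union> B3 k)"
        let ?J1 = "simple_ito_integral W (n1 k) (\<tau>1 k) (\<xi>1 k) \<omega>"
        let ?J2 = "simple_ito_integral W (n2 k) (\<tau>2 k) (\<xi>2 k) \<omega>"
        let ?J3 = "simple_ito_integral W (n3 k) (\<tau>3 k) (\<xi>3 k) \<omega>"
        have "?e \<omega> \<le> \<delta>"
          using \<omega> nin by (intro small) (auto simp: D1_def D2_def D3_def not_less)
        then have "norm (simple_ito_integral W N \<tau> \<xi> \<omega>) \<le> \<epsilon>"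
          using \<omega> nin by (auto simp: E_def not_less)
        then have J: "norm (?J1 - ?J2 - ?J3) \<le> \<epsilon>" by (simp add: i i')
        have B: "norm (?J1 - Z1 \<omega>) \<le> \<epsilon>" "norm (?J2 - Z2 \<omega>) \<le> \<epsilon>" "norm (?J3 - Z3 \<omega>) \<le> \<epsilon>"
          using \<omega> nin by (auto simp: B1_def B2_def B3_def not_less)
        have Qe: "Q \<omega> = (?J1 - ?J2 - ?J3) - (?J1 - Z1 \<omega>) + (?J2 - Z2 \<omega>) + (?J3 - Z3 \<omega>)"
          by (simp add: Q_def)
        have "norm (Q \<omega>) \<le> norm (?J1 - ?J2 - ?J3) + norm (?J1 - Z1 \<omega>) + norm (?J2 - Z2 \<omega>) + norm (?J3 - Z3 \<omega>)"
          unfolding Qe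
          by (rule order_trans[OF norm_triangle_ineq add_right_mono[OF order_trans[OF norm_triangle_ineq add_right_mono[OF norm_triangle_ineq4]]]])
        also have "\<dots> \<le> 4 * \<epsilon>" using J B by simp
        finally show False using \<omega> by simp
      qed
      then have "measure P {\<omega> \<in> space P. \<omega> \<in> A \<and> 4 * \<epsilon> < norm (Q \<omega>)} \<le> measure P (E \<union> (D1 k \<union> D2 k \<union> D3 k \<union> B1 k \<union> B2 k \<union> B3 k))"
        using Em sets by (intro P.finite_measure_mono) auto
      also have "\<dots> \<le> measure P E + (measure P (D1 k) + measure P (D2 k) + measure P (D3 k) + measure P (B1 k) + measure P (B2 k) + measure P (B3 k))"
        using Em sets by (intro order_trans[OF measure_Un_le] add_mono order_refl) auto
      finally show ?thesis using Eb by simp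
    qed
    have "(\<lambda>k. C * \<delta> / \<epsilon>\<^sup>2 + (measure P (D1 k) + measure P (D2 k) + measure P (D3 k) + measure P (B1 k) + measure P (B2 k) + measure P (B3 k)))
      \<longlonglongrightarrow> C * \<delta> / \<epsilon>\<^sup>2 + (0 + 0 + 0 + 0 + 0 + 0)"
      unfolding D1_def D2_def D3_def B1_def B2_def B3_def dist_def
      using that by (intro tendsto_add tendsto_const d1[rule_format] d2[rule_format] d3[rule_format] z1[rule_format] z2[rule_format] z3[rule_format]) auto
    then show ?thesis using le by (intro LIMSEQ_le_const) auto
  qed
  have meas0: "measure P {\<omega> \<in> space P. \<omega> \<in> A \<and> \<epsilon> < norm (Q \<omega>)} = 0" if "0 < \<epsilon>" for \<epsilon>
  proof -
    have "measure P {\<omega> \<in> space P. \<omega> \<in> A \<and> \<epsilon> < norm (Q \<omega>)} \<le> 0 + e" if "0 < e" for e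
    proof -
      have "measure P {\<omega> \<in> space P. \<omega> \<in> A \<and> \<epsilon> < norm (Q \<omega>)} \<le> C * (e * (\<epsilon> / 4)\<^sup>2 / (C + 1)) / (\<epsilon> / 4)\<^sup>2"
        using bound[of "\<epsilon> / 4" "e * (\<epsilon> / 4)\<^sup>2 / (C + 1)"] \<open>0 < \<epsilon>\<close> \<open>0 < e\<close> C0 by simp
      also have "\<dots> = e * (C / (C + 1))"
      proof -
        have "C * (e * x / k) / x = e * (C / k)" if "x \<noteq> 0" for x k :: real
          using that by (simp add: divide_simps)
        then show ?thesis using \<open>0 < \<epsilon>\<close> by simp
      qed
      also have "\<dots> \<le> e * 1" using \<open>0 < e\<close> C0 by (intro mult_left_mono) auto
      finally show ?thesis by simp
    qed
    then have "measure P {\<omega> \<in> space P. \<omega> \<in> A \<and> \<epsilon> < norm (Q \<omega>)} \<le> 0"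
      by (rule field_le_epsilon)
    then show ?thesis by (simp add: measure_le_0_iff)
  qed
  have "AE \<omega> in P. \<omega> \<in> A \<longrightarrow> Q \<omega> = 0"
    by (rule P.AE_eq_0_of_measure[OF Qm A]) (rule meas0)
  then show ?thesis
    by eventually_elim (auto simp: Q_def)
qed

lemma has_ito_integral_cong:
  assumes I: "has_ito_integral P F W t H Z" and "0 \<le> t"
    and eq: "\<And>s \<omega>. s \<in> {0..t} \<Longrightarrow> \<omega> \<in> space M \<Longrightarrow> H s \<omega> = H' s \<omega>"
  shows "has_ito_integral P F W t H' Z"
proof -
  have pm: "progressively_measurable F t H'"
    unfolding progressively_measurable_def
  proof
    fix s assume s: "s \<in> {0..t}"
    have "(\<lambda>(u, \<omega>). H u \<omega>) \<in> borel_measurable (restrict_space borel {0..s} \<Otimes>\<^sub>M F s)"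
      using I s by (auto simp: has_ito_integral_def ito_integrand_def progressively_measurable_def)
    then show "(\<lambda>(u, \<omega>). H' u \<omega>) \<in> borel_measurable (restrict_space borel {0..s} \<Otimes>\<^sub>M F s)"
      by (rule measurable_cong[THEN iffD1, rotated])
         (use eq s in \<open>auto simp: space_pair_measure space_restrict_space\<close>)
  qed
  have int: "(\<integral>\<^sup>+s\<in>{0..t}. ennreal ((norm (G s \<omega> - H s \<omega>))\<^sup>2) \<partial>lborel) = (\<integral>\<^sup>+s\<in>{0..t}. ennreal ((norm (G s \<omega> - H' s \<omega>))\<^sup>2) \<partial>lborel)"
    if "\<omega> \<in> space P" for G \<omega>
    using that eq by (intro nn_integral_cong) (auto simp: indicator_def)
  have int0: "(\<integral>\<^sup>+s\<in>{0..t}. ennreal ((norm (H s \<omega>))\<^sup>2) \<partial>lborel) = (\<integral>\<^sup>+s\<in>{0..t}. ennreal ((norm (H' s \<omega>))\<^sup>2) \<partial>lborel)"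
    if "\<omega> \<in> space P" for \<omega>
    using that eq by (intro nn_integral_cong) (auto simp: indicator_def)
  have "AE \<omega> in P. (\<integral>\<^sup>+s\<in>{0..t}. ennreal ((norm (H s \<omega>))\<^sup>2) \<partial>lborel) < \<infinity>"
    using I by (simp add: has_ito_integral_def ito_integrand_def)
  then have "AE \<omega> in P. (\<integral>\<^sup>+s\<in>{0..t}. ennreal ((norm (H' s \<omega>))\<^sup>2) \<partial>lborel) < \<infinity>"
    using AE_space by eventually_elim (simp add: int0)
  moreover have "{\<omega> \<in> space P. e < (\<integral>\<^sup>+s\<in>{0..t}. ennreal ((norm (G s \<omega> - H s \<omega>))\<^sup>2) \<partial>lborel)} =
     {\<omega> \<in> space P. e < (\<integral>\<^sup>+s\<in>{0..t}. ennreal ((norm (G s \<omega> - H' s \<omega>))\<^sup>2) \<partial>lborel)}" for e G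
    using int by auto
  ultimately show ?thesis
    using I pm unfolding has_ito_integral_def ito_integrand_def by simp
qed

text \<open>
  An additional last cell with value zero extends every simple integrand from \<open>[0, s]\<close> to \<open>[0, t]\<close>;
  this makes integrals up to different times comparable.
\<close>

lemma has_ito_integral_extend:
  fixes H :: "real \<Rightarrow> 'a \<Rightarrow> real ^ 'm ^ 'd::finite"
  assumes I: "has_ito_integral P F W s H Z" and st: "0 \<le> s" "s \<le> t"
  shows "has_ito_integral P F W t (\<lambda>u \<omega>. if u \<le> s then H u \<omega> else 0) Z"
proof -
  let ?H = "\<lambda>u \<omega>. if u \<le> s then H u \<omega> else 0"
  obtain n \<tau> \<xi> where S: "\<And>k::nat. simple_integrand P F s (n k) (\<tau> k) (\<xi> k :: nat \<Rightarrow> 'a \<Rightarrow> real ^ 'm ^ 'd)"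
    and d: "\<forall>\<epsilon>>0. (\<lambda>k. measure P {\<omega> \<in> space P. ennreal \<epsilon> <
             (\<integral>\<^sup>+ u\<in>{0..s}. ennreal ((norm (simple_process (n k) (\<tau> k) (\<xi> k) u \<omega> - H u \<omega>))\<^sup>2)
                \<partial>lborel)}) \<longlonglongrightarrow> 0"
    and z: "\<forall>\<epsilon>>0. (\<lambda>k. measure P {\<omega> \<in> space P. \<epsilon> <
             norm (simple_ito_integral W (n k) (\<tau> k) (\<xi> k) \<omega> - Z \<omega>)}) \<longlonglongrightarrow> 0"
    using I unfolding has_ito_integral_def by blast
  have pH: "progressively_measurable F s H" and Zm: "Z \<in> borel_measurable P"
    and fin: "AE \<omega> in P. (\<integral>\<^sup>+ u\<in>{0..s}. ennreal ((norm (H u \<omega>))\<^sup>2) \<partial>lborel) < \<infinity>"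
    using I by (auto simp: has_ito_integral_def ito_integrand_def)
  have pm: "progressively_measurable F t ?H"
    unfolding progressively_measurable_def
  proof
    fix r assume r: "r \<in> {0..t}"
    let ?r = "min s r"
    have r0: "?r \<in> {0..s}" using r st by auto
    have a: "(\<lambda>x. (min (fst x) ?r, snd x)) \<in> measurable (restrict_space borel {0..r} \<Otimes>\<^sub>M F r) (restrict_space borel {0..?r} \<Otimes>\<^sub>M F ?r)"
    proof (rule measurable_Pair)
      show "(\<lambda>x. snd x) \<in> measurable (restrict_space borel {0..r} \<Otimes>\<^sub>M F r) (F ?r)"
        by (rule measurable_compose[OF measurable_snd]) (rule measurable_F_mono[of ?r r], auto)
      have "(\<lambda>u. min u ?r) \<in> measurable (restrict_space borel {0..r}) (restrict_space borel {0..?r})"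
        using r0 by (intro measurable_restrict_space2 measurable_restrict_space1) (auto simp: space_restrict_space)
      then show "(\<lambda>x. min (fst x) ?r) \<in> measurable (restrict_space borel {0..r} \<Otimes>\<^sub>M F r) (restrict_space borel {0..?r})"
        by (rule measurable_compose[OF measurable_fst])
    qed
    have b: "(\<lambda>(u, \<omega>). H u \<omega>) \<in> borel_measurable (restrict_space borel {0..?r} \<Otimes>\<^sub>M F ?r)"
      using pH r0 by (auto simp: progressively_measurable_def)
    have [measurable]: "(\<lambda>x. H (min (fst x) ?r) (snd x)) \<in> borel_measurable (restrict_space borel {0..r} \<Otimes>\<^sub>M F r)"
      using measurable_compose[OF a b] by (simp add: case_prod_beta)
    have [measurable]: "(\<lambda>u. u) \<in> borel_measurable (restrict_space borel {0..r})"
      by (rule measurable_restrict_space1) auto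
    have "(\<lambda>x. if fst x \<le> s then H (min (fst x) ?r) (snd x) else 0) \<in> borel_measurable (restrict_space borel {0..r} \<Otimes>\<^sub>M F r)"
      by measurable
    then show "(\<lambda>(u, \<omega>). ?H u \<omega>) \<in> borel_measurable (restrict_space borel {0..r} \<Otimes>\<^sub>M F r)"
      by (rule measurable_cong[THEN iffD1, rotated])
         (auto simp: space_pair_measure space_restrict_space min_def)
  qed
  have int: "(\<integral>\<^sup>+ u\<in>{0..t}. ennreal ((norm (G u - ?H u \<omega>))\<^sup>2) \<partial>lborel) = (\<integral>\<^sup>+ u\<in>{0..s}. ennreal ((norm (G u - H u \<omega>))\<^sup>2) \<partial>lborel)"
    if "\<And>u. s < u \<Longrightarrow> u \<le> t \<Longrightarrow> G u = 0" for G and \<omega>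
    using that st by (intro nn_integral_cong) (auto simp: indicator_def)
  have fin': "AE \<omega> in P. (\<integral>\<^sup>+ u\<in>{0..t}. ennreal ((norm (?H u \<omega>))\<^sup>2) \<partial>lborel) < \<infinity>"
    using fin
  proof eventually_elim
    case (elim \<omega>)
    then show ?case using int[of "\<lambda>_. 0" \<omega>] by simp
  qed
  define \<tau>' where "\<tau>' = (\<lambda>k i. if i = Suc (n k) then t else \<tau> k i)"
  define \<xi>' where "\<xi>' = (\<lambda>k i. if i = n k then (\<lambda>_. 0) else \<xi> k i)"
  have S': "simple_integrand P F t (Suc (n k)) (\<tau>' k) (\<xi>' k)" for k
    unfolding simple_integrand_def
  proof (intro conjI allI impI)
    show "\<tau>' k 0 = 0" "\<tau>' k (Suc (n k)) = t" using simple_integrandD(1)[OF S[of k]] by (auto simp: \<tau>'_def)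
    fix i assume i: "i < Suc (n k)"
    show "\<tau>' k i \<le> \<tau>' k (Suc i)"
      using i simple_integrandD(2,3)[OF S[of k]] st by (cases "i = n k") (auto simp: \<tau>'_def)
    show "\<xi>' k i \<in> borel_measurable (F (\<tau>' k i))"
      using i simple_integrandD(7)[OF S[of k]] by (cases "i = n k") (auto simp: \<tau>'_def \<xi>'_def)
    show "\<exists>B. \<forall>\<omega>\<in>space P. norm (\<xi>' k i \<omega>) \<le> B"
      using i simple_integrandD(8)[OF S[of k]] by (cases "i = n k") (auto simp: \<xi>'_def)
  qed
  have proc: "simple_process (Suc (n k)) (\<tau>' k) (\<xi>' k) u \<omega> = simple_process (n k) (\<tau> k) (\<xi> k) u \<omega>" for k u \<omega>
    unfolding simple_process_def by (auto simp: \<tau>'_def \<xi>'_def intro!: sum.cong)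
  have itg: "simple_ito_integral W (Suc (n k)) (\<tau>' k) (\<xi>' k) \<omega> = simple_ito_integral W (n k) (\<tau> k) (\<xi> k) \<omega>" for k \<omega>
    unfolding simple_ito_integral_def by (auto simp: \<tau>'_def \<xi>'_def intro!: sum.cong)
  have out: "simple_process (n k) (\<tau> k) (\<xi> k) u \<omega> = 0" if "s < u" for k u \<omega>
    using simple_integrandD(2,3)[OF S[of k]] that by (intro simple_process_outside) auto
  have d': "(\<integral>\<^sup>+ u\<in>{0..t}. ennreal ((norm (simple_process (Suc (n k)) (\<tau>' k) (\<xi>' k) u \<omega> - ?H u \<omega>))\<^sup>2) \<partial>lborel) =
      (\<integral>\<^sup>+ u\<in>{0..s}. ennreal ((norm (simple_process (n k) (\<tau> k) (\<xi> k) u \<omega> - H u \<omega>))\<^sup>2) \<partial>lborel)" for k \<omega>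
    unfolding proc by (rule int) (rule out)
  have c1: "(\<lambda>k. measure P {\<omega> \<in> space P. ennreal \<epsilon> <
             (\<integral>\<^sup>+ u\<in>{0..t}. ennreal ((norm (simple_process (Suc (n k)) (\<tau>' k) (\<xi>' k) u \<omega> - ?H u \<omega>))\<^sup>2)
                \<partial>lborel)}) \<longlonglongrightarrow> 0" if "0 < \<epsilon>" for \<epsilon>
    unfolding d' using d that by blast
  have c2: "(\<lambda>k. measure P {\<omega> \<in> space P. \<epsilon> <
             norm (simple_ito_integral W (Suc (n k)) (\<tau>' k) (\<xi>' k) \<omega> - Z \<omega>)}) \<longlonglongrightarrow> 0" if "0 < \<epsilon>" for \<epsilon>
    unfolding itg using z that by blast
  show ?thesis
    unfolding has_ito_integral_def ito_integrand_def
    by (intro conjI pm fin' Zm exI[of _ "\<lambda>k. Suc (n k)"] exI[of _ \<tau>'] exI[of _ \<xi>'] allI impI S' c1 c2)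
qed

section \<open>Left-continuous adapted processes\<close>

text \<open>
  The class of integrands that is stable under everything needed below: it contains the continuous
  adapted processes and their products with a left-continuous switch, every member is progressively
  measurable, and a path is recovered from its values at the left end points of a grid.
  Boundedness of each path makes it square integrable against every square integrable kernel.
\<close>

definition left_adapted :: "(real \<Rightarrow> 'a \<Rightarrow> 'b::real_normed_vector) \<Rightarrow> bool" where
  "left_adapted \<eta> \<longleftrightarrow> (\<forall>u\<in>{0..T}. \<eta> u \<in> borel_measurable (F u)) \<and>
     (\<forall>\<omega>\<in>space M. \<forall>u\<in>{0<..T}. ((\<lambda>v. \<eta> v \<omega>) \<longlongrightarrow> \<eta> u \<omega>) (at_left u)) \<and>
     (\<forall>\<omega>\<in>space M. \<exists>B. \<forall>u\<in>{0..T}. norm (\<eta> u \<omega>) \<le> B)"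

text \<open>
  The process is the limit of its values at the grid points \<open>g N (c N u)\<close>, which lie strictly to the
  left of \<open>u\<close> and therefore use only information that is available before \<open>u\<close>.
\<close>

lemma left_adapted_progressive:
  fixes \<eta> :: "real \<Rightarrow> 'a \<Rightarrow> 'b::real_normed_vector"
  assumes \<eta>: "left_adapted \<eta>" and "t \<le> T"
  shows "progressively_measurable F t \<eta>"
  unfolding progressively_measurable_def
proof
  fix s assume s: "s \<in> {0..t}"
  define g where "g = (\<lambda>(N::nat) (i::int). min s (max 0 ((of_int i - 1) / real (Suc N))))"
  define c where "c = (\<lambda>(N::nat) (u::real). \<lceil>u * real (Suc N)\<rceil>)"
  have "(\<lambda>x. \<eta> (g N (c N (fst x))) (snd x)) \<in> borel_measurable (restrict_space borel {0..s} \<Otimes>\<^sub>M F s)" for N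
  proof (rule measurable_compose_countable[where f = "\<lambda>i x. \<eta> (g N i) (snd x)"])
    fix i
    have "g N i \<in> {0..T}" "g N i \<le> s" using s \<open>t \<le> T\<close> by (auto simp: g_def)
    then have "\<eta> (g N i) \<in> borel_measurable (F s)"
      using \<eta> by (auto simp: left_adapted_def intro: measurable_F_mono)
    then show "(\<lambda>x. \<eta> (g N i) (snd x)) \<in> borel_measurable (restrict_space borel {0..s} \<Otimes>\<^sub>M F s)"
      by (rule measurable_compose[OF measurable_snd])
    have "c N \<in> measurable (restrict_space borel {0..s}) (count_space UNIV)"
      unfolding c_def by (intro measurable_restrict_space1) measurable
    then show "(\<lambda>x. c N (fst x)) \<in> measurable (restrict_space borel {0..s} \<Otimes>\<^sub>M F s) (count_space UNIV)"
      by (rule measurable_compose[OF measurable_fst])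
  qed
  then have "(\<lambda>x. \<eta> (fst x) (snd x)) \<in> borel_measurable (restrict_space borel {0..s} \<Otimes>\<^sub>M F s)"
  proof (rule borel_measurable_LIMSEQ_metric)
    fix x assume "x \<in> space (restrict_space borel {0..s} \<Otimes>\<^sub>M F s)"
    then have u: "fst x \<in> {0..s}" and \<omega>: "snd x \<in> space M"
      by (auto simp: space_pair_measure space_restrict_space)
    define u where "u = fst x"
    show "(\<lambda>N. \<eta> (g N (c N (fst x))) (snd x)) \<longlonglongrightarrow> \<eta> (fst x) (snd x)"
    proof (cases "fst x = 0")
      case True
      then show ?thesis using s by (simp add: g_def c_def)
    next
      case False
      then have u0: "0 < u" "u \<le> s" "u \<le> T" using u s \<open>t \<le> T\<close> by (auto simp: u_def)
      have lo: "u - inverse (real (Suc N)) \<le> g N (c N u)" and hi: "g N (c N u) < u" for N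
      proof -
        let ?i = "real_of_int \<lceil>u * real (Suc N)\<rceil>"
        have i: "u * real (Suc N) \<le> ?i" "?i < u * real (Suc N) + 1" by linarith+
        have "(u * real (Suc N) - 1) / real (Suc N) \<le> (?i - 1) / real (Suc N)"
          using i by (intro divide_right_mono) auto
        moreover have "(u * real (Suc N) - 1) / real (Suc N) = u - inverse (real (Suc N))"
          by (simp add: field_simps)
        moreover have "(?i - 1) / real (Suc N) < (u * real (Suc N)) / real (Suc N)"
          using i by (intro divide_strict_right_mono) auto
        moreover have "(u * real (Suc N)) / real (Suc N) = u" by simp
        moreover have "0 < inverse (real (Suc N))" by simp
        ultimately show "u - inverse (real (Suc N)) \<le> g N (c N u)" "g N (c N u) < u"
          using u0 by (auto simp: g_def c_def simp del: of_nat_Suc)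
      qed
      have "(\<lambda>N. g N (c N u)) \<longlonglongrightarrow> u"
      proof (rule tendsto_sandwich[OF _ _ _ tendsto_const])
        have "(\<lambda>N. u - inverse (real (Suc N))) \<longlonglongrightarrow> u - 0"
          by (intro tendsto_diff tendsto_const LIMSEQ_inverse_real_of_nat)
        then show "(\<lambda>N. u - inverse (real (Suc N))) \<longlonglongrightarrow> u" by simp
      qed (use lo hi in \<open>auto intro!: always_eventually less_imp_le\<close>)
      then have flt: "filterlim (\<lambda>N. g N (c N u)) (at_left u) sequentially"
        using hi by (auto simp: filterlim_at intro!: always_eventually) (metis less_irrefl)
      have "((\<lambda>v. \<eta> v (snd x)) \<longlongrightarrow> \<eta> u (snd x)) (at_left u)"
        using \<eta> \<omega> u0 by (auto simp: left_adapted_def)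
      from filterlim_compose[OF this flt] show ?thesis by (simp add: u_def)
    qed
  qed
  then show "(\<lambda>(u, \<omega>). \<eta> u \<omega>) \<in> borel_measurable (restrict_space borel {0..s} \<Otimes>\<^sub>M F s)"
    by (simp add: case_prod_beta)
qed

end

section \<open>Existence of the Ito integral\<close>

lemma convergent_of_summable_differences:
  fixes f :: "nat \<Rightarrow> 'b::banach"
  assumes "summable (\<lambda>k. f (Suc k) - f k)"
  shows "convergent f"
proof -
  have "(\<lambda>n. (\<Sum>k<n. f (Suc k) - f k) + f 0) \<longlonglongrightarrow> (\<Sum>k. f (Suc k) - f k) + f 0"
    by (intro tendsto_intros summable_LIMSEQ assms)
  then show ?thesis by (auto simp: sum_lessThan_telescope convergent_def)
qed

lemma (in finite_measure) measure_tendsto_0: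
  assumes A: "\<And>k::nat. A k \<in> sets M" and ev: "AE \<omega> in M. eventually (\<lambda>k. \<omega> \<notin> A k) sequentially"
  shows "(\<lambda>k. measure M (A k)) \<longlonglongrightarrow> 0"
proof -
  have "(\<lambda>k. \<integral>\<omega>. indicat_real (A k) \<omega> \<partial>M) \<longlonglongrightarrow> (\<integral>\<omega>. 0 \<partial>M)"
  proof (rule integral_dominated_convergence[where w = "\<lambda>_. 1"])
    show "AE \<omega> in M. (\<lambda>k. indicat_real (A k) \<omega>) \<longlonglongrightarrow> 0"
      using ev
    proof eventually_elim
      case (elim \<omega>)
      then have "eventually (\<lambda>k. indicat_real (A k) \<omega> = 0) sequentially"
        by eventually_elim (simp add: indicator_def)
      then show ?case by (rule tendsto_eventually)
    qed
  qed (use A in \<open>auto simp: indicator_def\<close>)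
  then show ?thesis using A sets.sets_into_space by (simp add: Int_absorb2)
qed

lemma sum2_power2_le: "(x + y)\<^sup>2 \<le> 2 * (x\<^sup>2 + y\<^sup>2)" for x y :: real
  using zero_le_power2[of "x - y"] by (simp add: power2_eq_square algebra_simps)

lemma nn_integral_partition_step:
  fixes \<tau> :: "nat \<Rightarrow> real"
  assumes mono: "\<And>k. k < N \<Longrightarrow> \<tau> k \<le> \<tau> (Suc k)" and v: "\<And>k. k < N \<Longrightarrow> 0 \<le> v k"
  shows "(\<integral>\<^sup>+s. ennreal (\<Sum>k<N. indicator {\<tau> k<..\<tau> (Suc k)} s *\<^sub>R v k) \<partial>lborel) = ennreal (\<Sum>k<N. (\<tau> (Suc k) - \<tau> k) * v k)"
proof -
  have "ennreal (\<Sum>k<N. indicator {\<tau> k<..\<tau> (Suc k)} s *\<^sub>R v k) = (\<Sum>k<N. ennreal (v k) * indicator {\<tau> k<..\<tau> (Suc k)} s)" for s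
  proof -
    have "ennreal (\<Sum>k<N. indicator {\<tau> k<..\<tau> (Suc k)} s *\<^sub>R v k) = (\<Sum>k<N. ennreal (indicator {\<tau> k<..\<tau> (Suc k)} s *\<^sub>R v k))"
      using v by (intro sum_ennreal[symmetric]) auto
    also have "\<dots> = (\<Sum>k<N. ennreal (v k) * indicator {\<tau> k<..\<tau> (Suc k)} s)"
      by (intro sum.cong refl) (auto simp: indicator_def)
    finally show ?thesis .
  qed
  then have "(\<integral>\<^sup>+s. ennreal (\<Sum>k<N. indicator {\<tau> k<..\<tau> (Suc k)} s *\<^sub>R v k) \<partial>lborel)
    = (\<integral>\<^sup>+s. (\<Sum>k<N. ennreal (v k) * indicator {\<tau> k<..\<tau> (Suc k)} s) \<partial>lborel)"
    by simp
  also have "\<dots> = (\<Sum>k<N. \<integral>\<^sup>+s. ennreal (v k) * indicator {\<tau> k<..\<tau> (Suc k)} s \<partial>lborel)"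
    by (rule nn_integral_sum) auto
  also have "\<dots> = (\<Sum>k<N. ennreal ((\<tau> (Suc k) - \<tau> k) * v k))"
    using mono v by (intro sum.cong) (auto simp: nn_integral_cmult ennreal_mult mult.commute)
  also have "\<dots> = ennreal (\<Sum>k<N. (\<tau> (Suc k) - \<tau> k) * v k)"
    using mono v by (intro sum_ennreal) auto
  finally show ?thesis .
qed

text \<open>
  The function is truncated to a ball, and a truncated function is almost everywhere the limit of
  continuous functions.  Projecting these to the ball keeps them continuous and makes dominated
  convergence applicable.
\<close>

lemma continuous_L2_approx:
  fixes f :: "real \<Rightarrow> 'b::euclidean_space"
  assumes f[measurable]: "f \<in> borel_measurable borel"
    and fin: "(\<integral>\<^sup>+s\<in>{0..t}. ennreal ((norm (f s))\<^sup>2) \<partial>lborel) < \<infinity>" and "0 < e"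
  shows "\<exists>g. continuous_on UNIV g \<and> (\<integral>\<^sup>+s\<in>{0..t}. ennreal ((norm (g s - f s))\<^sup>2) \<partial>lborel) \<le> ennreal e"
proof -
  define h where "h = (\<lambda>(R::nat) s. if norm (f s) \<le> real R then f s else 0)"
  have hm[measurable]: "h R \<in> borel_measurable borel" for R unfolding h_def by measurable
  have "(\<lambda>R. \<integral>\<^sup>+s\<in>{0..t}. ennreal ((norm (h R s - f s))\<^sup>2) \<partial>lborel) \<longlonglongrightarrow> (\<integral>\<^sup>+(s::real). 0 \<partial>lborel)"
  proof (rule nn_integral_dominated_convergence[where w = "\<lambda>s. ennreal ((norm (f s))\<^sup>2) * indicator {0..t} s"])
    show "AE s in lborel. ennreal ((norm (h R s - f s))\<^sup>2) * indicator {0..t} s \<le> ennreal ((norm (f s))\<^sup>2) * indicator {0..t} s" for R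
      by (intro AE_I2 mult_right_mono ennreal_leI power_mono) (auto simp: h_def)
    show "AE s in lborel. (\<lambda>R. ennreal ((norm (h R s - f s))\<^sup>2) * indicator {0..t} s) \<longlonglongrightarrow> 0"
    proof (rule AE_I2)
      fix s
      obtain R0 :: nat where "norm (f s) \<le> real R0" using real_arch_simple by blast
      then have "eventually (\<lambda>R. ennreal ((norm (h R s - f s))\<^sup>2) * indicator {0..t} s = 0) sequentially"
        by (intro eventually_sequentiallyI[of R0]) (auto simp: h_def)
      then show "(\<lambda>R. ennreal ((norm (h R s - f s))\<^sup>2) * indicator {0..t} s) \<longlonglongrightarrow> 0"
        by (rule tendsto_eventually)
    qed
  qed (use fin in auto)
  then have "eventually (\<lambda>R. (\<integral>\<^sup>+s\<in>{0..t}. ennreal ((norm (h R s - f s))\<^sup>2) \<partial>lborel) < ennreal (e / 4)) sequentially"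
    using \<open>0 < e\<close> by (intro order_tendstoD) auto
  then obtain R where R: "(\<integral>\<^sup>+s\<in>{0..t}. ennreal ((norm (h R s - f s))\<^sup>2) \<partial>lborel) < ennreal (e / 4)"
    by (auto simp: eventually_sequentially)
  have "h R measurable_on UNIV"
    by (rule lebesgue_measurable_imp_measurable_on) (auto intro: measurable_completion)
  then obtain N g where N: "negligible N" and g: "\<And>n. continuous_on UNIV (g n)"
    and lim: "\<And>s. s \<notin> N \<Longrightarrow> (\<lambda>n. g n s) \<longlonglongrightarrow> h R s"
    unfolding measurable_on_def by auto
  define p where "p = closest_point (cball (0::'b) (real R))"
  have pc: "continuous_on UNIV p"
    unfolding p_def by (intro continuous_on_closest_point) auto
  have pn: "norm (p x) \<le> real R" for x
    using closest_point_in_set[of "cball (0::'b) (real R)" x] by (auto simp: p_def)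
  have ph: "p (h R s) = h R s" for s
    unfolding p_def by (rule closest_point_self) (simp add: h_def)
  have pg: "continuous_on UNIV (\<lambda>s. p (g n s))" for n
    using continuous_on_compose2[OF pc g] by auto
  have pgm[measurable]: "(\<lambda>s. p (g n s)) \<in> borel_measurable borel" for n
    by (rule borel_measurable_continuous_onI[OF pg])
  have "AE s in lebesgue. s \<notin> N"
    using N by (intro AE_not_in) (simp add: negligible_iff_null_sets)
  then have aeN: "AE s in lborel. s \<notin> N" by (simp add: AE_completion_iff)
  have "(\<lambda>n. \<integral>\<^sup>+s\<in>{0..t}. ennreal ((norm (p (g n s) - h R s))\<^sup>2) \<partial>lborel) \<longlonglongrightarrow> (\<integral>\<^sup>+(s::real). 0 \<partial>lborel)"
  proof (rule nn_integral_dominated_convergence[where w = "\<lambda>s. ennreal ((2 * real R)\<^sup>2) * indicator {0..t} s"])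
    have "norm (p (g n s) - h R s) \<le> 2 * real R" for n s
      using norm_triangle_ineq4[of "p (g n s)" "h R s"] pn[of "g n s"] pn[of "h R s"] ph[of s] by simp
    then show "AE s in lborel. ennreal ((norm (p (g n s) - h R s))\<^sup>2) * indicator {0..t} s \<le> ennreal ((2 * real R)\<^sup>2) * indicator {0..t} s" for n
      by (intro AE_I2 mult_right_mono ennreal_leI power_mono) auto
    show "(\<integral>\<^sup>+s. ennreal ((2 * real R)\<^sup>2) * indicator {0..t} s \<partial>lborel) < \<infinity>"
      by (simp add: nn_integral_cmult ennreal_mult_less_top emeasure_lborel_Icc_eq)
    show "AE s in lborel. (\<lambda>n. ennreal ((norm (p (g n s) - h R s))\<^sup>2) * indicator {0..t} s) \<longlonglongrightarrow> 0"
      using aeN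
    proof eventually_elim
      case (elim s)
      have "(\<lambda>n. p (g n s)) \<longlonglongrightarrow> p (h R s)"
        by (rule continuous_on_tendsto_compose[OF pc lim[OF elim]]) auto
      then have "(\<lambda>n. (norm (p (g n s) - h R s))\<^sup>2) \<longlonglongrightarrow> (norm (p (h R s) - h R s))\<^sup>2"
        by (intro tendsto_intros)
      then have "(\<lambda>n. ennreal ((norm (p (g n s) - h R s))\<^sup>2)) \<longlonglongrightarrow> ennreal 0"
        by (intro tendsto_ennrealI) (simp add: ph)
      then show ?case by (auto simp: indicator_def)
    qed
  qed auto
  then have "eventually (\<lambda>n. (\<integral>\<^sup>+s\<in>{0..t}. ennreal ((norm (p (g n s) - h R s))\<^sup>2) \<partial>lborel) < ennreal (e / 4)) sequentially"
    using \<open>0 < e\<close> by (intro order_tendstoD) auto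
  then obtain n where n: "(\<integral>\<^sup>+s\<in>{0..t}. ennreal ((norm (p (g n s) - h R s))\<^sup>2) \<partial>lborel) < ennreal (e / 4)"
    by (auto simp: eventually_sequentially)
  have "(\<integral>\<^sup>+s\<in>{0..t}. ennreal ((norm (p (g n s) - f s))\<^sup>2) \<partial>lborel) \<le>
    (\<integral>\<^sup>+s. 2 * (ennreal ((norm (p (g n s) - h R s))\<^sup>2) * indicator {0..t} s + ennreal ((norm (h R s - f s))\<^sup>2) * indicator {0..t} s) \<partial>lborel)"
  proof (rule nn_integral_mono)
    fix s
    have "norm (p (g n s) - f s) \<le> norm (p (g n s) - h R s) + norm (h R s - f s)"
      using norm_triangle_ineq[of "p (g n s) - h R s" "h R s - f s"] by simp
    then have "(norm (p (g n s) - f s))\<^sup>2 \<le> 2 * ((norm (p (g n s) - h R s))\<^sup>2 + (norm (h R s - f s))\<^sup>2)"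
      by (intro order_trans[OF power_mono sum2_power2_le]) auto
    then have "ennreal ((norm (p (g n s) - f s))\<^sup>2) \<le> ennreal (2 * ((norm (p (g n s) - h R s))\<^sup>2 + (norm (h R s - f s))\<^sup>2))"
      by (rule ennreal_leI)
    then show "ennreal ((norm (p (g n s) - f s))\<^sup>2) * indicator {0..t} s \<le>
        2 * (ennreal ((norm (p (g n s) - h R s))\<^sup>2) * indicator {0..t} s + ennreal ((norm (h R s - f s))\<^sup>2) * indicator {0..t} s)"
      by (auto simp: indicator_def ennreal_mult)
  qed
  also have "\<dots> = 2 * ((\<integral>\<^sup>+s\<in>{0..t}. ennreal ((norm (p (g n s) - h R s))\<^sup>2) \<partial>lborel) + (\<integral>\<^sup>+s\<in>{0..t}. ennreal ((norm (h R s - f s))\<^sup>2) \<partial>lborel))"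
    by (simp add: nn_integral_cmult nn_integral_add)
  also have "\<dots> \<le> 2 * (ennreal (e / 4) + ennreal (e / 4))"
    using n R by (intro mult_left_mono add_mono) auto
  also have "\<dots> = ennreal 2 * ennreal (e / 4 + e / 4)"
    using \<open>0 < e\<close> by (subst ennreal_plus) auto
  also have "\<dots> = ennreal e"
    using \<open>0 < e\<close> by (subst ennreal_mult[symmetric]) auto
  finally show ?thesis using pg by (intro exI[of _ "\<lambda>s. p (g n s)"]) simp
qed

context brownian
begin

text \<open>
  The form of the tail bound that makes integrals of approximating sequences Cauchy in probability.
\<close>

lemma simple_integral_diff_prob_bound:
  fixes \<xi>1 \<xi>2 :: "nat \<Rightarrow> 'a \<Rightarrow> real ^ 'm ^ 'd::finite"
  assumes S1: "simple_integrand P F t N1 \<tau>1 \<xi>1" and S2: "simple_integrand P F t N2 \<tau>2 \<xi>2"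
    and H: "(\<lambda>(u, \<omega>). H u \<omega>) \<in> borel_measurable (restrict_space borel {0..t} \<Otimes>\<^sub>M F t)"
    and "t \<le> T" "0 < \<epsilon>" "0 < \<delta>"
  shows "measure P {\<omega> \<in> space P. \<epsilon> < norm (simple_ito_integral W N1 \<tau>1 \<xi>1 \<omega> - simple_ito_integral W N2 \<tau>2 \<xi>2 \<omega>)}
    \<le> ito_const (CARD('d) * CARD('m)) 1 * \<delta> / \<epsilon>\<^sup>2
      + measure P {\<omega> \<in> space P. ennreal (\<delta> / 4) < (\<integral>\<^sup>+s\<in>{0..t}. ennreal ((norm (simple_process N1 \<tau>1 \<xi>1 s \<omega> - H s \<omega>))\<^sup>2) \<partial>lborel)}
      + measure P {\<omega> \<in> space P. ennreal (\<delta> / 4) < (\<integral>\<^sup>+s\<in>{0..t}. ennreal ((norm (simple_process N2 \<tau>2 \<xi>2 s \<omega> - H s \<omega>))\<^sup>2) \<partial>lborel)}"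
    (is "_ \<le> _ + measure P ?D1 + measure P ?D2")
proof -
  obtain N \<tau> \<xi> where S: "simple_integrand P F t N \<tau> (\<xi> :: nat \<Rightarrow> 'a \<Rightarrow> real ^ 'm ^ 'd)"
    and p: "\<And>s \<omega>. simple_process N \<tau> \<xi> s \<omega> = simple_process N1 \<tau>1 \<xi>1 s \<omega> - simple_process N2 \<tau>2 \<xi>2 s \<omega>"
    and i: "\<And>\<omega>. simple_ito_integral W N \<tau> \<xi> \<omega> = simple_ito_integral W N1 \<tau>1 \<xi>1 \<omega> - simple_ito_integral W N2 \<tau>2 \<xi>2 \<omega>"
    using simple_integrand_diff[OF S1 S2] by blast
  let ?e = "\<lambda>\<omega>. \<Sum>j<N. (\<tau> (Suc j) - \<tau> j) * (norm (\<xi> j \<omega>))\<^sup>2"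
  let ?E = "{\<omega> \<in> space P. \<epsilon> < norm (simple_ito_integral W N \<tau> \<xi> \<omega>) \<and> ?e \<omega> \<le> \<delta>}"
  have \<xi>m: "\<xi> j \<in> borel_measurable P" if "j < N" for j
    using measurable_F_P[OF simple_integrand_measurable_F[OF S that]] .
  have em: "?e \<in> borel_measurable P"
    by (intro borel_measurable_sum borel_measurable_times borel_measurable_power borel_measurable_norm)
      (auto intro!: measurable_compose[OF \<xi>m borel_measurable_norm])
  have Em: "?E \<in> sets P"
    using measurable_F_P[OF simple_ito_integral_measurable[OF S \<open>t \<le> T\<close>]] em by measurable
  have Dm: "?D1 \<in> sets P" "?D2 \<in> sets P"
    using l2_distance_measurable[OF S1 H] l2_distance_measurable[OF S2 H] by measurable
  have small: "?e \<omega> \<le> \<delta>" if sp: "\<omega> \<in> space P" and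
      d1: "(\<integral>\<^sup>+s\<in>{0..t}. ennreal ((norm (simple_process N1 \<tau>1 \<xi>1 s \<omega> - H s \<omega>))\<^sup>2) \<partial>lborel) \<le> ennreal (\<delta> / 4)" and
      d2: "(\<integral>\<^sup>+s\<in>{0..t}. ennreal ((norm (simple_process N2 \<tau>2 \<xi>2 s \<omega> - H s \<omega>))\<^sup>2) \<partial>lborel) \<le> ennreal (\<delta> / 4)" for \<omega>
  proof -
    let ?f1 = "\<lambda>s. simple_process N1 \<tau>1 \<xi>1 s \<omega> - H s \<omega>"
    let ?f2 = "\<lambda>s. simple_process N2 \<tau>2 \<xi>2 s \<omega> - H s \<omega>"
    have sp': "\<omega> \<in> space (F t)" using sp by simp
    have fm: "?f1 \<in> borel_measurable (lebesgue_upto t)" "?f2 \<in> borel_measurable (lebesgue_upto t)"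
      using measurable_pair_section[OF simple_process_measurable[OF S1, unfolded measurable_lebesgue_upto_pair] sp']
        measurable_pair_section[OF simple_process_measurable[OF S2, unfolded measurable_lebesgue_upto_pair] sp']
        measurable_pair_section[OF H[unfolded measurable_lebesgue_upto_pair] sp']
      by measurable
    have "ennreal (?e \<omega>) = (\<integral>\<^sup>+s. ennreal ((norm (simple_process N \<tau> \<xi> s \<omega>))\<^sup>2) \<partial>lebesgue_upto t)"
      using simple_process_energy[of N \<tau> t \<xi> \<omega>] simple_integrandD(1-3)[OF S]
      by (simp add: nn_integral_lebesgue_upto)
    also have "\<dots> \<le> (\<integral>\<^sup>+s. 2 * (ennreal ((norm (?f1 s))\<^sup>2) + ennreal ((norm (?f2 s))\<^sup>2)) \<partial>lebesgue_upto t)"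
    proof (rule nn_integral_mono)
      fix s
      have sf: "simple_process N \<tau> \<xi> s \<omega> = ?f1 s - ?f2 s" by (simp add: p)
      have "norm (simple_process N \<tau> \<xi> s \<omega>) \<le> norm (?f1 s) + norm (?f2 s)"
        unfolding sf by (rule norm_triangle_ineq4)
      then have "(norm (simple_process N \<tau> \<xi> s \<omega>))\<^sup>2 \<le> 2 * ((norm (?f1 s))\<^sup>2 + (norm (?f2 s))\<^sup>2)"
        by (intro order_trans[OF power_mono sum2_power2_le]) auto
      then have "ennreal ((norm (simple_process N \<tau> \<xi> s \<omega>))\<^sup>2) \<le> ennreal (2 * ((norm (?f1 s))\<^sup>2 + (norm (?f2 s))\<^sup>2))"
        by (rule ennreal_leI)
      then show "ennreal ((norm (simple_process N \<tau> \<xi> s \<omega>))\<^sup>2) \<le> 2 * (ennreal ((norm (?f1 s))\<^sup>2) + ennreal ((norm (?f2 s))\<^sup>2))"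
        by (simp add: ennreal_mult)
    qed
    also have "\<dots> = 2 * ((\<integral>\<^sup>+s\<in>{0..t}. ennreal ((norm (?f1 s))\<^sup>2) \<partial>lborel) + (\<integral>\<^sup>+s\<in>{0..t}. ennreal ((norm (?f2 s))\<^sup>2) \<partial>lborel))"
      unfolding nn_integral_lebesgue_upto using fm by (simp add: nn_integral_cmult nn_integral_add)
    also have "\<dots> \<le> 2 * (ennreal (\<delta> / 4) + ennreal (\<delta> / 4))"
      using d1 d2 by (intro mult_left_mono add_mono) auto
    also have "\<dots> = ennreal 2 * ennreal (\<delta> / 4 + \<delta> / 4)"
      using \<open>0 < \<delta>\<close> by (subst ennreal_plus) auto
    also have "\<dots> = ennreal \<delta>"
      using \<open>0 < \<delta>\<close> by (subst ennreal_mult[symmetric]) auto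
    finally show ?thesis using \<open>0 < \<delta>\<close> by (simp add: ennreal_le_iff)
  qed
  have "{\<omega> \<in> space P. \<epsilon> < norm (simple_ito_integral W N1 \<tau>1 \<xi>1 \<omega> - simple_ito_integral W N2 \<tau>2 \<xi>2 \<omega>)} \<subseteq> ?E \<union> ?D1 \<union> ?D2"
    using small by (fastforce simp: i not_less)
  then have "measure P {\<omega> \<in> space P. \<epsilon> < norm (simple_ito_integral W N1 \<tau>1 \<xi>1 \<omega> - simple_ito_integral W N2 \<tau>2 \<xi>2 \<omega>)} \<le> measure P (?E \<union> ?D1 \<union> ?D2)"
    using Em Dm by (intro P.finite_measure_mono) auto
  also have "\<dots> \<le> measure P ?E + measure P ?D1 + measure P ?D2"
    using Em Dm by (intro order_trans[OF measure_Un_le] add_mono order_refl) auto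
  finally show ?thesis
    using simple_integral_prob_bound[OF S \<open>t \<le> T\<close> \<open>0 < \<epsilon>\<close>, of \<delta>] \<open>0 < \<delta>\<close> by simp
qed

end

lemma AE_lebesgue_upto: "AE u in lebesgue_upto t. 0 < u \<and> u \<le> t"
  by (subst AE_restrict_space_iff)
     (use AE_lborel_singleton[of 0] in \<open>auto elim!: eventually_mono\<close>)

lemma measurable_lebesgue_upto:
  "f \<in> measurable borel R \<Longrightarrow> f \<in> measurable (lebesgue_upto t) R"
  by (rule measurable_restrict_space1) simp

context brownian
begin

lemma left_adapted_bounded:
  assumes "left_adapted \<eta>" "\<omega> \<in> space M"
  obtains B where "0 \<le> B" "\<And>u. u \<in> {0..T} \<Longrightarrow> norm (\<eta> u \<omega>) \<le> B"
proof -
  obtain B where B: "\<forall>u\<in>{0..T}. norm (\<eta> u \<omega>) \<le> B"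
    using assms unfolding left_adapted_def by blast
  show ?thesis
  proof (rule that[of "max 0 B"])
    fix u assume "u \<in> {0..T}"
    then show "norm (\<eta> u \<omega>) \<le> max 0 B" by (rule max.coboundedI2[OF bspec[OF B]])
  qed simp
qed

lemma left_adapted_path_measurable:
  assumes "left_adapted \<eta>" "0 \<le> t" "t \<le> T" "\<omega> \<in> space M"
  shows "(\<lambda>u. \<eta> u \<omega>) \<in> borel_measurable (lebesgue_upto t)"
proof -
  have "(\<lambda>(u, \<omega>). \<eta> u \<omega>) \<in> borel_measurable (restrict_space borel {0..t} \<Otimes>\<^sub>M F t)"
    using left_adapted_progressive[OF assms(1,3)] assms(2) by (auto simp: progressively_measurable_def)
  from measurable_pair_section[OF this[unfolded measurable_lebesgue_upto_pair]] assms(4)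
  show ?thesis by simp
qed

lemma kernel_times_left_adapted_integrand:
  fixes \<kappa> :: "real \<Rightarrow> real ^ 'd::finite ^ 'd" and \<eta> :: "real \<Rightarrow> 'a \<Rightarrow> real ^ 'm ^ 'd"
  assumes \<kappa>[measurable]: "\<kappa> \<in> borel_measurable borel"
    and fin: "(\<integral>\<^sup>+s\<in>{0..t}. ennreal ((norm (\<kappa> s))\<^sup>2) \<partial>lborel) < \<infinity>"
    and \<eta>: "left_adapted \<eta>" and t: "0 \<le> t" "t \<le> T"
  shows "ito_integrand P F t (\<lambda>s \<omega>. \<kappa> s ** \<eta> s \<omega>)"
  unfolding ito_integrand_def
proof
  show "progressively_measurable F t (\<lambda>s \<omega>. \<kappa> s ** \<eta> s \<omega>)"
    unfolding progressively_measurable_def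
  proof
    fix s assume s: "s \<in> {0..t}"
    have "(\<lambda>(u, \<omega>). \<eta> u \<omega>) \<in> borel_measurable (restrict_space borel {0..s} \<Otimes>\<^sub>M F s)"
      using left_adapted_progressive[OF \<eta> t(2)] s by (auto simp: progressively_measurable_def)
    then have "(\<lambda>x. \<eta> (fst x) (snd x)) \<in> borel_measurable (restrict_space borel {0..s} \<Otimes>\<^sub>M F s)"
      by (simp add: case_prod_beta)
    moreover have "(\<lambda>x. \<kappa> (fst x)) \<in> borel_measurable (restrict_space borel {0..s} \<Otimes>\<^sub>M F s)"
      by (rule measurable_compose[OF measurable_fst measurable_restrict_space1[OF \<kappa>]])
    ultimately show "(\<lambda>(u, \<omega>). \<kappa> u ** \<eta> u \<omega>) \<in> borel_measurable (restrict_space borel {0..s} \<Otimes>\<^sub>M F s)"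
      unfolding case_prod_beta by measurable
  qed
  show "AE \<omega> in P. (\<integral>\<^sup>+s\<in>{0..t}. ennreal ((norm (\<kappa> s ** \<eta> s \<omega>))\<^sup>2) \<partial>lborel) < \<infinity>"
  proof (rule AE_I2)
    fix \<omega> assume "\<omega> \<in> space P"
    then obtain B where B: "0 \<le> B" "\<And>u. u \<in> {0..T} \<Longrightarrow> norm (\<eta> u \<omega>) \<le> B"
      using left_adapted_bounded[OF \<eta>] by auto
    have "(\<integral>\<^sup>+s\<in>{0..t}. ennreal ((norm (\<kappa> s ** \<eta> s \<omega>))\<^sup>2) \<partial>lborel)
      \<le> (\<integral>\<^sup>+s. ennreal (B\<^sup>2) * (ennreal ((norm (\<kappa> s))\<^sup>2) * indicator {0..t} s) \<partial>lborel)"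
    proof (rule nn_integral_mono)
      fix s
      show "ennreal ((norm (\<kappa> s ** \<eta> s \<omega>))\<^sup>2) * indicator {0..t} s \<le> ennreal (B\<^sup>2) * (ennreal ((norm (\<kappa> s))\<^sup>2) * indicator {0..t} s)"
      proof (cases "s \<in> {0..t}")
        case True
        then have "norm (\<kappa> s ** \<eta> s \<omega>) \<le> norm (\<kappa> s) * B"
          using t by (intro order_trans[OF norm_matrix_matrix_mult_le] mult_left_mono B(2)) auto
        then have "(norm (\<kappa> s ** \<eta> s \<omega>))\<^sup>2 \<le> B\<^sup>2 * (norm (\<kappa> s))\<^sup>2"
          using power_mono[of "norm (\<kappa> s ** \<eta> s \<omega>)" "norm (\<kappa> s) * B" 2] by (simp add: power_mult_distrib mult.commute)
        then show ?thesis using True by (simp add: ennreal_mult[symmetric] ennreal_leI)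
      qed simp
    qed
    also have "\<dots> = ennreal (B\<^sup>2) * (\<integral>\<^sup>+s\<in>{0..t}. ennreal ((norm (\<kappa> s))\<^sup>2) \<partial>lborel)"
      by (intro nn_integral_cmult) measurable
    also have "\<dots> < \<infinity>" using fin by (simp add: ennreal_mult_less_top)
    finally show "(\<integral>\<^sup>+s\<in>{0..t}. ennreal ((norm (\<kappa> s ** \<eta> s \<omega>))\<^sup>2) \<partial>lborel) < \<infinity>" .
  qed
qed

text \<open>
  The kernel is approximated in \<open>L\<^sup>2\<close> by continuous functions, the left-continuous factor by its
  values at the left end points of a grid.  In the moment bound \<open>g\<close> increases, so its value at a left
  end point is below its values on the cell, and the Riemann sum of the weighted kernel is
  controlled by the integral.  The factor 3 comes from splitting the continuous kernel at the left end
  point into its oscillation on the cell, the approximation error and \<open>\<kappa>\<close>.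
\<close>

lemma grid_approximation:
  fixes \<kappa> :: "real \<Rightarrow> real ^ 'd::finite ^ 'd" and \<eta> :: "real \<Rightarrow> 'a \<Rightarrow> real ^ 'm ^ 'd"
  assumes \<kappa>[measurable]: "\<kappa> \<in> borel_measurable borel"
    and fin: "(\<integral>\<^sup>+s\<in>{0..t}. ennreal ((norm (\<kappa> s))\<^sup>2) \<partial>lborel) < \<infinity>"
    and \<eta>: "left_adapted \<eta>" and t: "0 \<le> t" "t \<le> T"
  obtains N :: "nat \<Rightarrow> nat" and \<tau> and \<xi> :: "nat \<Rightarrow> nat \<Rightarrow> 'a \<Rightarrow> real ^ 'm ^ 'd" where
    "\<And>k. simple_integrand P F t (N k) (\<tau> k) (\<xi> k)"
    "\<And>\<omega>. \<omega> \<in> space M \<Longrightarrow> (\<lambda>k. \<integral>\<^sup>+s\<in>{0..t}. ennreal ((norm (simple_process (N k) (\<tau> k) (\<xi> k) s \<omega> - \<kappa> s ** \<eta> s \<omega>))\<^sup>2) \<partial>lborel) \<longlonglongrightarrow> 0"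
    "\<And>k n g V. 1 \<le> n \<Longrightarrow> mono_on {0..t} g \<Longrightarrow>
       (\<And>u. u \<in> {0..t} \<Longrightarrow> 0 \<le> g u \<and> (\<integral>\<^sup>+\<omega>. ennreal (norm (\<eta> u \<omega>) ^ (2 * n)) \<partial>P) \<le> ennreal (g u ^ n)) \<Longrightarrow>
       0 \<le> V \<Longrightarrow> (\<integral>\<^sup>+u\<in>{0..t}. ennreal ((norm (\<kappa> u))\<^sup>2 * g u) \<partial>lborel) \<le> ennreal V \<Longrightarrow>
       (\<integral>\<^sup>+\<omega>. ennreal (norm (simple_ito_integral W (N k) (\<tau> k) (\<xi> k) \<omega>) ^ (2 * n)) \<partial>P)
         \<le> ennreal ((ito_const (CARD('d) * CARD('m)) n * (3 * (inverse (real (Suc k)) * (g t * (t + 1)) + V))) ^ n)"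
proof -
  define e where "e = (\<lambda>k::nat. inverse (real (Suc k)))"
  have e0: "0 < e k" and e1: "e k \<le> 1" for k by (simp_all add: e_def divide_simps)
  have e_lim: "e \<longlonglongrightarrow> 0" unfolding e_def by (rule LIMSEQ_inverse_real_of_nat)
  have "\<exists>f. continuous_on UNIV f \<and> (\<integral>\<^sup>+s\<in>{0..t}. ennreal ((norm (f s - \<kappa> s))\<^sup>2) \<partial>lborel) \<le> ennreal (e k)" for k
    by (rule continuous_L2_approx[OF \<kappa> fin e0])
  then have "\<forall>k. \<exists>f. continuous_on UNIV f \<and> (\<integral>\<^sup>+s\<in>{0..t}. ennreal ((norm (f s - \<kappa> s))\<^sup>2) \<partial>lborel) \<le> ennreal (e k)" by blast
  from choice[OF this] obtain f where fc: "\<And>k. continuous_on UNIV (f k)"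
    and fk: "\<And>k. (\<integral>\<^sup>+s\<in>{0..t}. ennreal ((norm (f k s - \<kappa> s))\<^sup>2) \<partial>lborel) \<le> ennreal (e k)"
    by blast
  have [measurable]: "f k \<in> borel_measurable borel" for k
    by (rule borel_measurable_continuous_onI[OF fc])
  have "\<exists>n. Suc k \<le> n \<and> (\<forall>x\<in>{0..t}. \<forall>y\<in>{0..t}. \<bar>x - y\<bar> \<le> t / real n \<longrightarrow> norm (f k x - f k y) \<le> e k)" for k
  proof -
    have "uniformly_continuous_on {0..t} (f k)"
      by (rule compact_uniformly_continuous) (auto intro: continuous_on_subset[OF fc])
    then obtain d where d: "0 < d" "\<And>x y. x \<in> {0..t} \<Longrightarrow> y \<in> {0..t} \<Longrightarrow> dist y x < d \<Longrightarrow> dist (f k y) (f k x) < e k"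
      unfolding uniformly_continuous_on_def using e0[of k] by metis
    obtain n0 :: nat where n0: "t / d < real n0" using reals_Archimedean2 by blast
    define n where "n = max (Suc k) n0"
    have "t / d < real n" "0 < real n" using n0 by (auto simp: n_def)
    then have "t / real n < d" using d(1) by (simp add: field_simps)
    then show ?thesis
      using d(2) by (intro exI[of _ n]) (force simp: n_def dist_real_def dist_norm)
  qed
  then obtain N where N: "\<And>k. Suc k \<le> N k"
    and Nf: "\<And>k x y. x \<in> {0..t} \<Longrightarrow> y \<in> {0..t} \<Longrightarrow> \<bar>x - y\<bar> \<le> t / real (N k) \<Longrightarrow> norm (f k x - f k y) \<le> e k"
    by metis
  have N0: "0 < real (N k)" for k using N[of k] by simp
  define \<tau> where "\<tau> = (\<lambda>k j. t * real j / real (N k))"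
  \<comment> \<open>Values of norm above \<open>k\<close> are dropped because simple integrands are bounded; on a given path this
    changes nothing once \<open>k\<close> exceeds the bound of the path.\<close>
  define \<xi> where "\<xi> = (\<lambda>k j \<omega>. f k (\<tau> k j) ** (if norm (\<eta> (\<tau> k j) \<omega>) \<le> real k then \<eta> (\<tau> k j) \<omega> else 0))"
  have \<tau>0: "\<tau> k 0 = 0" and \<tau>N: "\<tau> k (N k) = t" for k
    using N0[of k] by (auto simp: \<tau>_def)
  have \<tau>_mono: "\<tau> k j \<le> \<tau> k (Suc j)" for k j
    using t N0[of k] by (auto simp: \<tau>_def intro!: divide_right_mono mult_left_mono)
  have \<tau>_width: "\<tau> k (Suc j) = \<tau> k j + t / real (N k)" for k j
    by (simp add: \<tau>_def add_divide_distrib distrib_left)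
  have \<tau>_range: "\<tau> k j \<in> {0..t}" if "j \<le> N k" for k j
  proof -
    have "real j / real (N k) \<le> 1" using that N0[of k] by simp
    then have "t * (real j / real (N k)) \<le> t * 1" using t(1) by (rule mult_left_mono)
    then show ?thesis using t by (auto simp: \<tau>_def)
  qed
  have S: "simple_integrand P F t (N k) (\<tau> k) (\<xi> k)" for k
    unfolding simple_integrand_def
  proof (intro conjI allI impI \<tau>0 \<tau>N \<tau>_mono)
    fix j assume j: "j < N k"
    have "\<eta> (\<tau> k j) \<in> borel_measurable (F (\<tau> k j))"
      using \<eta> \<tau>_range[of j k] j t by (auto simp: left_adapted_def)
    then show "\<xi> k j \<in> borel_measurable (F (\<tau> k j))"
      unfolding \<xi>_def by measurable
    have "norm (\<xi> k j \<omega>) \<le> norm (f k (\<tau> k j)) * real k" for \<omega>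
      unfolding \<xi>_def by (intro order_trans[OF norm_matrix_matrix_mult_le] mult_left_mono) auto
    then show "\<exists>B. \<forall>\<omega>\<in>space P. norm (\<xi> k j \<omega>) \<le> B" by blast
  qed
  have cell: "\<exists>j<N k. \<tau> k j < u \<and> u \<le> \<tau> k (Suc j)" if "0 < u" "u \<le> t" for k u
    by (rule partition_cell_exists) (use that \<tau>0 \<tau>N in auto)
  have dlim: "(\<lambda>k. \<integral>\<^sup>+s\<in>{0..t}. ennreal ((norm (simple_process (N k) (\<tau> k) (\<xi> k) s \<omega> - \<kappa> s ** \<eta> s \<omega>))\<^sup>2) \<partial>lborel) \<longlonglongrightarrow> 0"
    if \<omega>: "\<omega> \<in> space M" for \<omega>
  proof -
    obtain B where B: "0 \<le> B" "\<And>u. u \<in> {0..T} \<Longrightarrow> norm (\<eta> u \<omega>) \<le> B"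
      using left_adapted_bounded[OF \<eta> \<omega>] by auto
    define s where "s = (\<lambda>k u. \<Sum>j<N k. indicator {\<tau> k j<..\<tau> k (Suc j)} u *\<^sub>R \<eta> (\<tau> k j) \<omega>)"
    have s_cell: "s k u = \<eta> (\<tau> k j) \<omega>" if "j < N k" "\<tau> k j < u" "u \<le> \<tau> k (Suc j)" for k u j
      unfolding s_def using \<tau>_mono that by (rule sum_partition_cell)
    have sm: "s k \<in> borel_measurable (lebesgue_upto t)" for k
      unfolding s_def by (intro measurable_lebesgue_upto borel_measurable_sum borel_measurable_scaleR) auto
    have \<eta>m: "(\<lambda>u. \<eta> u \<omega>) \<in> borel_measurable (lebesgue_upto t)"
      by (rule left_adapted_path_measurable[OF \<eta> t \<omega>])
    have \<kappa>m: "\<kappa> \<in> borel_measurable (lebesgue_upto t)" "f k \<in> borel_measurable (lebesgue_upto t)" for k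
      by (auto intro!: measurable_lebesgue_upto)
    define R where "R = (\<lambda>k. \<integral>\<^sup>+u. ennreal ((norm (\<kappa> u) * norm (s k u - \<eta> u \<omega>))\<^sup>2) \<partial>lebesgue_upto t)"
    have R: "R \<longlonglongrightarrow> (\<integral>\<^sup>+(u::real). 0 \<partial>lebesgue_upto t)"
      unfolding R_def
    proof (rule nn_integral_dominated_convergence[where w = "\<lambda>u. ennreal ((2 * B)\<^sup>2) * ennreal ((norm (\<kappa> u))\<^sup>2)"])
      show "AE u in lebesgue_upto t. ennreal ((norm (\<kappa> u) * norm (s k u - \<eta> u \<omega>))\<^sup>2) \<le> ennreal ((2 * B)\<^sup>2) * ennreal ((norm (\<kappa> u))\<^sup>2)" for k
        using AE_lebesgue_upto
      proof eventually_elim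
        case (elim u)
        then obtain j where j: "j < N k" "\<tau> k j < u" "u \<le> \<tau> k (Suc j)" using cell by blast
        have "norm (s k u - \<eta> u \<omega>) \<le> norm (\<eta> (\<tau> k j) \<omega>) + norm (\<eta> u \<omega>)"
          unfolding s_cell[OF j] by (rule norm_triangle_ineq4)
        also have "\<dots> \<le> B + B" using \<tau>_range[of j k] j elim t by (intro add_mono B) auto
        finally have "norm (\<kappa> u) * norm (s k u - \<eta> u \<omega>) \<le> norm (\<kappa> u) * (2 * B)"
          by (intro mult_left_mono) auto
        then have "(norm (\<kappa> u) * norm (s k u - \<eta> u \<omega>))\<^sup>2 \<le> (norm (\<kappa> u) * (2 * B))\<^sup>2"
          by (intro power_mono) auto
        also have "\<dots> = (2 * B)\<^sup>2 * (norm (\<kappa> u))\<^sup>2" by (simp add: power_mult_distrib mult.commute)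
        finally have "ennreal ((norm (\<kappa> u) * norm (s k u - \<eta> u \<omega>))\<^sup>2) \<le> ennreal ((2 * B)\<^sup>2 * (norm (\<kappa> u))\<^sup>2)"
          by (rule ennreal_leI)
        then show ?case by (simp add: ennreal_mult)
      qed
      show "(\<integral>\<^sup>+u. ennreal ((2 * B)\<^sup>2) * ennreal ((norm (\<kappa> u))\<^sup>2) \<partial>lebesgue_upto t) < \<infinity>"
        using fin \<kappa>m by (simp add: nn_integral_cmult nn_integral_lebesgue_upto ennreal_mult_less_top)
      show "AE u in lebesgue_upto t. (\<lambda>k. ennreal ((norm (\<kappa> u) * norm (s k u - \<eta> u \<omega>))\<^sup>2)) \<longlonglongrightarrow> 0"
        using AE_lebesgue_upto
      proof eventually_elim
        case (elim u)
        obtain j where j: "\<And>k. j k < N k" "\<And>k. \<tau> k (j k) < u" "\<And>k. u \<le> \<tau> k (Suc (j k))"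
          using cell[of u] elim by metis
        have "(\<lambda>k. \<tau> k (j k)) \<longlonglongrightarrow> u"
        proof (rule tendsto_sandwich[OF _ _ _ tendsto_const])
          have "t / real (N k) \<le> t * e k" for k
            using N[of k] t by (auto simp: e_def divide_inverse intro!: mult_left_mono le_imp_inverse_le)
          then have "u - t * e k \<le> \<tau> k (j k)" for k
            using j(3)[of k] unfolding \<tau>_width by (smt (verit))
          then show "\<forall>\<^sub>F k in sequentially. u - t * e k \<le> \<tau> k (j k)" by simp
          have "(\<lambda>k. u - t * e k) \<longlonglongrightarrow> u - t * 0" by (intro tendsto_intros e_lim)
          then show "(\<lambda>k. u - t * e k) \<longlonglongrightarrow> u" by simp
          show "\<forall>\<^sub>F k in sequentially. \<tau> k (j k) \<le> u" by (intro always_eventually allI less_imp_le j(2))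
        qed
        then have flt: "filterlim (\<lambda>k. \<tau> k (j k)) (at_left u) sequentially"
          using j(2) by (auto simp: filterlim_at intro!: always_eventually)
        have "((\<lambda>v. \<eta> v \<omega>) \<longlongrightarrow> \<eta> u \<omega>) (at_left u)"
          using \<eta> \<omega> elim t by (auto simp: left_adapted_def)
        from filterlim_compose[OF this flt] have "(\<lambda>k. s k u) \<longlonglongrightarrow> \<eta> u \<omega>"
          by (simp add: s_cell[OF j])
        then have "(\<lambda>k. (norm (\<kappa> u) * norm (s k u - \<eta> u \<omega>))\<^sup>2) \<longlonglongrightarrow> (norm (\<kappa> u) * norm (\<eta> u \<omega> - \<eta> u \<omega>))\<^sup>2"
          by (intro tendsto_intros)
        then have "(\<lambda>k. ennreal ((norm (\<kappa> u) * norm (s k u - \<eta> u \<omega>))\<^sup>2)) \<longlonglongrightarrow> ennreal ((norm (\<kappa> u) * norm (\<eta> u \<omega> - \<eta> u \<omega>))\<^sup>2)"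
          by (rule tendsto_ennrealI)
        then show ?case by simp
      qed
    qed (use sm \<eta>m \<kappa>m in measurable)
    have bound: "(\<integral>\<^sup>+u\<in>{0..t}. ennreal ((norm (simple_process (N k) (\<tau> k) (\<xi> k) u \<omega> - \<kappa> u ** \<eta> u \<omega>))\<^sup>2) \<partial>lborel)
      \<le> 3 * (ennreal ((e k * B)\<^sup>2 * t) + ennreal (B\<^sup>2 * e k) + R k)" if kB: "B \<le> real k" for k
    proof -
      have "(\<integral>\<^sup>+u. ennreal ((norm (simple_process (N k) (\<tau> k) (\<xi> k) u \<omega> - \<kappa> u ** \<eta> u \<omega>))\<^sup>2) \<partial>lebesgue_upto t)
        \<le> (\<integral>\<^sup>+u. 3 * (ennreal ((e k * B)\<^sup>2) + ennreal (B\<^sup>2) * ennreal ((norm (f k u - \<kappa> u))\<^sup>2) + ennreal ((norm (\<kappa> u) * norm (s k u - \<eta> u \<omega>))\<^sup>2)) \<partial>lebesgue_upto t)"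
      proof (rule nn_integral_mono_AE)
        show "AE u in lebesgue_upto t. ennreal ((norm (simple_process (N k) (\<tau> k) (\<xi> k) u \<omega> - \<kappa> u ** \<eta> u \<omega>))\<^sup>2)
          \<le> 3 * (ennreal ((e k * B)\<^sup>2) + ennreal (B\<^sup>2) * ennreal ((norm (f k u - \<kappa> u))\<^sup>2) + ennreal ((norm (\<kappa> u) * norm (s k u - \<eta> u \<omega>))\<^sup>2))"
          using AE_lebesgue_upto
        proof eventually_elim
          case (elim u)
          then obtain j where j: "j < N k" "\<tau> k j < u" "u \<le> \<tau> k (Suc j)" using cell by blast
          let ?x = "\<eta> (\<tau> k j) \<omega>"
          have x: "norm ?x \<le> B" using \<tau>_range[of j k] j t by (intro B) auto
          have "simple_process (N k) (\<tau> k) (\<xi> k) u \<omega> = \<xi> k j \<omega>"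
            using \<tau>_mono j by (rule simple_process_cell)
          also have "\<dots> = f k (\<tau> k j) ** ?x" using x kB by (simp add: \<xi>_def)
          finally have p: "simple_process (N k) (\<tau> k) (\<xi> k) u \<omega> - \<kappa> u ** \<eta> u \<omega> =
            (f k (\<tau> k j) - f k u) ** ?x + (f k u - \<kappa> u) ** ?x + \<kappa> u ** (s k u - \<eta> u \<omega>)"
            by (simp add: s_cell[OF j] mm.diff_left mm.diff_right)
          have a: "norm ((f k (\<tau> k j) - f k u) ** ?x) \<le> e k * B"
          proof (rule order_trans[OF norm_matrix_matrix_mult_le mult_mono])
            show "norm (f k (\<tau> k j) - f k u) \<le> e k"
              using \<tau>_range[of j k] j elim \<tau>_width[of k j] by (intro Nf) auto
          qed (use x e0[of k] in \<open>auto intro: less_imp_le\<close>)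
          have b: "norm ((f k u - \<kappa> u) ** ?x) \<le> B * norm (f k u - \<kappa> u)"
            using x by (intro order_trans[OF norm_matrix_matrix_mult_le]) (simp add: mult.commute mult_right_mono)
          have c: "norm (\<kappa> u ** (s k u - \<eta> u \<omega>)) \<le> norm (\<kappa> u) * norm (s k u - \<eta> u \<omega>)"
            by (rule norm_matrix_matrix_mult_le)
          have "norm (simple_process (N k) (\<tau> k) (\<xi> k) u \<omega> - \<kappa> u ** \<eta> u \<omega>) \<le> e k * B + B * norm (f k u - \<kappa> u) + norm (\<kappa> u) * norm (s k u - \<eta> u \<omega>)"
            unfolding p by (intro norm_triangle_le add_mono a b c)
          then have "(norm (simple_process (N k) (\<tau> k) (\<xi> k) u \<omega> - \<kappa> u ** \<eta> u \<omega>))\<^sup>2 \<le> 3 * ((e k * B)\<^sup>2 + (B * norm (f k u - \<kappa> u))\<^sup>2 + (norm (\<kappa> u) * norm (s k u - \<eta> u \<omega>))\<^sup>2)"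
            by (intro order_trans[OF power_mono sum3_power2_le]) auto
          then have "ennreal ((norm (simple_process (N k) (\<tau> k) (\<xi> k) u \<omega> - \<kappa> u ** \<eta> u \<omega>))\<^sup>2) \<le> ennreal (3 * ((e k * B)\<^sup>2 + (B * norm (f k u - \<kappa> u))\<^sup>2 + (norm (\<kappa> u) * norm (s k u - \<eta> u \<omega>))\<^sup>2))"
            by (rule ennreal_leI)
          then show ?case by (simp add: ennreal_mult power_mult_distrib)
        qed
      qed
      also have "\<dots> = 3 * (ennreal ((e k * B)\<^sup>2) * ennreal t + ennreal (B\<^sup>2) * (\<integral>\<^sup>+u. ennreal ((norm (f k u - \<kappa> u))\<^sup>2) \<partial>lebesgue_upto t) + R k)"
        unfolding R_def using sm \<eta>m \<kappa>m t
        by (simp add: nn_integral_cmult nn_integral_add emeasure_restrict_space space_restrict_space mult.assoc)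
      also have "\<dots> \<le> 3 * (ennreal ((e k * B)\<^sup>2) * ennreal t + ennreal (B\<^sup>2) * ennreal (e k) + R k)"
        using fk[of k] by (intro mult_left_mono add_mono order_refl) (auto simp: nn_integral_lebesgue_upto)
      also have "\<dots> = 3 * (ennreal ((e k * B)\<^sup>2 * t) + ennreal (B\<^sup>2 * e k) + R k)"
        using t e0[of k] by (simp add: ennreal_mult)
      finally show ?thesis by (simp add: nn_integral_lebesgue_upto)
    qed
    obtain k0 :: nat where k0: "B \<le> real k0" using real_arch_simple by blast
    show ?thesis
    proof (rule tendsto_sandwich[OF _ _ tendsto_const])
      show "\<forall>\<^sub>F k in sequentially. (\<integral>\<^sup>+u\<in>{0..t}. ennreal ((norm (simple_process (N k) (\<tau> k) (\<xi> k) u \<omega> - \<kappa> u ** \<eta> u \<omega>))\<^sup>2) \<partial>lborel)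
        \<le> 3 * (ennreal ((e k * B)\<^sup>2 * t) + ennreal (B\<^sup>2 * e k) + R k)"
        using k0 by (intro eventually_sequentiallyI[of k0] bound) (auto intro: order_trans)
      have "(\<lambda>k. 3 * (ennreal ((e k * B)\<^sup>2 * t) + ennreal (B\<^sup>2 * e k) + R k)) \<longlonglongrightarrow> 3 * (ennreal ((0 * B)\<^sup>2 * t) + ennreal (B\<^sup>2 * 0) + (\<integral>\<^sup>+(u::real). 0 \<partial>lebesgue_upto t))"
        by (intro ennreal_tendsto_cmult tendsto_add tendsto_ennrealI tendsto_intros e_lim R) auto
      then show "(\<lambda>k. 3 * (ennreal ((e k * B)\<^sup>2 * t) + ennreal (B\<^sup>2 * e k) + R k)) \<longlonglongrightarrow> 0" by simp
    qed auto
  qed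
  have mom: "(\<integral>\<^sup>+\<omega>. ennreal (norm (simple_ito_integral W (N k) (\<tau> k) (\<xi> k) \<omega>) ^ (2 * n)) \<partial>P)
         \<le> ennreal ((ito_const (CARD('d) * CARD('m)) n * (3 * (inverse (real (Suc k)) * (g t * (t + 1)) + V))) ^ n)"
    if n: "1 \<le> n" and mono: "mono_on {0..t} g"
      and g: "\<And>u. u \<in> {0..t} \<Longrightarrow> 0 \<le> g u \<and> (\<integral>\<^sup>+\<omega>. ennreal (norm (\<eta> u \<omega>) ^ (2 * n)) \<partial>P) \<le> ennreal (g u ^ n)"
      and V: "0 \<le> V" "(\<integral>\<^sup>+u\<in>{0..t}. ennreal ((norm (\<kappa> u))\<^sup>2 * g u) \<partial>lborel) \<le> ennreal V" for k n g V
  proof -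
    define v where "v = (\<lambda>j. (norm (f k (\<tau> k j)))\<^sup>2 * g (\<tau> k j))"
    have v0: "0 \<le> v j" if "j < N k" for j using g[OF \<tau>_range[of j k]] that by (simp add: v_def)
    have \<eta>P: "\<eta> (\<tau> k j) \<in> borel_measurable P" if "j < N k" for j
      using \<eta> \<tau>_range[of j k] that t by (auto simp: left_adapted_def intro!: measurable_F_P[of _ "\<tau> k j"])
    have gt: "g u \<le> g t" if "u \<in> {0..t}" for u using mono_onD[OF mono, of u t] that by auto
    have gt0: "0 \<le> g t" using g[of t] t by auto
    have gm: "(\<lambda>u. g u) \<in> borel_measurable (lebesgue_upto t)"
    proof -
      have "g \<in> borel_measurable (restrict_space borel {0..t})"
        using mono by (rule borel_measurable_mono_on_fnc)
      moreover have "measurable (restrict_space borel {0..t}) borel = measurable (lebesgue_upto t) (borel :: real measure)"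
        by (intro measurable_cong_sets sets_restrict_space_cong) auto
      ultimately show ?thesis by simp
    qed
    have km: "\<kappa> \<in> borel_measurable (lebesgue_upto t)" "f k \<in> borel_measurable (lebesgue_upto t)"
      by (auto intro!: measurable_lebesgue_upto)
    have "(\<integral>\<^sup>+\<omega>. ennreal (norm (simple_ito_integral W (N k) (\<tau> k) (\<xi> k) \<omega>) ^ (2 * n)) \<partial>P)
      \<le> ennreal ((ito_const (CARD('d) * CARD('m)) n * (\<Sum>j<N k. (\<tau> k (Suc j) - \<tau> k j) * v j)) ^ n)"
    proof (rule simple_integral_moment[OF S t(2) n])
      fix j assume j: "j < N k"
      show "0 \<le> v j" by (rule v0[OF j])
      have "norm (\<xi> k j \<omega>) \<le> norm (f k (\<tau> k j)) * norm (\<eta> (\<tau> k j) \<omega>)" for \<omega>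
        unfolding \<xi>_def by (intro order_trans[OF norm_matrix_matrix_mult_le] mult_left_mono) auto
      then have "norm (\<xi> k j \<omega>) ^ (2 * n) \<le> norm (f k (\<tau> k j)) ^ (2 * n) * norm (\<eta> (\<tau> k j) \<omega>) ^ (2 * n)" for \<omega>
        unfolding power_mult_distrib[symmetric] by (intro power_mono) auto
      then have "(\<integral>\<^sup>+\<omega>. ennreal (norm (\<xi> k j \<omega>) ^ (2 * n)) \<partial>P) \<le> (\<integral>\<^sup>+\<omega>. ennreal (norm (f k (\<tau> k j)) ^ (2 * n)) * ennreal (norm (\<eta> (\<tau> k j) \<omega>) ^ (2 * n)) \<partial>P)"
        by (intro nn_integral_mono) (auto simp: ennreal_mult[symmetric] intro!: ennreal_leI)
      also have "\<dots> = ennreal (norm (f k (\<tau> k j)) ^ (2 * n)) * (\<integral>\<^sup>+\<omega>. ennreal (norm (\<eta> (\<tau> k j) \<omega>) ^ (2 * n)) \<partial>P)"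
        using \<eta>P[OF j] by (intro nn_integral_cmult) measurable
      also have "\<dots> \<le> ennreal (norm (f k (\<tau> k j)) ^ (2 * n)) * ennreal (g (\<tau> k j) ^ n)"
        using g[OF \<tau>_range[of j k]] j by (intro mult_left_mono) auto
      also have "\<dots> = ennreal (v j ^ n)"
        using g[OF \<tau>_range[of j k]] j by (simp add: v_def power_mult_distrib power_mult ennreal_mult)
      finally show "(\<integral>\<^sup>+\<omega>. ennreal (norm (\<xi> k j \<omega>) ^ (2 * n)) \<partial>P) \<le> ennreal (v j ^ n)" .
    qed
    also have "\<dots> \<le> ennreal ((ito_const (CARD('d) * CARD('m)) n * (3 * (e k * (g t * (t + 1)) + V))) ^ n)"
    proof (intro ennreal_leI power_mono mult_left_mono ito_const_nonneg mult_nonneg_nonneg)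
      have "ennreal (\<Sum>j<N k. (\<tau> k (Suc j) - \<tau> k j) * v j) = (\<integral>\<^sup>+u. ennreal (\<Sum>j<N k. indicator {\<tau> k j<..\<tau> k (Suc j)} u *\<^sub>R v j) \<partial>lborel)"
        by (rule nn_integral_partition_step[symmetric]) (use \<tau>_mono v0 in auto)
      also have "\<dots> = (\<integral>\<^sup>+u\<in>{0..t}. ennreal (\<Sum>j<N k. indicator {\<tau> k j<..\<tau> k (Suc j)} u *\<^sub>R v j) \<partial>lborel)"
      proof (rule nn_integral_cong)
        fix u
        show "ennreal (\<Sum>j<N k. indicator {\<tau> k j<..\<tau> k (Suc j)} u *\<^sub>R v j) = ennreal (\<Sum>j<N k. indicator {\<tau> k j<..\<tau> k (Suc j)} u *\<^sub>R v j) * indicator {0..t} u"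
        proof (cases "u \<in> {0..t}")
          case False
          then have o: "u \<le> \<tau> k 0 \<or> \<tau> k (N k) < u" using \<tau>0 \<tau>N by auto
          have "(\<Sum>j<N k. indicator {\<tau> k j<..\<tau> k (Suc j)} u *\<^sub>R v j) = 0"
            using \<tau>_mono o by (rule sum_partition_outside)
          then show ?thesis by simp
        qed simp
      qed
      also have "\<dots> = (\<integral>\<^sup>+u. ennreal (\<Sum>j<N k. indicator {\<tau> k j<..\<tau> k (Suc j)} u *\<^sub>R v j) \<partial>lebesgue_upto t)"
        by (rule nn_integral_lebesgue_upto)
      also have "\<dots> \<le> (\<integral>\<^sup>+u. 3 * (ennreal (e k * g t) + ennreal (g t) * ennreal ((norm (f k u - \<kappa> u))\<^sup>2) + ennreal ((norm (\<kappa> u))\<^sup>2 * g u)) \<partial>lebesgue_upto t)"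
      proof (rule nn_integral_mono_AE)
        show "AE u in lebesgue_upto t. ennreal (\<Sum>j<N k. indicator {\<tau> k j<..\<tau> k (Suc j)} u *\<^sub>R v j)
          \<le> 3 * (ennreal (e k * g t) + ennreal (g t) * ennreal ((norm (f k u - \<kappa> u))\<^sup>2) + ennreal ((norm (\<kappa> u))\<^sup>2 * g u))"
          using AE_lebesgue_upto
        proof eventually_elim
          case (elim u)
          then obtain j where j: "j < N k" "\<tau> k j < u" "u \<le> \<tau> k (Suc j)" using cell by blast
          have s: "(\<Sum>j<N k. indicator {\<tau> k j<..\<tau> k (Suc j)} u *\<^sub>R v j) = v j"
            using \<tau>_mono j by (rule sum_partition_cell)
          have u: "u \<in> {0..t}" using elim by auto
          have "norm (f k (\<tau> k j)) \<le> norm (f k (\<tau> k j) - f k u) + norm (f k u - \<kappa> u) + norm (\<kappa> u)"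
            using norm_triangle_ineq[of "f k (\<tau> k j) - f k u" "f k u"] norm_triangle_ineq[of "f k u - \<kappa> u" "\<kappa> u"] by simp
          also have "\<dots> \<le> e k + norm (f k u - \<kappa> u) + norm (\<kappa> u)"
            using \<tau>_range[of j k] j u \<tau>_width[of k j] by (intro add_right_mono Nf) auto
          finally have "(norm (f k (\<tau> k j)))\<^sup>2 \<le> 3 * ((e k)\<^sup>2 + (norm (f k u - \<kappa> u))\<^sup>2 + (norm (\<kappa> u))\<^sup>2)"
            by (intro order_trans[OF power_mono sum3_power2_le]) auto
          also have "(e k)\<^sup>2 \<le> e k" using e0[of k] e1[of k] by (simp add: power2_eq_square mult_left_le)
          finally have "(norm (f k (\<tau> k j)))\<^sup>2 \<le> 3 * (e k + (norm (f k u - \<kappa> u))\<^sup>2 + (norm (\<kappa> u))\<^sup>2)" by simp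
          moreover have "g (\<tau> k j) \<le> g u" using mono_onD[OF mono, of "\<tau> k j" u] \<tau>_range[of j k] j u by auto
          ultimately have "v j \<le> (3 * (e k + (norm (f k u - \<kappa> u))\<^sup>2 + (norm (\<kappa> u))\<^sup>2)) * g u"
            unfolding v_def using g[OF \<tau>_range[of j k]] j e0[of k] by (intro mult_mono) (auto intro!: add_nonneg_nonneg simp: less_imp_le)
          also have "\<dots> = 3 * (e k * g u + g u * (norm (f k u - \<kappa> u))\<^sup>2 + (norm (\<kappa> u))\<^sup>2 * g u)" by (simp add: algebra_simps)
          also have "\<dots> \<le> 3 * (e k * g t + g t * (norm (f k u - \<kappa> u))\<^sup>2 + (norm (\<kappa> u))\<^sup>2 * g u)"
            using gt[OF u] e0[of k] by (intro mult_left_mono add_mono mult_right_mono) auto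
          finally have "ennreal (v j) \<le> ennreal (3 * (e k * g t + g t * (norm (f k u - \<kappa> u))\<^sup>2 + (norm (\<kappa> u))\<^sup>2 * g u))"
            by (rule ennreal_leI)
          also have "\<dots> = 3 * (ennreal (e k * g t) + ennreal (g t) * ennreal ((norm (f k u - \<kappa> u))\<^sup>2) + ennreal ((norm (\<kappa> u))\<^sup>2 * g u))"
            using gt0 e0[of k] g[OF u] by (simp add: ennreal_mult less_imp_le)
          finally show ?case unfolding s .
        qed
      qed
      also have "\<dots> = 3 * (ennreal (e k * g t) * ennreal t + ennreal (g t) * (\<integral>\<^sup>+u\<in>{0..t}. ennreal ((norm (f k u - \<kappa> u))\<^sup>2) \<partial>lborel) + (\<integral>\<^sup>+u\<in>{0..t}. ennreal ((norm (\<kappa> u))\<^sup>2 * g u) \<partial>lborel))"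
        unfolding nn_integral_lebesgue_upto using gm km t
        by (simp add: nn_integral_cmult nn_integral_add emeasure_restrict_space space_restrict_space mult.assoc)
      also have "\<dots> \<le> 3 * (ennreal (e k * g t) * ennreal t + ennreal (g t) * ennreal (e k) + ennreal V)"
        using fk[of k] V(2) by (intro mult_left_mono add_mono order_refl) auto
      also have "\<dots> = ennreal (3 * (e k * (g t * (t + 1)) + V))"
      proof -
        have "3 * (ennreal (e k * g t) * ennreal t + ennreal (g t) * ennreal (e k) + ennreal V) = ennreal 3 * ennreal (e k * g t * t + g t * e k + V)"
          using t e0[of k] gt0 V(1) by (simp add: ennreal_mult less_imp_le)
        also have "\<dots> = ennreal (3 * (e k * g t * t + g t * e k + V))"
          using t e0[of k] gt0 V(1) by (intro ennreal_mult[symmetric]) (auto intro!: add_nonneg_nonneg mult_nonneg_nonneg simp: less_imp_le)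
        finally show ?thesis by (simp add: algebra_simps)
      qed
      finally show "(\<Sum>j<N k. (\<tau> k (Suc j) - \<tau> k j) * v j) \<le> 3 * (e k * (g t * (t + 1)) + V)"
        using t e0[of k] gt0 V(1)
        by (subst (asm) ennreal_le_iff) (auto intro!: add_nonneg_nonneg mult_nonneg_nonneg simp: less_imp_le)
    qed (use \<tau>_mono v0 in \<open>auto intro!: sum_nonneg mult_nonneg_nonneg\<close>)
    finally show ?thesis by (simp add: e_def)
  qed
  show ?thesis
  proof (rule that[of N \<tau> \<xi>])
  qed ((rule S dlim mom; assumption)+)
qed

text \<open>
  Existence of the integral: the integrals of the approximations are Cauchy in probability, so a
  sufficiently sparse subsequence converges almost surely.
\<close>

theorem kernel_ito_integral_exists:
  fixes \<kappa> :: "real \<Rightarrow> real ^ 'd::finite ^ 'd" and \<eta> :: "real \<Rightarrow> 'a \<Rightarrow> real ^ 'm ^ 'd"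
  assumes \<kappa>[measurable]: "\<kappa> \<in> borel_measurable borel"
    and fin: "(\<integral>\<^sup>+s\<in>{0..t}. ennreal ((norm (\<kappa> s))\<^sup>2) \<partial>lborel) < \<infinity>"
    and \<eta>: "left_adapted \<eta>" and t: "0 \<le> t" "t \<le> T"
  obtains Z where "Z \<in> borel_measurable (F t)" "has_ito_integral P F W t (\<lambda>s \<omega>. \<kappa> s ** \<eta> s \<omega>) Z"
    "\<And>n g V. 1 \<le> n \<Longrightarrow> mono_on {0..t} g \<Longrightarrow>
       (\<And>u. u \<in> {0..t} \<Longrightarrow> 0 \<le> g u \<and> (\<integral>\<^sup>+\<omega>. ennreal (norm (\<eta> u \<omega>) ^ (2 * n)) \<partial>P) \<le> ennreal (g u ^ n)) \<Longrightarrow>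
       0 \<le> V \<Longrightarrow> (\<integral>\<^sup>+u\<in>{0..t}. ennreal ((norm (\<kappa> u))\<^sup>2 * g u) \<partial>lborel) \<le> ennreal V \<Longrightarrow>
       (\<integral>\<^sup>+\<omega>. ennreal (norm (Z \<omega>) ^ (2 * n)) \<partial>P) \<le> ennreal ((ito_const (CARD('d) * CARD('m)) n * (3 * V)) ^ n)"
proof -
  obtain N \<tau> \<xi> where S: "\<And>k::nat. simple_integrand P F t (N k) (\<tau> k) (\<xi> k :: nat \<Rightarrow> 'a \<Rightarrow> real ^ 'm ^ 'd)"
    and dlim: "\<And>\<omega>. \<omega> \<in> space M \<Longrightarrow> (\<lambda>k. \<integral>\<^sup>+s\<in>{0..t}. ennreal ((norm (simple_process (N k) (\<tau> k) (\<xi> k) s \<omega> - \<kappa> s ** \<eta> s \<omega>))\<^sup>2) \<partial>lborel) \<longlonglongrightarrow> 0"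
    and mom: "\<And>k n g V. 1 \<le> n \<Longrightarrow> mono_on {0..t} g \<Longrightarrow>
       (\<And>u. u \<in> {0..t} \<Longrightarrow> 0 \<le> g u \<and> (\<integral>\<^sup>+\<omega>. ennreal (norm (\<eta> u \<omega>) ^ (2 * n)) \<partial>P) \<le> ennreal (g u ^ n)) \<Longrightarrow>
       0 \<le> V \<Longrightarrow> (\<integral>\<^sup>+u\<in>{0..t}. ennreal ((norm (\<kappa> u))\<^sup>2 * g u) \<partial>lborel) \<le> ennreal V \<Longrightarrow>
       (\<integral>\<^sup>+\<omega>. ennreal (norm (simple_ito_integral W (N k) (\<tau> k) (\<xi> k) \<omega>) ^ (2 * n)) \<partial>P)
         \<le> ennreal ((ito_const (CARD('d) * CARD('m)) n * (3 * (inverse (real (Suc k)) * (g t * (t + 1)) + V))) ^ n)"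
    by (rule grid_approximation[OF \<kappa> fin \<eta> t]) blast
  define H where "H = (\<lambda>s \<omega>. \<kappa> s ** \<eta> s \<omega>)"
  define d where "d = (\<lambda>k \<omega>. \<integral>\<^sup>+s\<in>{0..t}. ennreal ((norm (simple_process (N k) (\<tau> k) (\<xi> k) s \<omega> - H s \<omega>))\<^sup>2) \<partial>lborel)"
  define J where "J = (\<lambda>k. simple_ito_integral W (N k) (\<tau> k) (\<xi> k))"
  define C where "C = ito_const (CARD('d) * CARD('m)) 1"
  have C0: "0 \<le> C" unfolding C_def by (rule ito_const_nonneg)
  have I: "ito_integrand P F t H"
    unfolding H_def by (rule kernel_times_left_adapted_integrand[OF \<kappa> fin \<eta> t])
  note Hm = ito_integrand_joint[OF I t(1)]
  have dm[measurable]: "d k \<in> borel_measurable P" for k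
    unfolding d_def by (rule l2_distance_measurable[OF S Hm])
  have JF: "J k \<in> borel_measurable (F t)" for k
    unfolding J_def by (rule simple_ito_integral_measurable[OF S t(2)])
  then have Jm[measurable]: "J k \<in> borel_measurable P" for k by (rule measurable_F_P)
  have md: "(\<lambda>k. measure P {\<omega> \<in> space P. ennreal \<delta> < d k \<omega>}) \<longlonglongrightarrow> 0" if "0 < \<delta>" for \<delta>
  proof (rule P.measure_tendsto_0)
    show "AE \<omega> in P. \<forall>\<^sub>F k in sequentially. \<omega> \<notin> {\<omega> \<in> space P. ennreal \<delta> < d k \<omega>}"
    proof (rule AE_I2)
      fix \<omega> assume "\<omega> \<in> space P"
      then have "(\<lambda>k. d k \<omega>) \<longlonglongrightarrow> 0" unfolding d_def H_def using dlim by simp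
      then have "\<forall>\<^sub>F k in sequentially. d k \<omega> < ennreal \<delta>"
        using that by (intro order_tendstoD) auto
      then show "\<forall>\<^sub>F k in sequentially. \<omega> \<notin> {\<omega> \<in> space P. ennreal \<delta> < d k \<omega>}"
        by eventually_elim (auto simp: not_less)
    qed
  qed measurable
  have cauchy: "\<exists>K. \<forall>a\<ge>K. \<forall>b\<ge>K. measure P {\<omega> \<in> space P. e < norm (J a \<omega> - J b \<omega>)} \<le> e" if "0 < e" for e
  proof -
    define \<delta> where "\<delta> = (e / 3) * e\<^sup>2 / (C + 1)"
    have \<delta>0: "0 < \<delta>" using that C0 by (simp add: \<delta>_def)
    have "C * \<delta> / e\<^sup>2 = (e / 3) * (C / (C + 1))"
    proof -
      have "C * ((e / 3) * x / k) / x = (e / 3) * (C / k)" if "x \<noteq> 0" for x k :: real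
        using that by (simp add: divide_simps)
      then show ?thesis using that by (simp add: \<delta>_def)
    qed
    also have "\<dots> \<le> (e / 3) * 1" using that C0 by (intro mult_left_mono) auto
    finally have Cd: "C * \<delta> / e\<^sup>2 \<le> e / 3" by simp
    have "\<forall>\<^sub>F k in sequentially. measure P {\<omega> \<in> space P. ennreal (\<delta> / 4) < d k \<omega>} < e / 3"
      using md[of "\<delta> / 4"] \<delta>0 that by (intro order_tendstoD(2)) auto
    then obtain K where K: "\<And>k. K \<le> k \<Longrightarrow> measure P {\<omega> \<in> space P. ennreal (\<delta> / 4) < d k \<omega>} < e / 3"
      by (auto simp: eventually_sequentially)
    have "measure P {\<omega> \<in> space P. e < norm (J a \<omega> - J b \<omega>)} \<le> e" if ab: "K \<le> a" "K \<le> b" for a b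
    proof -
      have "measure P {\<omega> \<in> space P. e < norm (J a \<omega> - J b \<omega>)} \<le> C * \<delta> / e\<^sup>2
          + measure P {\<omega> \<in> space P. ennreal (\<delta> / 4) < d a \<omega>} + measure P {\<omega> \<in> space P. ennreal (\<delta> / 4) < d b \<omega>}"
        unfolding J_def C_def d_def
        by (rule simple_integral_diff_prob_bound[OF S S Hm t(2) \<open>0 < e\<close> \<delta>0])
      then show ?thesis using Cd K[OF ab(1)] K[OF ab(2)] by linarith
    qed
    then show ?thesis by blast
  qed
  have "\<forall>k::nat. \<exists>K. \<forall>a\<ge>K. \<forall>b\<ge>K. measure P {\<omega> \<in> space P. (1/2)^k < norm (J a \<omega> - J b \<omega>)} \<le> (1/2)^k"
    by (intro allI cauchy) simp
  from choice[OF this] obtain K where K: "\<And>k a b. K k \<le> a \<Longrightarrow> K k \<le> b \<Longrightarrow> measure P {\<omega> \<in> space P. (1/2)^k < norm (J a \<omega> - J b \<omega>)} \<le> (1/2)^k"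
    by blast
  define r where "r = (\<lambda>k. k + (\<Sum>j\<le>k. K j))"
  have r_ge: "k \<le> r k" for k by (simp add: r_def)
  have rK: "K k \<le> r k" "K k \<le> r (Suc k)" for k
    using member_le_sum[of k "{..k}" K] by (auto simp: r_def)
  have r_lim: "filterlim r at_top sequentially"
    by (rule filterlim_at_top_mono[OF filterlim_ident]) (use r_ge in auto)
  have "AE \<omega> in P. \<forall>\<^sub>F k in sequentially. \<omega> \<in> space P - {\<omega> \<in> space P. (1/2)^k < norm (J (r (Suc k)) \<omega> - J (r k) \<omega>)}"
  proof (rule borel_cantelli_AE1)
    show "{\<omega> \<in> space P. (1/2)^k < norm (J (r (Suc k)) \<omega> - J (r k) \<omega>)} \<in> sets P" for k by measurable
    show "summable (\<lambda>k. measure P {\<omega> \<in> space P. (1/2)^k < norm (J (r (Suc k)) \<omega> - J (r k) \<omega>)})"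
      by (rule summable_comparison_test'[OF summable_geometric[of "1/2::real"], where N = 0])
         (use K rK in auto)
  qed (simp add: P.emeasure_eq_measure)
  then have conv: "AE \<omega> in P. convergent (\<lambda>k. J (r k) \<omega>)"
  proof eventually_elim
    case (elim \<omega>)
    have "summable (\<lambda>k. J (r (Suc k)) \<omega> - J (r k) \<omega>)"
    proof (rule summable_comparison_test_ev[OF _ summable_geometric[of "1/2::real"]])
      show "\<forall>\<^sub>F k in sequentially. norm (J (r (Suc k)) \<omega> - J (r k) \<omega>) \<le> (1/2)^k"
        using elim by eventually_elim auto
    qed simp
    then show ?case by (rule convergent_of_summable_differences)
  qed
  define Z where "Z = (\<lambda>\<omega>. lim (\<lambda>k. J (r k) \<omega>))"
  have ZF: "Z \<in> borel_measurable (F t)"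
    unfolding Z_def by (rule borel_measurable_lim_metric) (rule JF)
  then have Zm[measurable]: "Z \<in> borel_measurable P" by (rule measurable_F_P)
  have Zlim: "AE \<omega> in P. (\<lambda>k. J (r k) \<omega>) \<longlonglongrightarrow> Z \<omega>"
    using conv by eventually_elim (simp add: Z_def convergent_LIMSEQ_iff)
  have z: "(\<lambda>k. measure P {\<omega> \<in> space P. \<epsilon> < norm (J (r k) \<omega> - Z \<omega>)}) \<longlonglongrightarrow> 0" if "0 < \<epsilon>" for \<epsilon>
  proof (rule P.measure_tendsto_0)
    show "AE \<omega> in P. \<forall>\<^sub>F k in sequentially. \<omega> \<notin> {\<omega> \<in> space P. \<epsilon> < norm (J (r k) \<omega> - Z \<omega>)}"
      using Zlim
    proof eventually_elim
      case (elim \<omega>)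
      then have "\<forall>\<^sub>F k in sequentially. dist (J (r k) \<omega>) (Z \<omega>) < \<epsilon>" using that by (rule tendstoD)
      then show ?case by eventually_elim (auto simp: dist_norm)
    qed
  qed measurable
  have d: "(\<lambda>k. measure P {\<omega> \<in> space P. ennreal \<epsilon> < d (r k) \<omega>}) \<longlonglongrightarrow> 0" if "0 < \<epsilon>" for \<epsilon>
    using filterlim_compose[OF md[OF that] r_lim] .
  have "has_ito_integral P F W t H Z"
    unfolding has_ito_integral_def
    by (intro conjI I Zm exI[of _ "\<lambda>k. N (r k)"] exI[of _ "\<lambda>k. \<tau> (r k)"] exI[of _ "\<lambda>k. \<xi> (r k)"] allI impI
        S d[unfolded d_def] z[unfolded J_def])
  moreover have "(\<integral>\<^sup>+\<omega>. ennreal (norm (Z \<omega>) ^ (2 * n)) \<partial>P) \<le> ennreal ((ito_const (CARD('d) * CARD('m)) n * (3 * V)) ^ n)"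
    if n: "1 \<le> n" and g: "mono_on {0..t} g"
       "\<And>u. u \<in> {0..t} \<Longrightarrow> 0 \<le> g u \<and> (\<integral>\<^sup>+\<omega>. ennreal (norm (\<eta> u \<omega>) ^ (2 * n)) \<partial>P) \<le> ennreal (g u ^ n)"
       and V: "0 \<le> V" "(\<integral>\<^sup>+u\<in>{0..t}. ennreal ((norm (\<kappa> u))\<^sup>2 * g u) \<partial>lborel) \<le> ennreal V" for n g V
  proof (rule nn_integral_le_of_tendsto)
    show "(\<integral>\<^sup>+\<omega>. ennreal (norm (J (r k) \<omega>) ^ (2 * n)) \<partial>P) \<le>
      ennreal ((ito_const (CARD('d) * CARD('m)) n * (3 * (inverse (real (Suc (r k))) * (g t * (t + 1)) + V))) ^ n)" for k
      unfolding J_def by (rule mom[OF n g V])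
    show "AE \<omega> in P. (\<lambda>k. ennreal (norm (J (r k) \<omega>) ^ (2 * n))) \<longlonglongrightarrow> ennreal (norm (Z \<omega>) ^ (2 * n))"
      using Zlim by eventually_elim (intro tendsto_ennrealI tendsto_intros)
    have "(\<lambda>k. inverse (real (Suc (r k)))) \<longlonglongrightarrow> 0"
      using filterlim_compose[OF LIMSEQ_inverse_real_of_nat r_lim] .
    then have "(\<lambda>k. ennreal ((ito_const (CARD('d) * CARD('m)) n * (3 * (inverse (real (Suc (r k))) * (g t * (t + 1)) + V))) ^ n))
      \<longlonglongrightarrow> ennreal ((ito_const (CARD('d) * CARD('m)) n * (3 * (0 * (g t * (t + 1)) + V))) ^ n)"
      by (intro tendsto_ennrealI tendsto_intros)
    then show "(\<lambda>k. ennreal ((ito_const (CARD('d) * CARD('m)) n * (3 * (inverse (real (Suc (r k))) * (g t * (t + 1)) + V))) ^ n))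
      \<longlonglongrightarrow> ennreal ((ito_const (CARD('d) * CARD('m)) n * (3 * V)) ^ n)" by simp
  qed measurable
  ultimately show ?thesis
    unfolding H_def by (intro that[OF ZF]) auto
qed

text \<open>By uniqueness the moment bound holds for every version of the integral.\<close>

lemma kernel_ito_integral_moment:
  fixes \<kappa> :: "real \<Rightarrow> real ^ 'd::finite ^ 'd" and \<eta> :: "real \<Rightarrow> 'a \<Rightarrow> real ^ 'm ^ 'd"
  assumes \<kappa>: "\<kappa> \<in> borel_measurable borel"
    and fin: "(\<integral>\<^sup>+s\<in>{0..t}. ennreal ((norm (\<kappa> s))\<^sup>2) \<partial>lborel) < \<infinity>"
    and \<eta>: "left_adapted \<eta>" and t: "0 \<le> t" "t \<le> T"
    and I1: "has_ito_integral P F W t H1 Z1" and I2: "has_ito_integral P F W t H2 Z2" and A: "A \<in> sets P"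
    and eq: "\<And>s \<omega>. s \<in> {0..t} \<Longrightarrow> \<omega> \<in> A \<Longrightarrow> \<kappa> s ** \<eta> s \<omega> = H1 s \<omega> - H2 s \<omega>"
    and n: "1 \<le> n" and g: "mono_on {0..t} g"
       "\<And>u. u \<in> {0..t} \<Longrightarrow> 0 \<le> g u \<and> (\<integral>\<^sup>+\<omega>. ennreal (norm (\<eta> u \<omega>) ^ (2 * n)) \<partial>P) \<le> ennreal (g u ^ n)"
    and V: "0 \<le> V" "(\<integral>\<^sup>+u\<in>{0..t}. ennreal ((norm (\<kappa> u))\<^sup>2 * g u) \<partial>lborel) \<le> ennreal V"
  shows "(\<integral>\<^sup>+\<omega>. ennreal (norm (Z1 \<omega> - Z2 \<omega>) ^ (2 * n)) * indicator A \<omega> \<partial>P)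
    \<le> ennreal ((ito_const (CARD('d) * CARD('m)) n * (3 * V)) ^ n)"
proof -
  obtain Z where Z: "has_ito_integral P F W t (\<lambda>s \<omega>. \<kappa> s ** \<eta> s \<omega>) Z"
    and m: "\<And>n g V. 1 \<le> n \<Longrightarrow> mono_on {0..t} g \<Longrightarrow>
       (\<And>u. u \<in> {0..t} \<Longrightarrow> 0 \<le> g u \<and> (\<integral>\<^sup>+\<omega>. ennreal (norm (\<eta> u \<omega>) ^ (2 * n)) \<partial>P) \<le> ennreal (g u ^ n)) \<Longrightarrow>
       0 \<le> V \<Longrightarrow> (\<integral>\<^sup>+u\<in>{0..t}. ennreal ((norm (\<kappa> u))\<^sup>2 * g u) \<partial>lborel) \<le> ennreal V \<Longrightarrow>
       (\<integral>\<^sup>+\<omega>. ennreal (norm (Z \<omega>) ^ (2 * n)) \<partial>P) \<le> ennreal ((ito_const (CARD('d) * CARD('m)) n * (3 * V)) ^ n)"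
    by (rule kernel_ito_integral_exists[OF \<kappa> fin \<eta> t]) blast
  have "AE \<omega> in P. \<omega> \<in> A \<longrightarrow> Z \<omega> = Z1 \<omega> - Z2 \<omega>"
    by (rule has_ito_integral_diff_on[OF t I1 I2 Z A eq])
  then have "(\<integral>\<^sup>+\<omega>. ennreal (norm (Z1 \<omega> - Z2 \<omega>) ^ (2 * n)) * indicator A \<omega> \<partial>P) \<le> (\<integral>\<^sup>+\<omega>. ennreal (norm (Z \<omega>) ^ (2 * n)) \<partial>P)"
    by (intro nn_integral_mono_AE) (auto elim!: eventually_mono simp: indicator_def)
  also have "\<dots> \<le> ennreal ((ito_const (CARD('d) * CARD('m)) n * (3 * V)) ^ n)"
    by (rule m[OF n g V])
  finally show ?thesis .
qed

end

section \<open>Continuous modifications and almost sure limits\<close>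

definition dyadic_index :: "real \<Rightarrow> nat \<Rightarrow> real \<Rightarrow> nat" where
  "dyadic_index T m t = nat \<lfloor>2 ^ m * t / T\<rfloor>"

definition dyadic_point :: "real \<Rightarrow> nat \<Rightarrow> nat \<Rightarrow> real" where
  "dyadic_point T m j = T * real j / 2 ^ m"

lemma dyadic_index_bounds:
  assumes "0 < T" "0 \<le> t"
  shows "real (dyadic_index T m t) \<le> 2 ^ m * t / T" "2 ^ m * t / T < real (dyadic_index T m t) + 1"
proof -
  have "0 \<le> 2 ^ m * t / T" using assms by simp
  then show "real (dyadic_index T m t) \<le> 2 ^ m * t / T" "2 ^ m * t / T < real (dyadic_index T m t) + 1"
    by (auto simp: dyadic_index_def)
qed

lemma dyadic_index_le:
  assumes "0 < T" "0 \<le> t" "t \<le> T"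
  shows "dyadic_index T m t \<le> 2 ^ m"
proof -
  have "2 ^ m * t / T \<le> 2 ^ m" using assms by (simp add: field_simps)
  then have "real (dyadic_index T m t) \<le> 2 ^ m"
    using dyadic_index_bounds(1)[OF assms(1,2), of m] by linarith
  also have "(2::real) ^ m = real (2 ^ m)" by simp
  finally show ?thesis by (rule of_nat_le_iff[THEN iffD1])
qed

lemma dyadic_point_bounds:
  assumes "0 < T" "0 \<le> t"
  shows "dyadic_point T m (dyadic_index T m t) \<le> t" "t - dyadic_point T m (dyadic_index T m t) \<le> T / 2 ^ m"
    "0 \<le> dyadic_point T m j"
proof -
  note b = dyadic_index_bounds[OF assms, of m]
  show "dyadic_point T m (dyadic_index T m t) \<le> t" "0 \<le> dyadic_point T m j"
    using b(1) assms by (auto simp: dyadic_point_def field_simps)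
  have "t < T * (real (dyadic_index T m t) + 1) / 2 ^ m"
    using b(2) assms by (simp add: field_simps)
  also have "\<dots> = dyadic_point T m (dyadic_index T m t) + T / 2 ^ m"
    by (simp add: dyadic_point_def distrib_left add_divide_distrib)
  finally show "t - dyadic_point T m (dyadic_index T m t) \<le> T / 2 ^ m" by simp
qed

lemma dyadic_index_Suc:
  assumes "0 < T" "0 \<le> t"
  shows "dyadic_index T (Suc m) t = 2 * dyadic_index T m t \<or> dyadic_index T (Suc m) t = 2 * dyadic_index T m t + 1"
proof -
  note b = dyadic_index_bounds[OF assms, of m] and b' = dyadic_index_bounds[OF assms, of "Suc m"]
  have "2 ^ Suc m * t / T = 2 * (2 ^ m * t / T)" by simp
  then have "real (dyadic_index T (Suc m) t) < 2 * real (dyadic_index T m t) + 2"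
    "2 * real (dyadic_index T m t) < real (dyadic_index T (Suc m) t) + 1"
    using b b' by linarith+
  then show ?thesis by linarith
qed

lemma dyadic_point_in:
  assumes "0 \<le> T" "j \<le> 2 ^ m"
  shows "dyadic_point T m j \<in> {0..T}"
proof -
  have "real j \<le> real (2 ^ m)" using assms by (simp only: of_nat_le_iff)
  then have "T * real j \<le> T * 2 ^ m" using assms by (intro mult_left_mono) auto
  then show ?thesis using assms by (simp add: dyadic_point_def field_simps)
qed

lemma dyadic_points_tendsto:
  assumes "0 < T" "0 \<le> t"
  shows "(\<lambda>m. dyadic_point T m (dyadic_index T m t)) \<longlonglongrightarrow> t"
proof (rule tendsto_sandwich[OF _ _ _ tendsto_const])
  show "\<forall>\<^sub>F m in sequentially. t - T / 2 ^ m \<le> dyadic_point T m (dyadic_index T m t)"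
    using dyadic_point_bounds(2)[OF assms] by (intro always_eventually allI) (simp add: algebra_simps)
  show "\<forall>\<^sub>F m in sequentially. dyadic_point T m (dyadic_index T m t) \<le> t"
    using dyadic_point_bounds(1)[OF assms] by (intro always_eventually allI)
  have "(\<lambda>m. t - T * (1 / 2) ^ m) \<longlonglongrightarrow> t - T * 0"
    by (intro tendsto_diff tendsto_mult tendsto_const LIMSEQ_power_zero) simp
  then show "(\<lambda>m. t - T / 2 ^ m) \<longlonglongrightarrow> t" by (simp add: power_divide)
qed

text \<open>
  Dyadic points make a supremum of a continuous path a countable one.
\<close>

lemma continuous_le_of_dyadic:
  fixes h :: "real \<Rightarrow> real"
  assumes u: "0 \<le> u" and h: "continuous_on {0..u} h"
    and le: "\<And>m j. j \<le> 2 ^ m \<Longrightarrow> h (dyadic_point u m j) \<le> N" and v: "v \<in> {0..u}"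
  shows "h v \<le> N"
proof (cases "u = 0")
  case True
  then show ?thesis using v le[of 0 0] by (simp add: dyadic_point_def)
next
  case False
  then have u0: "0 < u" using u by simp
  let ?d = "\<lambda>m. dyadic_point u m (dyadic_index u m v)"
  have idx: "dyadic_index u m v \<le> 2 ^ m" for m using dyadic_index_le[OF u0, of v m] v by simp
  have "(\<lambda>m. h (?d m)) \<longlonglongrightarrow> h v"
    by (rule continuous_on_tendsto_compose[OF h dyadic_points_tendsto[OF u0]])
       (use v dyadic_point_in[OF u idx] in auto)
  then show ?thesis using le[OF idx] by (intro LIMSEQ_le_const2) auto
qed

text \<open>
  The last points before \<open>t\<close> of two consecutive grids are equal or neighbours, so the values there form
  a Cauchy sequence with geometric rate, uniformly in \<open>t\<close>.  Two times closer than a cell width have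
  equal or neighbouring points, which makes the limit continuous.
\<close>

lemma dyadic_limit_continuous:
  fixes y :: "real \<Rightarrow> 'b::banach"
  assumes T: "0 < T" and r: "0 < r" "r < 1"
    and inc: "\<And>m j. j < 2 ^ m \<Longrightarrow> norm (y (dyadic_point T m (Suc j)) - y (dyadic_point T m j)) \<le> v * r ^ m"
  shows "\<exists>x. continuous_on {0..T} x \<and>
    (\<forall>t\<in>{0..T}. (\<lambda>m. y (dyadic_point T m (dyadic_index T m t))) \<longlonglongrightarrow> x t)"
proof -
  define a where "a = (\<lambda>m t. y (dyadic_point T m (dyadic_index T m t)))"
  have v0: "0 \<le> v" using order_trans[OF norm_ge_zero inc[of 0 0]] by simp
  have step: "norm (a (Suc m) t - a m t) \<le> v * r ^ Suc m" if t: "t \<in> {0..T}" for m t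
  proof -
    let ?k = "dyadic_index T m t"
    have p: "dyadic_point T (Suc m) (2 * ?k) = dyadic_point T m ?k"
      by (simp add: dyadic_point_def)
    consider "dyadic_index T (Suc m) t = 2 * ?k" | "dyadic_index T (Suc m) t = Suc (2 * ?k)"
      using dyadic_index_Suc[OF T, of t m] t by auto
    then show ?thesis
    proof cases
      case 1
      then show ?thesis using v0 r by (simp add: a_def p)
    next
      case 2
      have "2 * ?k < 2 ^ Suc m" using dyadic_index_le[OF T, of t "Suc m"] t 2 by simp
      from inc[OF this] show ?thesis by (simp add: a_def 2 p del: power_Suc)
    qed
  qed
  have tail: "norm (a (m + n) t - a m t) \<le> v * r ^ m * ((1 - r ^ n) / (1 - r))" if t: "t \<in> {0..T}" for m n t
  proof (induction n)
    case (Suc n)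
    have "norm (a (m + Suc n) t - a m t) \<le> norm (a (m + n) t - a m t) + norm (a (Suc (m + n)) t - a (m + n) t)"
      using norm_triangle_ineq[of "a (m + n) t - a m t" "a (Suc (m + n)) t - a (m + n) t"] by simp
    also have "norm (a (Suc (m + n)) t - a (m + n) t) \<le> v * r ^ (m + n)"
      using step[OF t, of "m + n"] mult_left_mono[OF power_decreasing[of "m + n" "Suc (m + n)" r] v0] r by simp
    finally have "norm (a (m + Suc n) t - a m t) \<le> v * r ^ m * ((1 - r ^ n) / (1 - r)) + v * r ^ (m + n)"
      using Suc by simp
    also have "\<dots> = v * r ^ m * ((1 - r ^ n) / (1 - r) + r ^ n)" by (simp add: power_add algebra_simps)
    also have "(1 - r ^ n) / (1 - r) + r ^ n = (1 - r ^ Suc n) / (1 - r)"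
      using r by (simp add: field_simps)
    finally show ?case .
  qed simp
  have tail': "norm (a (m + n) t - a m t) \<le> v * r ^ m / (1 - r)" if t: "t \<in> {0..T}" for m n t
  proof -
    have "(1 - r ^ n) / (1 - r) \<le> 1 / (1 - r)" using r by (intro divide_right_mono) auto
    then have "v * r ^ m * ((1 - r ^ n) / (1 - r)) \<le> v * r ^ m * (1 / (1 - r))"
      using v0 r by (intro mult_left_mono) auto
    then show ?thesis using tail[OF t, of m n] by simp
  qed
  define x where "x = (\<lambda>t. lim (\<lambda>m. a m t))"
  have lim: "(\<lambda>m. a m t) \<longlonglongrightarrow> x t" if t: "t \<in> {0..T}" for t
  proof -
    have "summable (\<lambda>m. a (Suc m) t - a m t)"
    proof (rule summable_comparison_test'[where N = 0])
      show "summable (\<lambda>m. v * r ^ Suc m)"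
        using r by (simp add: summable_mult summable_geometric del: power_Suc)
          (simp add: summable_Suc_iff summable_geometric)
    qed (use step[OF t] in auto)
    from convergent_of_summable_differences[OF this] show ?thesis
      by (simp add: x_def convergent_LIMSEQ_iff)
  qed
  have close: "norm (x t - a m t) \<le> v * r ^ m / (1 - r)" if t: "t \<in> {0..T}" for m t
  proof (rule LIMSEQ_le_const2)
    show "(\<lambda>n. norm (a (m + n) t - a m t)) \<longlonglongrightarrow> norm (x t - a m t)"
      by (intro tendsto_intros LIMSEQ_ignore_initial_segment[OF lim[OF t], of m, unfolded add.commute[of _ m]])
  qed (use tail'[OF t] in auto)
  have near: "norm (a m t - a m s) \<le> v * r ^ m" if st: "s \<in> {0..T}" "t \<in> {0..T}" "s \<le> t" "t - s < T / 2 ^ m" for m s t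
  proof -
    note bs = dyadic_index_bounds[OF T, of s m] and bt = dyadic_index_bounds[OF T, of t m]
    have "2 ^ m * s / T \<le> 2 ^ m * t / T" using st T by (intro divide_right_mono mult_left_mono) auto
    moreover have "2 ^ m * t / T < 2 ^ m * s / T + 1" using st T by (simp add: field_simps)
    ultimately have "real (dyadic_index T m s) < real (dyadic_index T m t) + 1"
      "real (dyadic_index T m t) < real (dyadic_index T m s) + 2"
      using bs bt st by auto
    then have "dyadic_index T m t = dyadic_index T m s \<or> dyadic_index T m t = Suc (dyadic_index T m s)"
      by linarith
    then show ?thesis
    proof
      assume "dyadic_index T m t = Suc (dyadic_index T m s)"
      moreover from this have "dyadic_index T m s < 2 ^ m" using dyadic_index_le[OF T, of t m] st by simp
      ultimately show ?thesis using inc[of "dyadic_index T m s" m] by (simp add: a_def)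
    qed (use v0 r in \<open>simp add: a_def\<close>)
  qed
  have mod: "norm (x t - x s) \<le> v * r ^ m * (1 + 2 / (1 - r))" if st: "s \<in> {0..T}" "t \<in> {0..T}" "\<bar>t - s\<bar> < T / 2 ^ m" for m s t
  proof -
    have n: "norm (a m t - a m s) \<le> v * r ^ m"
      using near[of s t m] near[of t s m] st by (cases "s \<le> t") (auto simp: norm_minus_commute)
    have "x t - x s = (x t - a m t) + (a m t - a m s) - (x s - a m s)" by simp
    then have "norm (x t - x s) \<le> norm (x t - a m t) + norm (a m t - a m s) + norm (x s - a m s)"
      by (metis (no_types) norm_triangle_ineq norm_triangle_ineq4 add_right_mono order_trans)
    also have "\<dots> \<le> v * r ^ m / (1 - r) + v * r ^ m + v * r ^ m / (1 - r)"
      using close[OF st(1), of m] close[OF st(2), of m] n by (intro add_mono)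
    finally show ?thesis by (simp add: algebra_simps)
  qed
  have "continuous_on {0..T} x"
    unfolding continuous_on_iff
  proof (intro ballI allI impI)
    fix s e :: real assume s: "s \<in> {0..T}" and e: "0 < e"
    have "(\<lambda>m. v * r ^ m * (1 + 2 / (1 - r))) \<longlonglongrightarrow> v * 0 * (1 + 2 / (1 - r))"
      using r by (intro tendsto_intros LIMSEQ_power_zero) auto
    then have "\<forall>\<^sub>F m in sequentially. v * r ^ m * (1 + 2 / (1 - r)) < e"
      using e by (intro order_tendstoD) auto
    then obtain m where m: "v * r ^ m * (1 + 2 / (1 - r)) < e" by (auto simp: eventually_sequentially)
    have "dist (x t) (x s) < e" if "t \<in> {0..T}" "dist t s < T / 2 ^ m" for t
      using mod[OF s that(1), of m] that m by (simp add: dist_real_def dist_norm)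
    then show "\<exists>d>0. \<forall>t\<in>{0..T}. dist t s < d \<longrightarrow> dist (x t) (x s) < e"
      using T by (intro exI[of _ "T / 2 ^ m"]) auto
  qed
  then show ?thesis using lim by (auto simp: a_def)
qed

lemma AE_eq_0_of_nn_integral_power:
  fixes f :: "'a \<Rightarrow> 'b::{real_normed_vector, second_countable_topology}"
  assumes [measurable]: "f \<in> borel_measurable N" and "0 < p"
    and "(\<integral>\<^sup>+x. ennreal (norm (f x) ^ p) \<partial>N) = 0"
  shows "AE x in N. f x = 0"
proof -
  have "AE x in N. ennreal (norm (f x) ^ p) = 0"
    using assms(3) by (subst (asm) nn_integral_0_iff_AE) auto
  then show ?thesis
  proof eventually_elim
    case (elim x)
    have "norm (f x) ^ p = 0"
      using ennreal_eq_0_iff[of "norm (f x) ^ p"] elim by (simp add: antisym del: power_eq_0_iff)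
    then show ?case by simp
  qed
qed

text \<open>
  Kolmogorov's continuity criterion.  The \<open>p\<close>-th powers of the increments over the \<open>2 ^ m\<close> cells of the
  dyadic grid have expected sum of order \<open>2 powr (- \<beta> * m)\<close>.  Half of this decay is spent on the factor
  \<open>R ^ m\<close>, the other half makes the expectations of \<open>e m\<close> summable.  So almost surely all \<open>e m\<close> are
  bounded together, and the increments decay like \<open>r ^ m\<close>.
\<close>

theorem (in prob_space) continuous_modification:
  fixes Y :: "real \<Rightarrow> 'a \<Rightarrow> 'b::{banach, second_countable_topology}"
  assumes T: "0 < T" and Ym: "\<And>t. t \<in> {0..T} \<Longrightarrow> Y t \<in> borel_measurable M"
    and p: "0 < p" and \<beta>: "0 < \<beta>" and c: "0 \<le> c"
    and Y: "\<And>s t. 0 \<le> s \<Longrightarrow> s \<le> t \<Longrightarrow> t \<le> T \<Longrightarrow>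
       (\<integral>\<^sup>+\<omega>. ennreal (norm (Y t \<omega> - Y s \<omega>) ^ p) \<partial>M) \<le> ennreal (c * (t - s) powr (1 + \<beta>))"
  shows "\<exists>X. (\<forall>\<omega>\<in>space M. continuous_on {0..T} (\<lambda>t. X t \<omega>)) \<and> (\<forall>t\<in>{0..T}. AE \<omega> in M. X t \<omega> = Y t \<omega>)"
proof -
  define R where "R = (2::real) powr (\<beta> / 2)"
  define q where "q = (2::real) powr (- \<beta> / 2)"
  define r where "r = (2::real) powr (- \<beta> / (2 * real p))"
  have R0: "0 < R" by (simp add: R_def)
  have q: "0 < q" "q < 1" using \<beta> by (auto simp: q_def powr_less_one)
  have r: "0 < r" "r < 1" using \<beta> p by (auto simp: r_def powr_less_one)
  have rp: "r ^ p = q" using p by (simp add: r_def q_def powr_realpow[symmetric] powr_powr)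
  have Rq: "R * q = 1" by (simp add: R_def q_def powr_add[symmetric])
  define e where "e = (\<lambda>m \<omega>. R ^ m * (\<Sum>j<2 ^ m. norm (Y (dyadic_point T m (Suc j)) \<omega> - Y (dyadic_point T m j) \<omega>) ^ p))"
  have dp: "dyadic_point T m j \<in> {0..T}" if "j \<le> 2 ^ m" for m j
    using T that by (intro dyadic_point_in) auto
  have Ydm: "Y (dyadic_point T m j) \<in> borel_measurable M" if "j \<le> 2 ^ m" for m j
    using Ym[OF dp[OF that]] .
  have incm: "(\<lambda>\<omega>. norm (Y (dyadic_point T m (Suc j)) \<omega> - Y (dyadic_point T m j) \<omega>) ^ p) \<in> borel_measurable M"
    if "j \<in> {..<2 ^ m}" for m j
  proof -
    have [measurable]: "Y (dyadic_point T m (Suc j)) \<in> borel_measurable M" "Y (dyadic_point T m j) \<in> borel_measurable M"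
      using that by (auto intro!: Ydm simp: Suc_le_eq)
    show ?thesis by measurable
  qed
  have em[measurable]: "e m \<in> borel_measurable M" for m
    unfolding e_def by (intro borel_measurable_times borel_measurable_const borel_measurable_sum incm)
  have e0: "0 \<le> e m \<omega>" for m \<omega> using R0 by (auto simp: e_def intro!: mult_nonneg_nonneg sum_nonneg)
  have int: "(\<integral>\<^sup>+\<omega>. ennreal (e m \<omega>) \<partial>M) \<le> ennreal (c * T powr (1 + \<beta>) * q ^ m)" for m
  proof -
    have "(\<integral>\<^sup>+\<omega>. ennreal (e m \<omega>) \<partial>M) =
      (\<integral>\<^sup>+\<omega>. ennreal (R ^ m) * (\<Sum>j<2 ^ m. ennreal (norm (Y (dyadic_point T m (Suc j)) \<omega> - Y (dyadic_point T m j) \<omega>) ^ p)) \<partial>M)"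
      unfolding e_def using R0 by (intro nn_integral_cong) (simp add: ennreal_mult sum_nonneg sum_ennreal)
    also have "\<dots> = ennreal (R ^ m) * (\<Sum>j<2 ^ m. \<integral>\<^sup>+\<omega>. ennreal (norm (Y (dyadic_point T m (Suc j)) \<omega> - Y (dyadic_point T m j) \<omega>) ^ p) \<partial>M)"
    proof -
      have *: "(\<lambda>\<omega>. ennreal (norm (Y (dyadic_point T m (Suc j)) \<omega> - Y (dyadic_point T m j) \<omega>) ^ p)) \<in> borel_measurable M" if "j \<in> {..<2 ^ m}" for j
        using incm[OF that] by (rule measurable_compose[OF _ measurable_ennreal])
      have sum: "(\<integral>\<^sup>+\<omega>. (\<Sum>j<2 ^ m. ennreal (norm (Y (dyadic_point T m (Suc j)) \<omega> - Y (dyadic_point T m j) \<omega>) ^ p)) \<partial>M)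
        = (\<Sum>j<2 ^ m. \<integral>\<^sup>+\<omega>. ennreal (norm (Y (dyadic_point T m (Suc j)) \<omega> - Y (dyadic_point T m j) \<omega>) ^ p) \<partial>M)"
        by (rule nn_integral_sum) (rule *)
      show ?thesis
        unfolding sum[symmetric] by (rule nn_integral_cmult) (intro borel_measurable_sum *)
    qed
    also have "\<dots> \<le> ennreal (R ^ m) * (\<Sum>j<(2::nat) ^ m. ennreal (c * (T / 2 ^ m) powr (1 + \<beta>)))"
    proof (intro mult_left_mono sum_mono)
      fix j :: nat assume "j \<in> {..<2 ^ m}"
      then have j: "j \<le> 2 ^ m" "Suc j \<le> 2 ^ m" by auto
      have "dyadic_point T m (Suc j) - dyadic_point T m j = T / 2 ^ m"
        by (simp add: dyadic_point_def field_simps)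
      moreover have "0 \<le> T / 2 ^ m" using T by simp
      ultimately show "(\<integral>\<^sup>+\<omega>. ennreal (norm (Y (dyadic_point T m (Suc j)) \<omega> - Y (dyadic_point T m j) \<omega>) ^ p) \<partial>M)
          \<le> ennreal (c * (T / 2 ^ m) powr (1 + \<beta>))"
        using Y[of "dyadic_point T m j" "dyadic_point T m (Suc j)"] dp[OF j(1)] dp[OF j(2)] by auto
    qed simp
    also have "\<dots> = ennreal (R ^ m * (2 ^ m * (c * (T / 2 ^ m) powr (1 + \<beta>))))"
      using R0 c by (simp add: ennreal_mult ennreal_of_nat_eq_real_of_nat ennreal_power[symmetric])
    also have "R ^ m * (2 ^ m * (c * (T / 2 ^ m) powr (1 + \<beta>))) = c * T powr (1 + \<beta>) * q ^ m"
    proof -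
      have "(T / 2 ^ m) powr (1 + \<beta>) = T powr (1 + \<beta>) / (2 ^ m) powr (1 + \<beta>)"
        using T by (simp add: powr_divide)
      also have "((2::real) ^ m) powr (1 + \<beta>) = 2 ^ m * (R ^ m * R ^ m)"
        by (simp add: R_def powr_realpow[symmetric] powr_powr powr_add[symmetric] algebra_simps)
      finally have "R ^ m * (2 ^ m * (c * (T / 2 ^ m) powr (1 + \<beta>))) = c * T powr (1 + \<beta>) / R ^ m"
        using R0 by (simp add: field_simps)
      also have "\<dots> = c * T powr (1 + \<beta>) * q ^ m"
        using Rq R0 by (simp add: field_simps power_mult_distrib[symmetric])
      finally show ?thesis .
    qed
    finally show ?thesis .
  qed
  have "(\<integral>\<^sup>+\<omega>. (\<Sum>m. ennreal (e m \<omega>)) \<partial>M) = (\<Sum>m. \<integral>\<^sup>+\<omega>. ennreal (e m \<omega>) \<partial>M)"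
    by (rule nn_integral_suminf) measurable
  also have "\<dots> \<le> (\<Sum>m. ennreal (c * T powr (1 + \<beta>) * q ^ m))"
    by (intro suminf_le int) auto
  also have "\<dots> = ennreal (\<Sum>m. c * T powr (1 + \<beta>) * q ^ m)"
    using q c by (intro suminf_ennreal2 summable_mult summable_geometric) auto
  also have "\<dots> < \<infinity>" by simp
  finally have fin: "AE \<omega> in M. (\<Sum>m. ennreal (e m \<omega>)) \<noteq> \<infinity>"
    by (intro nn_integral_noteq_infinite) auto
  define good where "good = (\<lambda>\<omega>. (\<Sum>m. ennreal (e m \<omega>)) \<noteq> \<infinity>)"
  have "\<exists>x. continuous_on {0..T} x \<and> (\<forall>t\<in>{0..T}. (\<lambda>m. Y (dyadic_point T m (dyadic_index T m t)) \<omega>) \<longlonglongrightarrow> x t)"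
    if \<omega>: "good \<omega>" for \<omega>
  proof -
    obtain w where w: "(\<Sum>m. ennreal (e m \<omega>)) = ennreal w" "0 \<le> w"
      using \<omega> by (cases "\<Sum>m. ennreal (e m \<omega>)") (auto simp: good_def)
    have ew: "e m \<omega> \<le> w" for m
    proof -
      have "ennreal (e m \<omega>) \<le> (\<Sum>m. ennreal (e m \<omega>))"
        using sum_le_suminf[of "\<lambda>m. ennreal (e m \<omega>)" "{m}"] by simp
      then show ?thesis using w by (simp add: ennreal_le_iff)
    qed
    show ?thesis
    proof (rule dyadic_limit_continuous[OF T r, where v = "root p w"])
      fix m j :: nat assume j: "j < 2 ^ m"
      let ?n = "norm (Y (dyadic_point T m (Suc j)) \<omega> - Y (dyadic_point T m j) \<omega>)"
      have "R ^ m * ?n ^ p \<le> e m \<omega>"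
        unfolding e_def using R0 j by (intro mult_left_mono member_le_sum) auto
      then have "R ^ m * ?n ^ p \<le> w" using ew[of m] by simp
      then have "q ^ m * (R ^ m * ?n ^ p) \<le> q ^ m * w" using q by (intro mult_left_mono) auto
      moreover have "q ^ m * (R ^ m * ?n ^ p) = ?n ^ p"
        using Rq by (simp add: mult.assoc[symmetric] power_mult_distrib[symmetric] mult.commute)
      moreover have "q ^ m * w = (root p w * r ^ m) ^ p"
        using p w(2) rp by (simp add: power_mult_distrib power_mult[symmetric] mult.commute[of m p] real_root_pow_pos2)
          (simp add: power_mult)
      ultimately have "?n ^ p \<le> (root p w * r ^ m) ^ p" by simp
      then show "?n \<le> root p w * r ^ m"
        using p w(2) r by (subst (asm) power_mono_iff) auto
    qed
  qed
  then have "\<forall>\<omega>. \<exists>x. good \<omega> \<longrightarrow> continuous_on {0..T} x \<and> (\<forall>t\<in>{0..T}. (\<lambda>m. Y (dyadic_point T m (dyadic_index T m t)) \<omega>) \<longlonglongrightarrow> x t)"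
    by blast
  from choice[OF this] obtain x where x: "\<And>\<omega>. good \<omega> \<Longrightarrow> continuous_on {0..T} (x \<omega>)"
    "\<And>\<omega> t. good \<omega> \<Longrightarrow> t \<in> {0..T} \<Longrightarrow> (\<lambda>m. Y (dyadic_point T m (dyadic_index T m t)) \<omega>) \<longlonglongrightarrow> x \<omega> t"
    by blast
  define X where "X = (\<lambda>t \<omega>. if good \<omega> then x \<omega> t else 0)"
  have "continuous_on {0..T} (\<lambda>t. X t \<omega>)" for \<omega>
    using x(1) by (cases "good \<omega>") (auto simp: X_def)
  moreover have "AE \<omega> in M. X t \<omega> = Y t \<omega>" if t: "t \<in> {0..T}" for t
  proof -
    define d where "d = (\<lambda>m. dyadic_point T m (dyadic_index T m t))"
    have dr: "d m \<in> {0..T}" "d m \<le> t" "t - d m \<le> T / 2 ^ m" for m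
      using dyadic_point_bounds[OF T, of t m] t by (auto simp: d_def)
    have [measurable]: "Y (d m) \<in> borel_measurable M" "Y t \<in> borel_measurable M" for m
      using Ym dr t by auto
    define L where "L = (\<lambda>\<omega>. lim (\<lambda>m. Y (d m) \<omega>))"
    have Lm[measurable]: "L \<in> borel_measurable M"
      unfolding L_def by (rule borel_measurable_lim_metric) measurable
    have lim: "AE \<omega> in M. (\<lambda>m. Y (d m) \<omega>) \<longlonglongrightarrow> X t \<omega>"
      using fin[folded good_def] by eventually_elim (use x(2) t in \<open>simp add: X_def d_def\<close>)
    then have LX: "AE \<omega> in M. L \<omega> = X t \<omega>"
      by eventually_elim (simp add: L_def limI)
    have "(\<integral>\<^sup>+\<omega>. ennreal (norm (L \<omega> - Y t \<omega>) ^ p) \<partial>M) \<le> ennreal 0"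
    proof (rule nn_integral_le_of_tendsto)
      show "(\<integral>\<^sup>+\<omega>. ennreal (norm (Y (d m) \<omega> - Y t \<omega>) ^ p) \<partial>M) \<le> ennreal (c * (T / 2 ^ m) powr (1 + \<beta>))" for m
      proof -
        have "(\<integral>\<^sup>+\<omega>. ennreal (norm (Y (d m) \<omega> - Y t \<omega>) ^ p) \<partial>M) \<le> ennreal (c * (t - d m) powr (1 + \<beta>))"
          using Y[of "d m" t] dr[of m] t by (simp add: norm_minus_commute)
        also have "\<dots> \<le> ennreal (c * (T / 2 ^ m) powr (1 + \<beta>))"
          using dr[of m] c \<beta> by (intro ennreal_leI mult_left_mono powr_mono2) auto
        finally show ?thesis .
      qed
      show "AE \<omega> in M. (\<lambda>m. ennreal (norm (Y (d m) \<omega> - Y t \<omega>) ^ p)) \<longlonglongrightarrow> ennreal (norm (L \<omega> - Y t \<omega>) ^ p)"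
        using lim LX by eventually_elim (auto intro!: tendsto_ennrealI tendsto_intros)
      have "(\<lambda>m. T / 2 ^ m) \<longlonglongrightarrow> 0"
        using tendsto_mult[OF tendsto_const[of T] LIMSEQ_power_zero[of "1/2::real"]] by (simp add: power_divide)
      then have "(\<lambda>m. (T / 2 ^ m) powr (1 + \<beta>)) \<longlonglongrightarrow> 0 powr (1 + \<beta>)"
        using \<beta> T by (intro tendsto_powr') auto
      from tendsto_ennrealI[OF tendsto_mult[OF tendsto_const[of c] this]]
      show "(\<lambda>m. ennreal (c * (T / 2 ^ m) powr (1 + \<beta>))) \<longlonglongrightarrow> ennreal 0" by simp
    qed measurable
    then have "AE \<omega> in M. L \<omega> - Y t \<omega> = 0"
      using p by (intro AE_eq_0_of_nn_integral_power[where p = p]) auto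
    with LX show ?thesis by eventually_elim simp
  qed
  ultimately show ?thesis by blast
qed

text \<open>
  Weighted by \<open>(4 ^ k) ^ n\<close>, the moments of the increments are still summable.  Where the sum \<open>S\<close> of these weighted
  powers is finite, it dominates every increment and hence every tail of the sequence.
\<close>

lemma (in prob_space) geometric_moment_limit:
  fixes f :: "nat \<Rightarrow> 'a \<Rightarrow> 'b::{banach, second_countable_topology}"
  assumes f[measurable]: "\<And>k. f k \<in> borel_measurable M" and n: "1 \<le> n" and D: "0 \<le> D"
    and inc: "\<And>k. (\<integral>\<^sup>+\<omega>. ennreal (norm (f (Suc k) \<omega> - f k \<omega>) ^ (2 * n)) \<partial>M) \<le> ennreal ((D * (1/8) ^ k) ^ n)"
  shows "AE \<omega> in M. (\<lambda>k. f k \<omega>) \<longlonglongrightarrow> lim (\<lambda>k. f k \<omega>)"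
    and "(\<integral>\<^sup>+\<omega>. ennreal (norm (f k \<omega> - lim (\<lambda>k. f k \<omega>)) ^ (2 * n)) \<partial>M) \<le> ennreal ((8 * D * (1/4) ^ k) ^ n)"
proof -
  define v where "v = (\<lambda>k \<omega>. (4 ^ k) ^ n * norm (f (Suc k) \<omega> - f k \<omega>) ^ (2 * n))"
  define S where "S = (\<lambda>\<omega>. \<Sum>k. ennreal (v k \<omega>))"
  have vm[measurable]: "v k \<in> borel_measurable M" for k unfolding v_def by measurable
  have v0: "0 \<le> v k \<omega>" for k \<omega> by (simp add: v_def)
  have Sm[measurable]: "S \<in> borel_measurable M" unfolding S_def by measurable
  have "(\<integral>\<^sup>+\<omega>. ennreal (v k \<omega>) \<partial>M) \<le> ennreal (D ^ n * ((1/2) ^ n) ^ k)" for k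
  proof -
    have "(\<integral>\<^sup>+\<omega>. ennreal (v k \<omega>) \<partial>M) = (\<integral>\<^sup>+\<omega>. ennreal ((4 ^ k) ^ n) * ennreal (norm (f (Suc k) \<omega> - f k \<omega>) ^ (2 * n)) \<partial>M)"
      by (simp add: v_def ennreal_mult)
    also have "\<dots> = ennreal ((4 ^ k) ^ n) * (\<integral>\<^sup>+\<omega>. ennreal (norm (f (Suc k) \<omega> - f k \<omega>) ^ (2 * n)) \<partial>M)"
      by (rule nn_integral_cmult) measurable
    also have "\<dots> \<le> ennreal ((4 ^ k) ^ n) * ennreal ((D * (1/8) ^ k) ^ n)"
      using inc by (intro mult_left_mono) auto
    also have "\<dots> = ennreal ((4 ^ k * (D * (1/8) ^ k)) ^ n)"
      using D by (subst power_mult_distrib) (simp add: ennreal_mult)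
    also have "(4::real) ^ k * (D * (1/8) ^ k) = D * (1/2) ^ k"
    proof -
      have "(4::real) ^ k * (1/8) ^ k = (1/2) ^ k" by (simp add: power_mult_distrib[symmetric])
      then show ?thesis by (metis mult.left_commute)
    qed
    also have "(D * (1/2) ^ k) ^ n = D ^ n * ((1/2) ^ n) ^ k"
      by (simp only: power_mult_distrib power_mult[symmetric] mult.commute)
    finally show ?thesis .
  qed
  moreover have half: "(1/2::real) ^ n \<le> 1/2"
    using n power_decreasing[of 1 n "1/2::real"] by simp
  ultimately have S: "(\<integral>\<^sup>+\<omega>. S \<omega> \<partial>M) \<le> ennreal (2 * D ^ n)"
  proof -
    assume le: "\<And>k. (\<integral>\<^sup>+\<omega>. ennreal (v k \<omega>) \<partial>M) \<le> ennreal (D ^ n * ((1/2) ^ n) ^ k)"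
    have "(\<integral>\<^sup>+\<omega>. S \<omega> \<partial>M) = (\<Sum>k. \<integral>\<^sup>+\<omega>. ennreal (v k \<omega>) \<partial>M)"
      unfolding S_def by (rule nn_integral_suminf) measurable
    also have "\<dots> \<le> (\<Sum>k. ennreal (D ^ n * (1/2) ^ k))"
    proof (intro suminf_le)
      fix k
      have "((1/2::real) ^ n) ^ k \<le> (1/2) ^ k" using half by (intro power_mono) auto
      then have "D ^ n * ((1/2) ^ n) ^ k \<le> D ^ n * (1/2) ^ k" using D by (intro mult_left_mono) auto
      then show "(\<integral>\<^sup>+\<omega>. ennreal (v k \<omega>) \<partial>M) \<le> ennreal (D ^ n * (1/2) ^ k)"
        using le[of k] by (meson ennreal_leI order_trans)
    qed auto
    also have "\<dots> = ennreal (\<Sum>k. D ^ n * (1/2) ^ k)"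
      using D by (intro suminf_ennreal2 summable_mult summable_geometric) auto
    also have "(\<Sum>k. D ^ n * (1/2) ^ k) = 2 * D ^ n"
      using suminf_geometric[of "1/2::real"] by (simp add: suminf_mult summable_geometric)
    finally show ?thesis .
  qed
  have fin: "AE \<omega> in M. S \<omega> \<noteq> \<infinity>"
    using S by (intro nn_integral_noteq_infinite) (auto simp: top_unique)
  have path: "(\<lambda>k. f k \<omega>) \<longlonglongrightarrow> lim (\<lambda>k. f k \<omega>) \<and>
      (\<forall>k. ennreal (norm (f k \<omega> - lim (\<lambda>k. f k \<omega>)) ^ (2 * n)) \<le> ennreal (4 ^ n * ((1/4) ^ k) ^ n) * S \<omega>)"
    if \<omega>: "S \<omega> \<noteq> \<infinity>" for \<omega>
  proof -
    obtain w where w: "S \<omega> = ennreal w" "0 \<le> w" using \<omega> by (cases "S \<omega>") auto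
    define r where "r = root (2 * n) w"
    have r: "0 \<le> r" "r ^ (2 * n) = w" using n w(2) by (auto simp: r_def real_root_pow_pos2)
    have step: "norm (f (Suc k) \<omega> - f k \<omega>) \<le> r * (1/2) ^ k" for k
    proof -
      have "ennreal (v k \<omega>) \<le> S \<omega>"
        unfolding S_def using sum_le_suminf[of "\<lambda>k. ennreal (v k \<omega>)" "{k}"] by simp
      then have "v k \<omega> \<le> w" using w by (simp add: ennreal_le_iff)
      then have "((1/4) ^ k) ^ n * v k \<omega> \<le> ((1/4) ^ k) ^ n * w" by (intro mult_left_mono) auto
      moreover have "((1/4) ^ k) ^ n * v k \<omega> = norm (f (Suc k) \<omega> - f k \<omega>) ^ (2 * n)"
      proof -
        have "((1/4::real) ^ k) ^ n * (4 ^ k) ^ n = 1" by (simp add: power_mult_distrib[symmetric])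
        then show ?thesis by (simp add: v_def mult.assoc[symmetric])
      qed
      moreover have "((1/4) ^ k) ^ n * w = (r * (1/2) ^ k) ^ (2 * n)"
      proof -
        have "((1/2::real) ^ k) ^ (2 * n) = (((1/2) ^ 2) ^ k) ^ n"
          by (simp only: power_mult[symmetric] mult_ac)
        then show ?thesis by (simp add: power_mult_distrib r(2) power_divide)
      qed
      ultimately have "norm (f (Suc k) \<omega> - f k \<omega>) ^ (2 * n) \<le> (r * (1/2) ^ k) ^ (2 * n)" by simp
      then show ?thesis using n r(1) by (subst (asm) power_mono_iff) auto
    qed
    have "summable (\<lambda>k. f (Suc k) \<omega> - f k \<omega>)"
      by (rule summable_comparison_test'[where N = 0 and g = "\<lambda>k. r * (1/2) ^ k"])
         (use step in \<open>auto intro!: summable_mult summable_geometric\<close>)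
    from convergent_of_summable_differences[OF this]
    have lim: "(\<lambda>k. f k \<omega>) \<longlonglongrightarrow> lim (\<lambda>k. f k \<omega>)" by (simp add: convergent_LIMSEQ_iff)
    have tail: "norm (f (m + k) \<omega> - f k \<omega>) \<le> r * (1/2) ^ k * (2 * (1 - (1/2) ^ m))" for k m
    proof (induction m)
      case (Suc m)
      have "norm (f (Suc m + k) \<omega> - f k \<omega>) \<le> norm (f (Suc (m + k)) \<omega> - f (m + k) \<omega>) + norm (f (m + k) \<omega> - f k \<omega>)"
        using norm_triangle_ineq[of "f (Suc (m + k)) \<omega> - f (m + k) \<omega>" "f (m + k) \<omega> - f k \<omega>"] by simp
      also have "\<dots> \<le> r * (1/2) ^ (m + k) + r * (1/2) ^ k * (2 * (1 - (1/2) ^ m))"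
        by (intro add_mono step Suc)
      also have "\<dots> = r * (1/2) ^ k * (2 * (1 - (1/2) ^ Suc m))"
        by (simp add: power_add algebra_simps)
      finally show ?case .
    qed simp
    have "norm (f k \<omega> - lim (\<lambda>k. f k \<omega>)) \<le> r * (1/2) ^ k * 2" for k
    proof (rule LIMSEQ_le_const2)
      show "(\<lambda>m. norm (f k \<omega> - f (m + k) \<omega>)) \<longlonglongrightarrow> norm (f k \<omega> - lim (\<lambda>k. f k \<omega>))"
        by (intro tendsto_norm tendsto_diff tendsto_const LIMSEQ_ignore_initial_segment[OF lim])
      have "r * (1/2) ^ k * (2 * (1 - (1/2) ^ m)) \<le> r * (1/2) ^ k * 2" for m
        using r(1) by (intro mult_left_mono) auto
      then show "\<exists>N. \<forall>m\<ge>N. norm (f k \<omega> - f (m + k) \<omega>) \<le> r * (1/2) ^ k * 2"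
        using order_trans[OF tail] by (auto simp: norm_minus_commute)
    qed
    then have "norm (f k \<omega> - lim (\<lambda>k. f k \<omega>)) ^ (2 * n) \<le> (r * (1/2) ^ k * 2) ^ (2 * n)" for k
      by (intro power_mono) auto
    moreover have "(r * (1/2) ^ k * 2) ^ (2 * n) = 4 ^ n * ((1/4) ^ k) ^ n * w" for k
    proof -
      have "((1/2::real) ^ k) ^ (2 * n) = (((1/2) ^ 2) ^ k) ^ n"
        by (simp only: power_mult[symmetric] mult_ac)
      moreover have "(2::real) ^ (2 * n) = 4 ^ n" by (simp add: power_mult)
      ultimately show ?thesis by (simp add: power_mult_distrib r(2) power_divide)
    qed
    ultimately have "ennreal (norm (f k \<omega> - lim (\<lambda>k. f k \<omega>)) ^ (2 * n)) \<le> ennreal (4 ^ n * ((1/4) ^ k) ^ n * w)" for k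
      by (intro ennreal_leI) simp
    then show ?thesis using lim w by (simp add: ennreal_mult)
  qed
  show "AE \<omega> in M. (\<lambda>k. f k \<omega>) \<longlonglongrightarrow> lim (\<lambda>k. f k \<omega>)"
    using fin by eventually_elim (use path in blast)
  have "(\<integral>\<^sup>+\<omega>. ennreal (norm (f k \<omega> - lim (\<lambda>k. f k \<omega>)) ^ (2 * n)) \<partial>M) \<le> (\<integral>\<^sup>+\<omega>. ennreal (4 ^ n * ((1/4) ^ k) ^ n) * S \<omega> \<partial>M)"
  proof (rule nn_integral_mono_AE)
    show "AE \<omega> in M. ennreal (norm (f k \<omega> - lim (\<lambda>k. f k \<omega>)) ^ (2 * n)) \<le> ennreal (4 ^ n * ((1/4) ^ k) ^ n) * S \<omega>"
      using fin by eventually_elim (use path in blast)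
  qed
  also have "\<dots> = ennreal (4 ^ n * ((1/4) ^ k) ^ n) * (\<integral>\<^sup>+\<omega>. S \<omega> \<partial>M)"
    by (rule nn_integral_cmult) measurable
  also have "\<dots> \<le> ennreal (4 ^ n * ((1/4) ^ k) ^ n) * ennreal (2 * D ^ n)"
    using S by (intro mult_left_mono) auto
  also have "\<dots> = ennreal (2 * (4 * D * (1/4) ^ k) ^ n)"
    using D by (simp add: ennreal_mult[symmetric] power_mult_distrib mult_ac)
  also have "\<dots> \<le> ennreal ((8 * D * (1/4) ^ k) ^ n)"
  proof (rule ennreal_leI)
    have "2 * (4 * D * (1/4) ^ k) ^ n \<le> 2 ^ n * (4 * D * (1/4) ^ k) ^ n"
      using n D power_increasing[of 1 n "2::real"] by (intro mult_right_mono) auto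
    also have "\<dots> = (2 * (4 * D * (1/4) ^ k)) ^ n" by (rule power_mult_distrib[symmetric])
    finally show "2 * (4 * D * (1/4) ^ k) ^ n \<le> (8 * D * (1/4) ^ k) ^ n" by (simp add: mult.assoc[symmetric])
  qed
  finally show "(\<integral>\<^sup>+\<omega>. ennreal (norm (f k \<omega> - lim (\<lambda>k. f k \<omega>)) ^ (2 * n)) \<partial>M) \<le> ennreal ((8 * D * (1/4) ^ k) ^ n)" .
qed

section \<open>Moment bounds for convolutions\<close>

lemma norm_add_power_le:
  fixes x y :: "'b::real_normed_vector"
  shows "norm (x + y) ^ (2 * n) \<le> 4 ^ n * (norm x ^ (2 * n) + norm y ^ (2 * n))"
proof -
  define m where "m = max (norm x) (norm y)"
  have m: "norm x \<le> m" "norm y \<le> m" "m = norm x \<or> m = norm y" by (auto simp: m_def max_def)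
  have "norm (x + y) \<le> 2 * m"
    using norm_triangle_ineq[of x y] m by linarith
  then have "norm (x + y) ^ (2 * n) \<le> (2 * m) ^ (2 * n)" by (intro power_mono) auto
  also have "\<dots> = 2 ^ (2 * n) * m ^ (2 * n)" by (rule power_mult_distrib)
  also have "(2::real) ^ (2 * n) = 4 ^ n" by (simp add: power_mult)
  also have "4 ^ n * m ^ (2 * n) \<le> 4 ^ n * (norm x ^ (2 * n) + norm y ^ (2 * n))"
    using m(3) by (intro mult_left_mono) auto
  finally show ?thesis .
qed

lemma power_add_le_power:
  fixes x y :: real
  assumes "0 \<le> x" "0 \<le> y" "1 \<le> n"
  shows "x ^ n + y ^ n \<le> (x + y) ^ n"
  using \<open>1 \<le> n\<close>
proof (induction n rule: dec_induct)
  case (step n)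
  have "x ^ Suc n + y ^ Suc n \<le> (x + y) * (x ^ n + y ^ n)"
    using assms by (simp add: algebra_simps)
  also have "\<dots> \<le> (x + y) * (x + y) ^ n" using assms step by (intro mult_left_mono) auto
  finally show ?case by simp
qed simp

text \<open>
  Jensen's inequality for \<open>y \<mapsto> y ^ n\<close> and the finite measure with density \<open>w\<close>.  The function lies above its
  tangent at the mean \<open>m\<close>, by Bernoulli's inequality, and the tangent is integrated.
\<close>

lemma weighted_power_mean:
  fixes w y :: "'b \<Rightarrow> real"
  assumes [measurable]: "w \<in> borel_measurable N" "y \<in> borel_measurable N"
    and w: "\<And>x. 0 \<le> w x" and y: "\<And>x. 0 \<le> y x"
    and J: "(\<integral>\<^sup>+x. ennreal (w x * y x) \<partial>N) = ennreal J" "0 \<le> J"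
    and V: "(\<integral>\<^sup>+x. ennreal (w x) \<partial>N) \<le> ennreal V" "0 \<le> V" and n: "1 \<le> n"
  shows "ennreal (J ^ n) \<le> ennreal (V ^ (n - 1)) * (\<integral>\<^sup>+x. ennreal (w x * y x ^ n) \<partial>N)"
proof (cases "J = 0")
  case False
  then have J0: "0 < J" using J by simp
  have V0: "0 < V"
  proof (rule ccontr)
    assume "\<not> 0 < V"
    then have "(\<integral>\<^sup>+x. ennreal (w x) \<partial>N) = 0" using V by (simp add: le_less)
    then have "AE x in N. ennreal (w x) = 0" by (subst (asm) nn_integral_0_iff_AE) auto
    then have "AE x in N. ennreal (w x * y x) = 0"
    proof eventually_elim
      case (elim x)
      then have "w x = 0" using w[of x] by (simp add: ennreal_eq_0_iff)
      then show ?case by simp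
    qed
    then have "(\<integral>\<^sup>+x. ennreal (w x * y x) \<partial>N) = 0" by (subst nn_integral_0_iff_AE) auto
    then show False using J J0 by simp
  qed
  define m where "m = J / V"
  have m0: "0 < m" using J0 V0 by (simp add: m_def)
  show ?thesis
  proof (cases "\<integral>\<^sup>+x. ennreal (w x * y x ^ n) \<partial>N")
    case (real I)
    have tangent: "real n * m ^ (n - 1) * y x \<le> y x ^ n + real (n - 1) * m ^ n" for x
    proof -
      have "1 + real n * (y x / m - 1) \<le> (1 + (y x / m - 1)) ^ n"
        using y[of x] m0 by (intro Bernoulli_inequality) auto
      then have "m ^ n * (1 + real n * (y x / m - 1)) \<le> m ^ n * (y x / m) ^ n"
        using m0 by (intro mult_left_mono) auto
      moreover have "m ^ n * (y x / m) ^ n = y x ^ n" using m0 by (simp add: power_divide)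
      moreover have "m ^ n * (1 + real n * (y x / m - 1)) = real n * m ^ (n - 1) * y x - real (n - 1) * m ^ n"
        using m0 n by (cases n) (auto simp: field_simps)
      ultimately show ?thesis by simp
    qed
    have "ennreal (real n * m ^ (n - 1)) * ennreal J = (\<integral>\<^sup>+x. ennreal (real n * m ^ (n - 1)) * ennreal (w x * y x) \<partial>N)"
      unfolding J(1)[symmetric] by (rule nn_integral_cmult[symmetric]) measurable
    also have "\<dots> \<le> (\<integral>\<^sup>+x. ennreal (w x * y x ^ n) + ennreal (real (n - 1) * m ^ n) * ennreal (w x) \<partial>N)"
    proof (rule nn_integral_mono)
      fix x
      have "w x * (real n * m ^ (n - 1) * y x) \<le> w x * (y x ^ n + real (n - 1) * m ^ n)"
        using tangent w by (intro mult_left_mono) auto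
      then have "ennreal (real n * m ^ (n - 1) * (w x * y x)) \<le> ennreal (w x * y x ^ n + real (n - 1) * m ^ n * w x)"
        by (intro ennreal_leI) (simp add: algebra_simps)
      then show "ennreal (real n * m ^ (n - 1)) * ennreal (w x * y x) \<le> ennreal (w x * y x ^ n) + ennreal (real (n - 1) * m ^ n) * ennreal (w x)"
        using m0 w[of x] y[of x] by (simp add: ennreal_mult)
    qed
    also have "\<dots> = ennreal I + ennreal (real (n - 1) * m ^ n) * (\<integral>\<^sup>+x. ennreal (w x) \<partial>N)"
      using real by (simp add: nn_integral_add nn_integral_cmult)
    also have "\<dots> \<le> ennreal I + ennreal (real (n - 1) * m ^ n) * ennreal V"
      using V by (intro add_left_mono mult_left_mono) auto
    finally have "real n * m ^ (n - 1) * J \<le> I + real (n - 1) * m ^ n * V"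
      using m0 J V real by (simp add: ennreal_mult[symmetric] ennreal_plus[symmetric] ennreal_le_iff del: ennreal_plus)
    moreover have "real n * m ^ (n - 1) * J = real n * m ^ n * V"
    proof -
      have "J = m * V" using V0 by (simp add: m_def)
      then show ?thesis using n by (cases n) (simp_all add: mult_ac)
    qed
    ultimately have "real n * m ^ n * V \<le> I + real (n - 1) * m ^ n * V" by linarith
    moreover have "real n * m ^ n * V = real (n - 1) * m ^ n * V + m ^ n * V"
    proof -
      have "real n = real (n - 1) + 1" using n by simp
      then show ?thesis by (metis distrib_right mult_1)
    qed
    ultimately have "m ^ n * V \<le> I" by linarith
    then have "V ^ (n - 1) * (m ^ n * V) \<le> V ^ (n - 1) * I" using V0 by (intro mult_left_mono) auto
    moreover have "V ^ (n - 1) * (m ^ n * V) = J ^ n"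
    proof -
      have "J = m * V" using V0 by (simp add: m_def)
      then show ?thesis using n by (cases n) (simp_all add: power_mult_distrib)
    qed
    ultimately have "J ^ n \<le> V ^ (n - 1) * I" by simp
    then have "ennreal (J ^ n) \<le> ennreal (V ^ (n - 1) * I)" by (rule ennreal_leI)
    then show ?thesis using V0 real by (simp add: ennreal_mult)
  next
    case top
    then show ?thesis using V0 by (simp add: ennreal_mult_top)
  qed
qed (use n in \<open>simp add: zero_power\<close>)

context brownian
begin

lemma drift_measurable:
  fixes \<kappa> :: "real \<Rightarrow> real ^ 'd::finite ^ 'd" and \<beta> :: "real \<Rightarrow> 'a \<Rightarrow> real ^ 'd"
  assumes \<kappa>: "\<kappa> \<in> borel_measurable borel" and \<beta>: "left_adapted \<beta>" and t: "0 \<le> t" "t \<le> T"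
  shows "(\<lambda>\<omega>. LINT s:{0..t}|lborel. \<kappa> s *v \<beta> s \<omega>) \<in> borel_measurable (F t)"
proof -
  interpret L: sigma_finite_measure "lebesgue_upto t"
    by (rule sigma_finite_measure_restrict_space[OF sigma_finite_lborel]) auto
  have "(\<lambda>(u, \<omega>). \<beta> u \<omega>) \<in> borel_measurable (restrict_space borel {0..t} \<Otimes>\<^sub>M F t)"
    using left_adapted_progressive[OF \<beta> t(2)] t by (auto simp: progressively_measurable_def)
  then have b: "(\<lambda>x. \<beta> (fst x) (snd x)) \<in> borel_measurable (lebesgue_upto t \<Otimes>\<^sub>M F t)"
    unfolding measurable_lebesgue_upto_pair by (simp add: case_prod_beta)
  have a: "(\<lambda>x. \<kappa> (fst x)) \<in> borel_measurable (lebesgue_upto t \<Otimes>\<^sub>M F t)"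
    by (rule measurable_compose[OF measurable_fst measurable_lebesgue_upto[OF \<kappa>]])
  have "(\<lambda>x. \<kappa> (fst x) *v \<beta> (fst x) (snd x)) \<in> borel_measurable (lebesgue_upto t \<Otimes>\<^sub>M F t)"
    using a b by measurable
  then have "(\<lambda>(\<omega>, u). \<kappa> u *v \<beta> u \<omega>) \<in> borel_measurable (F t \<Otimes>\<^sub>M lebesgue_upto t)"
    by (subst measurable_pair_swap_iff) (simp add: case_prod_beta)
  then have "(\<lambda>\<omega>. \<integral>u. \<kappa> u *v \<beta> u \<omega> \<partial>lebesgue_upto t) \<in> borel_measurable (F t)"
    by (rule L.borel_measurable_lebesgue_integral)
  then show ?thesis
    by (simp add: set_lebesgue_integral_def integral_restrict_space)
qed

lemma drift_integrable:
  fixes \<kappa> :: "real \<Rightarrow> real ^ 'd::finite ^ 'd" and \<beta> :: "real \<Rightarrow> 'a \<Rightarrow> real ^ 'd"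
  assumes \<kappa>: "\<kappa> \<in> borel_measurable borel"
    and fin: "(\<integral>\<^sup>+s\<in>{0..t}. ennreal ((norm (\<kappa> s))\<^sup>2) \<partial>lborel) < \<infinity>"
    and \<beta>: "left_adapted \<beta>" and t: "0 \<le> t" "t \<le> T" and \<omega>: "\<omega> \<in> space M"
  shows "set_integrable lborel {0..t} (\<lambda>s. \<kappa> s *v \<beta> s \<omega>)"
proof -
  obtain B where B: "0 \<le> B" "\<And>u. u \<in> {0..T} \<Longrightarrow> norm (\<beta> u \<omega>) \<le> B"
    by (rule left_adapted_bounded[OF \<beta> \<omega>]) blast
  have \<kappa>m: "\<kappa> \<in> borel_measurable (lebesgue_upto t)" by (rule measurable_lebesgue_upto[OF \<kappa>])
  have m: "(\<lambda>s. \<kappa> s *v \<beta> s \<omega>) \<in> borel_measurable (lebesgue_upto t)"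
    using left_adapted_path_measurable[OF \<beta> t \<omega>] \<kappa>m by measurable
  have "(\<integral>\<^sup>+s. ennreal (norm (\<kappa> s *v \<beta> s \<omega>)) \<partial>lebesgue_upto t) \<le> (\<integral>\<^sup>+s. ennreal B * (1 + ennreal ((norm (\<kappa> s))\<^sup>2)) \<partial>lebesgue_upto t)"
  proof (rule nn_integral_mono)
    fix s assume "s \<in> space (lebesgue_upto t)"
    then have "norm (\<beta> s \<omega>) \<le> B" using t by (intro B) (auto simp: space_restrict_space)
    moreover have "norm (\<kappa> s) \<le> 1 + (norm (\<kappa> s))\<^sup>2"
    proof -
      have "2 * norm (\<kappa> s) \<le> 1 + (norm (\<kappa> s))\<^sup>2"
        using zero_le_power2[of "norm (\<kappa> s) - 1"] unfolding power2_eq_square by (simp add: algebra_simps)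
      then show ?thesis using norm_ge_zero[of "\<kappa> s"] by linarith
    qed
    ultimately have "norm (\<kappa> s *v \<beta> s \<omega>) \<le> (1 + (norm (\<kappa> s))\<^sup>2) * B"
      by (intro order_trans[OF norm_matrix_vector_mult_le] mult_mono) auto
    then have "ennreal (norm (\<kappa> s *v \<beta> s \<omega>)) \<le> ennreal (B * (1 + (norm (\<kappa> s))\<^sup>2))"
      by (intro ennreal_leI) (simp add: mult.commute)
    then show "ennreal (norm (\<kappa> s *v \<beta> s \<omega>)) \<le> ennreal B * (1 + ennreal ((norm (\<kappa> s))\<^sup>2))"
      using B(1) by (simp add: ennreal_mult)
  qed
  also have "\<dots> = ennreal B * (ennreal t + (\<integral>\<^sup>+s. ennreal ((norm (\<kappa> s))\<^sup>2) \<partial>lebesgue_upto t))"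
    using \<kappa>m t by (simp add: nn_integral_cmult nn_integral_add emeasure_restrict_space space_restrict_space)
  also have "\<dots> < \<infinity>"
    using fin by (simp add: nn_integral_lebesgue_upto ennreal_mult_less_top)
  finally have "integrable (lebesgue_upto t) (\<lambda>s. \<kappa> s *v \<beta> s \<omega>)"
    using m by (intro integrableI_bounded) auto
  then show ?thesis by (simp add: set_integrable_def integrable_restrict_space)
qed

text \<open>
  The Cauchy-Schwarz inequality in time, then the power mean inequality with weight
  \<open>(norm (\<kappa> u))\<^sup>2 * g u\<close> applied to \<open>(norm (\<beta> u))\<^sup>2 / g u\<close>, whose \<open>n\<close>-th moment is at most 1.
\<close>

lemma drift_moment:
  fixes \<kappa> :: "real \<Rightarrow> real ^ 'd::finite ^ 'd" and \<beta> :: "real \<Rightarrow> 'a \<Rightarrow> real ^ 'd"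
  assumes \<kappa>: "\<kappa> \<in> borel_measurable borel"
    and fin: "(\<integral>\<^sup>+s\<in>{0..t}. ennreal ((norm (\<kappa> s))\<^sup>2) \<partial>lborel) < \<infinity>"
    and \<beta>: "left_adapted \<beta>" and t: "0 \<le> t" "t \<le> T" and n: "1 \<le> n" and g: "mono_on {0..t} g"
       "\<And>u. u \<in> {0..t} \<Longrightarrow> 0 < g u \<and> (\<integral>\<^sup>+\<omega>. ennreal (norm (\<beta> u \<omega>) ^ (2 * n)) \<partial>P) \<le> ennreal (g u ^ n)"
    and V: "0 \<le> V" "(\<integral>\<^sup>+u\<in>{0..t}. ennreal ((norm (\<kappa> u))\<^sup>2 * g u) \<partial>lborel) \<le> ennreal V"
  shows "(\<integral>\<^sup>+\<omega>. ennreal (norm (LINT s:{0..t}|lborel. \<kappa> s *v \<beta> s \<omega>) ^ (2 * n)) \<partial>P) \<le> ennreal ((t * V) ^ n)"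
proof -
  let ?L = "lebesgue_upto t"
  interpret L: sigma_finite_measure ?L
    by (rule sigma_finite_measure_restrict_space[OF sigma_finite_lborel]) auto
  interpret PL: pair_sigma_finite ?L P ..
  have \<kappa>m[measurable]: "\<kappa> \<in> borel_measurable ?L" by (rule measurable_lebesgue_upto[OF \<kappa>])
  \<comment> \<open>Outside \<open>[0, t]\<close> the sign of \<open>g\<close> is unknown; the value 1 allows division everywhere.\<close>
  define h where "h = (\<lambda>u. if u \<in> {0..t} then g u else 1)"
  have h0: "0 < h u" for u using g(2)[of u] by (simp add: h_def)
  have gm[measurable]: "h \<in> borel_measurable ?L"
  proof -
    have "g \<in> borel_measurable (restrict_space borel {0..t})"
      using g(1) by (rule borel_measurable_mono_on_fnc)
    moreover have "measurable (restrict_space borel {0..t}) borel = measurable ?L (borel :: real measure)"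
      by (intro measurable_cong_sets sets_restrict_space_cong) auto
    ultimately have "g \<in> borel_measurable ?L" by simp
    then show ?thesis
      by (rule measurable_cong[THEN iffD1, rotated]) (auto simp: h_def space_restrict_space)
  qed
  have bj: "(\<lambda>(u, \<omega>). \<beta> u \<omega>) \<in> borel_measurable (restrict_space borel {0..t} \<Otimes>\<^sub>M F t)"
    using left_adapted_progressive[OF \<beta> t(2)] t by (auto simp: progressively_measurable_def)
  have bP: "(\<lambda>x. \<beta> (fst x) (snd x)) \<in> borel_measurable (?L \<Otimes>\<^sub>M P)"
  proof -
    have "(\<lambda>x. (fst x, snd x)) \<in> measurable (?L \<Otimes>\<^sub>M P) (?L \<Otimes>\<^sub>M F t)"
      by (intro measurable_Pair measurable_fst measurable_compose[OF measurable_snd measurable_F_P[OF measurable_ident_sets[OF refl]]])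
    from measurable_compose[OF this bj[unfolded measurable_lebesgue_upto_pair]] show ?thesis
      by (simp add: case_prod_beta)
  qed
  define w where "w = (\<lambda>u. (norm (\<kappa> u))\<^sup>2 * h u)"
  define y where "y = (\<lambda>\<omega> u. (norm (\<beta> u \<omega>))\<^sup>2 / h u)"
  have wm[measurable]: "w \<in> borel_measurable ?L" unfolding w_def by measurable
  have w0: "0 \<le> w u" and y0: "0 \<le> y \<omega> u" for u \<omega> using h0[of u] by (auto simp: w_def y_def)
  have wV: "(\<integral>\<^sup>+u. ennreal (w u) \<partial>?L) \<le> ennreal V"
  proof -
    have "(\<integral>\<^sup>+u. ennreal (w u) \<partial>?L) = (\<integral>\<^sup>+u\<in>{0..t}. ennreal ((norm (\<kappa> u))\<^sup>2 * g u) \<partial>lborel)"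
      unfolding nn_integral_lebesgue_upto[symmetric]
      by (intro nn_integral_cong) (auto simp: w_def h_def indicator_def)
    then show ?thesis using V by simp
  qed
  have path: "ennreal (norm (LINT s:{0..t}|lborel. \<kappa> s *v \<beta> s \<omega>) ^ (2 * n)) \<le> ennreal (t ^ n * V ^ (n - 1)) * (\<integral>\<^sup>+u. ennreal (w u * y \<omega> u ^ n) \<partial>?L)"
    if \<omega>: "\<omega> \<in> space M" for \<omega>
  proof -
    obtain B where B: "0 \<le> B" "\<And>u. u \<in> {0..T} \<Longrightarrow> norm (\<beta> u \<omega>) \<le> B"
      by (rule left_adapted_bounded[OF \<beta> \<omega>]) blast
    have \<beta>m[measurable]: "(\<lambda>u. \<beta> u \<omega>) \<in> borel_measurable ?L"
      by (rule left_adapted_path_measurable[OF \<beta> t \<omega>])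
    have ym[measurable]: "y \<omega> \<in> borel_measurable ?L" unfolding y_def by measurable
    have wy: "w u * y \<omega> u = (norm (\<kappa> u))\<^sup>2 * (norm (\<beta> u \<omega>))\<^sup>2" for u
      using h0[of u] by (simp add: w_def y_def)
    have "(\<integral>\<^sup>+u. ennreal (w u * y \<omega> u) \<partial>?L) \<le> (\<integral>\<^sup>+u. ennreal (B\<^sup>2) * ennreal ((norm (\<kappa> u))\<^sup>2) \<partial>?L)"
    proof (rule nn_integral_mono)
      fix u assume "u \<in> space ?L"
      then have "norm (\<beta> u \<omega>) \<le> B" using t by (intro B) (auto simp: space_restrict_space)
      then have "(norm (\<beta> u \<omega>))\<^sup>2 \<le> B\<^sup>2" by (intro power_mono) auto
      then have "w u * y \<omega> u \<le> B\<^sup>2 * (norm (\<kappa> u))\<^sup>2"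
        using mult_left_mono[of "(norm (\<beta> u \<omega>))\<^sup>2" "B\<^sup>2" "(norm (\<kappa> u))\<^sup>2"] by (simp add: wy mult.commute)
      then show "ennreal (w u * y \<omega> u) \<le> ennreal (B\<^sup>2) * ennreal ((norm (\<kappa> u))\<^sup>2)"
        by (simp add: ennreal_mult[symmetric] ennreal_leI)
    qed
    also have "\<dots> < \<infinity>"
      using fin by (simp add: nn_integral_cmult nn_integral_lebesgue_upto ennreal_mult_less_top)
    finally obtain J where J: "(\<integral>\<^sup>+u. ennreal (w u * y \<omega> u) \<partial>?L) = ennreal J" "0 \<le> J"
      by (cases "\<integral>\<^sup>+u. ennreal (w u * y \<omega> u) \<partial>?L") auto
    have pm: "ennreal (J ^ n) \<le> ennreal (V ^ (n - 1)) * (\<integral>\<^sup>+u. ennreal (w u * y \<omega> u ^ n) \<partial>?L)"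
      by (rule weighted_power_mean[OF wm ym w0 y0 J wV V(1) n])
    let ?a = "norm (LINT s:{0..t}|lborel. \<kappa> s *v \<beta> s \<omega>)"
    have eq: "(LINT s:{0..t}|lborel. \<kappa> s *v \<beta> s \<omega>) = (\<integral>s. \<kappa> s *v \<beta> s \<omega> \<partial>?L)"
      by (simp add: set_lebesgue_integral_def integral_restrict_space)
    have int: "integrable ?L (\<lambda>s. \<kappa> s *v \<beta> s \<omega>)"
      using drift_integrable[OF \<kappa> fin \<beta> t \<omega>] by (simp add: set_integrable_def integrable_restrict_space)
    have "ennreal ?a \<le> (\<integral>\<^sup>+s. ennreal (norm (\<kappa> s *v \<beta> s \<omega>)) \<partial>?L)"
      unfolding eq by (rule integral_norm_bound_ennreal[OF int])
    also have "\<dots> \<le> (\<integral>\<^sup>+s. 1 * ennreal (norm (\<kappa> s) * norm (\<beta> s \<omega>)) \<partial>?L)"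
      by (intro nn_integral_mono) (auto intro!: ennreal_leI norm_matrix_vector_mult_le)
    finally have "(ennreal ?a)\<^sup>2 \<le> (\<integral>\<^sup>+s. 1 * ennreal (norm (\<kappa> s) * norm (\<beta> s \<omega>)) \<partial>?L)\<^sup>2"
      by (rule power_mono) simp
    also have "\<dots> \<le> (\<integral>\<^sup>+s. 1\<^sup>2 \<partial>?L) * (\<integral>\<^sup>+s. (ennreal (norm (\<kappa> s) * norm (\<beta> s \<omega>)))\<^sup>2 \<partial>?L)"
      by (rule Cauchy_Schwarz_nn_integral) measurable
    also have "\<dots> = ennreal t * ennreal J"
      using t unfolding J(1)[symmetric]
      by (simp add: emeasure_restrict_space space_restrict_space wy ennreal_power power_mult_distrib)
    finally have "?a\<^sup>2 \<le> t * J"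
      using t J by (simp add: ennreal_power ennreal_mult[symmetric] ennreal_le_iff)
    then have "?a ^ (2 * n) \<le> (t * J) ^ n"
      unfolding power_mult by (intro power_mono) auto
    then have "ennreal (?a ^ (2 * n)) \<le> ennreal (t ^ n) * ennreal (J ^ n)"
      using t J by (simp add: ennreal_mult[symmetric] ennreal_leI power_mult_distrib)
    also have "\<dots> \<le> ennreal (t ^ n) * (ennreal (V ^ (n - 1)) * (\<integral>\<^sup>+u. ennreal (w u * y \<omega> u ^ n) \<partial>?L))"
      using pm by (intro mult_left_mono) auto
    finally show ?thesis using t V by (simp add: ennreal_mult mult.assoc)
  qed
  have jm: "(\<lambda>(u, \<omega>). ennreal (w u * y \<omega> u ^ n)) \<in> borel_measurable (?L \<Otimes>\<^sub>M P)"
  proof -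
    have "(\<lambda>x. w (fst x)) \<in> borel_measurable (?L \<Otimes>\<^sub>M P)" "(\<lambda>x. h (fst x)) \<in> borel_measurable (?L \<Otimes>\<^sub>M P)"
      by (rule measurable_compose[OF measurable_fst wm], rule measurable_compose[OF measurable_fst gm])
    then show ?thesis using bP unfolding y_def case_prod_beta by measurable
  qed
  have "(\<integral>\<^sup>+\<omega>. ennreal (norm (LINT s:{0..t}|lborel. \<kappa> s *v \<beta> s \<omega>) ^ (2 * n)) \<partial>P)
      \<le> (\<integral>\<^sup>+\<omega>. ennreal (t ^ n * V ^ (n - 1)) * (\<integral>\<^sup>+u. ennreal (w u * y \<omega> u ^ n) \<partial>?L) \<partial>P)"
    using path by (intro nn_integral_mono) auto
  also have "\<dots> = ennreal (t ^ n * V ^ (n - 1)) * (\<integral>\<^sup>+\<omega>. (\<integral>\<^sup>+u. ennreal (w u * y \<omega> u ^ n) \<partial>?L) \<partial>P)"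
  proof (rule nn_integral_cmult)
    have "(\<lambda>(\<omega>, u). ennreal (w u * y \<omega> u ^ n)) \<in> borel_measurable (P \<Otimes>\<^sub>M ?L)"
      using jm by (subst measurable_pair_swap_iff) (simp add: case_prod_beta)
    then show "(\<lambda>\<omega>. \<integral>\<^sup>+u. ennreal (w u * y \<omega> u ^ n) \<partial>?L) \<in> borel_measurable P"
      by (rule L.borel_measurable_nn_integral)
  qed
  also have "(\<integral>\<^sup>+\<omega>. (\<integral>\<^sup>+u. ennreal (w u * y \<omega> u ^ n) \<partial>?L) \<partial>P) = (\<integral>\<^sup>+u. (\<integral>\<^sup>+\<omega>. ennreal (w u * y \<omega> u ^ n) \<partial>P) \<partial>?L)"
    using PL.Fubini'[OF jm] .
  also have "\<dots> \<le> (\<integral>\<^sup>+u. ennreal (w u) \<partial>?L)"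
  proof (rule nn_integral_mono)
    fix u assume "u \<in> space ?L"
    then have u: "u \<in> {0..t}" by (simp add: space_restrict_space)
    have bm: "\<beta> u \<in> borel_measurable P"
      using \<beta> u t by (auto simp: left_adapted_def intro!: measurable_F_P[of _ u])
    have "(\<integral>\<^sup>+\<omega>. ennreal (w u * y \<omega> u ^ n) \<partial>P) = (\<integral>\<^sup>+\<omega>. ennreal (w u / h u ^ n) * ennreal (norm (\<beta> u \<omega>) ^ (2 * n)) \<partial>P)"
      using w0[of u] h0[of u] by (intro nn_integral_cong) (simp add: y_def power_divide power_mult ennreal_mult[symmetric])
    also have "\<dots> = ennreal (w u / h u ^ n) * (\<integral>\<^sup>+\<omega>. ennreal (norm (\<beta> u \<omega>) ^ (2 * n)) \<partial>P)"
      using bm by (intro nn_integral_cmult) measurable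
    also have "\<dots> \<le> ennreal (w u / h u ^ n) * ennreal (h u ^ n)"
      using g(2)[OF u] u by (intro mult_left_mono) (auto simp: h_def)
    also have "\<dots> = ennreal (w u)"
      using w0[of u] h0[of u] by (simp add: ennreal_mult[symmetric])
    finally show "(\<integral>\<^sup>+\<omega>. ennreal (w u * y \<omega> u ^ n) \<partial>P) \<le> ennreal (w u)" .
  qed
  also note wV
  finally have "(\<integral>\<^sup>+\<omega>. ennreal (norm (LINT s:{0..t}|lborel. \<kappa> s *v \<beta> s \<omega>) ^ (2 * n)) \<partial>P) \<le> ennreal (t ^ n * V ^ (n - 1)) * ennreal V"
    by (simp add: mult_left_mono)
  also have "\<dots> = ennreal (t ^ n * V ^ (n - 1) * V)"
    using t V by (intro ennreal_mult[symmetric]) auto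
  also have "t ^ n * V ^ (n - 1) * V = (t * V) ^ n"
    using n by (cases n) (simp_all add: power_mult_distrib)
  finally show ?thesis .
qed

definition volterra_const :: "nat \<Rightarrow> nat \<Rightarrow> real" where
  "volterra_const c n = 4 * (T + 3 * ito_const c n)"

lemma volterra_const_pos: "0 < volterra_const c n"
  unfolding volterra_const_def
  by (intro mult_pos_pos add_pos_nonneg mult_nonneg_nonneg T_pos ito_const_nonneg) simp_all

text \<open>
  The estimate behind existence, uniqueness and continuity.  It is stated for a difference \<open>Z1 - Z2\<close>
  of versions of integrals that agrees with the convolution of \<open>\<kappa>\<close> only on an event \<open>A\<close>: locality of
  the integral transfers the moment bound, and the drift is treated along each path.
\<close>

lemma volterra_estimate:
  fixes \<kappa> :: "real \<Rightarrow> real ^ 'd::finite ^ 'd" and \<beta> :: "real \<Rightarrow> 'a \<Rightarrow> real ^ 'd" and \<eta> :: "real \<Rightarrow> 'a \<Rightarrow> real ^ 'm ^ 'd"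
  assumes \<kappa>: "\<kappa> \<in> borel_measurable borel"
    and fin: "(\<integral>\<^sup>+s\<in>{0..t}. ennreal ((norm (\<kappa> s))\<^sup>2) \<partial>lborel) < \<infinity>"
    and \<beta>: "left_adapted \<beta>" and \<eta>: "left_adapted \<eta>" and t: "0 \<le> t" "t \<le> T"
    and I1: "has_ito_integral P F W t H1 Z1" and I2: "has_ito_integral P F W t H2 Z2" and A[measurable]: "A \<in> sets P"
    and eq: "\<And>s \<omega>. s \<in> {0..t} \<Longrightarrow> \<omega> \<in> A \<Longrightarrow> \<kappa> s ** \<eta> s \<omega> = H1 s \<omega> - H2 s \<omega>"
    and D: "AE \<omega> in P. \<omega> \<in> A \<longrightarrow> Q \<omega> = (LINT s:{0..t}|lborel. \<kappa> s *v \<beta> s \<omega>) + (Z1 \<omega> - Z2 \<omega>)"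
    and n: "1 \<le> n" and g: "mono_on {0..t} g"
       "\<And>u. u \<in> {0..t} \<Longrightarrow> 0 < g u \<and> (\<integral>\<^sup>+\<omega>. ennreal (norm (\<beta> u \<omega>) ^ (2 * n)) \<partial>P) \<le> ennreal (g u ^ n)
          \<and> (\<integral>\<^sup>+\<omega>. ennreal (norm (\<eta> u \<omega>) ^ (2 * n)) \<partial>P) \<le> ennreal (g u ^ n)"
    and V: "0 \<le> V" "(\<integral>\<^sup>+u\<in>{0..t}. ennreal ((norm (\<kappa> u))\<^sup>2 * g u) \<partial>lborel) \<le> ennreal V"
  shows "(\<integral>\<^sup>+\<omega>. ennreal (norm (Q \<omega>) ^ (2 * n)) * indicator A \<omega> \<partial>P) \<le> ennreal ((volterra_const (CARD('d) * CARD('m)) n * V) ^ n)"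
proof -
  define c where "c = ito_const (CARD('d) * CARD('m)) n"
  have c0: "0 \<le> c" unfolding c_def by (rule ito_const_nonneg)
  define D' where "D' = (\<lambda>\<omega>. LINT s:{0..t}|lborel. \<kappa> s *v \<beta> s \<omega>)"
  have [measurable]: "D' \<in> borel_measurable P"
    unfolding D'_def by (rule measurable_F_P[OF drift_measurable[OF \<kappa> \<beta> t]])
  have [measurable]: "Z1 \<in> borel_measurable P" "Z2 \<in> borel_measurable P"
    using I1 I2 by (auto simp: has_ito_integral_def)
  have d: "(\<integral>\<^sup>+\<omega>. ennreal (norm (D' \<omega>) ^ (2 * n)) \<partial>P) \<le> ennreal ((t * V) ^ n)"
    unfolding D'_def by (rule drift_moment[OF \<kappa> fin \<beta> t n g(1) _ V]) (use g(2) in auto)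
  have z: "(\<integral>\<^sup>+\<omega>. ennreal (norm (Z1 \<omega> - Z2 \<omega>) ^ (2 * n)) * indicator A \<omega> \<partial>P) \<le> ennreal ((c * (3 * V)) ^ n)"
    unfolding c_def by (rule kernel_ito_integral_moment[OF \<kappa> fin \<eta> t I1 I2 A eq n g(1) _ V]) (use g(2) in \<open>auto simp: less_imp_le\<close>)
  have "(\<integral>\<^sup>+\<omega>. ennreal (norm (Q \<omega>) ^ (2 * n)) * indicator A \<omega> \<partial>P)
    \<le> (\<integral>\<^sup>+\<omega>. ennreal (4 ^ n) * (ennreal (norm (D' \<omega>) ^ (2 * n)) + ennreal (norm (Z1 \<omega> - Z2 \<omega>) ^ (2 * n)) * indicator A \<omega>) \<partial>P)"
  proof (rule nn_integral_mono_AE)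
    show "AE \<omega> in P. ennreal (norm (Q \<omega>) ^ (2 * n)) * indicator A \<omega> \<le> ennreal (4 ^ n) * (ennreal (norm (D' \<omega>) ^ (2 * n)) + ennreal (norm (Z1 \<omega> - Z2 \<omega>) ^ (2 * n)) * indicator A \<omega>)"
      using D
    proof eventually_elim
      case (elim \<omega>)
      show ?case
      proof (cases "\<omega> \<in> A")
        case True
        then have Q: "Q \<omega> = D' \<omega> + (Z1 \<omega> - Z2 \<omega>)" using elim by (simp add: D'_def)
        have "ennreal (norm (Q \<omega>) ^ (2 * n)) \<le> ennreal (4 ^ n * (norm (D' \<omega>) ^ (2 * n) + norm (Z1 \<omega> - Z2 \<omega>) ^ (2 * n)))"
          unfolding Q by (intro ennreal_leI norm_add_power_le)
        then show ?thesis using True by (simp add: ennreal_mult)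
      qed simp
    qed
  qed
  also have "\<dots> = ennreal (4 ^ n) * ((\<integral>\<^sup>+\<omega>. ennreal (norm (D' \<omega>) ^ (2 * n)) \<partial>P) + (\<integral>\<^sup>+\<omega>. ennreal (norm (Z1 \<omega> - Z2 \<omega>) ^ (2 * n)) * indicator A \<omega> \<partial>P))"
    by (subst nn_integral_cmult, measurable, subst nn_integral_add) auto
  also have "\<dots> \<le> ennreal (4 ^ n) * (ennreal ((t * V) ^ n) + ennreal ((c * (3 * V)) ^ n))"
    using d z by (intro mult_left_mono add_mono) auto
  also have "\<dots> = ennreal (4 ^ n * ((t * V) ^ n + (c * (3 * V)) ^ n))"
    using t V c0 by (simp add: ennreal_mult)
  also have "\<dots> \<le> ennreal ((volterra_const (CARD('d) * CARD('m)) n * V) ^ n)"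
  proof (rule ennreal_leI)
    have "(t * V) ^ n + (c * (3 * V)) ^ n \<le> (t * V + c * (3 * V)) ^ n"
      using t V c0 n by (intro power_add_le_power) auto
    also have "\<dots> \<le> ((T + 3 * c) * V) ^ n"
      using t V c0 mult_right_mono[of t T V] by (intro power_mono) (auto simp: algebra_simps)
    finally have "4 ^ n * ((t * V) ^ n + (c * (3 * V)) ^ n) \<le> 4 ^ n * ((T + 3 * c) * V) ^ n" by simp
    also have "\<dots> = (volterra_const (CARD('d) * CARD('m)) n * V) ^ n"
      by (simp only: volterra_const_def c_def power_mult_distrib mult.assoc)
    finally show "4 ^ n * ((t * V) ^ n + (c * (3 * V)) ^ n) \<le> (volterra_const (CARD('d) * CARD('m)) n * V) ^ n" .
  qed
  finally show ?thesis .
qed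

section \<open>Continuous adapted processes and switches\<close>

definition cont_adapted :: "(real \<Rightarrow> 'a \<Rightarrow> 'b::topological_space) \<Rightarrow> bool" where
  "cont_adapted X \<longleftrightarrow> (\<forall>t\<in>{0..T}. X t \<in> borel_measurable (F t)) \<and>
     (\<forall>\<omega>\<in>space M. continuous_on {0..T} (\<lambda>t. X t \<omega>))"

text \<open>The indicator of being not later than some random time; with left continuity, products stay left-continuous adapted.\<close>

definition switch :: "(real \<Rightarrow> 'a \<Rightarrow> real) \<Rightarrow> bool" where
  "switch \<alpha> \<longleftrightarrow> left_adapted \<alpha> \<and> (\<forall>u\<in>{0..T}. \<forall>\<omega>\<in>space M. \<alpha> u \<omega> = 0 \<or> \<alpha> u \<omega> = 1) \<and>
     (\<forall>s u. \<forall>\<omega>\<in>space M. 0 \<le> s \<and> s \<le> u \<and> u \<le> T \<and> \<alpha> u \<omega> = 1 \<longrightarrow> \<alpha> s \<omega> = 1)"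

lemma left_adapted_of_cont_adapted:
  fixes X :: "real \<Rightarrow> 'a \<Rightarrow> 'b::real_normed_vector"
  assumes X: "cont_adapted X"
  shows "left_adapted X"
  unfolding left_adapted_def
proof (intro conjI ballI)
  fix \<omega> assume \<omega>: "\<omega> \<in> space M"
  then have c: "continuous_on {0..T} (\<lambda>t. X t \<omega>)" using X by (simp add: cont_adapted_def)
  show "\<exists>B. \<forall>u\<in>{0..T}. norm (X u \<omega>) \<le> B"
    using compact_imp_bounded[OF compact_continuous_image[OF c]] by (auto simp: bounded_iff)
  fix u assume u: "u \<in> {0<..T}"
  have "((\<lambda>v. X v \<omega>) \<longlongrightarrow> X u \<omega>) (at u within {0..T})"
    using c u by (auto simp: continuous_on)
  then have "((\<lambda>v. X v \<omega>) \<longlongrightarrow> X u \<omega>) (at u within {0..u})"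
    by (rule tendsto_within_subset) (use u in auto)
  then show "((\<lambda>v. X v \<omega>) \<longlongrightarrow> X u \<omega>) (at_left u)"
    using u by (simp add: at_within_Icc_at_left)
qed (use X in \<open>simp add: cont_adapted_def\<close>)

lemma left_adapted_switched:
  fixes X :: "real \<Rightarrow> 'a \<Rightarrow> 'b::{real_normed_vector, second_countable_topology}"
  assumes "switch \<alpha>" and X: "left_adapted X"
  shows "left_adapted (\<lambda>u \<omega>. \<alpha> u \<omega> *\<^sub>R X u \<omega>)"
  unfolding left_adapted_def
proof (intro conjI ballI)
  have \<alpha>: "left_adapted \<alpha>" using assms by (simp add: switch_def)
  fix u assume "u \<in> {0..T}"
  then have [measurable]: "\<alpha> u \<in> borel_measurable (F u)" "X u \<in> borel_measurable (F u)"
    using \<alpha> X by (auto simp: left_adapted_def)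
  show "(\<lambda>\<omega>. \<alpha> u \<omega> *\<^sub>R X u \<omega>) \<in> borel_measurable (F u)" by measurable
next
  have \<alpha>: "left_adapted \<alpha>" using assms by (simp add: switch_def)
  fix \<omega> assume \<omega>: "\<omega> \<in> space M"
  obtain B where B: "0 \<le> B" "\<And>u. u \<in> {0..T} \<Longrightarrow> norm (X u \<omega>) \<le> B"
    by (rule left_adapted_bounded[OF X \<omega>]) blast
  have "norm (\<alpha> u \<omega> *\<^sub>R X u \<omega>) \<le> B" if "u \<in> {0..T}" for u
  proof -
    have "\<alpha> u \<omega> = 0 \<or> \<alpha> u \<omega> = 1" using assms(1) that \<omega> by (simp add: switch_def)
    then show ?thesis using B that by auto
  qed
  then show "\<exists>B. \<forall>u\<in>{0..T}. norm (\<alpha> u \<omega> *\<^sub>R X u \<omega>) \<le> B" by blast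
  fix u assume "u \<in> {0<..T}"
  then have "((\<lambda>v. \<alpha> v \<omega>) \<longlongrightarrow> \<alpha> u \<omega>) (at_left u)" "((\<lambda>v. X v \<omega>) \<longlongrightarrow> X u \<omega>) (at_left u)"
    using \<alpha> X \<omega> by (auto simp: left_adapted_def)
  then show "((\<lambda>v. \<alpha> v \<omega> *\<^sub>R X v \<omega>) \<longlongrightarrow> \<alpha> u \<omega> *\<^sub>R X u \<omega>) (at_left u)"
    by (rule tendsto_scaleR)
qed

lemma cont_adapted_compose:
  fixes X :: "real \<Rightarrow> 'a \<Rightarrow> 'b::topological_space" and f :: "real \<times> 'b \<Rightarrow> 'c::topological_space"
  assumes X: "cont_adapted X" and f: "continuous_on ({0..T} \<times> UNIV) f"
  shows "cont_adapted (\<lambda>t \<omega>. f (t, X t \<omega>))"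
  unfolding cont_adapted_def
proof (intro conjI ballI)
  fix t assume t: "t \<in> {0..T}"
  have "continuous_on UNIV (\<lambda>x. f (t, x))"
    by (rule continuous_on_compose2[OF f continuous_on_Pair[OF continuous_on_const continuous_on_id]]) (use t in auto)
  then have f_t: "(\<lambda>x. f (t, x)) \<in> borel_measurable borel" by (rule borel_measurable_continuous_onI)
  have "X t \<in> borel_measurable (F t)" using X t by (simp add: cont_adapted_def)
  from measurable_compose[OF this f_t] show "(\<lambda>\<omega>. f (t, X t \<omega>)) \<in> borel_measurable (F t)" .
next
  fix \<omega> assume "\<omega> \<in> space M"
  then have "continuous_on {0..T} (\<lambda>t. X t \<omega>)" using X by (simp add: cont_adapted_def)
  then have "continuous_on {0..T} (\<lambda>t. (t, X t \<omega>))" by (intro continuous_on_Pair continuous_on_id)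
  then show "continuous_on {0..T} (\<lambda>t. f (t, X t \<omega>))"
    by (rule continuous_on_compose2[OF f]) auto
qed

lemma cont_adapted_diff:
  fixes X Y :: "real \<Rightarrow> 'a \<Rightarrow> 'b::{real_normed_vector, second_countable_topology}"
  assumes "cont_adapted X" "cont_adapted Y"
  shows "cont_adapted (\<lambda>t \<omega>. X t \<omega> - Y t \<omega>)"
  using assms unfolding cont_adapted_def by (auto intro!: continuous_intros borel_measurable_diff)

lemma has_ito_integral_zero:
  assumes "0 \<le> t"
  shows "has_ito_integral P F W t (\<lambda>_ _. 0 :: real ^ 'm ^ 'd::finite) (\<lambda>_. 0)"
proof -
  define \<tau> where "\<tau> = (\<lambda>(k::nat) (i::nat). if i = 0 then 0 else t)"
  define \<xi> where "\<xi> = (\<lambda>(k::nat) (i::nat) (\<omega>::'a). 0 :: real ^ 'm ^ 'd)"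
  have "simple_integrand P F t 1 (\<tau> k) (\<xi> k)" for k
    using assms by (auto simp: simple_integrand_def \<tau>_def \<xi>_def)
  moreover have "simple_process 1 (\<tau> k) (\<xi> k) s \<omega> = 0" "simple_ito_integral W 1 (\<tau> k) (\<xi> k) \<omega> = 0" for k s \<omega>
    by (simp_all add: simple_process_def simple_ito_integral_def \<xi>_def)
  moreover have "ito_integrand P F t (\<lambda>_ _. 0 :: real ^ 'm ^ 'd)"
    by (simp add: ito_integrand_def progressively_measurable_def)
  ultimately show ?thesis
    unfolding has_ito_integral_def
    by (intro conjI exI[of _ "\<lambda>_. 1"] exI[of _ \<tau>] exI[of _ \<xi>]) auto
qed

text \<open>
  The condition \<open>1 < n * \<gamma>\<close> leaves the exponent above 1 that the continuity criterion requires.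
\<close>

lemma cont_adapted_modification:
  fixes Q :: "real \<Rightarrow> 'a \<Rightarrow> 'b::{banach, second_countable_topology}"
  assumes Q: "\<And>t. t \<in> {0..T} \<Longrightarrow> Q t \<in> borel_measurable (F t)"
    and n: "1 \<le> n" "1 < real n * \<gamma>" and D: "0 \<le> D"
    and inc: "\<And>s t. 0 \<le> s \<Longrightarrow> s \<le> t \<Longrightarrow> t \<le> T \<Longrightarrow>
      (\<integral>\<^sup>+\<omega>. ennreal (norm (Q t \<omega> - Q s \<omega>) ^ (2 * n)) \<partial>P) \<le> ennreal ((D * (t - s) powr \<gamma>) ^ n)"
  shows "\<exists>X. cont_adapted X \<and> (\<forall>t\<in>{0..T}. AE \<omega> in M. Q t \<omega> = X t \<omega>)"
proof -
  have pw: "(x powr \<gamma>) ^ n = x powr (1 + (real n * \<gamma> - 1))" if "0 \<le> x" for x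
    using that n by (cases "x = 0") (auto simp: powr_realpow[symmetric] powr_powr mult.commute zero_power)
  obtain X where X: "\<And>\<omega>. \<omega> \<in> space P \<Longrightarrow> continuous_on {0..T} (\<lambda>t. X t \<omega>)"
    "\<And>t. t \<in> {0..T} \<Longrightarrow> AE \<omega> in P. X t \<omega> = Q t \<omega>"
  proof -
    have "\<exists>X. (\<forall>\<omega>\<in>space P. continuous_on {0..T} (\<lambda>t. X t \<omega>)) \<and> (\<forall>t\<in>{0..T}. AE \<omega> in P. X t \<omega> = Q t \<omega>)"
    proof (rule P.continuous_modification[OF T_pos, where p = "2 * n" and \<beta> = "real n * \<gamma> - 1" and c = "D ^ n"])
      show "Q t \<in> borel_measurable P" if "t \<in> {0..T}" for t by (rule measurable_F_P[OF Q[OF that]])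
      show "(\<integral>\<^sup>+\<omega>. ennreal (norm (Q t \<omega> - Q s \<omega>) ^ (2 * n)) \<partial>P) \<le> ennreal (D ^ n * (t - s) powr (1 + (real n * \<gamma> - 1)))"
        if "0 \<le> s" "s \<le> t" "t \<le> T" for s t
        using inc[OF that] pw[of "t - s"] that by (simp add: power_mult_distrib)
    qed (use n D in auto)
    then show ?thesis using that by blast
  qed
  have ae: "AE \<omega> in M. Q t \<omega> = X t \<omega>" if "t \<in> {0..T}" for t
    using X(2)[OF that] unfolding AE_completion_iff by eventually_elim simp
  moreover have "cont_adapted X"
    unfolding cont_adapted_def using X(1) measurable_F_cong_AE[OF Q ae] by auto
  ultimately show ?thesis by blast
qed

text \<open>
  Measurability comes from testing the dyadic points of \<open>[0, u]\<close> only.  For left continuity, a path that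
  exceeds \<open>N\<close> somewhere in \<open>[0, u]\<close> does so already before \<open>u\<close>.
\<close>

lemma switch_of_bound:
  fixes h :: "real \<Rightarrow> 'a \<Rightarrow> real"
  assumes h: "cont_adapted h"
  shows "switch (\<lambda>u \<omega>. if \<forall>v\<in>{0..u}. h v \<omega> \<le> N then 1 else 0)"
proof -
  define \<alpha> where "\<alpha> = (\<lambda>u \<omega>. if \<forall>v\<in>{0..u}. h v \<omega> \<le> N then 1 else 0 :: real)"
  have cont: "continuous_on {0..T} (\<lambda>t. h t \<omega>)" if "\<omega> \<in> space M" for \<omega>
    using h that by (simp add: cont_adapted_def)
  have "left_adapted \<alpha>"
    unfolding left_adapted_def
  proof (intro conjI ballI)
    fix u assume u: "u \<in> {0..T}"
    have hm: "h (dyadic_point u m j) \<in> borel_measurable (F u)" if "j \<le> 2 ^ m" for m j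
      using h dyadic_point_in[of u j m] that u by (auto simp: cont_adapted_def intro: measurable_F_mono[of "dyadic_point u m j" u])
    have eq: "(\<forall>v\<in>{0..u}. h v \<omega> \<le> N) \<longleftrightarrow> (\<forall>m. \<forall>j\<in>{..2 ^ m}. h (dyadic_point u m j) \<omega> \<le> N)" if \<omega>: "\<omega> \<in> space M" for \<omega>
    proof
      assume "\<forall>v\<in>{0..u}. h v \<omega> \<le> N"
      then show "\<forall>m. \<forall>j\<in>{..2 ^ m}. h (dyadic_point u m j) \<omega> \<le> N"
        using dyadic_point_in[of u] u by auto
    next
      assume le: "\<forall>m. \<forall>j\<in>{..2 ^ m}. h (dyadic_point u m j) \<omega> \<le> N"
      have c: "continuous_on {0..u} (\<lambda>v. h v \<omega>)"
        by (rule continuous_on_subset[OF cont[OF \<omega>]]) (use u in auto)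
      show "\<forall>v\<in>{0..u}. h v \<omega> \<le> N"
        using continuous_le_of_dyadic[OF _ c, of N] le u by auto
    qed
    have set: "{\<omega> \<in> space (F u). \<forall>m. \<forall>j\<in>{..2 ^ m}. h (dyadic_point u m j) \<omega> \<le> N} \<in> sets (F u)"
    proof (intro sets.sets_Collect_countable_All sets.sets_Collect_finite_All)
      fix m j :: nat assume "j \<in> {..2 ^ m}"
      then show "{\<omega> \<in> space (F u). h (dyadic_point u m j) \<omega> \<le> N} \<in> sets (F u)"
        using hm[of j m] by (intro borel_measurable_le) auto
    qed auto
    have "(\<lambda>\<omega>. if \<forall>m. \<forall>j\<in>{..2 ^ m}. h (dyadic_point u m j) \<omega> \<le> N then 1 else 0 :: real) \<in> borel_measurable (F u)"
      by (intro measurable_If set) auto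
    then show "\<alpha> u \<in> borel_measurable (F u)"
      by (rule measurable_cong[THEN iffD1, rotated]) (simp add: \<alpha>_def eq)
  next
    fix \<omega> assume "\<omega> \<in> space M"
    show "\<exists>B. \<forall>u\<in>{0..T}. norm (\<alpha> u \<omega>) \<le> B" by (intro exI[of _ 1]) (simp add: \<alpha>_def)
  next
    fix \<omega> u assume \<omega>: "\<omega> \<in> space M" and u: "u \<in> {0<..T}"
    show "((\<lambda>v. \<alpha> v \<omega>) \<longlongrightarrow> \<alpha> u \<omega>) (at_left u)"
    proof (cases "\<forall>v\<in>{0..u}. h v \<omega> \<le> N")
      case True
      then have "\<alpha> v \<omega> = \<alpha> u \<omega>" if "v < u" for v using that by (auto simp: \<alpha>_def)
      then have "\<forall>\<^sub>F v in at_left u. \<alpha> v \<omega> = \<alpha> u \<omega>"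
        by (intro eventually_at_leftI[of 0 u]) (use u in auto)
      then show ?thesis by (rule tendsto_eventually)
    next
      case False
      then obtain v0 where v0: "v0 \<in> {0..u}" "N < h v0 \<omega>" by (auto simp: not_le)
      have "\<exists>v1. 0 \<le> v1 \<and> v1 < u \<and> N < h v1 \<omega>"
      proof (cases "v0 < u")
        case False
        then have "N < h u \<omega>" using v0 by auto
        moreover have "((\<lambda>v. h v \<omega>) \<longlongrightarrow> h u \<omega>) (at_left u)"
          using left_adapted_of_cont_adapted[OF h] \<omega> u by (auto simp: left_adapted_def)
        ultimately have "\<forall>\<^sub>F v in at_left u. N < h v \<omega>" by (intro order_tendstoD(1))
        moreover have "\<forall>\<^sub>F v in at_left u. 0 < v \<and> v < u"
          by (intro eventually_at_leftI[of 0 u]) (use u in auto)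
        ultimately have "\<forall>\<^sub>F v in at_left u. 0 \<le> v \<and> v < u \<and> N < h v \<omega>" by eventually_elim auto
        then show ?thesis by (rule eventually_happens'[rotated]) simp
      qed (use v0 in auto)
      then obtain v1 where v1: "0 \<le> v1" "v1 < u" "N < h v1 \<omega>" by blast
      have eqv: "\<alpha> v \<omega> = \<alpha> u \<omega>" if "v1 < v" for v
      proof -
        have "\<not> (\<forall>x\<in>{0..v}. h x \<omega> \<le> N)"
          using v1 that by (intro notI) (auto dest!: bspec[of _ _ v1])
        moreover have "\<not> (\<forall>x\<in>{0..u}. h x \<omega> \<le> N)" by fact
        ultimately show ?thesis by (simp only: \<alpha>_def if_False)
      qed
      have "\<forall>\<^sub>F v in at_left u. \<alpha> v \<omega> = \<alpha> u \<omega>"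
      proof (rule eventually_at_leftI[of v1 u])
        show "\<alpha> v \<omega> = \<alpha> u \<omega>" if "v \<in> {v1<..<u}" for v
          using that by (intro eqv) simp
      qed (rule v1)
      then show ?thesis by (rule tendsto_eventually)
    qed
  qed
  then show ?thesis
    unfolding switch_def \<alpha>_def[symmetric] by (auto simp: \<alpha>_def split: if_splits)
qed

lemma switch_one: "switch (\<lambda>_ _. 1)"
  unfolding switch_def left_adapted_def by (auto intro!: exI[of _ 1])

end

section \<open>The Volterra equation\<close>

text \<open>
  The assumption \<open>k_modulus\<close> combines the two increment conditions on the kernel: extended by zero, the
  kernels of two times \<open>s \<le> t\<close> have squared \<open>L\<^sup>2\<close> distance at most \<open>c * (t - s) powr \<gamma>\<close>.
\<close>

locale volterra = brownian M T W
  for M :: "'a measure" and T :: real and W :: "real \<Rightarrow> 'a \<Rightarrow> real ^ 'm::finite" +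
  fixes k :: "real \<Rightarrow> real ^ 'd::finite ^ 'd" and b :: "real \<times> (real ^ 'd) \<Rightarrow> real ^ 'd"
    and \<sigma> :: "real \<times> (real ^ 'd) \<Rightarrow> real ^ 'm ^ 'd" and X\<^sub>0 :: "real ^ 'd" and L \<gamma> c :: real
  assumes k_measurable: "(\<lambda>v. if v \<in> {0..T} then k v else 0) \<in> borel_measurable borel"
    and k_square: "(\<integral>\<^sup>+v\<in>{0..T}. ennreal ((norm (k v))\<^sup>2) \<partial>lborel) < \<infinity>"
    and \<gamma>_pos: "0 < \<gamma>" and c_nonneg: "0 \<le> c"
    and k_modulus: "\<And>s t. 0 \<le> s \<Longrightarrow> s \<le> t \<Longrightarrow> t \<le> T \<Longrightarrow>
      (\<integral>\<^sup>+u\<in>{0..t}. ennreal ((norm (k (t - u) - (if u \<le> s then k (s - u) else 0)))\<^sup>2) \<partial>lborel)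
        \<le> ennreal (c * (t - s) powr \<gamma>)"
    and L_pos: "0 < L" and b_lipschitz: "L-lipschitz_on ({0..T} \<times> UNIV) b"
    and \<sigma>_lipschitz: "L-lipschitz_on ({0..T} \<times> UNIV) \<sigma>"
begin

definition ker :: "real \<Rightarrow> real \<Rightarrow> real ^ 'd ^ 'd" where
  "ker t u = (if u \<in> {0..t} then k (t - u) else 0)"

definition C :: "nat \<Rightarrow> real" where
  "C n = volterra_const (CARD('d) * CARD('m)) n"

lemma C_pos: "0 < C n"
  unfolding C_def by (rule volterra_const_pos)

text \<open>
  The random variable \<open>Q\<close> is a version of the right-hand side of the equation at time \<open>t\<close>, with the process
  \<open>X\<close> in the coefficients.  Separating \<open>Q\<close> from \<open>X t\<close> describes the Picard map.
\<close>

definition solves_at :: "(real \<Rightarrow> 'a \<Rightarrow> real ^ 'd) \<Rightarrow> real \<Rightarrow> ('a \<Rightarrow> real ^ 'd) \<Rightarrow> bool" where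
  "solves_at X t Q \<longleftrightarrow> (\<exists>Z. has_ito_integral P F W t (\<lambda>s \<omega>. k (t - s) ** \<sigma> (s, X s \<omega>)) Z \<and>
     (AE \<omega> in M. set_integrable lborel {0..t} (\<lambda>s. k (t - s) *v b (s, X s \<omega>)) \<and>
        Q \<omega> = X\<^sub>0 + (LINT s:{0..t}|lborel. k (t - s) *v b (s, X s \<omega>)) + Z \<omega>))"

lemma strong_solution_iff:
  "volterra_strong_solution M W T X\<^sub>0 k b \<sigma> X \<longleftrightarrow> cont_adapted X \<and> (\<forall>t\<in>{0..T}. solves_at X t (X t))"
  by (auto simp: volterra_strong_solution_def cont_adapted_def solves_at_def)

lemma solves_at_cong_AE:
  assumes "solves_at X t Q" "AE \<omega> in M. Q \<omega> = Q' \<omega>"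
  shows "solves_at X t Q'"
proof -
  obtain Z where Z: "has_ito_integral P F W t (\<lambda>s \<omega>. k (t - s) ** \<sigma> (s, X s \<omega>)) Z"
    "AE \<omega> in M. set_integrable lborel {0..t} (\<lambda>s. k (t - s) *v b (s, X s \<omega>)) \<and>
        Q \<omega> = X\<^sub>0 + (LINT s:{0..t}|lborel. k (t - s) *v b (s, X s \<omega>)) + Z \<omega>"
    using assms(1) by (auto simp: solves_at_def)
  from Z(2) assms(2) have "AE \<omega> in M. set_integrable lborel {0..t} (\<lambda>s. k (t - s) *v b (s, X s \<omega>)) \<and>
        Q' \<omega> = X\<^sub>0 + (LINT s:{0..t}|lborel. k (t - s) *v b (s, X s \<omega>)) + Z \<omega>"
    by eventually_elim simp
  with Z(1) show ?thesis by (auto simp: solves_at_def)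
qed

definition k_ext :: "real \<Rightarrow> real ^ 'd ^ 'd" where
  "k_ext v = (if v \<in> {0..T} then k v else 0)"

lemma k_ext_measurable [measurable]: "k_ext \<in> borel_measurable borel"
  using k_measurable by (simp add: k_ext_def[abs_def])

lemma ker_measurable:
  assumes t: "0 \<le> t" "t \<le> T"
  shows "ker t \<in> borel_measurable borel"
proof -
  have eq: "ker t = (\<lambda>u. if u \<in> {0..t} then k_ext (t - u) else 0)"
    using t by (auto simp: ker_def k_ext_def fun_eq_iff)
  show ?thesis unfolding eq by measurable
qed

lemma ker_integral:
  assumes t: "0 \<le> t" "t \<le> T" and w[measurable]: "w \<in> borel_measurable borel"
  shows "(\<integral>\<^sup>+u\<in>{0..t}. ennreal ((norm (ker t u))\<^sup>2) * w (t - u) \<partial>lborel)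
    \<le> (\<integral>\<^sup>+v\<in>{0..T}. ennreal ((norm (k v))\<^sup>2) * w v \<partial>lborel)"
proof -
  define f where "f = (\<lambda>v. ennreal ((norm (k_ext v))\<^sup>2) * w v * indicator {0..T} v)"
  have m: "f \<in> borel_measurable borel" unfolding f_def by measurable
  have "(\<integral>\<^sup>+u\<in>{0..t}. ennreal ((norm (ker t u))\<^sup>2) * w (t - u) \<partial>lborel) \<le> (\<integral>\<^sup>+u. f (t + (- 1) * u) \<partial>lborel)"
  proof (rule nn_integral_mono)
    fix u
    show "ennreal ((norm (ker t u))\<^sup>2) * w (t - u) * indicator {0..t} u \<le> f (t + (- 1) * u)"
    proof (cases "u \<in> {0..t}")
      case True
      then have "t + (- 1) * u \<in> {0..T}" "k_ext (t - u) = ker t u"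
        using t by (auto simp: ker_def k_ext_def)
      then show ?thesis using True by (simp add: f_def)
    qed simp
  qed
  also have "\<dots> = (\<integral>\<^sup>+v. f v \<partial>lborel)"
  proof -
    have "(\<integral>\<^sup>+v. f v \<partial>lborel) = ennreal \<bar>- 1\<bar> * (\<integral>\<^sup>+u. f (t + (- 1) * u) \<partial>lborel)"
      by (rule nn_integral_real_affine[OF m]) simp
    then show ?thesis by simp
  qed
  also have "\<dots> = (\<integral>\<^sup>+v\<in>{0..T}. ennreal ((norm (k v))\<^sup>2) * w v \<partial>lborel)"
    by (intro nn_integral_cong) (auto simp: f_def k_ext_def indicator_def)
  finally show ?thesis .
qed

lemma ker_square:
  assumes "0 \<le> t" "t \<le> T"
  shows "(\<integral>\<^sup>+u\<in>{0..t}. ennreal ((norm (ker t u))\<^sup>2) \<partial>lborel) < \<infinity>"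
  using ker_integral[OF assms, of "\<lambda>_. 1"] k_square by (simp add: le_less_trans)

lemma coefficients_cont_adapted:
  assumes "cont_adapted X"
  shows "cont_adapted (\<lambda>u \<omega>. b (u, X u \<omega>))" "cont_adapted (\<lambda>u \<omega>. \<sigma> (u, X u \<omega>))"
  by (rule cont_adapted_compose[OF assms lipschitz_on_continuous_on[OF b_lipschitz]],
      rule cont_adapted_compose[OF assms lipschitz_on_continuous_on[OF \<sigma>_lipschitz]])

lemma coefficient_difference_le:
  assumes "u \<in> {0..T}"
  shows "norm (b (u, x) - b (u, y)) \<le> L * norm (x - y)" "norm (\<sigma> (u, x) - \<sigma> (u, y)) \<le> L * norm (x - y)"
  using lipschitz_onD[OF b_lipschitz, of "(u, x)" "(u, y)"] lipschitz_onD[OF \<sigma>_lipschitz, of "(u, x)" "(u, y)"] assms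
  by (auto simp: dist_norm dist_Pair_Pair)

lemma solves_at_exists:
  assumes X: "cont_adapted X" and t: "0 \<le> t" "t \<le> T"
  shows "\<exists>Q\<in>borel_measurable (F t). solves_at X t Q"
proof -
  note bX = left_adapted_of_cont_adapted[OF coefficients_cont_adapted(1)[OF X]]
  note \<sigma>X = left_adapted_of_cont_adapted[OF coefficients_cont_adapted(2)[OF X]]
  obtain Z where Z: "Z \<in> borel_measurable (F t)" "has_ito_integral P F W t (\<lambda>s \<omega>. ker t s ** \<sigma> (s, X s \<omega>)) Z"
    by (rule kernel_ito_integral_exists[OF ker_measurable[OF t] ker_square[OF t] \<sigma>X t]) blast
  have Z': "has_ito_integral P F W t (\<lambda>s \<omega>. k (t - s) ** \<sigma> (s, X s \<omega>)) Z"
    by (rule has_ito_integral_cong[OF Z(2) t(1)]) (simp add: ker_def)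
  define D where "D = (\<lambda>\<omega>. LINT s:{0..t}|lborel. ker t s *v b (s, X s \<omega>))"
  have [measurable]: "D \<in> borel_measurable (F t)"
    unfolding D_def by (rule drift_measurable[OF ker_measurable[OF t] bX t])
  have [measurable]: "Z \<in> borel_measurable (F t)" by fact
  have ker_b: "set_integrable lborel {0..t} (\<lambda>s. k (t - s) *v b (s, X s \<omega>)) \<longleftrightarrow> set_integrable lborel {0..t} (\<lambda>s. ker t s *v b (s, X s \<omega>))"
    "(LINT s:{0..t}|lborel. k (t - s) *v b (s, X s \<omega>)) = D \<omega>" for \<omega>
    unfolding D_def by (intro set_integrable_cong set_lebesgue_integral_cong; auto simp: ker_def)+
  have "solves_at X t (\<lambda>\<omega>. X\<^sub>0 + D \<omega> + Z \<omega>)"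
    unfolding solves_at_def
  proof (intro exI[of _ Z] conjI Z' AE_I2)
    fix \<omega> assume "\<omega> \<in> space M"
    then show "set_integrable lborel {0..t} (\<lambda>s. k (t - s) *v b (s, X s \<omega>))"
      unfolding ker_b by (rule drift_integrable[OF ker_measurable[OF t] ker_square[OF t] bX t])
  qed (simp add: ker_b)
  moreover have "(\<lambda>\<omega>. X\<^sub>0 + D \<omega> + Z \<omega>) \<in> borel_measurable (F t)" by measurable
  ultimately show ?thesis by blast
qed

text \<open>
  The Picard map contracts by the factor \<open>\<rho>\<close> in the moment norms weighted with \<open>exp (\<theta> * u)\<close>.  The
  convolution turns the weight into \<open>exp (\<theta> * t)\<close> times the integral of \<open>(norm (k v))\<^sup>2 * exp (- \<theta> * v)\<close>.
  On the event that the switch \<open>\<alpha>\<close> is still on at \<open>t\<close>, it has been on at all earlier times, so there the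
  switched coefficients have the same integrals as the original ones.
\<close>

lemma picard_difference:
  assumes X1: "cont_adapted X1" and X2: "cont_adapted X2" and t: "0 \<le> t" "t \<le> T"
    and S1: "solves_at X1 t Q1" and S2: "solves_at X2 t Q2"
    and \<alpha>: "switch \<alpha>" and n: "1 \<le> n" and B: "0 < B" and \<rho>: "0 \<le> \<rho>"
    and lam: "0 \<le> \<theta>" "(\<integral>\<^sup>+v\<in>{0..T}. ennreal ((norm (k v))\<^sup>2) * ennreal (exp (- (\<theta> * v))) \<partial>lborel) \<le> ennreal (\<rho> / (C n * L\<^sup>2))"
    and hyp: "\<And>u. u \<in> {0..t} \<Longrightarrow> (\<integral>\<^sup>+\<omega>. ennreal (\<alpha> u \<omega> * norm (X1 u \<omega> - X2 u \<omega>) ^ (2 * n)) \<partial>P) \<le> ennreal ((B * exp (\<theta> * u)) ^ n)"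
  shows "(\<integral>\<^sup>+\<omega>. ennreal (\<alpha> t \<omega> * norm (Q1 \<omega> - Q2 \<omega>) ^ (2 * n)) \<partial>P) \<le> ennreal ((\<rho> * B * exp (\<theta> * t)) ^ n)"
proof -
  define A where "A = {\<omega> \<in> space M. \<alpha> t \<omega> = 1}"
  have \<alpha>l: "left_adapted \<alpha>" and \<alpha>01: "\<And>u \<omega>. u \<in> {0..T} \<Longrightarrow> \<omega> \<in> space M \<Longrightarrow> \<alpha> u \<omega> = 0 \<or> \<alpha> u \<omega> = 1"
    and \<alpha>dec: "\<And>s u \<omega>. \<omega> \<in> space M \<Longrightarrow> 0 \<le> s \<Longrightarrow> s \<le> u \<Longrightarrow> u \<le> T \<Longrightarrow> \<alpha> u \<omega> = 1 \<Longrightarrow> \<alpha> s \<omega> = 1"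
    using \<alpha> by (auto simp: switch_def)
  have \<alpha>m: "\<alpha> u \<in> borel_measurable P" if "u \<in> {0..T}" for u
    using \<alpha>l that by (auto simp: left_adapted_def intro!: measurable_F_P[of _ u])
  have A: "A \<in> sets P"
  proof -
    have "\<alpha> t -` {1} \<inter> space P \<in> sets P"
      using \<alpha>m[of t] t by (intro measurable_sets[of _ _ borel]) auto
    moreover have "\<alpha> t -` {1} \<inter> space P = A" by (auto simp: A_def)
    ultimately show ?thesis by simp
  qed
  define \<beta> where "\<beta> = (\<lambda>u \<omega>. \<alpha> u \<omega> *\<^sub>R (b (u, X1 u \<omega>) - b (u, X2 u \<omega>)))"
  define \<eta> where "\<eta> = (\<lambda>u \<omega>. \<alpha> u \<omega> *\<^sub>R (\<sigma> (u, X1 u \<omega>) - \<sigma> (u, X2 u \<omega>)))"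
  have \<beta>: "left_adapted \<beta>" unfolding \<beta>_def
    by (intro left_adapted_switched[OF \<alpha>] left_adapted_of_cont_adapted cont_adapted_diff coefficients_cont_adapted X1 X2)
  have \<eta>: "left_adapted \<eta>" unfolding \<eta>_def
    by (intro left_adapted_switched[OF \<alpha>] left_adapted_of_cont_adapted cont_adapted_diff coefficients_cont_adapted X1 X2)
  obtain Z1 where Z1: "has_ito_integral P F W t (\<lambda>s \<omega>. k (t - s) ** \<sigma> (s, X1 s \<omega>)) Z1"
    and E1: "AE \<omega> in M. set_integrable lborel {0..t} (\<lambda>s. k (t - s) *v b (s, X1 s \<omega>)) \<and>
        Q1 \<omega> = X\<^sub>0 + (LINT s:{0..t}|lborel. k (t - s) *v b (s, X1 s \<omega>)) + Z1 \<omega>"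
    using S1 by (auto simp: solves_at_def)
  obtain Z2 where Z2: "has_ito_integral P F W t (\<lambda>s \<omega>. k (t - s) ** \<sigma> (s, X2 s \<omega>)) Z2"
    and E2: "AE \<omega> in M. set_integrable lborel {0..t} (\<lambda>s. k (t - s) *v b (s, X2 s \<omega>)) \<and>
        Q2 \<omega> = X\<^sub>0 + (LINT s:{0..t}|lborel. k (t - s) *v b (s, X2 s \<omega>)) + Z2 \<omega>"
    using S2 by (auto simp: solves_at_def)
  have one: "\<alpha> s \<omega> = 1" if "s \<in> {0..t}" "\<omega> \<in> A" for s \<omega>
    using \<alpha>dec[of \<omega> s t] that t by (auto simp: A_def)
  have eq: "ker t s ** \<eta> s \<omega> = k (t - s) ** \<sigma> (s, X1 s \<omega>) - k (t - s) ** \<sigma> (s, X2 s \<omega>)"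
    if "s \<in> {0..t}" "\<omega> \<in> A" for s \<omega>
    using that one[OF that] by (simp add: ker_def \<eta>_def mm.diff_right)
  have D: "AE \<omega> in P. \<omega> \<in> A \<longrightarrow> Q1 \<omega> - Q2 \<omega> = (LINT s:{0..t}|lborel. ker t s *v \<beta> s \<omega>) + (Z1 \<omega> - Z2 \<omega>)"
    using AE_completion[OF E1] AE_completion[OF E2]
  proof eventually_elim
    case (elim \<omega>)
    show ?case
    proof
      assume \<omega>: "\<omega> \<in> A"
      have "(LINT s:{0..t}|lborel. ker t s *v \<beta> s \<omega>) = (LINT s:{0..t}|lborel. k (t - s) *v b (s, X1 s \<omega>) - k (t - s) *v b (s, X2 s \<omega>))"
        by (rule set_lebesgue_integral_cong) (auto simp: ker_def \<beta>_def one[OF _ \<omega>] mv.diff_right)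
      also have "\<dots> = (LINT s:{0..t}|lborel. k (t - s) *v b (s, X1 s \<omega>)) - (LINT s:{0..t}|lborel. k (t - s) *v b (s, X2 s \<omega>))"
        using elim by (intro set_integral_diff) auto
      finally show "Q1 \<omega> - Q2 \<omega> = (LINT s:{0..t}|lborel. ker t s *v \<beta> s \<omega>) + (Z1 \<omega> - Z2 \<omega>)"
        using elim by simp
    qed
  qed
  define g where "g = (\<lambda>u. L\<^sup>2 * (B * exp (\<theta> * u)))"
  have g0: "0 < g u" for u using L_pos B by (simp add: g_def)
  have gmono: "mono_on {0..t} g"
    unfolding g_def using L_pos B lam(1) by (intro mono_onI mult_left_mono) (auto intro!: mult_left_mono)
  have mom: "(\<integral>\<^sup>+\<omega>. ennreal (norm (\<alpha> u \<omega> *\<^sub>R (f (u, X1 u \<omega>) - f (u, X2 u \<omega>))) ^ (2 * n)) \<partial>P) \<le> ennreal (g u ^ n)"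
    if u: "u \<in> {0..t}" and f: "\<And>x y. norm (f (u, x) - f (u, y)) \<le> L * norm (x - y)"
    for u and f :: "real \<times> (real ^ 'd) \<Rightarrow> 'z::real_normed_vector"
  proof -
    have X12m[measurable]: "X1 u \<in> borel_measurable P" "X2 u \<in> borel_measurable P"
      using X1 X2 u t by (auto simp: cont_adapted_def intro!: measurable_F_P[of _ u])
    have [measurable]: "\<alpha> u \<in> borel_measurable P" using \<alpha>m u t by auto
    have "(\<integral>\<^sup>+\<omega>. ennreal (norm (\<alpha> u \<omega> *\<^sub>R (f (u, X1 u \<omega>) - f (u, X2 u \<omega>))) ^ (2 * n)) \<partial>P)
      \<le> (\<integral>\<^sup>+\<omega>. ennreal (L ^ (2 * n)) * ennreal (\<alpha> u \<omega> * norm (X1 u \<omega> - X2 u \<omega>) ^ (2 * n)) \<partial>P)"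
    proof (rule nn_integral_mono)
      fix \<omega> assume "\<omega> \<in> space P"
      then have "\<alpha> u \<omega> = 0 \<or> \<alpha> u \<omega> = 1" using \<alpha>01[of u \<omega>] u t by auto
      moreover have "norm (f (u, X1 u \<omega>) - f (u, X2 u \<omega>)) ^ (2 * n) \<le> (L * norm (X1 u \<omega> - X2 u \<omega>)) ^ (2 * n)"
        using f by (intro power_mono) auto
      ultimately show "ennreal (norm (\<alpha> u \<omega> *\<^sub>R (f (u, X1 u \<omega>) - f (u, X2 u \<omega>))) ^ (2 * n))
        \<le> ennreal (L ^ (2 * n)) * ennreal (\<alpha> u \<omega> * norm (X1 u \<omega> - X2 u \<omega>) ^ (2 * n))"
        using n L_pos by (auto simp: ennreal_mult[symmetric] power_mult_distrib intro!: ennreal_leI)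
    qed
    also have "\<dots> = ennreal (L ^ (2 * n)) * (\<integral>\<^sup>+\<omega>. ennreal (\<alpha> u \<omega> * norm (X1 u \<omega> - X2 u \<omega>) ^ (2 * n)) \<partial>P)"
      by (rule nn_integral_cmult) measurable
    also have "\<dots> \<le> ennreal (L ^ (2 * n)) * ennreal ((B * exp (\<theta> * u)) ^ n)"
      using hyp[OF u] by (intro mult_left_mono) auto
    also have "\<dots> = ennreal (g u ^ n)"
      using L_pos B by (simp add: ennreal_mult[symmetric] g_def power_mult_distrib power_mult)
    finally show ?thesis .
  qed
  define V where "V = \<rho> / C n * (B * exp (\<theta> * t))"
  have V0: "0 \<le> V" using \<rho> B C_pos[of n] by (simp add: V_def)
  have V: "(\<integral>\<^sup>+u\<in>{0..t}. ennreal ((norm (ker t u))\<^sup>2 * g u) \<partial>lborel) \<le> ennreal V"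
  proof -
    let ?c = "L\<^sup>2 * (B * exp (\<theta> * t))"
    have "(\<integral>\<^sup>+u\<in>{0..t}. ennreal ((norm (ker t u))\<^sup>2 * g u) \<partial>lborel)
      = (\<integral>\<^sup>+u. ennreal ?c * (ennreal ((norm (ker t u))\<^sup>2) * ennreal (exp (- (\<theta> * (t - u)))) * indicator {0..t} u) \<partial>lborel)"
    proof (rule nn_integral_cong)
      fix u
      have "g u = ?c * exp (- (\<theta> * (t - u)))"
        by (simp add: g_def exp_add[symmetric] algebra_simps)
      then show "ennreal ((norm (ker t u))\<^sup>2 * g u) * indicator {0..t} u = ennreal ?c * (ennreal ((norm (ker t u))\<^sup>2) * ennreal (exp (- (\<theta> * (t - u)))) * indicator {0..t} u)"
        using L_pos B by (simp add: ennreal_mult[symmetric] mult_ac indicator_def)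
    qed
    also have "\<dots> = ennreal ?c * (\<integral>\<^sup>+u\<in>{0..t}. ennreal ((norm (ker t u))\<^sup>2) * ennreal (exp (- (\<theta> * (t - u)))) \<partial>lborel)"
    proof (rule nn_integral_cmult)
      have [measurable]: "ker t \<in> borel_measurable borel" by (rule ker_measurable[OF t])
      show "(\<lambda>u. ennreal ((norm (ker t u))\<^sup>2) * ennreal (exp (- (\<theta> * (t - u)))) * indicator {0..t} u) \<in> borel_measurable lborel"
        by measurable
    qed
    also have "\<dots> \<le> ennreal ?c * (\<integral>\<^sup>+v\<in>{0..T}. ennreal ((norm (k v))\<^sup>2) * ennreal (exp (- (\<theta> * v))) \<partial>lborel)"
      by (intro mult_left_mono ker_integral[OF t, of "\<lambda>v. ennreal (exp (- (\<theta> * v)))"]) auto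
    also have "\<dots> \<le> ennreal ?c * ennreal (\<rho> / (C n * L\<^sup>2))"
      using lam by (intro mult_left_mono) auto
    also have "\<dots> = ennreal V"
      using L_pos B C_pos[of n] \<rho> by (simp add: ennreal_mult[symmetric] V_def field_simps)
    finally show ?thesis .
  qed
  have "(\<integral>\<^sup>+\<omega>. ennreal (norm (Q1 \<omega> - Q2 \<omega>) ^ (2 * n)) * indicator A \<omega> \<partial>P) \<le> ennreal ((C n * V) ^ n)"
    unfolding C_def
  proof (rule volterra_estimate[OF ker_measurable[OF t] ker_square[OF t] \<beta> \<eta> t Z1 Z2 A eq D n gmono _ V0 V])
    fix u assume u: "u \<in> {0..t}"
    then have uT: "u \<in> {0..T}" using t by auto
    show "0 < g u \<and> (\<integral>\<^sup>+\<omega>. ennreal (norm (\<beta> u \<omega>) ^ (2 * n)) \<partial>P) \<le> ennreal (g u ^ n)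
        \<and> (\<integral>\<^sup>+\<omega>. ennreal (norm (\<eta> u \<omega>) ^ (2 * n)) \<partial>P) \<le> ennreal (g u ^ n)"
      unfolding \<beta>_def \<eta>_def
      using g0 mom[OF u, of b] mom[OF u, of \<sigma>] coefficient_difference_le[OF uT] by blast
  qed
  moreover have "C n * V = \<rho> * B * exp (\<theta> * t)" using C_pos[of n] by (simp add: V_def)
  moreover have "(\<integral>\<^sup>+\<omega>. ennreal (\<alpha> t \<omega> * norm (Q1 \<omega> - Q2 \<omega>) ^ (2 * n)) \<partial>P) = (\<integral>\<^sup>+\<omega>. ennreal (norm (Q1 \<omega> - Q2 \<omega>) ^ (2 * n)) * indicator A \<omega> \<partial>P)"
    using \<alpha>01[of t] t by (intro nn_integral_cong) (force simp: A_def indicator_def)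
  ultimately show ?thesis by simp
qed

text \<open>
  Dominated convergence as \<open>\<theta>\<close> tends to infinity.
\<close>

lemma exponential_weight:
  assumes "0 < e"
  shows "\<exists>\<theta>\<ge>0. (\<integral>\<^sup>+v\<in>{0..T}. ennreal ((norm (k v))\<^sup>2) * ennreal (exp (- (\<theta> * v))) \<partial>lborel) \<le> ennreal e"
proof -
  let ?u = "\<lambda>(N::nat) v. ennreal ((norm (k_ext v))\<^sup>2) * ennreal (exp (- (real N * v))) * indicator {0..T} v"
  have "(\<lambda>N. \<integral>\<^sup>+v. ?u N v \<partial>lborel) \<longlonglongrightarrow> (\<integral>\<^sup>+(v::real). 0 \<partial>lborel)"
  proof (rule nn_integral_dominated_convergence[where w = "\<lambda>v. ennreal ((norm (k_ext v))\<^sup>2) * indicator {0..T} v"])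
    show "AE v in lborel. ?u N v \<le> ennreal ((norm (k_ext v))\<^sup>2) * indicator {0..T} v" for N
    proof (rule AE_I2)
      fix v
      have "ennreal ((norm (k_ext v))\<^sup>2) * ennreal (exp (- (real N * v))) \<le> ennreal ((norm (k_ext v))\<^sup>2) * 1" if "0 \<le> v"
        using that by (intro mult_left_mono) (auto simp: ennreal_1[symmetric] simp del: ennreal_1 intro!: ennreal_leI)
      then show "?u N v \<le> ennreal ((norm (k_ext v))\<^sup>2) * indicator {0..T} v" by (auto simp: indicator_def)
    qed
    have "(\<integral>\<^sup>+v. ennreal ((norm (k_ext v))\<^sup>2) * indicator {0..T} v \<partial>lborel) = (\<integral>\<^sup>+v\<in>{0..T}. ennreal ((norm (k v))\<^sup>2) \<partial>lborel)"
      by (intro nn_integral_cong) (auto simp: indicator_def k_ext_def)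
    then show "(\<integral>\<^sup>+v. ennreal ((norm (k_ext v))\<^sup>2) * indicator {0..T} v \<partial>lborel) < \<infinity>" using k_square by simp
    show "AE v in lborel. (\<lambda>N. ?u N v) \<longlonglongrightarrow> 0"
      using AE_lborel_singleton[of 0]
    proof eventually_elim
      case (elim v)
      show ?case
      proof (cases "0 < v")
        case True
        have "(\<lambda>N. exp (- v) ^ N) \<longlonglongrightarrow> 0" using True by (intro LIMSEQ_power_zero) auto
        then have "(\<lambda>N. exp (- (real N * v))) \<longlonglongrightarrow> 0" by (simp add: exp_of_nat_mult[symmetric] mult.commute)
        then have "(\<lambda>N. ennreal ((norm (k_ext v))\<^sup>2 * exp (- (real N * v)))) \<longlonglongrightarrow> ennreal ((norm (k_ext v))\<^sup>2 * 0)"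
          by (intro tendsto_ennrealI tendsto_mult tendsto_const)
        then have "(\<lambda>N. ennreal ((norm (k_ext v))\<^sup>2) * ennreal (exp (- (real N * v)))) \<longlonglongrightarrow> 0"
          by (simp add: ennreal_mult)
        then show ?thesis by (cases "v \<in> {0..T}") (simp_all add: indicator_def)
      qed (use elim in \<open>auto simp: indicator_def\<close>)
    qed
  qed measurable
  then have "\<forall>\<^sub>F N in sequentially. (\<integral>\<^sup>+v. ?u N v \<partial>lborel) < ennreal e"
    using assms by (intro order_tendstoD(2)) auto
  then obtain N where N: "(\<integral>\<^sup>+v. ?u N v \<partial>lborel) < ennreal e" by (auto simp: eventually_sequentially)
  have "(\<integral>\<^sup>+v. ?u N v \<partial>lborel) = (\<integral>\<^sup>+v\<in>{0..T}. ennreal ((norm (k v))\<^sup>2) * ennreal (exp (- (real N * v))) \<partial>lborel)"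
    by (intro nn_integral_cong) (auto simp: indicator_def k_ext_def)
  then show ?thesis using N by (intro exI[of _ "real N"]) auto
qed

section \<open>Picard iteration\<close>

text \<open>
  A bound for the squared moment norm of the coefficients along a process with squared moment norm at
  most \<open>G\<close>, from linear growth; the summand 1 only makes it positive.
\<close>

definition growth :: "real \<Rightarrow> real" where
  "growth G = 4 * ((norm (b (0, 0)) + norm (\<sigma> (0, 0)) + L * T)\<^sup>2 + L\<^sup>2 * G) + 1"

lemma growth_pos: "0 \<le> G \<Longrightarrow> 0 < growth G"
  unfolding growth_def by (intro add_nonneg_pos mult_nonneg_nonneg add_nonneg_nonneg) auto

lemma coefficient_moments:
  assumes X: "cont_adapted X" and n: "1 \<le> n" and G: "0 \<le> G" and u: "u \<in> {0..T}"
    and mom: "(\<integral>\<^sup>+\<omega>. ennreal (norm (X u \<omega>) ^ (2 * n)) \<partial>P) \<le> ennreal (G ^ n)"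
  shows "(\<integral>\<^sup>+\<omega>. ennreal (norm (b (u, X u \<omega>)) ^ (2 * n)) \<partial>P) \<le> ennreal (growth G ^ n)"
    and "(\<integral>\<^sup>+\<omega>. ennreal (norm (\<sigma> (u, X u \<omega>)) ^ (2 * n)) \<partial>P) \<le> ennreal (growth G ^ n)"
proof -
  define S where "S = norm (b (0, 0)) + norm (\<sigma> (0, 0)) + L * T"
  have S0: "0 \<le> S" using L_pos T_pos by (simp add: S_def)
  have [measurable]: "X u \<in> borel_measurable P"
    using X u by (auto simp: cont_adapted_def intro!: measurable_F_P[of _ u])
  have main: "(\<integral>\<^sup>+\<omega>. ennreal (norm (f (u, X u \<omega>)) ^ (2 * n)) \<partial>P) \<le> ennreal (growth G ^ n)"
    if f: "L-lipschitz_on ({0..T} \<times> UNIV) f" and f0: "norm (f (0, 0)) \<le> norm (b (0, 0)) + norm (\<sigma> (0, 0))"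
    for f :: "real \<times> (real ^ 'd) \<Rightarrow> 'z::real_normed_vector"
  proof -
    have le: "norm (f (u, x)) \<le> S + L * norm x" for x
    proof -
      have "dist (f (u, x)) (f (0, 0)) \<le> L * dist (u, x) (0, 0)"
        using u T_pos by (intro lipschitz_onD[OF f]) auto
      also have "dist (u, x) (0, 0) \<le> \<bar>u\<bar> + norm x"
        using norm_Pair_le[of u x] by (simp add: dist_norm)
      finally have "dist (f (u, x)) (f (0, 0)) \<le> L * (\<bar>u\<bar> + norm x)"
        using L_pos by (simp add: mult_left_mono)
      also have "\<dots> \<le> L * (T + norm x)" using u L_pos by (intro mult_left_mono add_right_mono) auto
      finally have "norm (f (u, x) - f (0, 0)) \<le> L * T + L * norm x" by (simp add: dist_norm distrib_left)
      moreover have "norm (f (u, x)) \<le> norm (f (u, x) - f (0, 0)) + norm (f (0, 0))"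
        using norm_triangle_ineq[of "f (u, x) - f (0, 0)" "f (0, 0)"] by simp
      ultimately show ?thesis using f0 by (simp add: S_def)
    qed
    have "(\<integral>\<^sup>+\<omega>. ennreal (norm (f (u, X u \<omega>)) ^ (2 * n)) \<partial>P)
      \<le> (\<integral>\<^sup>+\<omega>. ennreal (4 ^ n) * (ennreal (S ^ (2 * n)) + ennreal (L ^ (2 * n)) * ennreal (norm (X u \<omega>) ^ (2 * n))) \<partial>P)"
    proof (rule nn_integral_mono)
      fix \<omega>
      have "norm (f (u, X u \<omega>)) ^ (2 * n) \<le> norm (S + L * norm (X u \<omega>)) ^ (2 * n)"
        using le[of "X u \<omega>"] by (intro power_mono) auto
      also have "\<dots> \<le> 4 ^ n * (norm S ^ (2 * n) + norm (L * norm (X u \<omega>)) ^ (2 * n))"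
        by (rule norm_add_power_le)
      also have "\<dots> = 4 ^ n * (S ^ (2 * n) + L ^ (2 * n) * norm (X u \<omega>) ^ (2 * n))"
        using S0 L_pos by (simp add: power_mult_distrib abs_mult)
      finally have "ennreal (norm (f (u, X u \<omega>)) ^ (2 * n)) \<le> ennreal (4 ^ n * (S ^ (2 * n) + L ^ (2 * n) * norm (X u \<omega>) ^ (2 * n)))"
        by (rule ennreal_leI)
      then show "ennreal (norm (f (u, X u \<omega>)) ^ (2 * n)) \<le> ennreal (4 ^ n) * (ennreal (S ^ (2 * n)) + ennreal (L ^ (2 * n)) * ennreal (norm (X u \<omega>) ^ (2 * n)))"
        using S0 L_pos by (simp add: ennreal_mult)
    qed
    also have "\<dots> = ennreal (4 ^ n) * (ennreal (S ^ (2 * n)) + ennreal (L ^ (2 * n)) * (\<integral>\<^sup>+\<omega>. ennreal (norm (X u \<omega>) ^ (2 * n)) \<partial>P))"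
      by (simp add: nn_integral_cmult nn_integral_add P.emeasure_space_1[simplified])
    also have "\<dots> \<le> ennreal (4 ^ n) * (ennreal (S ^ (2 * n)) + ennreal (L ^ (2 * n)) * ennreal (G ^ n))"
      using mom by (intro mult_left_mono add_left_mono) auto
    also have "\<dots> = ennreal (4 ^ n * ((S\<^sup>2) ^ n + (L\<^sup>2 * G) ^ n))"
      using S0 L_pos G by (simp add: ennreal_mult power_mult_distrib power_mult)
    also have "\<dots> \<le> ennreal (growth G ^ n)"
    proof (rule ennreal_leI)
      have "4 ^ n * ((S\<^sup>2) ^ n + (L\<^sup>2 * G) ^ n) \<le> 4 ^ n * (S\<^sup>2 + L\<^sup>2 * G) ^ n"
        using G n by (intro mult_left_mono power_add_le_power) auto
      also have "\<dots> = (4 * (S\<^sup>2 + L\<^sup>2 * G)) ^ n" by (rule power_mult_distrib[symmetric])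
      also have "\<dots> \<le> growth G ^ n"
        using G by (intro power_mono) (auto simp: growth_def S_def)
      finally show "4 ^ n * ((S\<^sup>2) ^ n + (L\<^sup>2 * G) ^ n) \<le> growth G ^ n" .
    qed
    finally show ?thesis .
  qed
  show "(\<integral>\<^sup>+\<omega>. ennreal (norm (b (u, X u \<omega>)) ^ (2 * n)) \<partial>P) \<le> ennreal (growth G ^ n)"
    "(\<integral>\<^sup>+\<omega>. ennreal (norm (\<sigma> (u, X u \<omega>)) ^ (2 * n)) \<partial>P) \<le> ennreal (growth G ^ n)"
    by (rule main[OF b_lipschitz], simp, rule main[OF \<sigma>_lipschitz], simp)
qed

definition K_square :: real where
  "K_square = enn2real (\<integral>\<^sup>+v\<in>{0..T}. ennreal ((norm (k v))\<^sup>2) \<partial>lborel)"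

lemma ker_square_le:
  assumes "0 \<le> t" "t \<le> T"
  shows "(\<integral>\<^sup>+u\<in>{0..t}. ennreal ((norm (ker t u))\<^sup>2) \<partial>lborel) \<le> ennreal K_square"
proof -
  have "(\<integral>\<^sup>+v\<in>{0..T}. ennreal ((norm (k v))\<^sup>2) \<partial>lborel) = ennreal K_square"
    using k_square by (simp add: K_square_def)
  then show ?thesis using ker_integral[OF assms, of "\<lambda>_. 1"] by simp
qed

lemma first_step_moment:
  assumes X: "cont_adapted X" and t: "0 \<le> t" "t \<le> T" and Q: "solves_at X t Q" and n: "1 \<le> n" and G: "0 \<le> G"
    and mom: "\<And>u. u \<in> {0..T} \<Longrightarrow> (\<integral>\<^sup>+\<omega>. ennreal (norm (X u \<omega>) ^ (2 * n)) \<partial>P) \<le> ennreal (G ^ n)"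
  shows "(\<integral>\<^sup>+\<omega>. ennreal (norm (Q \<omega> - X\<^sub>0) ^ (2 * n)) \<partial>P) \<le> ennreal ((C n * (K_square * growth G)) ^ n)"
proof -
  note bX = left_adapted_of_cont_adapted[OF coefficients_cont_adapted(1)[OF X]]
  note \<sigma>X = left_adapted_of_cont_adapted[OF coefficients_cont_adapted(2)[OF X]]
  obtain Z where Z: "has_ito_integral P F W t (\<lambda>s \<omega>. k (t - s) ** \<sigma> (s, X s \<omega>)) Z"
    and E: "AE \<omega> in M. set_integrable lborel {0..t} (\<lambda>s. k (t - s) *v b (s, X s \<omega>)) \<and>
        Q \<omega> = X\<^sub>0 + (LINT s:{0..t}|lborel. k (t - s) *v b (s, X s \<omega>)) + Z \<omega>"
    using Q by (auto simp: solves_at_def)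
  have D: "AE \<omega> in P. \<omega> \<in> space P \<longrightarrow> Q \<omega> - X\<^sub>0 = (LINT s:{0..t}|lborel. ker t s *v b (s, X s \<omega>)) + (Z \<omega> - 0)"
    using AE_completion[OF E]
  proof eventually_elim
    case (elim \<omega>)
    have "(LINT s:{0..t}|lborel. ker t s *v b (s, X s \<omega>)) = (LINT s:{0..t}|lborel. k (t - s) *v b (s, X s \<omega>))"
      by (rule set_lebesgue_integral_cong) (auto simp: ker_def)
    then show ?case using elim by simp
  qed
  have K0: "0 \<le> K_square" by (simp add: K_square_def)
  have V: "(\<integral>\<^sup>+u\<in>{0..t}. ennreal ((norm (ker t u))\<^sup>2 * growth G) \<partial>lborel) \<le> ennreal (K_square * growth G)"
  proof -
    have [measurable]: "ker t \<in> borel_measurable borel" by (rule ker_measurable[OF t])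
    have "(\<integral>\<^sup>+u\<in>{0..t}. ennreal ((norm (ker t u))\<^sup>2 * growth G) \<partial>lborel) = (\<integral>\<^sup>+u. ennreal (growth G) * (ennreal ((norm (ker t u))\<^sup>2) * indicator {0..t} u) \<partial>lborel)"
      using growth_pos[OF G] by (intro nn_integral_cong) (simp add: ennreal_mult mult_ac)
    also have "\<dots> = ennreal (growth G) * (\<integral>\<^sup>+u\<in>{0..t}. ennreal ((norm (ker t u))\<^sup>2) \<partial>lborel)"
      by (rule nn_integral_cmult) measurable
    also have "\<dots> \<le> ennreal (growth G) * ennreal K_square"
      by (intro mult_left_mono ker_square_le[OF t]) simp
    also have "\<dots> = ennreal (K_square * growth G)"
      using growth_pos[OF G] K0 by (simp add: ennreal_mult mult.commute)
    finally show ?thesis .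
  qed
  have "(\<integral>\<^sup>+\<omega>. ennreal (norm (Q \<omega> - X\<^sub>0) ^ (2 * n)) * indicator (space P) \<omega> \<partial>P) \<le> ennreal ((C n * (K_square * growth G)) ^ n)"
    unfolding C_def
  proof (rule volterra_estimate[OF ker_measurable[OF t] ker_square[OF t] bX \<sigma>X t Z has_ito_integral_zero[OF t(1)] sets.top _ D n _ _ _ V])
    show "mono_on {0..t} (\<lambda>_. growth G)" by (simp add: mono_on_def)
    fix u assume "u \<in> {0..t}"
    then have u: "u \<in> {0..T}" using t by auto
    show "0 < growth G \<and> (\<integral>\<^sup>+\<omega>. ennreal (norm (b (u, X u \<omega>)) ^ (2 * n)) \<partial>P) \<le> ennreal (growth G ^ n) \<and>
      (\<integral>\<^sup>+\<omega>. ennreal (norm (\<sigma> (u, X u \<omega>)) ^ (2 * n)) \<partial>P) \<le> ennreal (growth G ^ n)"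
      using growth_pos[OF G] coefficient_moments[OF X n G u mom[OF u]] by blast
  qed (use K0 growth_pos[OF G] in \<open>auto simp: ker_def\<close>)
  moreover have "(\<integral>\<^sup>+\<omega>. ennreal (norm (Q \<omega> - X\<^sub>0) ^ (2 * n)) * indicator (space P) \<omega> \<partial>P) = (\<integral>\<^sup>+\<omega>. ennreal (norm (Q \<omega> - X\<^sub>0) ^ (2 * n)) \<partial>P)"
    by (intro nn_integral_cong) simp
  ultimately show ?thesis by simp
qed

text \<open>
  The integral up to \<open>s\<close> is one up to \<open>t\<close> with the kernel extended by zero, so that the increment is
  the convolution with the difference \<open>\<kappa>\<close> of two kernels.
\<close>

lemma increment_moment:
  assumes X: "cont_adapted X" and st: "0 \<le> s" "s \<le> t" "t \<le> T" and Qs: "solves_at X s Q" and Qt: "solves_at X t Q'"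
    and n: "1 \<le> n" and G: "0 \<le> G"
    and mom: "\<And>u. u \<in> {0..T} \<Longrightarrow> (\<integral>\<^sup>+\<omega>. ennreal (norm (X u \<omega>) ^ (2 * n)) \<partial>P) \<le> ennreal (G ^ n)"
  shows "(\<integral>\<^sup>+\<omega>. ennreal (norm (Q' \<omega> - Q \<omega>) ^ (2 * n)) \<partial>P) \<le> ennreal ((C n * growth G * c * (t - s) powr \<gamma>) ^ n)"
proof -
  have t: "0 \<le> t" "t \<le> T" and s: "0 \<le> s" "s \<le> T" using st by auto
  note bX = left_adapted_of_cont_adapted[OF coefficients_cont_adapted(1)[OF X]]
  note \<sigma>X = left_adapted_of_cont_adapted[OF coefficients_cont_adapted(2)[OF X]]
  define \<kappa> where "\<kappa> = (\<lambda>u. ker t u - ker s u)"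
  have \<kappa>m: "\<kappa> \<in> borel_measurable borel"
    unfolding \<kappa>_def using ker_measurable[OF t] ker_measurable[OF s] by measurable
  have mod: "(\<integral>\<^sup>+u\<in>{0..t}. ennreal ((norm (\<kappa> u))\<^sup>2) \<partial>lborel) \<le> ennreal (c * (t - s) powr \<gamma>)"
  proof -
    have "(\<integral>\<^sup>+u\<in>{0..t}. ennreal ((norm (\<kappa> u))\<^sup>2) \<partial>lborel) = (\<integral>\<^sup>+u\<in>{0..t}. ennreal ((norm (k (t - u) - (if u \<le> s then k (s - u) else 0)))\<^sup>2) \<partial>lborel)"
      using st by (intro nn_integral_cong) (auto simp: \<kappa>_def ker_def indicator_def)
    then show ?thesis using k_modulus[OF st] by simp
  qed
  obtain Z' where Z': "has_ito_integral P F W t (\<lambda>u \<omega>. k (t - u) ** \<sigma> (u, X u \<omega>)) Z'"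
    and E': "AE \<omega> in M. set_integrable lborel {0..t} (\<lambda>u. k (t - u) *v b (u, X u \<omega>)) \<and>
        Q' \<omega> = X\<^sub>0 + (LINT u:{0..t}|lborel. k (t - u) *v b (u, X u \<omega>)) + Z' \<omega>"
    using Qt by (auto simp: solves_at_def)
  obtain Z where Z: "has_ito_integral P F W s (\<lambda>u \<omega>. k (s - u) ** \<sigma> (u, X u \<omega>)) Z"
    and E: "AE \<omega> in M. set_integrable lborel {0..s} (\<lambda>u. k (s - u) *v b (u, X u \<omega>)) \<and>
        Q \<omega> = X\<^sub>0 + (LINT u:{0..s}|lborel. k (s - u) *v b (u, X u \<omega>)) + Z \<omega>"
    using Qs by (auto simp: solves_at_def)
  have D: "AE \<omega> in P. \<omega> \<in> space P \<longrightarrow> Q' \<omega> - Q \<omega> = (LINT u:{0..t}|lborel. \<kappa> u *v b (u, X u \<omega>)) + (Z' \<omega> - Z \<omega>)"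
    using AE_completion[OF E'] AE_completion[OF E]
  proof eventually_elim
    case (elim \<omega>)
    have it: "set_integrable lborel {0..t} (\<lambda>u. ker t u *v b (u, X u \<omega>)) \<longleftrightarrow> set_integrable lborel {0..t} (\<lambda>u. k (t - u) *v b (u, X u \<omega>))"
      by (rule set_integrable_cong) (auto simp: ker_def)
    have lt: "(LINT u:{0..t}|lborel. ker t u *v b (u, X u \<omega>)) = (LINT u:{0..t}|lborel. k (t - u) *v b (u, X u \<omega>))"
      by (rule set_lebesgue_integral_cong) (auto simp: ker_def)
    have eq: "(\<lambda>u. indicat_real {0..s} u *\<^sub>R (k (s - u) *v b (u, X u \<omega>))) = (\<lambda>u. indicat_real {0..t} u *\<^sub>R (ker s u *v b (u, X u \<omega>)))"
      using st by (auto simp: fun_eq_iff ker_def indicator_def)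
    have "(LINT u:{0..t}|lborel. \<kappa> u *v b (u, X u \<omega>)) = (LINT u:{0..t}|lborel. ker t u *v b (u, X u \<omega>) - ker s u *v b (u, X u \<omega>))"
      by (simp add: \<kappa>_def mv.diff_left)
    also have "\<dots> = (LINT u:{0..t}|lborel. ker t u *v b (u, X u \<omega>)) - (LINT u:{0..t}|lborel. ker s u *v b (u, X u \<omega>))"
      using elim it eq by (intro set_integral_diff) (auto simp: set_integrable_def)
    finally show ?case
      using elim lt eq by (simp add: set_lebesgue_integral_def)
  qed
  let ?V = "growth G * (c * (t - s) powr \<gamma>)"
  have V: "(\<integral>\<^sup>+u\<in>{0..t}. ennreal ((norm (\<kappa> u))\<^sup>2 * growth G) \<partial>lborel) \<le> ennreal ?V"
  proof -
    have [measurable]: "\<kappa> \<in> borel_measurable borel" by (rule \<kappa>m)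
    have "(\<integral>\<^sup>+u\<in>{0..t}. ennreal ((norm (\<kappa> u))\<^sup>2 * growth G) \<partial>lborel) = (\<integral>\<^sup>+u. ennreal (growth G) * (ennreal ((norm (\<kappa> u))\<^sup>2) * indicator {0..t} u) \<partial>lborel)"
      using growth_pos[OF G] by (intro nn_integral_cong) (simp add: ennreal_mult mult_ac)
    also have "\<dots> = ennreal (growth G) * (\<integral>\<^sup>+u\<in>{0..t}. ennreal ((norm (\<kappa> u))\<^sup>2) \<partial>lborel)"
      by (rule nn_integral_cmult) measurable
    also have "\<dots> \<le> ennreal (growth G) * ennreal (c * (t - s) powr \<gamma>)"
      by (intro mult_left_mono mod) simp
    also have "\<dots> = ennreal ?V"
      using growth_pos[OF G] c_nonneg by (simp add: ennreal_mult)
    finally show ?thesis .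
  qed
  have "(\<integral>\<^sup>+\<omega>. ennreal (norm (Q' \<omega> - Q \<omega>) ^ (2 * n)) * indicator (space P) \<omega> \<partial>P) \<le> ennreal ((C n * ?V) ^ n)"
    unfolding C_def
  proof (rule volterra_estimate[OF \<kappa>m _ bX \<sigma>X t Z' has_ito_integral_extend[OF Z st(1,2)] sets.top _ D n _ _ _ V])
    show "(\<integral>\<^sup>+u\<in>{0..t}. ennreal ((norm (\<kappa> u))\<^sup>2) \<partial>lborel) < \<infinity>"
      using mod by (rule le_less_trans) simp
    show "mono_on {0..t} (\<lambda>_. growth G)" by (simp add: mono_on_def)
    show "\<kappa> u ** \<sigma> (u, X u \<omega>) = k (t - u) ** \<sigma> (u, X u \<omega>) - (if u \<le> s then k (s - u) ** \<sigma> (u, X u \<omega>) else 0)"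
      if "u \<in> {0..t}" for u \<omega>
      using that by (auto simp: \<kappa>_def ker_def mm.diff_left)
    fix u assume "u \<in> {0..t}"
    then have u: "u \<in> {0..T}" using t by auto
    show "0 < growth G \<and> (\<integral>\<^sup>+\<omega>. ennreal (norm (b (u, X u \<omega>)) ^ (2 * n)) \<partial>P) \<le> ennreal (growth G ^ n) \<and>
      (\<integral>\<^sup>+\<omega>. ennreal (norm (\<sigma> (u, X u \<omega>)) ^ (2 * n)) \<partial>P) \<le> ennreal (growth G ^ n)"
      using growth_pos[OF G] coefficient_moments[OF X n G u mom[OF u]] by blast
  qed (use growth_pos[OF G] c_nonneg in \<open>auto intro!: mult_nonneg_nonneg\<close>)
  moreover have "(\<integral>\<^sup>+\<omega>. ennreal (norm (Q' \<omega> - Q \<omega>) ^ (2 * n)) * indicator (space P) \<omega> \<partial>P) = (\<integral>\<^sup>+\<omega>. ennreal (norm (Q' \<omega> - Q \<omega>) ^ (2 * n)) \<partial>P)"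
    by (intro nn_integral_cong) simp
  ultimately show ?thesis by (simp add: mult.assoc)
qed

lemma picard_step:
  assumes X: "cont_adapted X" and n: "1 \<le> n" "1 < real n * \<gamma>" and G: "0 \<le> G"
    and mom: "\<And>u. u \<in> {0..T} \<Longrightarrow> (\<integral>\<^sup>+\<omega>. ennreal (norm (X u \<omega>) ^ (2 * n)) \<partial>P) \<le> ennreal (G ^ n)"
  shows "\<exists>X'. cont_adapted X' \<and> (\<forall>t\<in>{0..T}. solves_at X t (X' t))"
proof -
  have "\<forall>t\<in>{0..T}. \<exists>Q. Q \<in> borel_measurable (F t) \<and> solves_at X t Q"
    using solves_at_exists[OF X] by fastforce
  from bchoice[OF this] obtain Q where Q: "\<And>t. t \<in> {0..T} \<Longrightarrow> Q t \<in> borel_measurable (F t)"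
    "\<And>t. t \<in> {0..T} \<Longrightarrow> solves_at X t (Q t)" by blast
  have "\<exists>X'. cont_adapted X' \<and> (\<forall>t\<in>{0..T}. AE \<omega> in M. Q t \<omega> = X' t \<omega>)"
  proof (rule cont_adapted_modification[OF Q(1) n, where D = "C n * growth G * c"])
    show "0 \<le> C n * growth G * c"
      using C_pos[of n] growth_pos[OF G] c_nonneg by simp
    show "(\<integral>\<^sup>+\<omega>. ennreal (norm (Q t \<omega> - Q s \<omega>) ^ (2 * n)) \<partial>P) \<le> ennreal ((C n * growth G * c * (t - s) powr \<gamma>) ^ n)"
      if "0 \<le> s" "s \<le> t" "t \<le> T" for s t
      by (rule increment_moment[OF X that Q(2) Q(2) n(1) G mom]) (use that in auto)
  qed
  then show ?thesis using solves_at_cong_AE[OF Q(2)] by blast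
qed

lemma small_weight:
  "\<exists>\<theta>\<ge>0. (\<integral>\<^sup>+v\<in>{0..T}. ennreal ((norm (k v))\<^sup>2) * ennreal (exp (- (\<theta> * v))) \<partial>lborel) \<le> ennreal (1/8 / (C n * L\<^sup>2))"
  using L_pos C_pos[of n] by (intro exponential_weight) simp

section \<open>Existence and uniqueness\<close>

text \<open>
  The Picard iterates stay in a ball around the initial value in the weighted norm, so their moments and
  therefore the constants in their moduli of continuity are bounded uniformly.  They converge by
  contraction, and the limit inherits the modulus, hence has a continuous modification.  The right-hand
  side formed with the limit is the limit of the iterates, again by contraction.
\<close>

theorem volterra_solution_exists:
  "\<exists>X. cont_adapted X \<and> (\<forall>t\<in>{0..T}. solves_at X t (X t))"
proof -
  obtain n0 :: nat where n0: "1 / \<gamma> < real n0" using reals_Archimedean2 by blast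
  define n where "n = max 1 n0"
  have n1: "1 \<le> n" and n\<gamma>: "1 < real n * \<gamma>"
  proof -
    have "1 / \<gamma> < real n" using n0 by (simp add: n_def)
    then show "1 < real n * \<gamma>" using \<gamma>_pos by (simp add: field_simps)
  qed (simp add: n_def)
  obtain \<theta> where \<theta>: "0 \<le> \<theta>" "(\<integral>\<^sup>+v\<in>{0..T}. ennreal ((norm (k v))\<^sup>2) * ennreal (exp (- (\<theta> * v))) \<partial>lborel) \<le> ennreal (1/8 / (C n * L\<^sup>2))"
    using small_weight by blast
  define x0 where "x0 = (\<lambda>(t::real) (\<omega>::'a). X\<^sub>0)"
  have x0: "cont_adapted x0" by (simp add: cont_adapted_def x0_def)
  define G0 where "G0 = (norm X\<^sub>0)\<^sup>2"
  have G0: "0 \<le> G0" by (simp add: G0_def)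
  have x0_mom: "(\<integral>\<^sup>+\<omega>. ennreal (norm (x0 u \<omega>) ^ (2 * n)) \<partial>P) \<le> ennreal (G0 ^ n)" for u
    using P.emeasure_space_1 by (simp add: x0_def G0_def power_mult)
  obtain X1 where X1: "cont_adapted X1" "\<And>t. t \<in> {0..T} \<Longrightarrow> solves_at x0 t (X1 t)"
    using picard_step[OF x0 n1 n\<gamma> G0 x0_mom] by blast
  define B0 where "B0 = C n * (K_square * growth G0)"
  have B0: "0 \<le> B0" using C_pos[of n] growth_pos[OF G0] by (simp add: B0_def K_square_def)
  have X1_mom: "(\<integral>\<^sup>+\<omega>. ennreal (norm (X1 u \<omega> - X\<^sub>0) ^ (2 * n)) \<partial>P) \<le> ennreal (B0 ^ n)" if "u \<in> {0..T}" for u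
    unfolding B0_def by (rule first_step_moment[OF x0 _ _ X1(2)[OF that] n1 G0 x0_mom]) (use that in auto)
  \<comment> \<open>The factor 4 from splitting a \<open>2n\<close>-th power leaves the contraction rate \<open>4 / 8\<close>, and a ball of radius
    \<open>8 * B0\<close> has room for the image \<open>B0\<close> of the constant process.\<close>
  define B where "B = 8 * B0 + 1"
  have B: "0 < B" using B0 by (simp add: B_def)
  define E where "E = exp (\<theta> * T)"
  have E: "1 \<le> E" using \<theta>(1) T_pos by (simp add: E_def)
  have exp_bounds: "1 \<le> exp (\<theta> * u)" "exp (\<theta> * u) \<le> E" if "u \<in> {0..T}" for u
    using that \<theta>(1) by (auto simp: E_def mult_left_mono)
  define Inv where "Inv = (\<lambda>X. cont_adapted X \<and> (\<forall>u\<in>{0..T}. (\<integral>\<^sup>+\<omega>. ennreal (norm (X u \<omega> - X\<^sub>0) ^ (2 * n)) \<partial>P) \<le> ennreal ((B * exp (\<theta> * u)) ^ n)))"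
  define G where "G = 4 * (B * E + G0)"
  have G: "0 \<le> G" using B E G0 by (simp add: G_def)
  have meas: "X u \<in> borel_measurable P" if "cont_adapted X" "u \<in> {0..T}" for X :: "real \<Rightarrow> 'a \<Rightarrow> real ^ 'd" and u
    using that by (auto simp: cont_adapted_def intro!: measurable_F_P[of _ u])
  have Inv_mom: "(\<integral>\<^sup>+\<omega>. ennreal (norm (X u \<omega>) ^ (2 * n)) \<partial>P) \<le> ennreal (G ^ n)" if X: "Inv X" and u: "u \<in> {0..T}" for X u
  proof -
    have [measurable]: "X u \<in> borel_measurable P" using X u by (intro meas) (auto simp: Inv_def)
    have "(\<integral>\<^sup>+\<omega>. ennreal (norm (X u \<omega>) ^ (2 * n)) \<partial>P) \<le> (\<integral>\<^sup>+\<omega>. ennreal (4 ^ n) * (ennreal (norm (X u \<omega> - X\<^sub>0) ^ (2 * n)) + ennreal (G0 ^ n)) \<partial>P)"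
    proof (rule nn_integral_mono)
      fix \<omega>
      have "norm (X u \<omega>) ^ (2 * n) \<le> 4 ^ n * (norm (X u \<omega> - X\<^sub>0) ^ (2 * n) + norm X\<^sub>0 ^ (2 * n))"
        using norm_add_power_le[of "X u \<omega> - X\<^sub>0" X\<^sub>0 n] by simp
      then have "ennreal (norm (X u \<omega>) ^ (2 * n)) \<le> ennreal (4 ^ n * (norm (X u \<omega> - X\<^sub>0) ^ (2 * n) + G0 ^ n))"
        by (intro ennreal_leI) (simp add: G0_def power_mult)
      then show "ennreal (norm (X u \<omega>) ^ (2 * n)) \<le> ennreal (4 ^ n) * (ennreal (norm (X u \<omega> - X\<^sub>0) ^ (2 * n)) + ennreal (G0 ^ n))"
        using G0 by (simp add: ennreal_mult)
    qed
    also have "\<dots> = ennreal (4 ^ n) * ((\<integral>\<^sup>+\<omega>. ennreal (norm (X u \<omega> - X\<^sub>0) ^ (2 * n)) \<partial>P) + ennreal (G0 ^ n))"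
      using P.emeasure_space_1 by (simp add: nn_integral_cmult nn_integral_add)
    also have "\<dots> \<le> ennreal (4 ^ n) * (ennreal ((B * exp (\<theta> * u)) ^ n) + ennreal (G0 ^ n))"
      using X u by (intro mult_left_mono add_right_mono) (auto simp: Inv_def)
    also have "\<dots> = ennreal (4 ^ n * ((B * exp (\<theta> * u)) ^ n + G0 ^ n))"
      using B G0 by (simp add: ennreal_mult)
    also have "\<dots> \<le> ennreal (G ^ n)"
    proof (rule ennreal_leI)
      have "(B * exp (\<theta> * u)) ^ n + G0 ^ n \<le> (B * exp (\<theta> * u) + G0) ^ n"
        using B G0 n1 by (intro power_add_le_power) auto
      also have "\<dots> \<le> (B * E + G0) ^ n"
        using B G0 exp_bounds[OF u] by (intro power_mono add_right_mono mult_left_mono) auto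
      finally have "4 ^ n * ((B * exp (\<theta> * u)) ^ n + G0 ^ n) \<le> 4 ^ n * (B * E + G0) ^ n" by simp
      also have "\<dots> = G ^ n" by (simp only: G_def power_mult_distrib)
      finally show "4 ^ n * ((B * exp (\<theta> * u)) ^ n + G0 ^ n) \<le> G ^ n" .
    qed
    finally show ?thesis .
  qed
  have contract: "(\<integral>\<^sup>+\<omega>. ennreal (norm (Q1 \<omega> - Q2 \<omega>) ^ (2 * n)) \<partial>P) \<le> ennreal ((1/8 * A * exp (\<theta> * t)) ^ n)"
    if "cont_adapted Y1" "cont_adapted Y2" "t \<in> {0..T}" "solves_at Y1 t Q1" "solves_at Y2 t Q2" "0 < A"
      and "\<And>u. u \<in> {0..T} \<Longrightarrow> (\<integral>\<^sup>+\<omega>. ennreal (norm (Y1 u \<omega> - Y2 u \<omega>) ^ (2 * n)) \<partial>P) \<le> ennreal ((A * exp (\<theta> * u)) ^ n)"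
    for Y1 Y2 t Q1 Q2 A
    using picard_difference[OF that(1,2) _ _ that(4,5) switch_one n1 that(6) _ \<theta>] that(3,7) by simp
  have Inv_x0: "Inv x0" unfolding Inv_def
    using x0 B n1 by (auto simp: x0_def zero_power)
  have next_step: "\<exists>X'. Inv X' \<and> (\<forall>t\<in>{0..T}. solves_at X t (X' t))" if X: "Inv X" for X
  proof -
    have cX: "cont_adapted X" using X by (simp add: Inv_def)
    obtain X' where X': "cont_adapted X'" "\<And>t. t \<in> {0..T} \<Longrightarrow> solves_at X t (X' t)"
      using picard_step[OF cX n1 n\<gamma> G Inv_mom[OF X]] by blast
    have "(\<integral>\<^sup>+\<omega>. ennreal (norm (X' u \<omega> - X\<^sub>0) ^ (2 * n)) \<partial>P) \<le> ennreal ((B * exp (\<theta> * u)) ^ n)" if u: "u \<in> {0..T}" for u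
    proof -
      have [measurable]: "X' u \<in> borel_measurable P" "X1 u \<in> borel_measurable P"
        using u X'(1) X1(1) by (auto intro!: meas)
      have d: "(\<integral>\<^sup>+\<omega>. ennreal (norm (X' u \<omega> - X1 u \<omega>) ^ (2 * n)) \<partial>P) \<le> ennreal ((1/8 * B * exp (\<theta> * u)) ^ n)"
        by (rule contract[OF cX x0 u X'(2)[OF u] X1(2)[OF u] B]) (use X in \<open>simp add: Inv_def x0_def\<close>)
      have "(\<integral>\<^sup>+\<omega>. ennreal (norm (X' u \<omega> - X\<^sub>0) ^ (2 * n)) \<partial>P) \<le> (\<integral>\<^sup>+\<omega>. ennreal (4 ^ n) * (ennreal (norm (X' u \<omega> - X1 u \<omega>) ^ (2 * n)) + ennreal (norm (X1 u \<omega> - X\<^sub>0) ^ (2 * n))) \<partial>P)"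
      proof (rule nn_integral_mono)
        fix \<omega>
        have "norm (X' u \<omega> - X\<^sub>0) ^ (2 * n) \<le> 4 ^ n * (norm (X' u \<omega> - X1 u \<omega>) ^ (2 * n) + norm (X1 u \<omega> - X\<^sub>0) ^ (2 * n))"
          using norm_add_power_le[of "X' u \<omega> - X1 u \<omega>" "X1 u \<omega> - X\<^sub>0" n] by simp
        then have "ennreal (norm (X' u \<omega> - X\<^sub>0) ^ (2 * n)) \<le> ennreal (4 ^ n * (norm (X' u \<omega> - X1 u \<omega>) ^ (2 * n) + norm (X1 u \<omega> - X\<^sub>0) ^ (2 * n)))"
          by (rule ennreal_leI)
        then show "ennreal (norm (X' u \<omega> - X\<^sub>0) ^ (2 * n)) \<le> ennreal (4 ^ n) * (ennreal (norm (X' u \<omega> - X1 u \<omega>) ^ (2 * n)) + ennreal (norm (X1 u \<omega> - X\<^sub>0) ^ (2 * n)))"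
          by (simp add: ennreal_mult)
      qed
      also have "\<dots> = ennreal (4 ^ n) * ((\<integral>\<^sup>+\<omega>. ennreal (norm (X' u \<omega> - X1 u \<omega>) ^ (2 * n)) \<partial>P) + (\<integral>\<^sup>+\<omega>. ennreal (norm (X1 u \<omega> - X\<^sub>0) ^ (2 * n)) \<partial>P))"
        by (simp add: nn_integral_cmult nn_integral_add)
      also have "\<dots> \<le> ennreal (4 ^ n) * (ennreal ((1/8 * B * exp (\<theta> * u)) ^ n) + ennreal (B0 ^ n))"
        using d X1_mom[OF u] by (intro mult_left_mono add_mono) auto
      also have "\<dots> = ennreal (4 ^ n * ((1/8 * B * exp (\<theta> * u)) ^ n + B0 ^ n))"
        using B B0 by (simp add: ennreal_mult)
      also have "\<dots> \<le> ennreal ((B * exp (\<theta> * u)) ^ n)"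
      proof (rule ennreal_leI)
        have "(1/8 * B * exp (\<theta> * u)) ^ n + B0 ^ n \<le> (1/8 * B * exp (\<theta> * u) + B0) ^ n"
          using B B0 n1 by (intro power_add_le_power) auto
        then have "4 ^ n * ((1/8 * B * exp (\<theta> * u)) ^ n + B0 ^ n) \<le> 4 ^ n * (1/8 * B * exp (\<theta> * u) + B0) ^ n" by simp
        also have "\<dots> = (4 * (1/8 * B * exp (\<theta> * u) + B0)) ^ n" by (rule power_mult_distrib[symmetric])
        also have "\<dots> \<le> (B * exp (\<theta> * u)) ^ n"
        proof (rule power_mono)
          have "8 * B0 \<le> B * 1" by (simp add: B_def)
          also have "\<dots> \<le> B * exp (\<theta> * u)" using B exp_bounds[OF u] by (intro mult_left_mono) auto
          finally show "4 * (1/8 * B * exp (\<theta> * u) + B0) \<le> B * exp (\<theta> * u)" by simp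
        qed (use B B0 in simp)
        finally show "4 ^ n * ((1/8 * B * exp (\<theta> * u)) ^ n + B0 ^ n) \<le> (B * exp (\<theta> * u)) ^ n" .
      qed
      finally show ?thesis .
    qed
    then have "Inv X'" using X'(1) by (simp add: Inv_def)
    then show ?thesis using X'(2) by blast
  qed
  have "\<exists>Xs. \<forall>j. (Inv (Xs j) \<and> (j = 0 \<longrightarrow> Xs j = x0)) \<and> (\<forall>t\<in>{0..T}. solves_at (Xs j) t (Xs (Suc j) t))"
    by (rule dependent_nat_choice) (use Inv_x0 next_step in auto)
  then obtain Xs where Xs: "\<And>j. Inv (Xs j)" "Xs 0 = x0" "\<And>j t. t \<in> {0..T} \<Longrightarrow> solves_at (Xs j) t (Xs (Suc j) t)"
    by blast
  have cXs: "cont_adapted (Xs j)" for j using Xs(1) by (simp add: Inv_def)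
  have diff: "(\<integral>\<^sup>+\<omega>. ennreal (norm (Xs (Suc j) u \<omega> - Xs j u \<omega>) ^ (2 * n)) \<partial>P) \<le> ennreal (((1/8) ^ j * B * exp (\<theta> * u)) ^ n)"
    if "u \<in> {0..T}" for j u
    using that
  proof (induction j arbitrary: u)
    case 0
    then show ?case using Xs(1)[of 1] by (simp add: Inv_def Xs(2) x0_def)
  next
    case (Suc j)
    have "(\<integral>\<^sup>+\<omega>. ennreal (norm (Xs (Suc (Suc j)) u \<omega> - Xs (Suc j) u \<omega>) ^ (2 * n)) \<partial>P) \<le> ennreal ((1/8 * ((1/8) ^ j * B) * exp (\<theta> * u)) ^ n)"
      by (rule contract[OF cXs cXs Suc.prems Xs(3)[OF Suc.prems] Xs(3)[OF Suc.prems] _ Suc.IH]) (use B in auto)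
    then show ?case by (simp add: mult.assoc)
  qed
  define D where "D = B * E"
  have D: "0 < D" using B E by (simp add: D_def)
  have diff': "(\<integral>\<^sup>+\<omega>. ennreal (norm (Xs (Suc j) u \<omega> - Xs j u \<omega>) ^ (2 * n)) \<partial>P) \<le> ennreal ((D * (1/8) ^ j) ^ n)"
    if u: "u \<in> {0..T}" for j u
  proof -
    have "(1/8) ^ j * B * exp (\<theta> * u) \<le> (1/8) ^ j * B * E"
      using B exp_bounds[OF u] by (intro mult_left_mono) auto
    then have "((1/8) ^ j * B * exp (\<theta> * u)) ^ n \<le> (D * (1/8) ^ j) ^ n"
      using B by (intro power_mono) (auto simp: D_def mult_ac)
    then show ?thesis using diff[OF u, of j] by (meson ennreal_leI order_trans)
  qed
  define Xt where "Xt = (\<lambda>t \<omega>. lim (\<lambda>j. Xs j t \<omega>))"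
  have lim: "AE \<omega> in P. (\<lambda>j. Xs j t \<omega>) \<longlonglongrightarrow> Xt t \<omega>" if "t \<in> {0..T}" for t
    unfolding Xt_def
    by (rule P.geometric_moment_limit(1)[where f = "\<lambda>j. Xs j t" and n = n and D = D])
       (use meas[OF cXs that] n1 D diff'[OF that] in auto)
  have Xt_close: "(\<integral>\<^sup>+\<omega>. ennreal (norm (Xs j t \<omega> - Xt t \<omega>) ^ (2 * n)) \<partial>P) \<le> ennreal ((8 * D * (1/4) ^ j) ^ n)" if "t \<in> {0..T}" for j t
    unfolding Xt_def
    by (rule P.geometric_moment_limit(2)[where f = "\<lambda>j. Xs j t" and n = n and D = D])
       (use meas[OF cXs that] n1 D diff'[OF that] in auto)
  have XtF: "Xt t \<in> borel_measurable (F t)" if "t \<in> {0..T}" for t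
    unfolding Xt_def by (rule borel_measurable_lim_metric) (use cXs that in \<open>simp add: cont_adapted_def\<close>)
  define R where "R = C n * growth G * c"
  have R: "0 \<le> R" using C_pos[of n] growth_pos[OF G] c_nonneg by (simp add: R_def)
  have "\<exists>X. cont_adapted X \<and> (\<forall>t\<in>{0..T}. AE \<omega> in M. Xt t \<omega> = X t \<omega>)"
  proof (rule cont_adapted_modification[OF XtF n1 n\<gamma> R])
    fix s t assume st: "0 \<le> s" "s \<le> t" "t \<le> T"
    then have sT: "s \<in> {0..T}" and tT: "t \<in> {0..T}" by auto
    show "(\<integral>\<^sup>+\<omega>. ennreal (norm (Xt t \<omega> - Xt s \<omega>) ^ (2 * n)) \<partial>P) \<le> ennreal ((R * (t - s) powr \<gamma>) ^ n)"
    proof (rule nn_integral_le_of_tendsto)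
      show "(\<integral>\<^sup>+\<omega>. ennreal (norm (Xs (Suc j) t \<omega> - Xs (Suc j) s \<omega>) ^ (2 * n)) \<partial>P) \<le> ennreal ((R * (t - s) powr \<gamma>) ^ n)" for j
        unfolding R_def by (rule increment_moment[OF cXs st Xs(3)[OF sT] Xs(3)[OF tT] n1 G Inv_mom[OF Xs(1)]])
      show "(\<lambda>\<omega>. ennreal (norm (Xs (Suc j) t \<omega> - Xs (Suc j) s \<omega>) ^ (2 * n))) \<in> borel_measurable P" for j
        using meas[OF cXs sT, of "Suc j"] meas[OF cXs tT, of "Suc j"] by measurable
      show "AE \<omega> in P. (\<lambda>j. ennreal (norm (Xs (Suc j) t \<omega> - Xs (Suc j) s \<omega>) ^ (2 * n))) \<longlonglongrightarrow> ennreal (norm (Xt t \<omega> - Xt s \<omega>) ^ (2 * n))"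
        using lim[OF sT] lim[OF tT]
      proof eventually_elim
        case (elim \<omega>)
        show ?case
          by (intro tendsto_ennrealI tendsto_power tendsto_norm tendsto_diff LIMSEQ_Suc[OF elim(1)] LIMSEQ_Suc[OF elim(2)])
      qed
    qed (rule tendsto_const)
  qed
  then obtain X where X: "cont_adapted X" "\<And>t. t \<in> {0..T} \<Longrightarrow> AE \<omega> in M. Xt t \<omega> = X t \<omega>" by blast
  have "solves_at X t (X t)" if t: "t \<in> {0..T}" for t
  proof -
    obtain Q where Q: "Q \<in> borel_measurable (F t)" "solves_at X t Q"
      using solves_at_exists[OF X(1)] t by auto
    have [measurable]: "Q \<in> borel_measurable P" "Xt t \<in> borel_measurable P"
      using measurable_F_P[OF Q(1)] measurable_F_P[OF XtF[OF t]] by auto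
    define A where "A = (\<lambda>j. 8 * D * (1/4) ^ j)"
    have A: "0 < A j" for j using D by (simp add: A_def)
    have close: "(\<integral>\<^sup>+\<omega>. ennreal (norm (Xs j u \<omega> - X u \<omega>) ^ (2 * n)) \<partial>P) \<le> ennreal ((A j * exp (\<theta> * u)) ^ n)" if u: "u \<in> {0..T}" for j u
    proof -
      have "(\<integral>\<^sup>+\<omega>. ennreal (norm (Xs j u \<omega> - X u \<omega>) ^ (2 * n)) \<partial>P) = (\<integral>\<^sup>+\<omega>. ennreal (norm (Xs j u \<omega> - Xt u \<omega>) ^ (2 * n)) \<partial>P)"
        by (rule nn_integral_cong_AE, rule eventually_mono[OF AE_completion[OF X(2)[OF u]]]) simp
      also have "\<dots> \<le> ennreal (A j ^ n)" using Xt_close[OF u, of j] by (simp add: A_def)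
      also have "\<dots> \<le> ennreal ((A j * exp (\<theta> * u)) ^ n)"
      proof (intro ennreal_leI power_mono)
        have "A j * 1 \<le> A j * exp (\<theta> * u)" using A[of j] exp_bounds[OF u] by (intro mult_left_mono) auto
        then show "A j \<le> A j * exp (\<theta> * u)" by simp
      qed (use A[of j] in simp)
      finally show ?thesis .
    qed
    have "(\<integral>\<^sup>+\<omega>. ennreal (norm (Xt t \<omega> - Q \<omega>) ^ (2 * n)) \<partial>P) \<le> ennreal 0"
    proof (rule nn_integral_le_of_tendsto)
      show "(\<integral>\<^sup>+\<omega>. ennreal (norm (Xs (Suc j) t \<omega> - Q \<omega>) ^ (2 * n)) \<partial>P) \<le> ennreal ((1/8 * A j * exp (\<theta> * t)) ^ n)" for j
        by (rule contract[OF cXs X(1) t Xs(3)[OF t] Q(2) A close])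
      show "(\<lambda>\<omega>. ennreal (norm (Xs (Suc j) t \<omega> - Q \<omega>) ^ (2 * n))) \<in> borel_measurable P" for j
        using meas[OF cXs t, of "Suc j"] by measurable
      show "AE \<omega> in P. (\<lambda>j. ennreal (norm (Xs (Suc j) t \<omega> - Q \<omega>) ^ (2 * n))) \<longlonglongrightarrow> ennreal (norm (Xt t \<omega> - Q \<omega>) ^ (2 * n))"
        using lim[OF t]
      proof eventually_elim
        case (elim \<omega>)
        show ?case by (intro tendsto_ennrealI tendsto_power tendsto_norm tendsto_diff tendsto_const LIMSEQ_Suc[OF elim])
      qed
      have "(\<lambda>j. (1/4 :: real) ^ j) \<longlonglongrightarrow> 0" by (rule LIMSEQ_power_zero) simp
      then have "(\<lambda>j. ennreal ((1/8 * A j * exp (\<theta> * t)) ^ n)) \<longlonglongrightarrow> ennreal ((1/8 * (8 * D * 0) * exp (\<theta> * t)) ^ n)"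
        unfolding A_def by (intro tendsto_ennrealI tendsto_power tendsto_mult tendsto_const)
      then show "(\<lambda>j. ennreal ((1/8 * A j * exp (\<theta> * t)) ^ n)) \<longlonglongrightarrow> ennreal 0" using n1 by (simp add: zero_power)
    qed
    then have "AE \<omega> in P. Xt t \<omega> - Q \<omega> = 0"
      using n1 by (intro AE_eq_0_of_nn_integral_power[where p = "2 * n"]) auto
    then have "AE \<omega> in M. Xt t \<omega> - Q \<omega> = 0" by (simp only: AE_completion_iff)
    with X(2)[OF t] have "AE \<omega> in M. Q \<omega> = X t \<omega>" by eventually_elim simp
    then show ?thesis by (rule solves_at_cong_AE[OF Q(2)])
  qed
  then show ?thesis using X(1) by blast
qed

text \<open>
  A solution need not have moments a priori.  Up to the time at which one of the two leaves a ball of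
  radius \<open>N\<close>, however, the difference is bounded, and there the contraction can be iterated.
  Every continuous path stays in some ball, so letting \<open>N\<close> grow covers almost all paths.
\<close>

theorem volterra_solution_unique:
  assumes X: "cont_adapted X" "\<And>t. t \<in> {0..T} \<Longrightarrow> solves_at X t (X t)"
    and Y: "cont_adapted Y" "\<And>t. t \<in> {0..T} \<Longrightarrow> solves_at Y t (Y t)"
  shows "AE \<omega> in M. \<forall>t\<in>{0..T}. Y t \<omega> = X t \<omega>"
proof -
  obtain \<theta> where \<theta>: "0 \<le> \<theta>" "(\<integral>\<^sup>+v\<in>{0..T}. ennreal ((norm (k v))\<^sup>2) * ennreal (exp (- (\<theta> * v))) \<partial>lborel) \<le> ennreal (1/8 / (C 1 * L\<^sup>2))"
    using small_weight by blast
  define h where "h = (\<lambda>t \<omega>. max (norm (X t \<omega>)) (norm (Y t \<omega>)))"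
  have h: "cont_adapted h"
    using X(1) Y(1) unfolding cont_adapted_def h_def
    by (auto intro!: borel_measurable_max continuous_on_max continuous_on_norm
        measurable_compose[OF _ borel_measurable_norm])
  define \<alpha> where "\<alpha> = (\<lambda>(N::nat) u \<omega>. if \<forall>v\<in>{0..u}. h v \<omega> \<le> real N then 1 else 0 :: real)"
  have \<alpha>: "switch (\<alpha> N)" for N unfolding \<alpha>_def by (rule switch_of_bound[OF h])
  have meas: "X u \<in> borel_measurable P" "Y u \<in> borel_measurable P" "\<alpha> N u \<in> borel_measurable P" if "u \<in> {0..T}" for u N
    using that X(1) Y(1) \<alpha>[of N] by (auto simp: cont_adapted_def switch_def left_adapted_def intro!: measurable_F_P[of _ u])
  have localised: "AE \<omega> in P. \<alpha> N u \<omega> *\<^sub>R (X u \<omega> - Y u \<omega>) = 0" if u: "u \<in> {0..T}" for N u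
  proof -
    define B where "B = 4 * (real N)\<^sup>2 + 1"
    have B: "0 < B" by (simp add: B_def add_nonneg_pos)
    have iter: "(\<integral>\<^sup>+\<omega>. ennreal (\<alpha> N u \<omega> * norm (X u \<omega> - Y u \<omega>) ^ (2 * 1)) \<partial>P) \<le> ennreal (((1/8) ^ j * B * exp (\<theta> * u)) ^ 1)"
      if "u \<in> {0..T}" for u j
      using that
    proof (induction j arbitrary: u)
      case 0
      have "\<alpha> N u \<omega> * norm (X u \<omega> - Y u \<omega>) ^ (2 * 1) \<le> B * exp (\<theta> * u)" for \<omega>
      proof (cases "\<forall>v\<in>{0..u}. h v \<omega> \<le> real N")
        case True
        then have "h u \<omega> \<le> real N" using 0 by auto
        then have "norm (X u \<omega> - Y u \<omega>) \<le> 2 * real N"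
          using norm_triangle_ineq4[of "X u \<omega>" "Y u \<omega>"] by (simp add: h_def)
        then have "(norm (X u \<omega> - Y u \<omega>))\<^sup>2 \<le> (2 * real N)\<^sup>2" by (intro power_mono) auto
        also have "\<dots> \<le> B * 1" by (simp add: B_def power_mult_distrib)
        also have "\<dots> \<le> B * exp (\<theta> * u)" using B \<theta>(1) 0 by (intro mult_left_mono) auto
        finally show ?thesis using True by (simp add: \<alpha>_def)
      next
        case False
        then have "\<alpha> N u \<omega> = 0" unfolding \<alpha>_def by (rule if_not_P)
        then show ?thesis using B by simp
      qed
      then have "(\<integral>\<^sup>+\<omega>. ennreal (\<alpha> N u \<omega> * norm (X u \<omega> - Y u \<omega>) ^ (2 * 1)) \<partial>P) \<le> (\<integral>\<^sup>+\<omega>. ennreal (B * exp (\<theta> * u)) \<partial>P)"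
        by (intro nn_integral_mono ennreal_leI)
      also have "\<dots> = ennreal (B * exp (\<theta> * u))" using P.emeasure_space_1 by simp
      finally show ?case by simp
    next
      case (Suc j)
      have "(\<integral>\<^sup>+\<omega>. ennreal (\<alpha> N u \<omega> * norm (X u \<omega> - Y u \<omega>) ^ (2 * 1)) \<partial>P) \<le> ennreal ((1/8 * ((1/8) ^ j * B) * exp (\<theta> * u)) ^ 1)"
        by (rule picard_difference[OF X(1) Y(1) _ _ X(2)[OF Suc.prems] Y(2)[OF Suc.prems] \<alpha> _ _ _ \<theta>])
           (use Suc B in auto)
      then show ?case by (simp add: mult.assoc)
    qed
    have "(\<integral>\<^sup>+\<omega>. ennreal (norm (\<alpha> N u \<omega> *\<^sub>R (X u \<omega> - Y u \<omega>)) ^ 2) \<partial>P) \<le> ennreal 0"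
    proof (rule LIMSEQ_le_const)
      have "(\<lambda>j. (1/8 :: real) ^ j) \<longlonglongrightarrow> 0" by (rule LIMSEQ_power_zero) simp
      then have "(\<lambda>j. ennreal (((1/8) ^ j * B * exp (\<theta> * u)) ^ 1)) \<longlonglongrightarrow> ennreal ((0 * B * exp (\<theta> * u)) ^ 1)"
        by (intro tendsto_ennrealI tendsto_power tendsto_mult tendsto_const)
      then show "(\<lambda>j. ennreal (((1/8) ^ j * B * exp (\<theta> * u)) ^ 1)) \<longlonglongrightarrow> ennreal 0" by simp
      have "(\<integral>\<^sup>+\<omega>. ennreal (norm (\<alpha> N u \<omega> *\<^sub>R (X u \<omega> - Y u \<omega>)) ^ 2) \<partial>P) = (\<integral>\<^sup>+\<omega>. ennreal (\<alpha> N u \<omega> * norm (X u \<omega> - Y u \<omega>) ^ (2 * 1)) \<partial>P)"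
        by (intro nn_integral_cong) (simp add: \<alpha>_def)
      then show "\<exists>J. \<forall>j\<ge>J. (\<integral>\<^sup>+\<omega>. ennreal (norm (\<alpha> N u \<omega> *\<^sub>R (X u \<omega> - Y u \<omega>)) ^ 2) \<partial>P) \<le> ennreal (((1/8) ^ j * B * exp (\<theta> * u)) ^ 1)"
        using iter[OF u] by auto
    qed
    moreover have "(\<lambda>\<omega>. \<alpha> N u \<omega> *\<^sub>R (X u \<omega> - Y u \<omega>)) \<in> borel_measurable P"
      using meas[OF u] by measurable
    ultimately show ?thesis by (intro AE_eq_0_of_nn_integral_power[where p = 2]) auto
  qed
  have "AE \<omega> in P. \<forall>N m j. \<alpha> N (dyadic_point T m (min j (2 ^ m))) \<omega> *\<^sub>R (X (dyadic_point T m (min j (2 ^ m))) \<omega> - Y (dyadic_point T m (min j (2 ^ m))) \<omega>) = 0"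
    unfolding AE_all_countable using T_pos by (intro allI localised dyadic_point_in) auto
  then have "AE \<omega> in M. \<forall>N m j. \<alpha> N (dyadic_point T m (min j (2 ^ m))) \<omega> *\<^sub>R (X (dyadic_point T m (min j (2 ^ m))) \<omega> - Y (dyadic_point T m (min j (2 ^ m))) \<omega>) = 0"
    by (simp only: AE_completion_iff)
  with AE_space show ?thesis
  proof eventually_elim
    case (elim \<omega>)
    have cX: "continuous_on {0..T} (\<lambda>t. X t \<omega>)" and cY: "continuous_on {0..T} (\<lambda>t. Y t \<omega>)"
      using X(1) Y(1) elim(1) by (auto simp: cont_adapted_def)
    obtain B where B: "\<And>u. u \<in> {0..T} \<Longrightarrow> norm (h u \<omega>) \<le> B"
      by (rule left_adapted_bounded[OF left_adapted_of_cont_adapted[OF h] elim(1)]) blast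
    obtain N :: nat where N: "B \<le> real N" using real_arch_simple by blast
    have one: "\<alpha> N u \<omega> = 1" if "u \<in> {0..T}" for u
    proof -
      have "h v \<omega> \<le> real N" if "v \<in> {0..u}" for v
        using B[of v] N that \<open>u \<in> {0..T}\<close> by (auto simp: h_def)
      then show ?thesis by (simp add: \<alpha>_def)
    qed
    have eq: "X (dyadic_point T m j) \<omega> = Y (dyadic_point T m j) \<omega>" if "j \<le> 2 ^ m" for m j
    proof -
      have d: "dyadic_point T m j \<in> {0..T}" using T_pos that by (intro dyadic_point_in) auto
      have "\<alpha> N (dyadic_point T m (min j (2 ^ m))) \<omega> *\<^sub>R (X (dyadic_point T m (min j (2 ^ m))) \<omega> - Y (dyadic_point T m (min j (2 ^ m))) \<omega>) = 0"
        using elim(2) by blast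
      then show ?thesis using one[OF d] that by (simp add: min_absorb1)
    qed
    show ?case
    proof
      fix t assume t: "t \<in> {0..T}"
      have "norm (X t \<omega> - Y t \<omega>) \<le> 0"
      proof (rule continuous_le_of_dyadic[of T "\<lambda>t. norm (X t \<omega> - Y t \<omega>)"])
        show "continuous_on {0..T} (\<lambda>t. norm (X t \<omega> - Y t \<omega>))"
          by (intro continuous_on_norm continuous_on_diff cX cY)
      qed (use T_pos eq t in auto)
      then show "Y t \<omega> = X t \<omega>" by simp
    qed
  qed
qed

end

section \<open>From entrywise bounds to the Frobenius norm\<close>

lemma sum_entry_squares:
  fixes A :: "real ^ 'n::finite ^ 'm::finite"
  shows "ennreal ((norm A)\<^sup>2) = (\<Sum>i\<in>UNIV. \<Sum>j\<in>UNIV. ennreal ((A $ i $ j)\<^sup>2))"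
proof -
  have "(norm A)\<^sup>2 = (\<Sum>i\<in>UNIV. \<Sum>j\<in>UNIV. (A $ i $ j)\<^sup>2)"
    by (simp add: norm_vec_def L2_set_def sum_nonneg)
  then show ?thesis by (simp add: sum_nonneg sum_ennreal)
qed

lemma nn_integral_norm_square_le:
  fixes A :: "real \<Rightarrow> real ^ 'n::finite ^ 'm::finite"
  assumes [measurable]: "A \<in> borel_measurable borel" "I \<in> sets borel"
    and le: "\<And>i j. (\<integral>\<^sup>+u\<in>I. ennreal ((A u $ i $ j)\<^sup>2) \<partial>lborel) \<le> ennreal a" and a: "0 \<le> a"
  shows "(\<integral>\<^sup>+u\<in>I. ennreal ((norm (A u))\<^sup>2) \<partial>lborel) \<le> ennreal (real (CARD('m) * CARD('n)) * a)"
proof -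
  have [measurable]: "(\<lambda>u. A u $ i $ j) \<in> borel_measurable borel" for i j
    by (rule borel_measurable_vec_nth[OF borel_measurable_vec_nth[OF assms(1)]])
  have "(\<integral>\<^sup>+u\<in>I. ennreal ((norm (A u))\<^sup>2) \<partial>lborel)
      = (\<integral>\<^sup>+u. (\<Sum>i\<in>UNIV. \<Sum>j\<in>UNIV. ennreal ((A u $ i $ j)\<^sup>2) * indicator I u) \<partial>lborel)"
    by (simp only: sum_entry_squares sum_distrib_right)
  also have "\<dots> = (\<Sum>i\<in>UNIV. \<Sum>j\<in>UNIV. \<integral>\<^sup>+u. ennreal ((A u $ i $ j)\<^sup>2) * indicator I u \<partial>lborel)"
    by (subst nn_integral_sum, measurable, subst nn_integral_sum, measurable)
  also have "\<dots> \<le> (\<Sum>i\<in>(UNIV :: 'm set). \<Sum>j\<in>(UNIV :: 'n set). ennreal a)"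
    by (intro sum_mono le)
  also have "\<dots> = ennreal (real (CARD('m) * CARD('n)) * a)"
    using a by (simp add: ennreal_of_nat_eq_real_of_nat ennreal_mult mult.assoc)
  finally show ?thesis .
qed

theorem proposition3p4:
  fixes T \<gamma> c :: real
    and K :: "real \<Rightarrow> real \<Rightarrow> real ^ 'd::finite ^ 'd"
    and Kbar :: "real \<Rightarrow> real ^ 'd ^ 'd"
    and X\<^sub>0 :: "real ^ 'd"
    and b :: "real \<times> (real ^ 'd) \<Rightarrow> real ^ 'd"
    and \<sigma> :: "real \<times> (real ^ 'd) \<Rightarrow> real ^ 'm::finite ^ 'd"
    and M :: "'a measure"
    and W :: "real \<Rightarrow> 'a \<Rightarrow> real ^ 'm"
  assumes "0 < T"
    and "\<And>s t. s \<in> {0..T} \<Longrightarrow> t \<in> {0..T} \<Longrightarrow> K t s = (if s \<le> t then Kbar (t - s) else 0)"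
    and "(\<lambda>(t, s). K t s) \<in> borel_measurable (restrict_space borel ({0..T} \<times> {0..T}))"
    and "(SUP t\<in>{0..T}. \<integral>\<^sup>+ s\<in>{0..t}. ennreal ((norm (K t s))\<^sup>2) \<partial>lborel) < \<infinity>"
    and "0 < \<gamma>" "\<gamma> \<le> 2" "0 < c"
    and "\<And>i j s t. 0 \<le> s \<Longrightarrow> s < t \<Longrightarrow> t \<le> T \<Longrightarrow>
      (\<integral>\<^sup>+ u\<in>{s..t}. ennreal ((Kbar (t - u) $ i $ j)\<^sup>2) \<partial>lborel) \<le> ennreal (c * (t - s) powr \<gamma>)"
    and "\<And>i j s t. 0 \<le> s \<Longrightarrow> s < t \<Longrightarrow> t \<le> T \<Longrightarrow>
      (\<integral>\<^sup>+ u\<in>{0..s}. ennreal ((Kbar (t - u) $ i $ j - Kbar (s - u) $ i $ j)\<^sup>2) \<partial>lborel)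
        \<le> ennreal (c * (t - s) powr \<gamma>)"
    and "\<exists>L. L-lipschitz_on ({0..T} \<times> UNIV) b"
    and "\<exists>L. L-lipschitz_on ({0..T} \<times> UNIV) \<sigma>"
    and "brownian_motion M T W"
  shows "\<exists>X. volterra_strong_solution M W T X\<^sub>0 Kbar b \<sigma> X \<and>
    (\<forall>Y. volterra_strong_solution M W T X\<^sub>0 Kbar b \<sigma> Y \<longrightarrow>
       (AE \<omega> in M. \<forall>t\<in>{0..T}. Y t \<omega> = X t \<omega>))"
proof -
  define N where "N = real (CARD('d) * CARD('d))"
  \<comment> \<open>Each of the \<open>N\<close> entries contributes \<open>c\<close> on \<open>[0, s]\<close> and again on \<open>[s, t]\<close>.\<close>
  define c' where "c' = 2 * (N * c)"
  have N: "0 \<le> N" by (simp add: N_def)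
  obtain Lb L\<sigma> where L: "Lb-lipschitz_on ({0..T} \<times> UNIV) b" "L\<sigma>-lipschitz_on ({0..T} \<times> UNIV) \<sigma>"
    using assms(10,11) by blast
  define L where "L = max 1 (max Lb L\<sigma>)"
  have k: "(\<lambda>v. if v \<in> {0..T} then Kbar v else 0) \<in> borel_measurable borel"
  proof -
    \<comment> \<open>The one-variable kernel is the section \<open>s = 0\<close> of the two-variable one.\<close>
    have "(\<lambda>v. (v, 0::real)) \<in> restrict_space borel {0..T} \<rightarrow>\<^sub>M restrict_space borel ({0..T} \<times> {0..T})"
      using assms(1) by (intro measurable_restrict_space3) (auto intro!: borel_measurable_continuous_onI continuous_intros)
    from measurable_compose[OF this assms(3)]
    have "(\<lambda>v. K v 0) \<in> borel_measurable (restrict_space borel {0..T})" by simp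
    also have "?this \<longleftrightarrow> Kbar \<in> borel_measurable (restrict_space borel {0..T})"
      using assms(1,2) by (intro measurable_cong) (auto simp: space_restrict_space)
    finally have "(\<lambda>v. indicator {0..T} v *\<^sub>R Kbar v) \<in> borel_measurable borel"
      by (subst (asm) borel_measurable_restrict_space_iff) auto
    also have "(\<lambda>v. indicator {0..T} v *\<^sub>R Kbar v) = (\<lambda>v. if v \<in> {0..T} then Kbar v else 0)"
      by (auto simp: indicator_def)
    finally show ?thesis .
  qed
  define k_ext where "k_ext = (\<lambda>v. if v \<in> {0..T} then Kbar v else 0)"
  have k_ext [measurable]: "k_ext \<in> borel_measurable borel" using k by (simp add: k_ext_def)
  have tail: "(\<integral>\<^sup>+u\<in>{s..t}. ennreal ((norm (k_ext (t - u)))\<^sup>2) \<partial>lborel) \<le> ennreal (N * (c * (t - s) powr \<gamma>))"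
    if st: "0 \<le> s" "s < t" "t \<le> T" for s t
    unfolding N_def
  proof (rule nn_integral_norm_square_le)
    fix i j
    have "(\<integral>\<^sup>+u\<in>{s..t}. ennreal ((k_ext (t - u) $ i $ j)\<^sup>2) \<partial>lborel) = (\<integral>\<^sup>+u\<in>{s..t}. ennreal ((Kbar (t - u) $ i $ j)\<^sup>2) \<partial>lborel)"
      by (intro nn_integral_cong) (use st in \<open>auto simp: k_ext_def indicator_def\<close>)
    then show "(\<integral>\<^sup>+u\<in>{s..t}. ennreal ((k_ext (t - u) $ i $ j)\<^sup>2) \<partial>lborel) \<le> ennreal (c * (t - s) powr \<gamma>)"
      using assms(8)[OF st] by simp
  qed (use assms(7) in auto)
  have shift: "(\<integral>\<^sup>+u\<in>{0..s}. ennreal ((norm (k_ext (t - u) - k_ext (s - u)))\<^sup>2) \<partial>lborel) \<le> ennreal (N * (c * (t - s) powr \<gamma>))"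
    if st: "0 \<le> s" "s < t" "t \<le> T" for s t
    unfolding N_def
  proof (rule nn_integral_norm_square_le)
    fix i j
    have "(\<integral>\<^sup>+u\<in>{0..s}. ennreal (((k_ext (t - u) - k_ext (s - u)) $ i $ j)\<^sup>2) \<partial>lborel)
      = (\<integral>\<^sup>+u\<in>{0..s}. ennreal ((Kbar (t - u) $ i $ j - Kbar (s - u) $ i $ j)\<^sup>2) \<partial>lborel)"
      by (intro nn_integral_cong) (use st in \<open>auto simp: k_ext_def indicator_def\<close>)
    then show "(\<integral>\<^sup>+u\<in>{0..s}. ennreal (((k_ext (t - u) - k_ext (s - u)) $ i $ j)\<^sup>2) \<partial>lborel) \<le> ennreal (c * (t - s) powr \<gamma>)"
      using assms(9)[OF st] by simp
  qed (use assms(7) in auto)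
  interpret V: volterra M T W Kbar b \<sigma> X\<^sub>0 L \<gamma> c'
  proof unfold_locales
    show "brownian_motion M T W" "0 < T" "0 < \<gamma>" by fact+
    show "(\<lambda>v. if v \<in> {0..T} then Kbar v else 0) \<in> borel_measurable borel" by (rule k)
    show "0 \<le> c'" using N assms(7) by (simp add: c'_def)
    show "0 < L" by (simp add: L_def)
    show "L-lipschitz_on ({0..T} \<times> UNIV) b" "L-lipschitz_on ({0..T} \<times> UNIV) \<sigma>"
      using L by (auto simp: L_def intro: lipschitz_on_le)
    have "(\<integral>\<^sup>+v\<in>{0..T}. ennreal ((norm (Kbar v))\<^sup>2) \<partial>lborel) = (\<integral>\<^sup>+v. ennreal ((norm (k_ext v))\<^sup>2) * indicator {0..T} v \<partial>lborel)"
      by (intro nn_integral_cong) (auto simp: k_ext_def indicator_def)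
    also have "\<dots> = (\<integral>\<^sup>+u. ennreal ((norm (k_ext (T + (- 1) * u)))\<^sup>2) * indicator {0..T} (T + (- 1) * u) \<partial>lborel)"
      by (subst nn_integral_real_affine[where c = "- 1" and t = T]) auto
    also have "\<dots> = (\<integral>\<^sup>+u\<in>{0..T}. ennreal ((norm (k_ext (T - u)))\<^sup>2) \<partial>lborel)"
      by (intro nn_integral_cong) (auto simp: indicator_def)
    also have "\<dots> \<le> ennreal (N * (c * (T - 0) powr \<gamma>))" using assms(1) by (intro tail) auto
    also have "\<dots> < \<infinity>" by simp
    finally show "(\<integral>\<^sup>+v\<in>{0..T}. ennreal ((norm (Kbar v))\<^sup>2) \<partial>lborel) < \<infinity>" .
  next
    fix s t assume st: "0 \<le> s" "s \<le> t" "t \<le> T"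
    show "(\<integral>\<^sup>+u\<in>{0..t}. ennreal ((norm (Kbar (t - u) - (if u \<le> s then Kbar (s - u) else 0)))\<^sup>2) \<partial>lborel)
        \<le> ennreal (c' * (t - s) powr \<gamma>)"
    proof (cases "s = t")
      case True
      then have "(\<integral>\<^sup>+u\<in>{0..t}. ennreal ((norm (Kbar (t - u) - (if u \<le> s then Kbar (s - u) else 0)))\<^sup>2) \<partial>lborel) = (\<integral>\<^sup>+u. 0 \<partial>(lborel :: real measure))"
        by (intro nn_integral_cong) (auto simp: indicator_def)
      then show ?thesis by simp
    next
      case False
      then have st': "0 \<le> s" "s < t" "t \<le> T" using st by auto
      have "(\<integral>\<^sup>+u\<in>{0..t}. ennreal ((norm (Kbar (t - u) - (if u \<le> s then Kbar (s - u) else 0)))\<^sup>2) \<partial>lborel)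
        \<le> (\<integral>\<^sup>+u. ennreal ((norm (k_ext (t - u) - k_ext (s - u)))\<^sup>2) * indicator {0..s} u
              + ennreal ((norm (k_ext (t - u)))\<^sup>2) * indicator {s..t} u \<partial>lborel)"
        by (intro nn_integral_mono) (use st' in \<open>auto simp: k_ext_def indicator_def\<close>)
      also have "\<dots> = (\<integral>\<^sup>+u\<in>{0..s}. ennreal ((norm (k_ext (t - u) - k_ext (s - u)))\<^sup>2) \<partial>lborel)
              + (\<integral>\<^sup>+u\<in>{s..t}. ennreal ((norm (k_ext (t - u)))\<^sup>2) \<partial>lborel)"
        by (rule nn_integral_add) measurable
      also have "\<dots> \<le> ennreal (N * (c * (t - s) powr \<gamma>)) + ennreal (N * (c * (t - s) powr \<gamma>))"
        by (intro add_mono shift tail st')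
      also have "\<dots> = ennreal (c' * (t - s) powr \<gamma>)"
        using N assms(7) by (subst ennreal_plus[symmetric]) (auto simp: c'_def algebra_simps)
      finally show ?thesis .
    qed
  qed
  obtain X where X: "V.cont_adapted X" "\<And>t. t \<in> {0..T} \<Longrightarrow> V.solves_at X t (X t)"
    using V.volterra_solution_exists by blast
  show ?thesis
  proof (intro exI[of _ X] conjI allI impI)
    show "volterra_strong_solution M W T X\<^sub>0 Kbar b \<sigma> X"
      unfolding V.strong_solution_iff using X by blast
    fix Y assume "volterra_strong_solution M W T X\<^sub>0 Kbar b \<sigma> Y"
    then have "V.cont_adapted Y" "\<And>t. t \<in> {0..T} \<Longrightarrow> V.solves_at Y t (Y t)"
      unfolding V.strong_solution_iff by auto
    from V.volterra_solution_unique[OF X this]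
    show "AE \<omega> in M. \<forall>t\<in>{0..T}. Y t \<omega> = X t \<omega>" .
  qed
qed

end
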